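(* Let $(p,q)$ be a pair of coprime nonnegative integers with $(p,q)\notin\{(0,1),(1,0),(1,1)\}$, and let $\pi/3<\alpha<2\pi/3$ satisfy $$\alpha > 2\arcsin \sqrt{ \frac{p^2+pq+q^2}{4(p^2+pq+q^2)-\pi^2} }.$$ Then on a regular tetrahedron in spherical space $\mathbb{S}^3$ with face angle $\alpha$ there is no simple closed geodesic of type $(p,q)$.
   Context: $\mathbb{S}^3$ is the three-dimensional spherical space of constant curvature $1$ (the unit sphere in $\mathbb{R}^4$). A regular tetrahedron in $\mathbb{S}^3$ is a closed convex polyhedron with four faces, all of whose faces are congruent regular spherical triangles (on a unit two-sphere) and all of whose vertices are regular trihedral angles; its face angle is the interior angle $\alpha$ of a face triangle. For each $\alpha\in(\pi/3,2\pi/3)$ such a tetrahedron exists and is unique up to rigid motion. "On the tetrahedron" refers to its surface (the union of the faces) with the intrinsic metric. A geodesic on it is a locally shortest curve on the surface; it consists of geodesic segments in the faces, forms equal angles with the common edge when passing from one face to the adjacent one, and does not pass through vertices. A closed geodesic is simple if it has no self-intersections and does not repeat itself. A vertex of a geodesic is a point of the geodesic on an edge of the tetrahedron. A simple closed geodesic is of type $(p,q)$ if it has $p$ vertices on each of two opposite edges of the tetrahedron, $q$ vertices on each of two other opposite edges, and $p+q$ vertices on each of the remaining two opposite edges. *)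

theory Defs
  imports "HOL-Analysis.Analysis"
begin

section \<open>Spherical polyhedra\<close>

text \<open>
  Points of the unit sphere are unit vectors, and a subset \<open>P\<close> of the sphere is studied through
  the cone \<open>conic hull P\<close> over it (if \<open>P\<close> lies on the sphere, then
  \<open>P = sphere 0 1 \<inter> conic hull P\<close>). In particular a convex polyhedron in the sphere is a set
  whose cone is a convex polyhedral cone, and its \<open>k\<close>-dimensional faces are cut out by the
  \<open>(k + 1)\<close>-dimensional faces of that cone.
\<close>

definition sph_hull :: "'a::euclidean_space set \<Rightarrow> 'a set" where
  "sph_hull V = sphere 0 1 \<inter> convex_cone hull V"

definition sph_polyhedron :: "'a::euclidean_space set \<Rightarrow> bool" where
  "sph_polyhedron P \<longleftrightarrow>
     P \<subseteq> sphere 0 1 \<and> polyhedron (conic hull P) \<and> interior (conic hull P) \<noteq> {}"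

definition sph_faces :: "nat \<Rightarrow> 'a::euclidean_space set \<Rightarrow> 'a set set" where
  "sph_faces k P =
     {sphere 0 1 \<inter> F | F. F face_of (conic hull P) \<and> aff_dim F = int k + 1}"

definition surface :: "'a::euclidean_space set \<Rightarrow> 'a set" where
  "surface P = \<Union> (sph_faces 2 P)"


section \<open>Spherical distances, angles and triangles\<close>

definition sph_dist :: "'a::euclidean_space \<Rightarrow> 'a \<Rightarrow> real" where
  "sph_dist x y = arccos (x \<bullet> y)"

text \<open>The unit tangent vector at \<open>x\<close> of the great circle arc from \<open>x\<close> to \<open>y\<close>.\<close>

definition sph_dir :: "'a::euclidean_space \<Rightarrow> 'a \<Rightarrow> 'a" where
  "sph_dir x y = sgn (y - (x \<bullet> y) *\<^sub>R x)"

definition sph_angle :: "'a::euclidean_space \<Rightarrow> 'a \<Rightarrow> 'a \<Rightarrow> real" where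
  "sph_angle y x z = sph_dist (sph_dir x y) (sph_dir x z)"

definition equilateral :: "'a::euclidean_space \<Rightarrow> 'a \<Rightarrow> 'a \<Rightarrow> bool" where
  "equilateral a b c \<longleftrightarrow> sph_dist a b = sph_dist b c \<and> sph_dist b c = sph_dist c a"

definition equiangular :: "real \<Rightarrow> 'a::euclidean_space \<Rightarrow> 'a \<Rightarrow> 'a \<Rightarrow> bool" where
  "equiangular \<alpha> a b c \<longleftrightarrow>
     sph_angle b a c = \<alpha> \<and> sph_angle c b a = \<alpha> \<and> sph_angle a c b = \<alpha>"

definition regular_triangle :: "real \<Rightarrow> 'a::euclidean_space set \<Rightarrow> bool" where
  "regular_triangle \<alpha> F \<longleftrightarrow>
     (\<exists>a b c. distinct [a, b, c] \<and> {a, b, c} \<subseteq> sphere 0 1 \<and> independent {a, b, c} \<and>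
        F = sph_hull {a, b, c} \<and> equilateral a b c \<and> equiangular \<alpha> a b c)"

definition congruent_sets :: "'a::euclidean_space set \<Rightarrow> 'a set \<Rightarrow> bool" where
  "congruent_sets F G \<longleftrightarrow> (\<exists>f. orthogonal_transformation f \<and> f ` F = G)"


section \<open>Regular tetrahedra\<close>

text \<open>
  The vertex \<open>v\<close> is a regular trihedral angle: exactly three edges issue from it, and its plane
  angles are equal, as are its dihedral angles. The trihedral angle cuts out a spherical triangle
  on the unit sphere of the tangent space at \<open>v\<close>; the sides of this triangle are the plane angles,
  and its angles are the dihedral angles.
\<close>

definition regular_trihedral_at :: "'a::euclidean_space set \<Rightarrow> 'a \<Rightarrow> bool" where
  "regular_trihedral_at P v \<longleftrightarrow>
     (\<exists>a b c. {a, b, c} \<subseteq> sphere 0 1 \<and>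
        distinct [sph_hull {v, a}, sph_hull {v, b}, sph_hull {v, c}] \<and>
        {E \<in> sph_faces 1 P. v \<in> E} = {sph_hull {v, a}, sph_hull {v, b}, sph_hull {v, c}} \<and>
        equilateral (sph_dir v a) (sph_dir v b) (sph_dir v c) \<and>
        (\<exists>\<delta>. equiangular \<delta> (sph_dir v a) (sph_dir v b) (sph_dir v c)))"

definition regular_tetrahedron :: "real \<Rightarrow> 'a::euclidean_space set \<Rightarrow> bool" where
  "regular_tetrahedron \<alpha> T \<longleftrightarrow>
     sph_polyhedron T \<and> card (sph_faces 2 T) = 4 \<and>
     (\<forall>F \<in> sph_faces 2 T. regular_triangle \<alpha> F) \<and>
     (\<forall>F \<in> sph_faces 2 T. \<forall>G \<in> sph_faces 2 T. congruent_sets F G) \<and>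
     (\<forall>v \<in> \<Union> (sph_faces 0 T). regular_trihedral_at T v)"


section \<open>Geodesics\<close>

text \<open>
  The length of a curve is the supremum of the lengths of inscribed polygons. Measuring these with
  the Euclidean distance of the ambient space or with \<open>sph_dist\<close> gives the same length for
  continuous curves on the unit sphere.
\<close>

definition curve_length :: "real \<Rightarrow> real \<Rightarrow> (real \<Rightarrow> 'a::metric_space) \<Rightarrow> ennreal" where
  "curve_length a b g =
     (SUP ts \<in> {ts. sorted ts \<and> set ts \<subseteq> {a..b}}.
        \<Sum>i < length ts - 1. ennreal (dist (g (ts ! i)) (g (ts ! Suc i))))"

definition intrinsic_dist :: "'a::metric_space set \<Rightarrow> 'a \<Rightarrow> 'a \<Rightarrow> ennreal" where
  "intrinsic_dist S x y =
     (INF g \<in> {g. path g \<and> path_image g \<subseteq> S \<and> pathstart g = x \<and> pathfinish g = y}.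
        curve_length 0 1 g)"

definition shortest_on :: "'a::metric_space set \<Rightarrow> (real \<Rightarrow> 'a) \<Rightarrow> real \<Rightarrow> real \<Rightarrow> bool" where
  "shortest_on S g a b \<longleftrightarrow>
     curve_length a b g < \<infinity> \<and> curve_length a b g = intrinsic_dist S (g a) (g b)"

text \<open>
  A closed curve is a continuous curve of period \<open>1\<close> on the real line, so that being locally
  shortest is also demanded at the point where the curve closes up.
\<close>

definition closed_geodesic :: "'a::metric_space set \<Rightarrow> (real \<Rightarrow> 'a) \<Rightarrow> bool" where
  "closed_geodesic S g \<longleftrightarrow>
     continuous_on UNIV g \<and> range g \<subseteq> S \<and> (\<forall>t. g (t + 1) = g t) \<and>
     (\<forall>t. \<exists>e>0. shortest_on S g (t - e) (t + e))"

definition simple_closed_geodesic :: "'a::metric_space set \<Rightarrow> (real \<Rightarrow> 'a) \<Rightarrow> bool" where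
  "simple_closed_geodesic S g \<longleftrightarrow> closed_geodesic S g \<and> inj_on g {0..<1}"

definition has_vertices_on :: "(real \<Rightarrow> 'a) \<Rightarrow> nat \<Rightarrow> 'a set \<Rightarrow> bool" where
  "has_vertices_on g n E \<longleftrightarrow> finite (range g \<inter> E) \<and> card (range g \<inter> E) = n"

text \<open>Two edges of a tetrahedron are opposite iff they are disjoint.\<close>

definition geodesic_type ::
    "'a::euclidean_space set \<Rightarrow> nat \<Rightarrow> nat \<Rightarrow> (real \<Rightarrow> 'a) \<Rightarrow> bool" where
  "geodesic_type T p q g \<longleftrightarrow>
     (\<exists>A A' B B' C C'.
        distinct [A, A', B, B', C, C'] \<and> sph_faces 1 T = {A, A', B, B', C, C'} \<and>
        A \<inter> A' = {} \<and> B \<inter> B' = {} \<and> C \<inter> C' = {} \<and>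
        has_vertices_on g p A \<and> has_vertices_on g p A' \<and>
        has_vertices_on g q B \<and> has_vertices_on g q B' \<and>
        has_vertices_on g (p + q) C \<and> has_vertices_on g (p + q) C')"

end

theory Submission
  imports Defs
begin


section \<open>The length of a curve\<close>

text \<open>Let \<open>c\<close> be the cosine of the edge length \<open>side\<close> of the
  tetrahedron and N = p^2 + p q + q^2. Spherical trigonometry gives c = cos \<alpha> / (1 - cos
  \<alpha>), and the hypothesis on \<alpha> turns into pi^2 < 2 (1 - c) N. A simple closed geodesic
  of type (p, q) would give the opposite inequality (\<open>type_bound\<close>), because its length
  L satisfies 4 sin (side / 2) sqrt N \<le> L < 2 pi, where sin (side / 2)^2 = (1 - c) / 2.

  Upper bound (\<open>total_length\<close>). The opposite edges with p + q points each are special: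
  in every face each arc of the geodesic has exactly one end on such an edge
  (\<open>arc_opp\<close>). Take on one of them the crossing nearest to an end vertex i. From there
  the geodesic turns around i in both directions (\<open>start\<close>), and the two strands then
  run side by side through the same faces with no other strand between them
  (\<open>band_step\<close>), until a second vertex e separates them; behind e they join
  (\<open>band_end\<close>). So one side of the geodesic is a strip with i and e at its ends.
  Develop the faces met by one strand onto the unit sphere in 3-space so that this strand runs along
  the equator. The great circles carrying the arcs of the other strand then all have the same image
  (\<open>dev_opposite_strand\<close>), a circle with normal W. The crossings of the first strand
  lie strictly on one side of that circle, and so do the feet of i and e on the equator, since each
  of these vertices is equally far from both circles. Hence the piece between the feet lies in an
  open half of the equator and is shorter than pi (\<open>lens\<close>). The same holds for the
  other strand, and the two pieces make up the geodesic. That each foot lies between the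
  neighbouring crossings, as the picture suggests, is the content of \<open>fan\<close>.

  Lower bound (\<open>length_lower\<close>). Map every edge linearly onto the corresponding edge of
  the Euclidean tetrahedron with the same vertices. Segments joining consecutive crossings do not
  become longer (\<open>corner_chord\<close>). Project each Euclidean segment onto the direction
  that a Euclidean geodesic of type (p, q) has in the plane development
  (\<open>corner_bound\<close>) and add up. The contribution of a crossing no longer depends on its
  position on the edge (\<open>crossing_sum\<close>), and the total is the Euclidean length 2 sqrt N
  times the Euclidean edge 2 sin (side / 2).

  Reduction. The curve is only assumed to be locally shortest. Comparison with explicit detours
  shows that it is a great circle arc between consecutive crossings (\<open>arc_between\<close>),
  avoids the vertices because the face angles there add up to less than 2 pi
  (\<open>no_vertex\<close>), and makes equal angles with each edge (\<open>straight\<close>). The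
  locale \<open>dgeo\<close> keeps only the resulting periodic sequence of crossing points and
  faces. On the polyhedral side, \<open>regular_tetrahedron_vertices\<close> extracts four unit
  vectors with equal inner products.\<close>

fun chain_len :: "(real \<Rightarrow> 'a::metric_space) \<Rightarrow> real list \<Rightarrow> ennreal" where
  "chain_len g (x # y # ts) = ennreal (dist (g x) (g y)) + chain_len g (y # ts)"
| "chain_len g _ = 0"

lemma chain_len_eq_sum:
  "chain_len g ts = (\<Sum>i < length ts - 1. ennreal (dist (g (ts ! i)) (g (ts ! Suc i))))"
proof (induction g ts rule: chain_len.induct)
  case (1 g x y ts)
  have "{..<length (x # y # ts) - 1} = insert 0 (Suc ` {..<length (y # ts) - 1})"
    by (simp add: lessThan_Suc_eq_insert_0)
  then show ?case using 1 by (simp add: sum.reindex del: sum_ennreal)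
qed auto

lemma curve_length_eq_chain:
  "curve_length a b g = (SUP ts \<in> {ts. sorted ts \<and> set ts \<subseteq> {a..b}}. chain_len g ts)"
  unfolding curve_length_def chain_len_eq_sum ..

lemma chain_len_le_curve_length:
  "sorted ts \<Longrightarrow> set ts \<subseteq> {a..b} \<Longrightarrow> chain_len g ts \<le> curve_length a b g"
  unfolding curve_length_eq_chain by (rule SUP_upper) auto

lemma curve_length_leI:
  "(\<And>ts. sorted ts \<Longrightarrow> set ts \<subseteq> {a..b} \<Longrightarrow> chain_len g ts \<le> B) \<Longrightarrow> curve_length a b g \<le> B"
  unfolding curve_length_eq_chain by (rule SUP_least) auto

lemma chain_len_append:
  "chain_len g (xs @ [y]) + chain_len g (y # zs) = chain_len g (xs @ y # zs)"
  by (induction g xs rule: chain_len.induct) (auto simp: add.assoc)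

lemma chain_len_Cons_le: "chain_len g ts \<le> chain_len g (x # ts)"
  by (cases ts) (auto simp: add_increasing)

lemma chain_len_append_le: "chain_len g xs + chain_len g ys \<le> chain_len g (xs @ ys)"
proof (induction g xs rule: chain_len.induct)
  case (1 g x y ts)
  then show ?case by (simp add: add.assoc add_left_mono)
next
  case ("2_2" g v)
  then show ?case using chain_len_Cons_le[of g ys v] by simp
qed auto

lemma chain_len_insert_le: "chain_len g (xs @ ys) \<le> chain_len g (xs @ y # ys)"
proof (induction g xs rule: chain_len.induct)
  case (1 g x z ts)
  then show ?case by (simp add: add_left_mono)
next
  case ("2_1" g)
  then show ?case by (simp add: chain_len_Cons_le)
next
  case ("2_2" g v)
  show ?case
  proof (cases ys)
    case (Cons w ws)
    have "ennreal (dist (g v) (g w)) \<le> ennreal (dist (g v) (g y)) + ennreal (dist (g y) (g w))"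
      by (simp flip: ennreal_plus add: dist_triangle)
    then show ?thesis using Cons by (simp flip: add.assoc add: add_right_mono)
  qed auto
qed

lemma chain_len_cong: "(\<And>t. t \<in> set ts \<Longrightarrow> g t = h t) \<Longrightarrow> chain_len g ts = chain_len h ts"
  by (induction g ts rule: chain_len.induct) auto

lemma chain_len_map: "chain_len (\<lambda>t. g (f t)) ts = chain_len g (map f ts)"
  by (induction g "map f ts" arbitrary: ts rule: chain_len.induct) auto

lemma curve_length_superadd:
  assumes "a \<le> b" "b \<le> c"
  shows "curve_length a b g + curve_length b c g \<le> curve_length a c g"
proof -
  let ?X = "\<lambda>a b. {ts. sorted ts \<and> set ts \<subseteq> {a..b::real}}"
  have ne: "?X a b \<noteq> {}" "?X b c \<noteq> {}" by (auto intro: exI[of _ "[]"])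
  have "curve_length a b g + curve_length b c g
      = (SUP ts\<in>?X a b. SUP us\<in>?X b c. chain_len g ts + chain_len g us)"
    unfolding curve_length_eq_chain
    by (subst ennreal_SUP_add_left[OF ne(1), symmetric] ennreal_SUP_add_right[OF ne(2), symmetric])+ simp
  also have "\<dots> \<le> curve_length a c g"
  proof (intro SUP_least)
    fix ts us assume ts: "ts \<in> ?X a b" and us: "us \<in> ?X b c"
    have "sorted (ts @ us)" using ts us by (fastforce simp: sorted_append)
    moreover have "set (ts @ us) \<subseteq> {a..c}" using ts us assms by fastforce
    ultimately have "chain_len g (ts @ us) \<le> curve_length a c g" by (rule chain_len_le_curve_length)
    then show "chain_len g ts + chain_len g us \<le> curve_length a c g"
      using chain_len_append_le order_trans by blast
  qed
  finally show ?thesis .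
qed

lemma curve_length_subadd:
  assumes "a \<le> b" "b \<le> c"
  shows "curve_length a c g \<le> curve_length a b g + curve_length b c g"
proof (rule curve_length_leI)
  fix ts assume ts: "sorted ts" "set ts \<subseteq> {a..c}"
  define xs where "xs = takeWhile (\<lambda>t. t \<le> b) ts"
  define ys where "ys = dropWhile (\<lambda>t. t \<le> b) ts"
  have tsplit: "ts = xs @ ys" by (simp add: xs_def ys_def)
  have sx: "sorted xs" "sorted ys" using ts(1) unfolding tsplit by (auto simp: sorted_append)
  have xb: "x \<le> b" if "x \<in> set xs" for x using that unfolding xs_def by (auto dest: set_takeWhileD)
  have yb: "b \<le> y" if "y \<in> set ys" for y
  proof (cases ys)
    case Nil then show ?thesis using that by simp
  next
    case (Cons w ws)
    have "b < w" using Cons hd_dropWhile[of "\<lambda>t. t \<le> b" ts] unfolding ys_def by auto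
    then show ?thesis using that sx(2) Cons by auto
  qed
  have "chain_len g ts \<le> chain_len g (xs @ b # ys)" unfolding tsplit by (rule chain_len_insert_le)
  also have "\<dots> = chain_len g (xs @ [b]) + chain_len g (b # ys)" by (simp add: chain_len_append)
  also have "\<dots> \<le> curve_length a b g + curve_length b c g"
  proof (intro add_mono chain_len_le_curve_length)
    show "sorted (xs @ [b])" "sorted (b # ys)" using sx xb yb by (auto simp: sorted_append)
    show "set (xs @ [b]) \<subseteq> {a..b}" "set (b # ys) \<subseteq> {b..c}"
      using ts(2) xb yb assms unfolding tsplit by auto
  qed
  finally show "chain_len g ts \<le> curve_length a b g + curve_length b c g" .
qed

lemma curve_length_cong:
  "(\<And>t. t \<in> {a..b} \<Longrightarrow> g t = h t) \<Longrightarrow> curve_length a b g = curve_length a b h"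
  unfolding curve_length_eq_chain by (intro SUP_cong refl chain_len_cong) auto

lemma curve_length_reparam_le:
  assumes "mono_on {a..b} f" "f ` {a..b} \<subseteq> {c..d}"
  shows "curve_length a b (\<lambda>t. g (f t)) \<le> curve_length c d g"
proof (rule curve_length_leI)
  fix ts assume ts: "sorted ts" "set ts \<subseteq> {a..b}"
  have "sorted (map f ts)"
    using ts assms(1) by (induction ts) (auto simp: mono_on_def)
  then show "chain_len (\<lambda>t. g (f t)) ts \<le> curve_length c d g"
    unfolding chain_len_map using ts assms(2) by (intro chain_len_le_curve_length) auto
qed

lemma curve_length_Lipschitz:
  fixes g :: "real \<Rightarrow> 'a::metric_space"
  assumes "\<And>s t. s \<in> {0..1} \<Longrightarrow> t \<in> {0..1} \<Longrightarrow> dist (g s) (g t) \<le> C * \<bar>s - t\<bar>" "0 \<le> C"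
  shows "curve_length 0 1 g \<le> ennreal C"
proof (rule curve_length_leI)
  fix ts :: "real list"
  assume ts: "sorted ts" "set ts \<subseteq> {0..1}"
  have *: "sorted (x # us) \<Longrightarrow> set (x # us) \<subseteq> {0..1} \<Longrightarrow> chain_len g (x # us) \<le> ennreal (C * (1 - x))"
    for us x
  proof (induction us arbitrary: x)
    case (Cons y us)
    have "ennreal (dist (g x) (g y)) \<le> ennreal (C * (y - x))"
      using assms(1)[of x y] Cons.prems by (intro ennreal_leI) auto
    moreover have "chain_len g (y # us) \<le> ennreal (C * (1 - y))"
      using Cons by auto
    ultimately have "chain_len g (x # y # us) \<le> ennreal (C * (y - x)) + ennreal (C * (1 - y))"
      by (auto intro: add_mono)
    also have "\<dots> = ennreal (C * (1 - x))"
      using Cons.prems assms(2) by (subst ennreal_plus[symmetric]) (auto simp: algebra_simps mult_left_le intro!: mult_left_mono)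
    finally show ?case .
  qed simp
  show "chain_len g ts \<le> ennreal C"
  proof (cases ts)
    case (Cons x us)
    have "C * (1 - x) \<le> C" using ts Cons assms(2) by (auto simp: algebra_simps)
    then show ?thesis using *[of x us] ts Cons by (auto intro: order_trans ennreal_leI)
  qed simp
qed

section \<open>Spherical distance\<close>

lemma unit_inner: "norm x = 1 \<Longrightarrow> x \<bullet> x = 1" for x :: "'a::real_inner"
  by (simp add: norm_eq_1)

lemma norm_lincomb_squared:
  fixes u v :: "'a::real_inner"
  shows "(norm (b *\<^sub>R u + a *\<^sub>R v))\<^sup>2 = b\<^sup>2 * (norm u)\<^sup>2 + a\<^sup>2 * (norm v)\<^sup>2 + 2 * a * b * (u \<bullet> v)"
  unfolding power2_norm_eq_inner
  by (simp add: inner_add inner_commute[of v u] power2_eq_square algebra_simps)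

lemma abs_inner_unit_le_one:
  fixes x y :: "'a::real_inner"
  assumes "norm x = 1" "norm y = 1" shows "\<bar>x \<bullet> y\<bar> \<le> 1"
  using Cauchy_Schwarz_ineq2[of x y] assms by simp

lemma cos_sph_dist: "norm x = 1 \<Longrightarrow> norm y = 1 \<Longrightarrow> cos (sph_dist x y) = x \<bullet> y"
  unfolding sph_dist_def using abs_inner_unit_le_one[of x y] by (simp add: cos_arccos_abs)

lemma sin_sph_dist: "norm x = 1 \<Longrightarrow> norm y = 1 \<Longrightarrow> sin (sph_dist x y) = sqrt (1 - (x \<bullet> y)\<^sup>2)"
  unfolding sph_dist_def using abs_inner_unit_le_one[of x y] by (simp add: sin_arccos_abs)

lemma sph_dist_bounds: "norm x = 1 \<Longrightarrow> norm y = 1 \<Longrightarrow> 0 \<le> sph_dist x y \<and> sph_dist x y \<le> pi"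
  unfolding sph_dist_def using abs_inner_unit_le_one[of x y] by (auto intro: arccos_lbound arccos_ubound)

lemma sph_dist_self [simp]: "norm x = 1 \<Longrightarrow> sph_dist x x = 0"
  by (simp add: sph_dist_def unit_inner)

lemma sph_dist_commute: "sph_dist x y = sph_dist y x"
  by (simp add: sph_dist_def inner_commute)

lemma sph_dist_eq_0: "norm x = 1 \<Longrightarrow> norm y = 1 \<Longrightarrow> sph_dist x y = 0 \<longleftrightarrow> x = y"
proof
  assume n: "norm x = 1" "norm y = 1" and "sph_dist x y = 0"
  then have "x \<bullet> y = 1" using cos_sph_dist[of x y] by simp
  then have "(norm (x - y))\<^sup>2 = 0" using n
    by (simp add: power2_norm_eq_inner inner_diff inner_commute unit_inner)
  then show "x = y" by simp
qed simp

lemma sph_dist_eq_pi: "norm x = 1 \<Longrightarrow> norm y = 1 \<Longrightarrow> sph_dist x y = pi \<longleftrightarrow> y = - x"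
proof
  assume n: "norm x = 1" "norm y = 1" and "sph_dist x y = pi"
  then have "x \<bullet> y = - 1" using cos_sph_dist[of x y] by simp
  then have "(norm (x + y))\<^sup>2 = 0" using n
    by (simp add: power2_norm_eq_inner inner_add inner_commute unit_inner)
  then show "y = - x" by (simp add: eq_neg_iff_add_eq_0 add.commute)
qed (simp add: sph_dist_def unit_inner)

lemma chord_eq_2_sin:
  assumes "norm x = 1" "norm y = 1"
  shows "dist x y = 2 * sin (sph_dist x y / 2)"
proof -
  have "(dist x y)\<^sup>2 = 2 - 2 * cos (sph_dist x y)"
    using assms by (simp add: cos_sph_dist dist_norm power2_norm_eq_inner inner_diff inner_commute unit_inner)
  also have "\<dots> = (2 * sin (sph_dist x y / 2))\<^sup>2"
    using cos_double_sin[of "sph_dist x y / 2"] by (simp add: power_mult_distrib)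
  finally show ?thesis
    using sph_dist_bounds[OF assms] by (intro power2_eq_imp_eq[of "dist x y"]) (auto intro!: sin_ge_zero)
qed

lemma perp_norm:
  assumes "norm x = 1" "norm y = 1"
  shows "norm (x - (x \<bullet> y) *\<^sub>R y) = sin (sph_dist x y)"
proof -
  have "(norm (x - (x \<bullet> y) *\<^sub>R y))\<^sup>2 = 1 - (x \<bullet> y)\<^sup>2"
    using assms by (simp add: power2_norm_eq_inner inner_diff inner_commute unit_inner) (simp add: power2_eq_square)
  then show ?thesis using assms by (simp add: sin_sph_dist real_sqrt_unique)
qed

text \<open>Split \<open>x\<close> and \<open>z\<close> into parts along and perpendicular to
  \<open>y\<close>. Cauchy-Schwarz for the perpendicular parts gives cos (a + b) \<le> cos d for the
  three distances, and cos decreases on [0, pi]; a sum beyond pi exceeds every distance.\<close>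

lemma sph_dist_triangle:
  assumes "norm x = 1" "norm y = 1" "norm z = 1"
  shows "sph_dist x z \<le> sph_dist x y + sph_dist y z"
proof (cases "sph_dist x y + sph_dist y z \<le> pi")
  case True
  let ?u = "x - (x \<bullet> y) *\<^sub>R y" and ?v = "z - (z \<bullet> y) *\<^sub>R y"
  have "x \<bullet> z = (x \<bullet> y) * (y \<bullet> z) + ?u \<bullet> ?v"
    using assms by (simp add: inner_diff inner_commute unit_inner algebra_simps)
  moreover have "- (norm ?u * norm ?v) \<le> ?u \<bullet> ?v" using Cauchy_Schwarz_ineq2[of ?u ?v] by linarith
  moreover have "norm ?u = sin (sph_dist x y)" "norm ?v = sin (sph_dist y z)"
    using assms by (simp_all add: perp_norm sph_dist_commute)
  ultimately have "cos (sph_dist x y + sph_dist y z) \<le> cos (sph_dist x z)"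
    using assms by (simp add: cos_add cos_sph_dist)
  then show ?thesis
    using True sph_dist_bounds assms by (subst (asm) cos_mono_le_eq) (auto intro: add_nonneg_nonneg)
next
  case False
  then show ?thesis using sph_dist_bounds[OF assms(1,3)] by linarith
qed

text \<open>Equality in the Cauchy-Schwarz step of the triangle inequality makes the perpendicular
  parts at \<open>y\<close> opposite, which writes \<open>y\<close> as a nonnegative combination of
  \<open>x\<close> and \<open>z\<close>. For antipodal ends the distances add up to pi at every
  point, hence the bound below pi.\<close>

lemma sph_dist_additive_imp_between:
  assumes n: "norm x = 1" "norm y = 1" "norm z = 1"
    and eq: "sph_dist x y + sph_dist y z \<le> sph_dist x z" and "sph_dist x z < pi"
  shows "\<exists>l m. 0 \<le> l \<and> 0 \<le> m \<and> y = l *\<^sub>R x + m *\<^sub>R z"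
proof (cases "sph_dist x z = 0")
  case True
  then have "sph_dist x y = 0" using eq sph_dist_bounds n by (smt (verit))
  then have "y = 1 *\<^sub>R x + 0 *\<^sub>R z" using n sph_dist_eq_0[of x y] by simp
  then show ?thesis by (metis zero_le_one order_refl)
next
  case False
  let ?a = "sph_dist x y" and ?b = "sph_dist y z"
  have ab: "?a + ?b = sph_dist x z" using eq sph_dist_triangle[OF n] by linarith
  let ?u = "x - (x \<bullet> y) *\<^sub>R y" and ?v = "z - (z \<bullet> y) *\<^sub>R y"
  have nu: "norm ?u = sin ?a" "norm ?v = sin ?b"
    using n by (simp_all add: perp_norm sph_dist_commute)
  have "x \<bullet> z = (x \<bullet> y) * (y \<bullet> z) + ?u \<bullet> ?v"
    using n by (simp add: inner_diff inner_commute unit_inner algebra_simps)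
  moreover have "x \<bullet> z = cos (?a + ?b)" using ab n by (simp add: cos_sph_dist)
  ultimately have uv: "?u \<bullet> ?v = - (sin ?a * sin ?b)"
    using n by (simp add: cos_add cos_sph_dist)
  have "(norm (sin ?b *\<^sub>R ?u + sin ?a *\<^sub>R ?v))\<^sup>2
      = (sin ?b)\<^sup>2 * (norm ?u)\<^sup>2 + (sin ?a)\<^sup>2 * (norm ?v)\<^sup>2 + 2 * sin ?a * sin ?b * (?u \<bullet> ?v)"
    unfolding norm_lincomb_squared by simp
  also have "\<dots> = 0" unfolding nu uv by (simp add: power2_eq_square)
  finally have "sin ?b *\<^sub>R ?u + sin ?a *\<^sub>R ?v = 0" by simp
  then have "sin ?b *\<^sub>R x + sin ?a *\<^sub>R z = (sin ?b * (x \<bullet> y) + sin ?a * (z \<bullet> y)) *\<^sub>R y"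
    by (simp add: algebra_simps)
  also have "sin ?b * (x \<bullet> y) + sin ?a * (z \<bullet> y) = sin (?a + ?b)"
    using n by (simp add: sin_add cos_sph_dist inner_commute)
  finally have e: "sin ?b *\<^sub>R x + sin ?a *\<^sub>R z = sin (sph_dist x z) *\<^sub>R y" using ab by simp
  have pos: "sin (sph_dist x z) > 0" using False assms(5) sph_dist_bounds[OF n(1,3)] by (intro sin_gt_zero) auto
  have "y = (1 / sin (sph_dist x z)) *\<^sub>R (sin ?b *\<^sub>R x + sin ?a *\<^sub>R z)" unfolding e using pos by simp
  then have "y = (sin ?b / sin (sph_dist x z)) *\<^sub>R x + (sin ?a / sin (sph_dist x z)) *\<^sub>R z"
    by (simp add: scaleR_add_right)
  moreover have "0 \<le> sin ?b" "0 \<le> sin ?a" using sph_dist_bounds n by (auto intro!: sin_ge_zero)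
  ultimately show ?thesis using pos by (metis divide_nonneg_pos)
qed

text \<open>A chord is twice the sine of half the angle, and u cos u \<le> sin u. The factor tends
  to 1 with \<open>d\<close>, which lets chords replace arcs on fine subdivisions.\<close>

lemma sph_dist_le_chord:
  assumes "norm x = 1" "norm y = 1" "dist x y \<le> d" "d < 2"
  shows "sph_dist x y * sqrt (1 - d\<^sup>2 / 4) \<le> dist x y"
proof -
  let ?u = "sph_dist x y / 2"
  have ub: "0 \<le> ?u" "?u \<le> pi / 2" using sph_dist_bounds[OF assms(1,2)] by auto
  have dd: "dist x y = 2 * sin ?u" using chord_eq_2_sin[OF assms(1,2)] .
  have "?u \<noteq> pi / 2" using dd assms by auto
  then have ul: "?u < pi / 2" using ub by auto
  have "?u \<le> tan ?u"
  proof (cases "?u = 0")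
    case False
    then have "0 < tan ?u" using ub ul by (intro tan_gt_zero) auto
    moreover have "\<bar>?u\<bar> \<le> \<bar>tan ?u\<bar>" using ub ul by (intro abs_tan_ge) auto
    ultimately show ?thesis by linarith
  qed simp
  then have "?u * cos ?u \<le> sin ?u" using cos_gt_zero[of ?u] ub ul
    by (cases "?u = 0") (auto simp: tan_def field_simps)
  moreover have "sqrt (1 - d\<^sup>2 / 4) \<le> cos ?u"
  proof (rule real_le_lsqrt)
    have "(sin ?u)\<^sup>2 \<le> (d / 2)\<^sup>2" using dd assms ub ul by (intro power_mono) (auto intro!: sin_ge_zero)
    then show "1 - d\<^sup>2 / 4 \<le> (cos ?u)\<^sup>2" by (simp add: cos_squared_eq power_divide)
  qed (use ub ul in \<open>auto intro!: cos_ge_zero\<close>)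
  ultimately have "?u * sqrt (1 - d\<^sup>2 / 4) \<le> sin ?u" using ub(1) mult_left_mono[of _ "cos ?u" ?u] by fastforce
  then show ?thesis using dd by simp
qed

lemma ennreal_le_plus: "x \<le> y + z \<Longrightarrow> 0 \<le> y \<Longrightarrow> 0 \<le> z \<Longrightarrow> ennreal x \<le> ennreal y + ennreal z"
  by (simp add: ennreal_leI flip: ennreal_plus)

text \<open>\<open>curve_length\<close> sums ambient chords. Uniform continuity gives a subdivision
  with chords below \<open>d\<close>; each chord is at least its angle times sqrt (1 - d^2 / 4), the
  angles obey the triangle inequality, and then \<open>d\<close> tends to 0.\<close>

lemma sph_dist_le_curve_length:
  fixes g :: "real \<Rightarrow> 'a::euclidean_space"
  assumes "s \<le> t" and cont: "continuous_on {s..t} g" and n: "\<And>r. r \<in> {s..t} \<Longrightarrow> norm (g r) = 1"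
  shows "ennreal (sph_dist (g s) (g t)) \<le> curve_length s t g"
proof -
  define A where "A = sph_dist (g s) (g t)"
  have step: "ennreal (A * sqrt (1 - d\<^sup>2 / 4)) \<le> curve_length s t g" if d: "0 < d" "d < 2" for d
  proof -
    have "uniformly_continuous_on {s..t} g" using cont by (simp add: compact_uniformly_continuous)
    then obtain e where e: "e > 0" "\<And>r r'. r \<in> {s..t} \<Longrightarrow> r' \<in> {s..t} \<Longrightarrow> dist r' r < e \<Longrightarrow> dist (g r') (g r) < d"
      unfolding uniformly_continuous_on_def using d by metis
    \<comment> \<open>Consecutive parameters differ by e / 2 < e, so their images are closer than
      \<open>d\<close>; the chain grows by one point at a time and carries the estimate for its last
      point.\<close>
    have main: "\<exists>ts. sorted (ts @ [s + real n * (e/2)]) \<and> set ts \<subseteq> {s..s + real n * (e/2)} \<and> (ts @ [s + real n * (e/2)]) ! 0 = s \<and>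
        ennreal (sph_dist (g s) (g (s + real n * (e/2))) * sqrt (1 - d\<^sup>2 / 4)) \<le> chain_len g (ts @ [s + real n * (e/2)])"
      if "s + real n * (e/2) \<le> t" for n
      using that
    proof (induction n)
      case 0
      then show ?case using n[of s] assms(1) by (intro exI[of _ "[]"]) simp
    next
      case (Suc n)
      define b where "b = s + real n * (e/2)"
      define c where "c = s + real (Suc n) * (e/2)"
      have c_eq: "c = b + e/2" unfolding b_def c_def by (simp add: algebra_simps)
      have sb: "s \<le> b" using e(1) unfolding b_def by simp
      have ct: "c \<le> t" using Suc.prems unfolding c_def .
      have bt: "b \<le> t" using c_eq ct e(1) by linarith
      obtain ts where ts: "sorted (ts @ [b])" "set ts \<subseteq> {s..b}" "(ts @ [b]) ! 0 = s"
        "ennreal (sph_dist (g s) (g b) * sqrt (1 - d\<^sup>2 / 4)) \<le> chain_len g (ts @ [b])"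
        using Suc.IH bt unfolding b_def[symmetric] by blast
      have ns: "norm (g s) = 1" "norm (g b) = 1" "norm (g c) = 1"
        using sb bt ct c_eq e(1) assms(1) by (auto intro!: n)
      have "\<bar>c - b\<bar> < e" using c_eq e(1) by simp
      then have dbc: "dist (g b) (g c) < d"
        using sb bt ct c_eq e(1) by (subst dist_commute, intro e(2)) (auto simp: dist_real_def)
      then have c1: "sph_dist (g b) (g c) * sqrt (1 - d\<^sup>2 / 4) \<le> dist (g b) (g c)"
        using ns d by (intro sph_dist_le_chord) auto
      have sq: "0 \<le> sqrt (1 - d\<^sup>2 / 4)" using d power_mono[of d 2 2] by simp
      have "sph_dist (g s) (g c) * sqrt (1 - d\<^sup>2 / 4)
          \<le> (sph_dist (g s) (g b) + sph_dist (g b) (g c)) * sqrt (1 - d\<^sup>2 / 4)"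
        using sph_dist_triangle[OF ns] sq by (rule mult_right_mono)
      also have "\<dots> \<le> sph_dist (g s) (g b) * sqrt (1 - d\<^sup>2 / 4) + dist (g b) (g c)"
        using c1 by (simp add: algebra_simps)
      finally have "ennreal (sph_dist (g s) (g c) * sqrt (1 - d\<^sup>2 / 4))
          \<le> ennreal (sph_dist (g s) (g b) * sqrt (1 - d\<^sup>2 / 4)) + ennreal (dist (g b) (g c))"
        using sq sph_dist_bounds[OF ns(1,2)] by (intro ennreal_le_plus) (simp_all add: mult_nonneg_nonneg)
      also have "\<dots> \<le> chain_len g (ts @ [b]) + chain_len g [b, c]" using ts(4) by (intro add_mono) auto
      also have "\<dots> = chain_len g ((ts @ [b]) @ [c])" using chain_len_append[of g ts b "[c]"] by simp
      finally have len: "ennreal (sph_dist (g s) (g c) * sqrt (1 - d\<^sup>2 / 4)) \<le> chain_len g ((ts @ [b]) @ [c])" .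
      have bc: "b \<le> c" using c_eq e(1) by simp
      have "sorted ((ts @ [b]) @ [c])" using ts(1,2) bc by (fastforce simp: sorted_append)
      moreover have "set (ts @ [b]) \<subseteq> {s..c}" using ts(2) bc sb by fastforce
      moreover have "((ts @ [b]) @ [c]) ! 0 = s" using ts(3) by (cases ts) auto
      ultimately show ?case unfolding c_def[symmetric] using len by blast
    qed
    define N where "N = nat \<lfloor>(t - s) / (e/2)\<rfloor>"
    define b where "b = s + real N * (e/2)"
    have "0 \<le> (t - s) / (e/2)" using assms(1) e(1) by simp
    then have "real N = of_int \<lfloor>(t - s) / (e/2)\<rfloor>" unfolding N_def by simp
    then have "real N \<le> (t - s) / (e/2)" and "(t - s) / (e/2) < real N + 1" by linarith+
    then have Nle: "real N * (e/2) \<le> t - s" "t - s < (real N + 1) * (e/2)"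
      using e(1) by (simp_all only: pos_le_divide_eq pos_divide_less_eq half_gt_zero)
    have bt: "b \<le> t" "t < b + e" "s \<le> b" using Nle e(1) unfolding b_def by (simp_all add: distrib_right)
    obtain ts where ts: "sorted (ts @ [b])" "set ts \<subseteq> {s..b}"
      "ennreal (sph_dist (g s) (g b) * sqrt (1 - d\<^sup>2 / 4)) \<le> chain_len g (ts @ [b])"
      using main[of N] bt unfolding b_def[symmetric] by blast
    have ns: "norm (g s) = 1" "norm (g b) = 1" "norm (g t) = 1" using bt assms(1) by (auto intro!: n)
    have "dist (g b) (g t) < d" using e(1) bt assms(1) by (subst dist_commute, intro e(2)) (auto simp: dist_real_def)
    then have c1: "sph_dist (g b) (g t) * sqrt (1 - d\<^sup>2 / 4) \<le> dist (g b) (g t)"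
      using ns d by (intro sph_dist_le_chord) auto
    have sq: "0 \<le> sqrt (1 - d\<^sup>2 / 4)" using d power_mono[of d 2 2] by simp
    have "A * sqrt (1 - d\<^sup>2 / 4) \<le> (sph_dist (g s) (g b) + sph_dist (g b) (g t)) * sqrt (1 - d\<^sup>2 / 4)"
      unfolding A_def using sph_dist_triangle[OF ns] sq by (rule mult_right_mono)
    also have "\<dots> \<le> sph_dist (g s) (g b) * sqrt (1 - d\<^sup>2 / 4) + dist (g b) (g t)"
      using c1 by (simp add: algebra_simps)
    finally have "ennreal (A * sqrt (1 - d\<^sup>2 / 4))
        \<le> ennreal (sph_dist (g s) (g b) * sqrt (1 - d\<^sup>2 / 4)) + ennreal (dist (g b) (g t))"
      using sq sph_dist_bounds[OF ns(1,2)] by (intro ennreal_le_plus) (simp_all add: mult_nonneg_nonneg)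
    also have "\<dots> \<le> chain_len g (ts @ [b]) + chain_len g [b, t]" using ts(3) by (intro add_mono) auto
    also have "\<dots> = chain_len g (ts @ [b, t])" using chain_len_append[of g ts b "[t]"] by simp
    also have "\<dots> \<le> curve_length s t g"
      using ts(1,2) bt by (intro chain_len_le_curve_length) (fastforce simp: sorted_append)+
    finally show ?thesis .
  qed
  have "((\<lambda>d. ennreal (A * sqrt (1 - d\<^sup>2 / 4))) \<longlongrightarrow> ennreal (A * sqrt (1 - 0\<^sup>2 / 4))) (at_right 0)"
    by (intro tendsto_ennrealI tendsto_intros) auto
  moreover have "eventually (\<lambda>d. ennreal (A * sqrt (1 - d\<^sup>2 / 4)) \<le> curve_length s t g) (at_right 0)"
    unfolding eventually_at_right_field using step by (intro exI[of _ 2]) simp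
  ultimately have "ennreal (A * sqrt (1 - 0\<^sup>2 / 4)) \<le> curve_length s t g"
    by (rule tendsto_upperbound) simp
  then show ?thesis by (simp add: A_def)
qed


section \<open>Connecting curves and uniform local minimality\<close>

text \<open>Intrinsic distances are bounded above by exhibiting one curve of controlled length; such
  bounds add up under concatenation.\<close>

definition joined :: "'a::metric_space set \<Rightarrow> 'a \<Rightarrow> 'a \<Rightarrow> ennreal \<Rightarrow> bool" where
  "joined S x y l \<longleftrightarrow>
     (\<exists>h. path h \<and> path_image h \<subseteq> S \<and> pathstart h = x \<and> pathfinish h = y \<and> curve_length 0 1 h \<le> l)"

lemma joined_curve:
  assumes "a \<le> b" "continuous_on {a..b} g" "g ` {a..b} \<subseteq> S"
  shows "joined S (g a) (g b) (curve_length a b g)"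
proof -
  let ?f = "\<lambda>t. a + (b - a) * t"
  have f: "?f ` {0..1} \<subseteq> {a..b}"
  proof clarify
    fix t :: real assume "t \<in> {0..1}"
    then have "0 \<le> (b - a) * t" "(b - a) * t \<le> b - a" using assms(1) by (auto intro: mult_left_le)
    then show "a + (b - a) * t \<in> {a..b}" by auto
  qed
  have "mono_on {0..1} ?f" using assms(1) by (auto simp: mono_on_def mult_left_mono)
  then have "curve_length 0 1 (\<lambda>t. g (?f t)) \<le> curve_length a b g" using f by (rule curve_length_reparam_le)
  moreover have "path (\<lambda>t. g (?f t))"
    unfolding path_def using f by (intro continuous_on_compose2[OF assms(2)] continuous_intros) auto
  ultimately show ?thesis using f assms(3) unfolding joined_def
    by (intro exI[of _ "\<lambda>t. g (?f t)"]) (auto simp: path_image_def pathstart_def pathfinish_def)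
qed

lemma joined_trans:
  assumes "joined S x y k" "joined S y z l"
  shows "joined S x z (k + l)"
proof -
  obtain h1 h2 where h: "path h1" "path_image h1 \<subseteq> S" "pathstart h1 = x" "pathfinish h1 = y" "curve_length 0 1 h1 \<le> k"
     "path h2" "path_image h2 \<subseteq> S" "pathstart h2 = y" "pathfinish h2 = z" "curve_length 0 1 h2 \<le> l"
    using assms unfolding joined_def by blast
  let ?h = "h1 +++ h2"
  have y: "h1 1 = h2 0" using h by (simp add: pathstart_def pathfinish_def)
  have e2: "?h t = h2 (2 * t - 1)" if "t \<in> {1/2..1}" for t
    
  proof (cases "t = 1/2")
    case True
    show ?thesis unfolding True joinpaths_def using y by simp
  qed (use that in \<open>simp add: joinpaths_def\<close>)
  have "curve_length 0 1 ?h \<le> curve_length 0 (1/2) ?h + curve_length (1/2) 1 ?h"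
    by (rule curve_length_subadd) auto
  also have "curve_length 0 (1/2) ?h = curve_length 0 (1/2) (\<lambda>t. h1 (2 * t))"
    by (rule curve_length_cong) (auto simp: joinpaths_def)
  also have "\<dots> \<le> curve_length 0 1 h1" by (rule curve_length_reparam_le) (auto simp: mono_on_def)
  also have "curve_length (1/2) 1 ?h = curve_length (1/2) 1 (\<lambda>t. h2 (2 * t - 1))"
    using e2 by (intro curve_length_cong) auto
  also have "\<dots> \<le> curve_length 0 1 h2" by (rule curve_length_reparam_le) (auto simp: mono_on_def)
  also have "curve_length 0 1 h1 + curve_length 0 1 h2 \<le> k + l" using h by (intro add_mono)
  finally show ?thesis unfolding joined_def using h
    by (intro exI[of _ ?h]) (auto simp: path_image_join)
qed

lemma joined_imp_intrinsic_dist_le: "joined S x y l \<Longrightarrow> intrinsic_dist S x y \<le> l"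
  unfolding joined_def intrinsic_dist_def by (auto intro: INF_lower2)

lemma joined_arc:
  fixes x y :: "'a::euclidean_space"
  assumes n: "norm x = 1" "norm y = 1" and "y \<noteq> - x"
    and S: "\<And>l m. 0 \<le> l \<Longrightarrow> 0 \<le> m \<Longrightarrow> norm (l *\<^sub>R x + m *\<^sub>R y) = 1 \<Longrightarrow> l *\<^sub>R x + m *\<^sub>R y \<in> S"
  shows "joined S x y (ennreal (sph_dist x y))"
proof (cases "x = y")
  case True
  have "x \<in> S" using S[of 1 0] n by simp
  moreover have "curve_length 0 1 (\<lambda>t::real. x) \<le> ennreal 0" by (rule curve_length_Lipschitz) auto
  ultimately show ?thesis using True n unfolding joined_def
    by (intro exI[of _ "\<lambda>t. x"]) (auto simp: path_def path_image_def pathstart_def pathfinish_def)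
next
  case False
  define d where "d = sph_dist x y"
  have "d \<noteq> 0" "d \<noteq> pi" using False assms(3) sph_dist_eq_0[OF n] sph_dist_eq_pi[OF n] unfolding d_def by blast+
  then have d: "0 < d" "d < pi" using sph_dist_bounds[OF n] unfolding d_def by auto
  then have sd: "sin d > 0" by (intro sin_gt_zero)
  have xy: "x \<bullet> y = cos d" using n by (simp add: d_def cos_sph_dist)
  \<comment> \<open>Uniform parametrization of the great circle arc: the identity for
    \<open>h s \<bullet> h t\<close> says that parameters s, t in [0, 1] are at angle |s - t|
    d.\<close>
  define h where "h = (\<lambda>t. (sin ((1 - t) * d) / sin d) *\<^sub>R x + (sin (t * d) / sin d) *\<^sub>R y)"
  have hh: "h s \<bullet> h t = cos ((s - t) * d)" for s t
  proof -
    have "sin d * sin d * (h s \<bullet> h t) = sin ((1 - s) * d) * sin ((1 - t) * d) + sin (s * d) * sin (t * d)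
        + cos d * (sin ((1 - s) * d) * sin (t * d) + sin (s * d) * sin ((1 - t) * d))"
      using sd n unfolding h_def
      by (simp add: inner_add inner_commute[of y x] xy unit_inner field_simps)
    also have "\<dots> = sin d * sin d * cos ((s - t) * d)"
    proof -
      have 1: "sin ((1 - r) * d) = sin d * cos (r * d) - cos d * sin (r * d)" for r
        by (simp add: left_diff_distrib sin_diff)
      have 2: "cos ((s - t) * d) = cos (s * d) * cos (t * d) + sin (s * d) * sin (t * d)"
        by (simp add: left_diff_distrib cos_diff)
      have 3: "cos d * cos d = 1 - sin d * sin d" using sin_cos_squared_add[of d] by (simp add: power2_eq_square)
      show ?thesis unfolding 1 2 using 3 by algebra
    qed
    finally show ?thesis using sd by simp
  qed
  have hn: "norm (h t) = 1" for t using hh[of t t] by (simp add: norm_eq_1)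
  have "dist (h s) (h t) \<le> d * \<bar>s - t\<bar>" for s t
  proof -
    have "(dist (h s) (h t))\<^sup>2 = 2 - 2 * cos ((s - t) * d)"
      using hn by (simp add: dist_norm power2_norm_eq_inner inner_diff inner_commute[of "h t" "h s"] unit_inner hh[of s t])
    also have "\<dots> = (2 * sin ((s - t) * d / 2))\<^sup>2"
      using cos_double_sin[of "(s - t) * d / 2"] by (simp add: power_mult_distrib)
    finally have "dist (h s) (h t) = \<bar>2 * sin ((s - t) * d / 2)\<bar>"
      by (metis real_sqrt_abs real_sqrt_unique zero_le_dist)
    also have "\<dots> \<le> 2 * \<bar>(s - t) * d / 2\<bar>" using abs_sin_x_le_abs_x[of "(s - t) * d / 2"] by simp
    finally show ?thesis using d by (simp add: abs_mult mult.commute)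
  qed
  then have "curve_length 0 1 h \<le> ennreal d" using d by (intro curve_length_Lipschitz) auto
  moreover have "path h" unfolding path_def h_def using sd by (intro continuous_intros) auto
  moreover have "path_image h \<subseteq> S"
  proof -
    have "h t \<in> S" if "t \<in> {0..1}" for t
    proof -
      have "t * d \<le> 1 * d" using that d by (intro mult_right_mono) auto
      then have "0 \<le> sin ((1 - t) * d)" "0 \<le> sin (t * d)" using that d
        by (auto intro!: sin_ge_zero order.trans[OF _ less_imp_le[OF d(2)]] simp: left_diff_distrib)
      then show ?thesis using sd hn[of t] unfolding h_def by (intro S) auto
    qed
    then show ?thesis by (auto simp: path_image_def)
  qed
  moreover have "h 0 = x" "h 1 = y" using sd by (auto simp: h_def)
  ultimately show ?thesis unfolding joined_def d_def by (intro exI[of _ h]) (auto simp: pathstart_def pathfinish_def)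
qed

text \<open>A subarc of a shortest curve is shortest: replacing it cannot shorten the whole curve.\<close>

lemma shortest_on_subarc:
  fixes g :: "real \<Rightarrow> 'a::euclidean_space"
  assumes sh: "shortest_on S g a b" and "a \<le> s" "s \<le> r" "r \<le> t" "t \<le> b"
    and cont: "continuous_on UNIV g" and S: "range g \<subseteq> S" and n: "\<And>t. norm (g t) = 1"
    and j: "joined S (g s) (g t) (ennreal l)" and l: "0 \<le> l"
  shows "sph_dist (g s) (g r) + sph_dist (g r) (g t) \<le> l"
proof -
  have c: "continuous_on {u..v} g" for u v using cont continuous_on_subset by blast
  have J: "u \<le> v \<Longrightarrow> joined S (g u) (g v) (curve_length u v g)" for u v
    using S by (intro joined_curve c) auto
  have "curve_length a s g + curve_length s t g + curve_length t b g \<le> curve_length a b g"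
    using curve_length_superadd[of a s t g] curve_length_superadd[of a t b g] assms(2-5)
    by (meson add_right_mono order_trans)
  also have "\<dots> = intrinsic_dist S (g a) (g b)" using sh by (simp add: shortest_on_def)
  also have "\<dots> \<le> curve_length a s g + ennreal l + curve_length t b g"
    using assms(2-5) by (intro joined_imp_intrinsic_dist_le joined_trans[OF joined_trans[OF J j] J]) auto
  finally have le: "curve_length a s g + curve_length s t g + curve_length t b g
     \<le> curve_length a s g + ennreal l + curve_length t b g" .
  have fin: "curve_length a b g < \<infinity>" using sh unfolding shortest_on_def by blast
  have "curve_length a s g \<le> curve_length a b g" "curve_length t b g \<le> curve_length a b g"
    using curve_length_superadd[of a s b g] curve_length_superadd[of a t b g] assms(2-5)
    by (auto intro: order_trans[rotated] simp: add_increasing add_increasing2)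
  then have "curve_length a s g < \<infinity>" "curve_length t b g < \<infinity>" using fin by (auto intro: le_less_trans)
  then have "curve_length s t g \<le> ennreal l" using le
    by (auto simp: add.assoc add.commute[of _ "curve_length t b g"] ennreal_add_left_cancel_le)
  moreover have "ennreal (sph_dist (g s) (g r)) + ennreal (sph_dist (g r) (g t)) \<le> curve_length s t g"
    using curve_length_superadd[OF assms(3,4), of g]
      sph_dist_le_curve_length[OF assms(3) c n] sph_dist_le_curve_length[OF assms(4) c n]
    by (meson add_mono order_trans)
  ultimately have "ennreal (sph_dist (g s) (g r) + sph_dist (g r) (g t)) \<le> ennreal l"
    using sph_dist_bounds[OF n[of s] n[of r]] sph_dist_bounds[OF n[of r] n[of t]]
    by (metis ennreal_plus order_trans)
  then show ?thesis using l by (simp add: ennreal_le_iff)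
qed

text \<open>The form in which minimality is used from here on: uniform in time, stated with angular
  distances of three points only, and tested against any connecting curve.\<close>

definition locally_minimal :: "'a::euclidean_space set \<Rightarrow> (real \<Rightarrow> 'a) \<Rightarrow> real \<Rightarrow> bool" where
  "locally_minimal S g e \<longleftrightarrow> e > 0 \<and>
     (\<forall>s r t l. s \<le> r \<and> r \<le> t \<and> t \<le> s + e \<and> 0 \<le> l \<and> joined S (g s) (g t) (ennreal l) \<longrightarrow>
        sph_dist (g s) (g r) + sph_dist (g r) (g t) \<le> l)"

lemma periodic_int:
  assumes "\<And>t. g (t + 1) = g (t::real)" shows "g (t + of_int k) = g t"
proof (induction k rule: int_induct[where k = 0])
  case (step1 i)
  then show ?case using assms[of "t + of_int i"] by (simp add: algebra_simps)
next
  case (step2 i)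
  then show ?case using assms[of "t + of_int (i - 1)"] by (simp add: algebra_simps)
qed simp

text \<open>A Lebesgue number for one period replaces the windows of \<open>closed_geodesic\<close>
  by windows of a fixed size, and periodicity moves any time into that period.\<close>

lemma closed_geodesic_locally_minimal:
  fixes g :: "real \<Rightarrow> 'a::euclidean_space"
  assumes g: "closed_geodesic S g" and S: "S \<subseteq> sphere 0 1"
  shows "\<exists>e. locally_minimal S g e"
proof -
  have cont: "continuous_on UNIV g" and rg: "range g \<subseteq> S" and per: "\<And>t. g (t + 1) = g t"
    and win: "\<And>t. \<exists>e>0. shortest_on S g (t - e) (t + e)"
    using g by (auto simp: closed_geodesic_def)
  have n: "norm (g t) = 1" for t using subsetD[OF rg rangeI[of g t]] S by auto
  obtain E where E: "\<And>t. E t > 0" "\<And>t. shortest_on S g (t - E t) (t + E t)" using win by metis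
  obtain e where e: "e > 0" "\<And>x. x \<in> {0..1} \<Longrightarrow> \<exists>t. ball x e \<subseteq> ball t (E t)"
  proof -
    have "compact {0..1::real}" "{0..1} \<subseteq> \<Union> ((\<lambda>t. ball t (E t)) ` {0..1})"
      "\<And>B. B \<in> (\<lambda>t. ball t (E t)) ` {0..1} \<Longrightarrow> open B"
      using E(1) by auto
    from Heine_Borel_lemma[OF this] that show ?thesis by (metis imageE)
  qed
  have "sph_dist (g s) (g r) + sph_dist (g r) (g t) \<le> l"
    if st: "s \<le> r" "r \<le> t" "t \<le> s + e/2" and l: "0 \<le> l" and j: "joined S (g s) (g t) (ennreal l)" for s r t l
  proof -
    define k where "k = \<lfloor>s\<rfloor>"
    have shift: "g (u - of_int k) = g u" for u using periodic_int[of g "u - of_int k" k] per by simp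
    have s01: "s - of_int k \<in> {0..1}" unfolding k_def by (auto simp: frac_def[symmetric] less_imp_le[OF frac_lt_1])
    obtain c where c: "ball (s - of_int k) e \<subseteq> ball c (E c)" using e(2)[OF s01] by blast
    have "s - of_int k \<in> ball c (E c)" "t - of_int k \<in> ball c (E c)"
      using c e(1) st by (auto simp: subset_iff dist_real_def)
    then have "c - E c \<le> s - of_int k" "t - of_int k \<le> c + E c" by (auto simp: dist_real_def)
    then show ?thesis
      using shortest_on_subarc[OF E(2)[of c], of "s - of_int k" "r - of_int k" "t - of_int k" l] st l j cont rg n
      unfolding shift by auto
  qed
  then show ?thesis using e(1) unfolding locally_minimal_def by (intro exI[of _ "e/2"]) auto
qed


section \<open>Great circle arcs and the unfolding of a sector\<close>

text \<open>Converse of \<open>sph_dist_additive_imp_between\<close>: in the plane of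
  \<open>x\<close> and \<open>z\<close> the sum of the two angles has the cosine and the sine of the
  whole angle, and the sign of the sine keeps the sum from exceeding pi.\<close>

lemma sph_dist_between:
  assumes n: "norm x = 1" "norm y = 1" "norm z = 1" and "z \<noteq> - x"
    and y: "y = l *\<^sub>R x + m *\<^sub>R z" "0 \<le> l" "0 \<le> m"
  shows "sph_dist x y + sph_dist y z = sph_dist x z"
proof (cases "x = z")
  case True
  then have "y = (l + m) *\<^sub>R x" using y by (simp add: scaleR_add_left)
  then have "y = x" using n y by simp
  then show ?thesis using True n by simp
next
  case False
  define d where "d = sph_dist x z"
  have dd: "0 < d" "d < pi" using sph_dist_bounds[OF n(1,3)] sph_dist_eq_0[OF n(1,3)] sph_dist_eq_pi[OF n(1,3)] False assms(4)
    unfolding d_def by linarith+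
  have sd: "sin d > 0" using dd by (rule sin_gt_zero)
  have xz: "x \<bullet> z = cos d" using n by (simp add: d_def cos_sph_dist)
  have one: "l\<^sup>2 + m\<^sup>2 + 2 * m * l * cos d = 1"
    using norm_lincomb_squared[of l x m z] n y(1) xz by simp
  have xy: "x \<bullet> y = l + m * cos d" and yz: "y \<bullet> z = l * cos d + m"
    using n xz unfolding y(1) by (simp_all add: inner_add unit_inner)
  have cs: "(cos d)\<^sup>2 = 1 - (sin d)\<^sup>2" by (simp add: cos_squared_eq)
  have "1 - (x \<bullet> y)\<^sup>2 = (m * sin d)\<^sup>2" unfolding xy using one cs by (simp add: power2_eq_square) algebra
  then have s1: "sin (sph_dist x y) = m * sin d" using n y(3) sd by (simp add: sin_sph_dist)
  have "1 - (y \<bullet> z)\<^sup>2 = (l * sin d)\<^sup>2" unfolding yz using one cs by (simp add: power2_eq_square) algebra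
  then have s2: "sin (sph_dist y z) = l * sin d" using n y(2) sd by (simp add: sin_sph_dist)
  have "cos (sph_dist x y + sph_dist y z) = (l + m * cos d) * (l * cos d + m) - (m * sin d) * (l * sin d)"
    using n by (simp add: cos_add cos_sph_dist xy yz s1 s2)
  then have c: "cos (sph_dist x y + sph_dist y z) = cos d" using one cs by algebra
  have "sin (sph_dist x y + sph_dist y z) = (m * sin d) * (l * cos d + m) + (l + m * cos d) * (l * sin d)"
    using n by (simp add: sin_add cos_sph_dist xy yz s1 s2)
  then have s: "sin (sph_dist x y + sph_dist y z) = sin d" using one by algebra
  have "sph_dist x y + sph_dist y z \<le> pi"
  proof (rule ccontr)
    assume "\<not> ?thesis"
    moreover have "sph_dist x y + sph_dist y z < 2 * pi \<or> sph_dist x y + sph_dist y z = 2 * pi"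
      using sph_dist_bounds[OF n(1,2)] sph_dist_bounds[OF n(2,3)] by linarith
    ultimately have "sin (sph_dist x y + sph_dist y z) \<le> 0"
      using sin_lt_zero[of "sph_dist x y + sph_dist y z"] by auto
    then show False using s sd by simp
  qed
  then show ?thesis using c dd cos_inj_pi[of "sph_dist x y + sph_dist y z" d]
      sph_dist_bounds[OF n(1,2)] sph_dist_bounds[OF n(2,3)] unfolding d_def by linarith
qed

text \<open>Unfolding the sector between two tangent directions at \<open>x\<close> into the sphere turns
  the detour \<open>y \<rightarrow> p \<rightarrow> p' \<rightarrow> z\<close> into a great circle arc,
  provided that the total angle is less than \<open>pi\<close>.\<close>

lemma sector_shortcut:
  fixes x :: "'a::euclidean_space"
  assumes n: "norm x = 1" "norm d1 = 1" "norm e1 = 1" "norm e2 = 1" "norm d2 = 1"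
    and o: "x \<bullet> d1 = 0" "x \<bullet> e1 = 0" "x \<bullet> e2 = 0" "x \<bullet> d2 = 0"
    and A: "d1 \<bullet> e1 = cos A" "e1 \<bullet> e2 = cos B" "e2 \<bullet> d2 = cos C"
    and pos: "0 \<le> A" "0 \<le> B" "0 \<le> C" "0 < A + B + C" "A + B + C < pi"
    and r: "0 < r" "r < pi / 2"
  shows "\<exists>s1 s2. 0 < s1 \<and> s1 \<le> r \<and> 0 < s2 \<and> s2 \<le> r \<and> (e1 = e2 \<and> B = 0 \<longrightarrow> s1 = s2) \<and>
     sph_dist (cos r *\<^sub>R x + sin r *\<^sub>R d1) (cos s1 *\<^sub>R x + sin s1 *\<^sub>R e1)
     + sph_dist (cos s1 *\<^sub>R x + sin s1 *\<^sub>R e1) (cos s2 *\<^sub>R x + sin s2 *\<^sub>R e2)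
     + sph_dist (cos s2 *\<^sub>R x + sin s2 *\<^sub>R e2) (cos r *\<^sub>R x + sin r *\<^sub>R d2) < 2 * r"
proof -
  define T where "T = A + B + C"
  \<comment> \<open>In polar coordinates about \<open>x\<close>, the great circle through the points
    at distance \<open>r\<close> and angles 0 and \<open>T\<close> has the equation cot s = q(a) cot
    r. The intermediate points of the detour are taken on it.\<close>
  define q where "q = (\<lambda>a. (sin (T - a) + sin a) / sin T)"
  define s where "s = (\<lambda>a. arctan (tan r / q a))"
  \<comment> \<open>The unfolded sector: polar coordinates about the pole (0, 1), with the three
    angles laid side by side.\<close>
  define P where "P = (\<lambda>\<rho> a. (of_real (sin \<rho>) * cis a, cos \<rho>) :: complex \<times> real)"
  have T: "0 < T" "T < pi" using pos by (auto simp: T_def)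
  have sT: "sin T > 0" using T by (rule sin_gt_zero)
  have tr: "0 < tan r" using r by (intro tan_gt_zero)
  \<comment> \<open>This yields s(a) \<le> r, so the detour stays within distance \<open>r\<close>
    of \<open>x\<close>.\<close>
  have q1: "1 \<le> q a" if a: "0 \<le> a" "a \<le> T" for a
  proof -
    have "sin T = sin (T - a) * cos a + cos (T - a) * sin a" using sin_add[of "T - a" a] by simp
    also have "\<dots> \<le> sin (T - a) * 1 + 1 * sin a"
      using a T by (intro add_mono mult_left_mono mult_right_mono sin_ge_zero) auto
    finally show ?thesis using sT unfolding q_def by simp
  qed
  have s: "0 < s a" "s a \<le> r" "s a < pi/2" if a: "0 \<le> a" "a \<le> T" for a
  proof -
    have "0 < tan r / q a" "tan r / q a \<le> tan r" using q1[OF a] tr by (auto simp: divide_le_eq)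
    then show "0 < s a" "s a \<le> r" "s a < pi/2" using r arctan_le_iff[of "tan r / q a" "tan r"]
      unfolding s_def by (auto simp: arctan_tan arctan_ubound)
  qed
  have s0: "s 0 = r" "s T = r" using sT r unfolding s_def q_def by (auto simp: arctan_tan)
  have tans: "sin (s a) * q a * cos r = cos (s a) * sin r" if a: "0 \<le> a" "a \<le> T" for a
  proof -
    have "cos (s a) > 0" "cos r > 0" using s[OF a] r by (auto intro!: cos_gt_zero)
    moreover have "tan (s a) = tan r / q a" unfolding s_def by (rule tan_arctan)
    ultimately show ?thesis using q1[OF a] by (simp add: tan_def field_simps)
  qed
  have PP: "P \<rho> a \<bullet> P \<rho>' b = cos \<rho> * cos \<rho>' + sin \<rho> * sin \<rho>' * cos (b - a)" for \<rho> a \<rho>' b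
    unfolding P_def by (simp add: inner_prod_def inner_complex_def cos_diff algebra_simps)
  have nP: "norm (P \<rho> a) = 1" for \<rho> a
    using PP[of \<rho> a \<rho> a] by (simp add: norm_eq_1 flip: power2_eq_square)
  have dP: "sph_dist (P \<rho> a) (P \<rho>' b) = sph_dist (cos \<rho> *\<^sub>R x + sin \<rho> *\<^sub>R e) (cos \<rho>' *\<^sub>R x + sin \<rho>' *\<^sub>R e')"
    if "e \<bullet> e' = cos (b - a)" "x \<bullet> e = 0" "x \<bullet> e' = 0" for e e' \<rho> a \<rho>' b
    unfolding sph_dist_def PP using that n(1)
    by (simp add: inner_add inner_commute[of e x] inner_commute[of e' x] unit_inner mult_ac)
  have btw: "sph_dist (P (s a) a) (P (s b) b) + sph_dist (P (s b) b) (P r T) = sph_dist (P (s a) a) (P r T)"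
    if ab: "0 \<le> a" "a \<le> b" "b \<le> T" for a b
  proof (cases "a = T")
    case True
    then have "b = T" using ab by simp
    then show ?thesis using True s0 nP by simp
  next
    case False
    then have aT: "0 < sin (T - a)" using ab T by (intro sin_gt_zero) auto
    have cr: "cos r > 0" "sin r > 0" using r by (auto intro!: cos_gt_zero sin_gt_zero)
    have ss: "sin (s a) > 0" "sin (s b) > 0" using s[of a] s[of b] ab r by (auto intro!: sin_gt_zero)
    define l where "l = sin (s b) * sin (T - b) / (sin (s a) * sin (T - a))"
    define m where "m = sin (s b) * sin (b - a) / (sin r * sin (T - a))"
    have lm: "0 \<le> l" "0 \<le> m" using ab T ss cr aT unfolding l_def m_def
      by (auto intro!: divide_nonneg_nonneg mult_nonneg_nonneg sin_ge_zero less_imp_le[OF ss(1)] less_imp_le[OF ss(2)] less_imp_le[OF aT] less_imp_le[OF cr(2)])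
    have l': "l * sin (s a) * sin (T - a) = sin (s b) * sin (T - b)" and m': "m * sin r * sin (T - a) = sin (s b) * sin (b - a)"
      using ss cr aT unfolding l_def m_def by auto
    have trig: "sin (T - b) * cos a + sin (b - a) * cos T = sin (T - a) * cos b"
      "sin (T - b) * sin a + sin (b - a) * sin T = sin (T - a) * sin b"
      using sin_cos_squared_add[of a] sin_cos_squared_add[of b] sin_cos_squared_add[of T]
      unfolding sin_diff by algebra+
    have "P (s b) b = l *\<^sub>R P (s a) a + m *\<^sub>R P r T"
    proof -
      have 1: "sin (s b) * cos b = l * (sin (s a) * cos a) + m * (sin r * cos T)"
      proof -
        have "sin (T - a) * (sin (s b) * cos b) = sin (T - a) * (l * (sin (s a) * cos a) + m * (sin r * cos T))"
          using l' m' trig(1) by algebra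
        then show ?thesis using aT by simp
      qed
      have 2: "sin (s b) * sin b = l * (sin (s a) * sin a) + m * (sin r * sin T)"
      proof -
        have "sin (T - a) * (sin (s b) * sin b) = sin (T - a) * (l * (sin (s a) * sin a) + m * (sin r * sin T))"
          using l' m' trig(2) by algebra
        then show ?thesis using aT by simp
      qed
      have 3: "cos (s b) = l * cos (s a) + m * cos r"
      proof -
        have ta: "sin (s a) * (q a * sin T) * cos r = cos (s a) * sin r * sin T"
          and tb: "sin (s b) * (q b * sin T) * cos r = cos (s b) * sin r * sin T"
          using tans[of a] tans[of b] ab by auto
        have qa: "q a * sin T = sin (T - a) + sin a" "q b * sin T = sin (T - b) + sin b"
          using sT unfolding q_def by auto
        have qt: "(sin (T - b)) * (sin (T - a) + sin a) + sin (b - a) * sin T = sin (T - a) * (sin (T - b) + sin b)"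
          using trig(2) by algebra
        have "(sin (T - a) * sin r * sin T) * cos (s b) = (sin (T - a) * sin r * sin T) * (l * cos (s a) + m * cos r)"
          using ta tb qt l' m' unfolding qa by algebra
        then show ?thesis using aT cr sT by simp
      qed
      show ?thesis unfolding P_def using 1 2 3 by (auto simp: complex_eq_iff)
    qed
    moreover have "P r T \<noteq> - P (s a) a"
    proof
      assume "P r T = - P (s a) a"
      then have "cos r = - cos (s a)" by (simp add: P_def)
      moreover have "cos (s a) > 0" using s[of a] ab by (intro cos_gt_zero) auto
      ultimately show False using cr by simp
    qed
    ultimately show ?thesis using lm by (intro sph_dist_between nP)
  qed
  let ?y = "cos r *\<^sub>R x + sin r *\<^sub>R d1" and ?z = "cos r *\<^sub>R x + sin r *\<^sub>R d2"
  let ?p1 = "cos (s A) *\<^sub>R x + sin (s A) *\<^sub>R e1" and ?p2 = "cos (s (A+B)) *\<^sub>R x + sin (s (A+B)) *\<^sub>R e2"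
  have "sph_dist ?y ?p1 = sph_dist (P (s 0) 0) (P (s A) A)"
    "sph_dist ?p1 ?p2 = sph_dist (P (s A) A) (P (s (A+B)) (A+B))"
    "sph_dist ?p2 ?z = sph_dist (P (s (A+B)) (A+B)) (P r T)"
    unfolding s0 using A o by (simp_all add: dP T_def)
  moreover have "sph_dist (P (s 0) 0) (P (s A) A) + sph_dist (P (s A) A) (P (s (A+B)) (A+B)) + sph_dist (P (s (A+B)) (A+B)) (P r T)
      = sph_dist (P (s 0) 0) (P r T)"
    using btw[of 0 A] btw[of A "A+B"] pos by (simp add: T_def)
  \<comment> \<open>The path through the pole has length 2 r, and it would be shortest only for T =
    pi.\<close>
  moreover have "sph_dist (P (s 0) 0) (P r T) < 2 * r"
  proof -
    have "cos T > - 1" using T cos_monotone_0_pi[of T pi] by simp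
    then have "sin r * sin r * cos T > sin r * sin r * (-1)"
      using sin_gt_zero[of r] r by (intro mult_strict_left_mono) auto
    then have "cos (2 * r) < P (s 0) 0 \<bullet> P r T" unfolding PP s0 cos_double by (simp add: power2_eq_square)
    then have "cos (2 * r) < cos (sph_dist (P (s 0) 0) (P r T))" by (simp add: cos_sph_dist nP)
    then show ?thesis using r sph_dist_bounds[OF nP nP] by (subst (asm) cos_mono_less_eq) auto
  qed
  ultimately have "sph_dist ?y ?p1 + sph_dist ?p1 ?p2 + sph_dist ?p2 ?z < 2 * r" by simp
  moreover have "A \<le> T" "A + B \<le> T" using pos by (auto simp: T_def)
  ultimately show ?thesis using s[of A] s[of "A + B"] pos
    by (intro exI[of _ "s A"] exI[of _ "s (A + B)"]) auto
qed


section \<open>Four indices, and coordinates on a regular tetrahedron\<close>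

text \<open>Since four names exhaust a set of four elements, they are distinct. In most uses the
  first two are the ends of an edge and the last two number the faces meeting in it.\<close>

definition quad :: "nat \<Rightarrow> nat \<Rightarrow> nat \<Rightarrow> nat \<Rightarrow> bool" where
  "quad i j k l \<longleftrightarrow> {i, j, k, l} = {..<4}"

lemma quadD:
  assumes "quad i j k l"
  shows "i < 4" "j < 4" "k < 4" "l < 4" "i \<noteq> j" "i \<noteq> k" "i \<noteq> l" "j \<noteq> k" "j \<noteq> l" "k \<noteq> l"
proof -
  have e: "{i, j, k, l} = {..<4}" using assms by (simp add: quad_def)
  then show "i < 4" "j < 4" "k < 4" "l < 4" by blast+
  have "card {i, j, k, l} = 4" using e by simp
  then show "i \<noteq> j" "i \<noteq> k" "i \<noteq> l" "j \<noteq> k" "j \<noteq> l" "k \<noteq> l"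
    by (auto simp: card_insert_if split: if_splits)
qed

lemma quadI: "i < 4 \<Longrightarrow> j < 4 \<Longrightarrow> k < 4 \<Longrightarrow> l < 4 \<Longrightarrow> distinct [i, j, k, l] \<Longrightarrow> quad i j k l"
  unfolding quad_def by (rule card_subset_eq) auto

lemma quad_cases: "quad i j k l \<Longrightarrow> n < 4 \<Longrightarrow> n = i \<or> n = j \<or> n = k \<or> n = l"
  unfolding quad_def by blast

lemma quad_all: "quad i j k l \<Longrightarrow> (\<forall>n<4. P n) \<longleftrightarrow> P i \<and> P j \<and> P k \<and> P l"
  using quad_cases[of i j k l] quadD[of i j k l] by metis

lemma quad_sum: "quad i j k l \<Longrightarrow> (\<Sum>n<4. f n) = f i + f j + f k + (f l :: 'b::comm_monoid_add)"
proof -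
  assume q: "quad i j k l"
  have "(\<Sum>n<4. f n) = sum f {i, j, k, l}" using q by (simp add: quad_def)
  then show ?thesis using quadD[OF q] by (simp add: add.assoc)
qed

lemma quad_ex: "i < 4 \<Longrightarrow> j < 4 \<Longrightarrow> i \<noteq> j \<Longrightarrow> \<exists>k l. quad i j k l"
proof -
  assume ij: "i < 4" "j < 4" "i \<noteq> j"
  have "card ({..<4} - {i, j}) = 2" using ij by (simp add: card_Diff_subset)
  then obtain k l where "{..<4} - {i, j} = {k, l}" "k \<noteq> l" by (auto simp: card_2_iff)
  then have "k < 4" "l < 4" "distinct [i, j, k, l]" using ij by auto
  then show ?thesis using ij quadI by blast
qed

lemma quad_ex1: "i < 4 \<Longrightarrow> \<exists>j k l. quad i j k l"
  using quad_ex[of i 0] quad_ex[of i 1] by (cases "i = 0") auto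

lemma quad_perm: "quad i j k l \<Longrightarrow> quad j i k l" "quad i j k l \<Longrightarrow> quad i k j l" "quad i j k l \<Longrightarrow> quad i j l k"
  unfolding quad_def by blast+

text \<open>For unit vectors that are not antipodal this is the shorter great circle arc, in a form
  that can be tested on linear coordinates.\<close>

definition between :: "'a::real_vector \<Rightarrow> 'a \<Rightarrow> 'a \<Rightarrow> bool" where
  "between x y p \<longleftrightarrow> (\<exists>l m. 0 \<le> l \<and> 0 \<le> m \<and> p = l *\<^sub>R x + m *\<^sub>R y)"

lemma betweenI: "0 \<le> l \<Longrightarrow> 0 \<le> m \<Longrightarrow> p = l *\<^sub>R x + m *\<^sub>R y \<Longrightarrow> between x y p"
  unfolding between_def by blast

lemma between_refl: "between x y x" "between x y y"
  by (rule betweenI[of 1 0]; simp) (rule betweenI[of 0 1]; simp)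

lemma between_commute: "between x y p \<Longrightarrow> between y x p"
  unfolding between_def by (metis add.commute)

lemma between_trans: "between x y p \<Longrightarrow> between x z y \<Longrightarrow> between x z p"
proof -
  assume "between x y p" "between x z y"
  then obtain l m l' m' where "0 \<le> l" "0 \<le> m" "p = l *\<^sub>R x + m *\<^sub>R y" "0 \<le> l'" "0 \<le> m'" "y = l' *\<^sub>R x + m' *\<^sub>R z"
    unfolding between_def by blast
  then show ?thesis by (intro betweenI[of "l + m * l'" "m * m'"]) (auto simp: algebra_simps)
qed

text \<open>The tetrahedron is given by the Gram matrix of its vertices, with \<open>c\<close> the
  cosine of the edge length. The bounds on \<open>c\<close> say that this matrix is positive
  definite: its eigenvalues are 1 - c and 1 + 3 c.\<close>

locale tetra =
  fixes v :: "nat \<Rightarrow> 'a::euclidean_space" and c :: real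
  assumes gram: "i < 4 \<Longrightarrow> j < 4 \<Longrightarrow> v i \<bullet> v j = (if i = j then 1 else c)"
    and c_bounds: "- 1 / 3 < c" "c < 1" and dim4: "DIM('a) = 4"
begin

text \<open>Coordinates with respect to the basis \<open>v\<close>: the formula applies the inverse
  of the Gram matrix to the vector of inner products.\<close>

definition co :: "nat \<Rightarrow> 'a \<Rightarrow> real" where
  "co i x = (v i \<bullet> x - c / (1 + 3 * c) * (\<Sum>j<4. v j \<bullet> x)) / (1 - c)"

lemma norm_v: "i < 4 \<Longrightarrow> norm (v i) = 1"
  by (simp add: norm_eq_1 gram)

lemma co_add [simp]: "co i (x + y) = co i x + co i y"
  unfolding co_def by (simp add: inner_add sum.distrib algebra_simps add_divide_distrib diff_divide_distrib)

lemma co_scale [simp]: "co i (a *\<^sub>R x) = a * co i x"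
  unfolding co_def by (simp add: sum_distrib_left[symmetric] algebra_simps diff_divide_distrib)

lemma co_0 [simp]: "co i 0 = 0" using co_scale[of i 0 0] by simp
lemma co_minus [simp]: "co i (- x) = - co i x" using co_scale[of i "-1" x] by simp
lemma co_diff [simp]: "co i (x - y) = co i x - co i y" using co_add[of i x "- y"] by simp

lemma linear_co: "linear (co i)" by (rule linearI) auto

lemma continuous_co: "continuous_on A (co i)"
  using linear_continuous_on[OF linear_conv_bounded_linear[THEN iffD1, OF linear_co]] .

lemma co_v: "i < 4 \<Longrightarrow> j < 4 \<Longrightarrow> co i (v j) = (if i = j then 1 else 0)"
proof -
  assume ij: "i < 4" "j < 4"
  have "(\<Sum>k<4. v k \<bullet> v j) = (\<Sum>k<4. c + (if k = j then 1 - c else 0))"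
    using ij by (intro sum.cong) (auto simp: gram)
  also have "\<dots> = 1 + 3 * c" using ij by (simp add: sum.distrib)
  finally show ?thesis unfolding co_def using ij c_bounds by (simp add: gram)
qed

lemma span_v: "span (v ` {..<4}) = UNIV"
proof -
  have inj: "inj_on v {..<4}"
  proof (rule inj_onI)
    fix i j assume "i \<in> {..<4::nat}" "j \<in> {..<4}" "v i = v j"
    then show "i = j" using gram[of i j] gram[of i i] c_bounds by (auto split: if_splits)
  qed
  have "independent (v ` {..<4})"
  proof
    assume "dependent (v ` {..<4})"
    then obtain j where j: "j < 4" "v j \<in> span (v ` {..<4} - {v j})" unfolding dependent_def by auto
    have "co j x = 0" if "x \<in> span (v ` {..<4} - {v j})" for x
    proof (rule linear_eq_0_on_span[OF linear_co _ that])
      fix x assume "x \<in> v ` {..<4} - {v j}"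
      then obtain i where "i < 4" "x = v i" "i \<noteq> j" by auto
      then show "co j x = 0" using j by (simp add: co_v)
    qed
    from this[OF j(2)] j(1) show False by (simp add: co_v)
  qed
  moreover have "card (v ` {..<4}) = 4" using inj by (simp add: card_image)
  ultimately show ?thesis using dim4 card_eq_dim[of "v ` {..<4}" UNIV] by (auto simp: dim_UNIV)
qed

lemma expand: "x = (\<Sum>i<4. co i x *\<^sub>R v i)"
proof -
  have "linear (\<lambda>x. \<Sum>i<4. co i x *\<^sub>R v i)"
    by (rule linearI) (auto simp: scaleR_add_left sum.distrib scaleR_sum_right)
  moreover have "(\<Sum>i<4. co i b *\<^sub>R v i) = id b" if b: "b \<in> v ` {..<4}" for b
  proof -
    obtain j where j: "j < 4" "b = v j" using b by auto
    have "(\<Sum>i<4. co i b *\<^sub>R v i) = (\<Sum>i<4. if i = j then v j else 0)"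
      using j by (intro sum.cong) (auto simp: co_v)
    then show ?thesis using j by simp
  qed
  ultimately have "(\<Sum>i<4. co i x *\<^sub>R v i) = id x"
    using linear_eq_on_span[OF _ linear_id, of "\<lambda>x. \<Sum>i<4. co i x *\<^sub>R v i" "v ` {..<4}" x] span_v by auto
  then show ?thesis by simp
qed

lemma expand_quad: "quad i j k l \<Longrightarrow> x = co i x *\<^sub>R v i + co j x *\<^sub>R v j + co k x *\<^sub>R v k + co l x *\<^sub>R v l"
  using expand[of x] quad_sum[of i j k l "\<lambda>i. co i x *\<^sub>R v i"] by simp

lemma co_eqI: "(\<And>i. i < 4 \<Longrightarrow> co i x = co i y) \<Longrightarrow> x = y"
  using expand[of x] expand[of y] by (metis (mono_tags, lifting) lessThan_iff sum.cong)

lemma inner_v: "quad i j k l \<Longrightarrow> v i \<bullet> x = co i x + c * (co j x + co k x + co l x)"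
proof -
  assume q: "quad i j k l"
  have "v i \<bullet> x = v i \<bullet> (co i x *\<^sub>R v i + co j x *\<^sub>R v j + co k x *\<^sub>R v k + co l x *\<^sub>R v l)"
    using expand_quad[OF q, of x] by simp
  then show ?thesis using quadD[OF q] by (simp add: inner_add gram algebra_simps)
qed

text \<open>Faces are numbered by the opposite vertex. Hence the edge joining vertices
  \<open>i\<close> and \<open>j\<close> is the common edge of the two faces numbered by the other
  two indices.\<close>

definition face :: "nat \<Rightarrow> 'a set" where
  "face l = {x. norm x = 1 \<and> (\<forall>i<4. 0 \<le> co i x) \<and> co l x = 0}"

definition edge :: "nat \<Rightarrow> nat \<Rightarrow> 'a set" where
  "edge i j = {x. norm x = 1 \<and> (\<forall>k<4. 0 \<le> co k x) \<and> (\<forall>k<4. k \<noteq> i \<and> k \<noteq> j \<longrightarrow> co k x = 0)}"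

definition bdry :: "'a set" where
  "bdry = (\<Union>l<4. face l)"

lemma edge_commute: "edge i j = edge j i" by (auto simp: edge_def)

lemma edge_iff: "quad i j k l \<Longrightarrow> x \<in> edge i j \<longleftrightarrow> norm x = 1 \<and> 0 \<le> co i x \<and> 0 \<le> co j x \<and> co k x = 0 \<and> co l x = 0"
  unfolding edge_def by (auto simp: quad_all dest: quadD)

lemma face_iff: "quad i j k l \<Longrightarrow> x \<in> face l \<longleftrightarrow> norm x = 1 \<and> 0 \<le> co i x \<and> 0 \<le> co j x \<and> 0 \<le> co k x \<and> co l x = 0"
  unfolding face_def by (auto simp: quad_all dest: quadD)

lemma closed_face: "closed (face l)"
proof -
  have "face l = {x. norm x = 1} \<inter> (\<Inter>i<4. {x. 0 \<le> co i x}) \<inter> {x. co l x = 0}"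
    by (auto simp: face_def)
  moreover have "closed {x::'a. norm x = 1}" "closed {x. co l x = 0}"
    by (intro closed_Collect_eq continuous_intros continuous_co)+
  moreover have "closed (\<Inter>i<4. {x. 0 \<le> co i x})"
    by (intro closed_INT ballI closed_Collect_le continuous_intros continuous_co)
  ultimately show ?thesis by (simp only: closed_Int)
qed

lemma nonneg_not_antipodal:
  assumes "\<forall>i<4. 0 \<le> co i x" "\<forall>i<4. 0 \<le> co i y" "norm x = 1" shows "y \<noteq> - x"
proof
  assume "y = - x"
  then have "x = 0" using assms by (intro co_eqI) (auto intro: antisym)
  then show False using assms by simp
qed

lemma between_nonneg: "between x y p \<Longrightarrow> \<forall>i<4. 0 \<le> co i x \<Longrightarrow> \<forall>i<4. 0 \<le> co i y \<Longrightarrow> \<forall>i<4. 0 \<le> co i p"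
  unfolding between_def by auto

text \<open>Two arcs overlapping in the piece from \<open>b\<close> to \<open>p\<close> form one
  arc. Eliminating \<open>p\<close> gives (1 - m r) b = l a + m s d, and m r \<ge> 1 would force
  \<open>b\<close> to be a multiple of \<open>p\<close>.\<close>

lemma between_glue:
  assumes nn: "\<forall>i<4. 0 \<le> co i a" "\<forall>i<4. 0 \<le> co i d" "\<forall>i<4. 0 \<le> co i b"
    and n: "norm b = 1" "norm p = 1" and "b \<noteq> p"
    and b: "between a p b" and p: "between b d p"
  shows "between a d b" "between a d p"
proof -
  obtain l m where lm: "0 \<le> l" "0 \<le> m" "b = l *\<^sub>R a + m *\<^sub>R p" using b unfolding between_def by blast
  obtain r s where rs: "0 \<le> r" "0 \<le> s" "p = r *\<^sub>R b + s *\<^sub>R d" using p unfolding between_def by blast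
  have eb: "(1 - m * r) *\<^sub>R b = l *\<^sub>R a + (m * s) *\<^sub>R d"
    using lm(3) by (subst (asm) rs(3)) (simp add: algebra_simps)
  have ep: "(1 - m * r) *\<^sub>R p = (r * l) *\<^sub>R a + s *\<^sub>R d"
    using rs(3) by (subst (asm) lm(3)) (simp add: algebra_simps)
  have pos: "0 < 1 - m * r"
  proof (rule ccontr)
    assume neg: "\<not> 0 < 1 - m * r"
    have z: "l * co i a = 0" if "i < 4" for i
    proof -
      have "(1 - m * r) * co i b = l * co i a + (m * s) * co i d"
        using arg_cong[OF eb, of "co i"] by simp
      moreover have "(1 - m * r) * co i b \<le> 0" using neg nn that by (intro mult_nonpos_nonneg) auto
      moreover have "0 \<le> l * co i a" "0 \<le> (m * s) * co i d" using lm rs nn that by auto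
      ultimately show ?thesis by linarith
    qed
    have "l *\<^sub>R a = 0" using z by (intro co_eqI) simp
    then have bm: "b = m *\<^sub>R p" using lm(3) by simp
    then have "norm b = \<bar>m\<bar> * norm p" by simp
    then have "m = 1" using n lm(2) by simp
    then show False using assms(6) bm by simp
  qed
  have "b = (1 / (1 - m * r)) *\<^sub>R (l *\<^sub>R a + (m * s) *\<^sub>R d)" using pos unfolding eb[symmetric] by simp
  then show "between a d b"
    using pos lm(1,2) rs(1,2) by (intro betweenI[of "l / (1 - m * r)" "m * s / (1 - m * r)"]) (simp_all add: scaleR_add_right)
  have "p = (1 / (1 - m * r)) *\<^sub>R ((r * l) *\<^sub>R a + s *\<^sub>R d)" using pos unfolding ep[symmetric] by simp
  then show "between a d p"
    using pos lm(1,2) rs(1,2) by (intro betweenI[of "r * l / (1 - m * r)" "s / (1 - m * r)"]) (simp_all add: scaleR_add_right)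
qed

lemma joined_face:
  assumes "l < 4" "x \<in> face l" "y \<in> face l"
  shows "joined bdry x y (ennreal (sph_dist x y))"
proof (rule joined_arc)
  show "norm x = 1" "norm y = 1" using assms by (auto simp: face_def)
  show "y \<noteq> - x" using assms by (intro nonneg_not_antipodal) (auto simp: face_def)
  fix a b :: real assume "0 \<le> a" "0 \<le> b" "norm (a *\<^sub>R x + b *\<^sub>R y) = 1"
  then have "a *\<^sub>R x + b *\<^sub>R y \<in> face l" using assms by (auto simp: face_def)
  then show "a *\<^sub>R x + b *\<^sub>R y \<in> bdry" using assms(1) by (auto simp: bdry_def)
qed

lemma unit_face: "x \<in> face l \<Longrightarrow> norm x = 1" by (simp add: face_def)
lemma unit_bdry: "x \<in> bdry \<Longrightarrow> norm x = 1" by (auto simp: face_def bdry_def)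
lemma nonneg_bdry: "x \<in> bdry \<Longrightarrow> i < 4 \<Longrightarrow> 0 \<le> co i x" by (auto simp: face_def bdry_def)

lemma joined_face2:
  assumes "l < 4" "l' < 4" "x \<in> face l" "p \<in> face l" "p \<in> face l'" "y \<in> face l'"
  shows "joined bdry x y (ennreal (sph_dist x p + sph_dist p y))"
proof -
  have "norm x = 1" "norm p = 1" "norm y = 1" using assms by (auto simp: face_def)
  then have "ennreal (sph_dist x p + sph_dist p y) = ennreal (sph_dist x p) + ennreal (sph_dist p y)"
    using sph_dist_bounds[of x p] sph_dist_bounds[of p y] by (simp add: ennreal_plus)
  then show ?thesis using joined_trans[OF joined_face[OF assms(1,3,4)] joined_face[OF assms(2,5,6)]] by simp
qed

lemma joined_face3:
  assumes "l < 4" "l' < 4" "l'' < 4" "x \<in> face l" "p \<in> face l" "p \<in> face l'" "q \<in> face l'" "q \<in> face l''" "y \<in> face l''"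
  shows "joined bdry x y (ennreal (sph_dist x p + sph_dist p q + sph_dist q y))"
proof -
  have n: "norm x = 1" "norm p = 1" "norm y = 1" "norm q = 1" using assms by (auto simp: face_def)
  then have "ennreal (sph_dist x p + sph_dist p q + sph_dist q y) = ennreal (sph_dist x p + sph_dist p q) + ennreal (sph_dist q y)"
    using sph_dist_bounds[of x p] sph_dist_bounds[of p q] sph_dist_bounds[of q y] by (simp add: ennreal_plus)
  then show ?thesis using joined_trans[OF joined_face2[OF assms(1,2,4,5,6,7)] joined_face[OF assms(3,8,9)]] by simp
qed

end


text \<open>A discrete subset of the circle \<open>\<real>/\<int>\<close>, enumerated by the integers.\<close>

lemma periodic_enumeration:
  fixes Z :: "real set"
  assumes per: "\<And>t. t + 1 \<in> Z \<longleftrightarrow> t \<in> Z" and fin: "finite (Z \<inter> {0..<1})" and ne: "Z \<inter> {0..<1} \<noteq> {}"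
  shows "\<exists>(\<tau> :: int \<Rightarrow> real) m. 0 < m \<and> strict_mono \<tau> \<and> range \<tau> = Z \<and> (\<forall>k. \<tau> (k + m) = \<tau> k + 1) \<and>
     \<tau> ` {0..<m} = Z \<inter> {0..<1}"
proof -
  define xs where "xs = sorted_list_of_set (Z \<inter> {0..<1})"
  define m where "m = int (length xs)"
  define \<tau> where "\<tau> = (\<lambda>k. xs ! nat (k mod m) + of_int (k div m))"
  have xs: "set xs = Z \<inter> {0..<1}" "sorted_wrt (<) xs" using fin by (auto simp: xs_def)
  have m: "0 < m" using ne xs(1) by (auto simp: m_def)
  have per': "t + of_int k \<in> Z \<longleftrightarrow> t \<in> Z" for t k
    using periodic_int[of "\<lambda>t. t \<in> Z" t k] per by auto
  have nth: "xs ! nat (k mod m) \<in> Z \<inter> {0..<1}" for k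
    using m nth_mem[of "nat (k mod m)" xs] unfolding xs(1)[symmetric] by (simp add: m_def nat_less_iff)
  have step: "\<tau> k < \<tau> (k + 1)" for k
  proof (cases "k mod m = m - 1")
    case True
    have km: "k = m * (k div m) + (m - 1)" using mult_div_mod_eq[of m k] True by simp
    have k1: "k + 1 = m * (k div m + 1)" using km by (simp add: algebra_simps)
    have "(k + 1) mod m = 0" "(k + 1) div m = k div m + 1"
      using int_mod_pos_eq[of "k + 1" m "k div m + 1" 0] int_div_pos_eq[of "k + 1" m "k div m + 1" 0] k1 m by auto
    then show ?thesis using nth[of k] nth[of "k + 1"] unfolding \<tau>_def by auto
  next
    case False
    have lt: "k mod m + 1 < m" using False pos_mod_bound[OF m, of k] by linarith
    have k1: "k + 1 = m * (k div m) + (k mod m + 1)" using mult_div_mod_eq[of m k] by simp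
    have nn: "0 \<le> k mod m + 1" using m by (simp add: add_nonneg_nonneg)
    have "(k + 1) mod m = k mod m + 1" "(k + 1) div m = k div m"
      using int_mod_pos_eq[OF k1 nn lt] int_div_pos_eq[OF k1 nn lt] by auto
    moreover have "xs ! nat (k mod m) < xs ! nat (k mod m + 1)"
      using lt m pos_mod_sign[OF m, of k] by (intro sorted_wrt_nth_less[OF xs(2)]) (simp_all add: m_def nat_less_eq_zless nat_less_iff)
    ultimately show ?thesis unfolding \<tau>_def by simp
  qed
  have steps: "\<tau> k < \<tau> (k + int (Suc n))" for k n
  proof (induction n)
    case 0 then show ?case using step[of k] by simp
  next
    case (Suc n) then show ?case using step[of "k + int (Suc n)"] by (simp add: algebra_simps)
  qed
  have mono: "strict_mono \<tau>"
  proof (rule strict_monoI)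
    fix k l :: int assume "k < l"
    then have "l = k + int (Suc (nat (l - k - 1)))" by simp
    then show "\<tau> k < \<tau> l" using steps[of k "nat (l - k - 1)"] by simp
  qed
  have rng: "range \<tau> = Z"
  proof
    show "range \<tau> \<subseteq> Z" using nth per' by (auto simp: \<tau>_def)
    show "Z \<subseteq> range \<tau>"
    proof
      fix t assume t: "t \<in> Z"
      have "t - of_int \<lfloor>t\<rfloor> \<in> Z \<inter> {0..<1}" using t per'[of "t - of_int \<lfloor>t\<rfloor>" "\<lfloor>t\<rfloor>"] by (auto; linarith)
      then obtain n where n: "n < length xs" "xs ! n = t - of_int \<lfloor>t\<rfloor>" by (auto simp: in_set_conv_nth simp flip: xs(1))
      have "(int n + m * \<lfloor>t\<rfloor>) mod m = int n" "(int n + m * \<lfloor>t\<rfloor>) div m = \<lfloor>t\<rfloor>" using n(1) int_mod_pos_eq[of "int n + m * \<lfloor>t\<rfloor>" m "\<lfloor>t\<rfloor>" "int n"] int_div_pos_eq[of "int n + m * \<lfloor>t\<rfloor>" m "\<lfloor>t\<rfloor>" "int n"]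
        by (auto simp: m_def)
      then have "\<tau> (int n + m * \<lfloor>t\<rfloor>) = t" using n unfolding \<tau>_def by simp
      then show "t \<in> range \<tau>" by (metis rangeI)
    qed
  qed
  have "\<tau> ` {0..<m} = set xs"
  proof -
    have e: "\<tau> k = xs ! nat k" if "k \<in> {0..<m}" for k using that unfolding \<tau>_def by simp
    show ?thesis
    proof
      show "\<tau> ` {0..<m} \<subseteq> set xs" using e by (auto simp: m_def nat_less_iff)
      show "set xs \<subseteq> \<tau> ` {0..<m}"
      proof
        fix t assume "t \<in> set xs"
        then obtain n where "n < length xs" "t = xs ! n" by (auto simp: in_set_conv_nth)
        then have "int n \<in> {0..<m}" "t = \<tau> (int n)" using e[of "int n"] by (auto simp: m_def)
        then show "t \<in> \<tau> ` {0..<m}" by (metis imageI)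
      qed
    qed
  qed
  moreover have "\<tau> (k + m) = \<tau> k + 1" for k using m unfolding \<tau>_def by simp
  ultimately show ?thesis using m mono rng xs(1) by blast
qed


section \<open>The geodesic as a periodic chain of great circle arcs\<close>

lemma locally_minimal_mono: "locally_minimal S g e \<Longrightarrow> 0 < e' \<Longrightarrow> e' \<le> e \<Longrightarrow> locally_minimal S g e'"
  unfolding locally_minimal_def by (meson add_left_mono order_trans)

context tetra begin

definition crossing :: "(real \<Rightarrow> 'a) \<Rightarrow> real \<Rightarrow> bool" where
  "crossing g t \<longleftrightarrow> (\<exists>i<4. \<exists>j<4. i \<noteq> j \<and> g t \<in> edge i j)"

lemma crossing_iff:
  assumes "g t \<in> bdry"
  shows "crossing g t \<longleftrightarrow> (\<exists>i<4. \<exists>j<4. i \<noteq> j \<and> co i (g t) = 0 \<and> co j (g t) = 0)"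
proof
  assume "crossing g t"
  then obtain i j where ij: "i < 4" "j < 4" "i \<noteq> j" "g t \<in> edge i j" by (auto simp: crossing_def)
  obtain k l where q: "quad i j k l" using quad_ex[OF ij(1,2,3)] by blast
  then show "\<exists>i<4. \<exists>j<4. i \<noteq> j \<and> co i (g t) = 0 \<and> co j (g t) = 0"
    using ij(4) quadD[OF q] edge_iff[OF q] by blast
next
  assume "\<exists>i<4. \<exists>j<4. i \<noteq> j \<and> co i (g t) = 0 \<and> co j (g t) = 0"
  then obtain i j where ij: "i < 4" "j < 4" "i \<noteq> j" "co i (g t) = 0" "co j (g t) = 0" by blast
  obtain k l where q: "quad i j k l" using quad_ex[OF ij(1,2,3)] by blast
  have q': "quad k l i j" using q unfolding quad_def by blast
  have "g t \<in> edge k l" unfolding edge_iff[OF q'] using ij(4,5) unit_bdry[OF assms] nonneg_bdry[OF assms] quadD[OF q] by auto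
  then show "crossing g t" using quadD[OF q] unfolding crossing_def by blast
qed

end

text \<open>\<open>\<tau>\<close> lists the times at which the curve meets an edge, \<open>m\<close>
  of them per period. Since windows are shorter than a period, distinct times in one window give
  distinct points.\<close>

locale geod = tetra +
  fixes g :: "real \<Rightarrow> 'a" and e :: real and \<tau> :: "int \<Rightarrow> real" and m :: int
  assumes cont: "continuous_on UNIV g" and rng: "g t \<in> bdry" and per: "g (t + 1) = g t"
    and inj: "inj_on g {0..<1}" and lmin: "locally_minimal bdry g e" and e_small: "e < 1 / 2"
    and fin: "i < 4 \<Longrightarrow> j < 4 \<Longrightarrow> i \<noteq> j \<Longrightarrow> finite (range g \<inter> edge i j)"
    and m_pos: "0 < m" and mono: "strict_mono \<tau>" and tau_range: "range \<tau> = {t. crossing g t}"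
    and tau_per: "\<tau> (k + m) = \<tau> k + 1"
begin

lemma e_pos: "0 < e" using lmin by (simp add: locally_minimal_def)

lemma unit: "norm (g t) = 1" using unit_bdry[OF rng] .

lemma nonneg: "i < 4 \<Longrightarrow> 0 \<le> co i (g t)" using nonneg_bdry[OF rng] .

lemma not_antipodal: "g t \<noteq> - g s" by (rule nonneg_not_antipodal) (auto intro: nonneg unit)

lemma g_eq_iff: "g s = g t \<longleftrightarrow> s - t \<in> \<int>"
proof
  assume "g s = g t"
  moreover have "g (frac u) = g u" for u
    using periodic_int[of g u "- \<lfloor>u\<rfloor>"] per by (simp add: frac_def)
  ultimately have "g (frac s) = g (frac t)" by simp
  then have "frac s = frac t" by (rule inj_onD[OF inj]) (auto simp: frac_lt_1)
  then have "s - t = of_int (\<lfloor>s\<rfloor> - \<lfloor>t\<rfloor>)" by (simp add: frac_def)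
  then show "s - t \<in> \<int>" by (metis Ints_of_int)
next
  assume "s - t \<in> \<int>"
  then obtain k where "s = t + of_int k" by (metis Ints_cases add.commute diff_add_cancel)
  then show "g s = g t" using periodic_int[of g t k] per by simp
qed

lemma g_neq: "s < t \<Longrightarrow> t < s + 1 \<Longrightarrow> g s \<noteq> g t"
proof
  assume st: "s < t" "t < s + 1" and "g s = g t"
  then have "t - s \<in> \<int>" using g_eq_iff[of t s] by simp
  then obtain k where "t - s = of_int k" by (auto elim: Ints_cases)
  then have "0 < (of_int k :: real)" "(of_int k :: real) < 1" using st by linarith+
  then show False by simp
qed

lemma minimal:
  "s \<le> r \<Longrightarrow> r \<le> t \<Longrightarrow> t \<le> s + e \<Longrightarrow> joined bdry (g s) (g t) (ennreal l) \<Longrightarrow> 0 \<le> l \<Longrightarrow>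
    sph_dist (g s) (g r) + sph_dist (g r) (g t) \<le> l"
  using lmin unfolding locally_minimal_def by blast

text \<open>The great circle arc inside the face is a competitor, so the three points give equality
  in the triangle inequality.\<close>

lemma same_face:
  assumes "s \<le> r" "r \<le> t" "t \<le> s + e" "l < 4" "g s \<in> face l" "g t \<in> face l"
  shows "between (g s) (g t) (g r)"
proof -
  have "sph_dist (g s) (g r) + sph_dist (g r) (g t) \<le> sph_dist (g s) (g t)"
    using assms sph_dist_bounds[OF unit unit] by (intro minimal joined_face) auto
  moreover have "sph_dist (g s) (g t) < pi"
    using sph_dist_bounds[OF unit unit, of s t] sph_dist_eq_pi[OF unit unit, of s t] not_antipodal[of t s] by auto
  ultimately show ?thesis unfolding between_def using sph_dist_additive_imp_between[OF unit unit unit] by blast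
qed

lemma tau_less: "k < l \<Longrightarrow> \<tau> k < \<tau> l" using mono by (simp add: strict_mono_def)

lemma tau_Suc_le: "\<tau> (k + 1) \<le> \<tau> k + 1"
  using strict_mono_less_eq[OF mono, of "k + 1" "k + m"] m_pos unfolding tau_per by simp

lemma gap: "\<tau> k < t \<Longrightarrow> t < \<tau> (k + 1) \<Longrightarrow> \<not> crossing g t"
proof
  assume t: "\<tau> k < t" "t < \<tau> (k + 1)" and "crossing g t"
  then obtain j where "t = \<tau> j" using tau_range by blast
  then show False using t strict_mono_less[OF mono] by auto
qed

lemma crossing_tau: "crossing g (\<tau> k)" using tau_range by blast

text \<open>The face that contains the arc from crossing \<open>k\<close> to crossing
  \<open>k + 1\<close>, read off at the middle time.\<close>

definition phi :: "int \<Rightarrow> nat" where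
  "phi k = (SOME l. l < 4 \<and> g ((\<tau> k + \<tau> (k + 1)) / 2) \<in> face l)"

definition x :: "int \<Rightarrow> 'a" where "x k = g (\<tau> k)"

lemma phi_mid: "phi k < 4 \<and> g ((\<tau> k + \<tau> (k + 1)) / 2) \<in> face (phi k)"
  unfolding phi_def by (rule someI_ex) (use rng in \<open>auto simp: bdry_def\<close>)

lemma phi_less: "phi k < 4" using phi_mid by blast

lemma phi_per: "phi (k + m) = phi k"
proof -
  have t: "\<tau> (k + m + 1) = \<tau> (k + 1) + 1" using tau_per[of "k + 1"] by (simp add: algebra_simps)
  have "g ((\<tau> (k + m) + \<tau> (k + m + 1)) / 2) = g ((\<tau> k + \<tau> (k + 1)) / 2 + 1)"
    unfolding t tau_per by (rule arg_cong[of _ _ g]) (simp add: field_simps)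
  then show ?thesis unfolding phi_def per by simp
qed

lemma x_per: "x (k + m) = x k" unfolding x_def tau_per per ..

lemma noncrossing_pos:
  "\<not> crossing g t \<Longrightarrow> l < 4 \<Longrightarrow> co l (g t) = 0 \<Longrightarrow> i < 4 \<Longrightarrow> i \<noteq> l \<Longrightarrow> 0 < co i (g t)"
  using crossing_iff[of g t, OF rng] nonneg[of i t] by force

text \<open>Between crossings, lying in face \<open>phi k\<close> is a closed condition, and it is
  equivalent to the open condition that the other three coordinates are positive. The time interval
  is connected.\<close>

lemma arc_face: "\<tau> k < t \<Longrightarrow> t < \<tau> (k + 1) \<Longrightarrow> co (phi k) (g t) = 0"
proof -
  assume t: "\<tau> k < t" "t < \<tau> (k + 1)"
  define I where "I = {\<tau> k<..<\<tau> (k + 1)}"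
  define A where "A = {t \<in> I. co (phi k) (g t) = 0}"
  have cc: "continuous_on B (\<lambda>t. co i (g t))" for i B
    by (rule continuous_on_compose2[OF continuous_co continuous_on_subset[OF cont]]) auto
  have cl: "closedin (top_of_set I) A"
    unfolding A_def by (rule continuous_closedin_preimage_constant[OF cc])
  have "A = I \<inter> (\<Inter>i\<in>{..<4} - {phi k}. {t. 0 < co i (g t)})"
  proof (intro equalityI subsetI)
    fix t assume "t \<in> A" then show "t \<in> I \<inter> (\<Inter>i\<in>{..<4} - {phi k}. {t. 0 < co i (g t)})"
      unfolding A_def I_def using noncrossing_pos[OF gap phi_less] by auto
  next
    fix t assume t: "t \<in> I \<inter> (\<Inter>i\<in>{..<4} - {phi k}. {t. 0 < co i (g t)})"
    obtain l where l: "l < 4" "co l (g t) = 0" using rng[of t] by (auto simp: bdry_def face_def)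
    then have "l = phi k" using t by force
    then show "t \<in> A" using t l by (simp add: A_def)
  qed
  moreover have "open (\<Inter>i\<in>{..<4} - {phi k}. {t. 0 < co i (g t)})"
    by (intro open_INT ballI open_Collect_less cc) auto
  ultimately have op: "openin (top_of_set I) A" by (simp add: openin_open_Int)
  have ne: "(\<tau> k + \<tau> (k + 1)) / 2 \<in> A"
    using tau_less[of k "k + 1"] phi_mid[of k] by (simp add: face_def A_def I_def)
  have "connected I" by (simp add: I_def)
  then have "A = {} \<or> A = I" using op cl unfolding connected_clopen by blast
  then have "A = I" using ne by auto
  moreover have "t \<in> I" using t by (simp add: I_def)
  ultimately show ?thesis by (auto simp: A_def)
qed

lemma arc_pos: "\<tau> k < t \<Longrightarrow> t < \<tau> (k + 1) \<Longrightarrow> i < 4 \<Longrightarrow> i \<noteq> phi k \<Longrightarrow> 0 < co i (g t)"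
  using noncrossing_pos[OF gap phi_less arc_face] .

lemma in_face: "\<tau> k \<le> t \<Longrightarrow> t \<le> \<tau> (k + 1) \<Longrightarrow> g t \<in> face (phi k)"
proof -
  assume t: "\<tau> k \<le> t" "t \<le> \<tau> (k + 1)"
  have "g ` closure {\<tau> k<..<\<tau> (k + 1)} \<subseteq> face (phi k)"
  proof (rule image_closure_subset)
    show "continuous_on (closure {\<tau> k<..<\<tau> (k + 1)}) g" using cont continuous_on_subset by blast
    show "closed (face (phi k))" by (rule closed_face)
    show "g ` {\<tau> k<..<\<tau> (k + 1)} \<subseteq> face (phi k)" using arc_face nonneg unit by (auto simp: face_def)
  qed
  moreover have "t \<in> closure {\<tau> k<..<\<tau> (k + 1)}" using t tau_less[of k "k + 1"] by simp
  ultimately show ?thesis by blast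
qed

text \<open>\<open>same_face\<close> works in windows of length \<open>e\<close>. Windows advanced
  by e / 2 overlap, and \<open>between_glue\<close> joins them into one arc.\<close>

lemma arc_between:
  assumes t: "\<tau> k \<le> t" "t \<le> \<tau> (k + 1)"
  shows "between (x k) (x (k + 1)) (g t)"
proof -
  define b where "b = (\<lambda>n. min (\<tau> (k + 1)) (\<tau> k + real n * (e / 2)))"
  have bb: "\<tau> k \<le> b n" "b n \<le> \<tau> (k + 1)" "b n \<le> b (Suc n)" "b (Suc n) \<le> b n + e / 2" for n
  proof -
    have s: "real (Suc n) * (e / 2) = real n * (e / 2) + e / 2" by (simp add: algebra_simps)
    have p: "0 \<le> real n * (e / 2)" using e_pos by simp
    show "\<tau> k \<le> b n" "b n \<le> \<tau> (k + 1)" "b n \<le> b (Suc n)" "b (Suc n) \<le> b n + e / 2"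
      using tau_less[of k "k + 1"] e_pos p unfolding b_def s by linarith+
  qed
  have fc: "g r \<in> face (phi k)" if "\<tau> k \<le> r" "r \<le> b n" for r n
    using that bb(2)[of n] by (intro in_face) auto
  have main: "\<forall>r. \<tau> k \<le> r \<and> r \<le> b (Suc n) \<longrightarrow> between (g (\<tau> k)) (g (b (Suc n))) (g r)" for n
  proof (induction n)
    case 0
    show ?case
    proof clarify
      fix r assume "\<tau> k \<le> r" "r \<le> b (Suc 0)"
      moreover have "b (Suc 0) \<le> \<tau> k + e" using e_pos by (simp add: b_def)
      ultimately show "between (g (\<tau> k)) (g (b (Suc 0))) (g r)"
        using bb[of "Suc 0"] fc[of _ "Suc 0"] by (intro same_face[OF _ _ _ phi_less[of k]]) auto
    qed
  next
    case (Suc n)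
    show ?case
    proof (cases "b (Suc n) = \<tau> (k + 1)")
      case True
      then have "b (Suc (Suc n)) = b (Suc n)" using bb(2,3) by (metis antisym)
      then show ?thesis using Suc by simp
    next
      case False
      have s: "real (Suc n) * (e / 2) = real n * (e / 2) + e / 2" by (simp add: algebra_simps)
      have lt: "b n < b (Suc n)" "b (Suc n) = b n + e / 2"
        using False e_pos unfolding b_def s by linarith+
      have ne: "g (b n) \<noteq> g (b (Suc n))" using lt e_small by (intro g_neq) auto
      have 1: "between (g (\<tau> k)) (g (b (Suc n))) (g (b n))" using Suc bb(1)[of n] lt by auto
      have w: "b (Suc (Suc n)) \<le> b n + e" using bb(4)[of "Suc n"] lt by auto
      have loc: "between (g (b n)) (g (b (Suc (Suc n)))) (g r)" if "b n \<le> r" "r \<le> b (Suc (Suc n))" for r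
        using that w bb(1)[of n] bb(1)[of "Suc (Suc n)"] by (intro same_face[OF _ _ _ phi_less[of k] fc[of _ "Suc (Suc n)"] fc[of _ "Suc (Suc n)"]]) auto
      have 2: "between (g (b n)) (g (b (Suc (Suc n)))) (g (b (Suc n)))" using loc lt bb(3)[of "Suc n"] by auto
      have nn: "\<forall>i<4. 0 \<le> co i (g t)" for t using nonneg by blast
      note gl = between_glue[OF nn nn nn unit unit ne 1 2]
      show ?thesis
      proof clarify
        fix r assume r: "\<tau> k \<le> r" "r \<le> b (Suc (Suc n))"
        show "between (g (\<tau> k)) (g (b (Suc (Suc n)))) (g r)"
        proof (cases "r \<le> b (Suc n)")
          case True
          then have "between (g (\<tau> k)) (g (b (Suc n))) (g r)" using Suc r by blast
          then show ?thesis using gl(2) by (rule between_trans)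
        next
          case False
          then have "between (g (b n)) (g (b (Suc (Suc n)))) (g r)" using loc r lt by auto
          then show ?thesis using between_trans[OF between_commute between_commute[OF gl(1)]] between_commute by blast
        qed
      qed
    qed
  qed
  obtain n where "(\<tau> (k + 1) - \<tau> k) / (e / 2) < real n" using reals_Archimedean2 by blast
  then have "\<tau> (k + 1) - \<tau> k < real (Suc n) * (e / 2)" using e_pos by (simp add: field_simps)
  then have "b (Suc n) = \<tau> (k + 1)" unfolding b_def by simp
  then show ?thesis using main[of n] t unfolding x_def by auto
qed

lemma arc_coeffs:
  assumes t: "\<tau> k < t" "t < \<tau> (k + 1)"
  shows "\<exists>a b. 0 < a \<and> 0 < b \<and> g t = a *\<^sub>R x k + b *\<^sub>R x (k + 1)"
proof -
  obtain a b where ab: "0 \<le> a" "0 \<le> b" "g t = a *\<^sub>R x k + b *\<^sub>R x (k + 1)"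
    using arc_between[of k t] t unfolding between_def by auto
  have "g (\<tau> k) \<noteq> g t" "g t \<noteq> g (\<tau> (k + 1))"
    using t tau_Suc_le[of k] g_neq[of "\<tau> k" t] g_neq[of t "\<tau> (k + 1)"] by auto
  then have ne: "g t \<noteq> x k" "g t \<noteq> x (k + 1)" unfolding x_def by auto
  have u: "norm (x k) = 1" "norm (x (k + 1)) = 1" unfolding x_def by (simp_all add: unit)
  have "a \<noteq> 0"
  proof
    assume "a = 0"
    then have "g t = b *\<^sub>R x (k + 1)" using ab by simp
    moreover from this have "b = 1" using unit[of t] u ab(2) by simp
    ultimately show False using ne by simp
  qed
  moreover have "b \<noteq> 0"
  proof
    assume "b = 0"
    then have "g t = a *\<^sub>R x k" using ab by simp
    moreover from this have "a = 1" using unit[of t] u ab(1) by simp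
    ultimately show False using ne by simp
  qed
  ultimately show ?thesis using ab by (intro exI[of _ a] exI[of _ b]) auto
qed

text \<open>A geodesic cannot touch an edge and return to the same face: the crossing would lie
  between two interior points of the face, where only one coordinate vanishes.\<close>

lemma phi_neq: "phi (k - 1) \<noteq> phi k"
proof
  assume eq: "phi (k - 1) = phi k"
  define s where "s = max (\<tau> k - e / 2) ((\<tau> (k - 1) + \<tau> k) / 2)"
  define t where "t = min (\<tau> k + e / 2) ((\<tau> k + \<tau> (k + 1)) / 2)"
  have s: "\<tau> (k - 1) < s" "s < \<tau> (k - 1 + 1)" "\<tau> k - e / 2 \<le> s"
    using tau_less[of "k - 1" k] e_pos unfolding s_def by (auto simp: less_max_iff_disj)
  have t: "\<tau> k < t" "t < \<tau> (k + 1)" "t \<le> \<tau> k + e / 2"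
    using tau_less[of k "k + 1"] e_pos unfolding t_def by (auto simp: min_less_iff_disj)
  have "between (g s) (g t) (g (\<tau> k))"
    using s t in_face[of "k - 1" s] in_face[of k t] eq by (intro same_face[OF _ _ _ phi_less[of k]]) auto
  then obtain a b where ab: "0 \<le> a" "0 \<le> b" "g (\<tau> k) = a *\<^sub>R g s + b *\<^sub>R g t" unfolding between_def by blast
  have "a \<noteq> 0 \<or> b \<noteq> 0" using ab unit[of "\<tau> k"] by auto
  then have "0 < co i (g (\<tau> k))" if "i < 4" "i \<noteq> phi k" for i
    using that ab arc_pos[OF s(1,2), of i] arc_pos[OF t(1,2), of i] eq
    by (auto simp: add_nonneg_pos add_pos_nonneg)
  then show False using crossing_tau[of k] crossing_iff[of g "\<tau> k", OF rng] by (metis less_irrefl)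
qed

lemma x_zero: "co (phi (k - 1)) (x k) = 0" "co (phi k) (x k) = 0"
  using in_face[of "k - 1" "\<tau> k"] in_face[of k "\<tau> k"] tau_less[of "k - 1" k] tau_less[of k "k + 1"]
  unfolding x_def by (auto simp: face_def)

end


section \<open>Face angles and shortcuts around a vertex\<close>

lemma norm_eq_1I: "(norm x)\<^sup>2 = 1 \<Longrightarrow> norm x = 1"
  using norm_ge_zero[of x] by (auto simp: power2_eq_1_iff)

lemma sph_dir_norm: "norm x = 1 \<Longrightarrow> norm y = 1 \<Longrightarrow> norm (y - (x \<bullet> y) *\<^sub>R x) = sqrt (1 - (x \<bullet> y)\<^sup>2)"
  for x y :: "'a::euclidean_space"
  using perp_norm[of y x] by (simp add: inner_commute sin_sph_dist)

lemma inner_sph_dir_perp: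
  "norm x = 1 \<Longrightarrow> norm y = 1 \<Longrightarrow> x \<bullet> u = 0 \<Longrightarrow> u \<bullet> sph_dir x y = (y \<bullet> u) / sqrt (1 - (x \<bullet> y)\<^sup>2)"
  unfolding sph_dir_def sgn_div_norm
  by (simp add: sph_dir_norm inner_diff inner_commute divide_inverse mult.commute)

lemma inner_sph_dir_self: "norm x = 1 \<Longrightarrow> x \<bullet> sph_dir x y = 0"
  unfolding sph_dir_def sgn_div_norm by (simp add: inner_diff unit_inner)

lemma sph_dir_between: "norm x = 1 \<Longrightarrow> 0 < b \<Longrightarrow> y = a *\<^sub>R x + b *\<^sub>R z \<Longrightarrow> sph_dir x y = sph_dir x z"
proof -
  assume n: "norm x = 1" and b: "0 < b" and y: "y = a *\<^sub>R x + b *\<^sub>R z"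
  have "y - (x \<bullet> y) *\<^sub>R x = b *\<^sub>R (z - (x \<bullet> z) *\<^sub>R x)"
    unfolding y using n by (simp add: inner_add unit_inner algebra_simps)
  then show ?thesis unfolding sph_dir_def using b by (simp add: sgn_scaleR)
qed

context tetra begin

definition side :: real where "side = arccos c"
text \<open>The face angle: for an equilateral triangle with side cosine c the cosine law gives (c -
  c^2) / (1 - c^2).\<close>

definition ang :: real where "ang = arccos (c / (1 + c))"

lemma cos_side: "cos side = c" unfolding side_def using c_bounds by (simp add: cos_arccos)

lemma side_bounds: "0 < side" "side < pi"
  unfolding side_def using c_bounds arccos_lt_bounded[of c] by auto

lemma sin_side: "0 < sin side" using side_bounds by (rule sin_gt_zero)

lemma cos_ang: "cos ang = c / (1 + c)"
  unfolding ang_def using c_bounds by (intro cos_arccos) (auto simp: field_simps)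

text \<open>The upper bound comes from c > -1/3 and says that the three face angles at a vertex add
  up to less than 2 pi; shortcuts around a vertex rest on this.\<close>

lemma ang_bounds: "0 < ang" "ang < 2 * pi / 3"
proof -
  have b: "- 1 / 2 < c / (1 + c)" "c / (1 + c) < 1" using c_bounds by (auto simp: field_simps)
  then show "0 < ang" using arccos_lt_bounded[of "c / (1 + c)"] unfolding ang_def by auto
  have "cos (2 * pi / 3) = - 1 / 2" using cos_120 by simp
  then have "cos (2 * pi / 3) < cos ang" using b unfolding cos_ang by simp
  then show "ang < 2 * pi / 3"
    using arccos_lt_bounded[of "c / (1 + c)"] b unfolding ang_def[symmetric]
    by (subst (asm) cos_mono_less_eq) auto
qed

text \<open>Unit tangent at vertex \<open>i\<close> of the edge towards vertex
  \<open>j\<close>.\<close>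

definition etan :: "nat \<Rightarrow> nat \<Rightarrow> 'a" where
  "etan i j = (1 / sin side) *\<^sub>R (v j - c *\<^sub>R v i)"

lemma sin2_side: "(sin side)\<^sup>2 = 1 - c\<^sup>2" using sin_cos_squared_add[of side] cos_side by simp

lemma etan_props:
  assumes "i < 4" "j < 4" "i \<noteq> j"
  shows "norm (etan i j) = 1" "v i \<bullet> etan i j = 0"
    "v j = c *\<^sub>R v i + sin side *\<^sub>R etan i j"
proof -
  have s: "sin side \<noteq> 0" using sin_side by simp
  have "etan i j \<bullet> etan i j = 1"
    using assms s sin2_side unfolding etan_def
    by (simp add: inner_diff gram field_simps power2_eq_square)
  then show "norm (etan i j) = 1" by (simp add: norm_eq_1)
  show "v i \<bullet> etan i j = 0" using assms unfolding etan_def by (simp add: inner_diff gram)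
  show "v j = c *\<^sub>R v i + sin side *\<^sub>R etan i j" using s unfolding etan_def by simp
qed

lemma etan_inner:
  assumes "i < 4" "j < 4" "k < 4" "i \<noteq> j" "i \<noteq> k" "j \<noteq> k"
  shows "etan i j \<bullet> etan i k = cos ang"
proof -
  have "etan i j \<bullet> etan i k = (c - c\<^sup>2) / (sin side)\<^sup>2"
    using assms unfolding etan_def by (simp add: inner_diff gram power2_eq_square)
  also have "\<dots> = cos ang"
  proof -
    have "c - c\<^sup>2 = (1 - c) * c" "1 - c\<^sup>2 = (1 - c) * (1 + c)" by (simp_all add: power2_eq_square algebra_simps)
    then show ?thesis unfolding sin2_side cos_ang using c_bounds by simp
  qed
  finally show ?thesis .
qed

lemma edge_point:
  assumes q: "quad i j f l" and s: "0 \<le> s" "s \<le> side"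
  shows "cos s *\<^sub>R v i + sin s *\<^sub>R etan i j \<in> edge i j"
proof -
  let ?p = "cos s *\<^sub>R v i + sin s *\<^sub>R etan i j"
  have ij: "i < 4" "j < 4" "i \<noteq> j" using quadD[OF q] by auto
  note et = etan_props[OF ij]
  have "(norm ?p)\<^sup>2 = 1"
    unfolding norm_lincomb_squared using et norm_v[OF ij(1)] by simp
  then have n: "norm ?p = 1" by (rule norm_eq_1I)
  have eq: "?p = (sin (side - s) / sin side) *\<^sub>R v i + (sin s / sin side) *\<^sub>R v j"
  proof -
    have "sin (side - s) / sin side = cos s - c * sin s / sin side"
      using sin_side by (simp add: sin_diff cos_side diff_divide_distrib)
    then show ?thesis unfolding etan_def by (simp add: scaleR_diff_right scaleR_diff_left mult.commute)
  qed
  have "0 \<le> sin (side - s)" "0 \<le> sin s" using s side_bounds by (auto intro!: sin_ge_zero)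
  then show ?thesis unfolding edge_iff[OF q]
    using n sin_side quadD[OF q] unfolding eq by (auto simp: co_v)
qed

text \<open>Polar coordinates of \<open>y\<close> about vertex \<open>i\<close>: the direction
  \<open>d\<close> is a positive combination of the tangents of the two edges bounding the face
  there, so it splits the face angle.\<close>

lemma vertex_direction:
  assumes q: "quad i j f l" and y: "y \<in> face f" "0 < co j y" "0 < co l y" and r: "sph_dist (v i) y = r" "0 < r" "r < pi / 2"
  shows "\<exists>d. norm d = 1 \<and> v i \<bullet> d = 0 \<and> y = cos r *\<^sub>R v i + sin r *\<^sub>R d \<and>
     0 < sph_dist (etan i j) d \<and> sph_dist (etan i j) d + sph_dist d (etan i l) = ang"
proof -
  have qq: "i < 4" "j < 4" "l < 4" "f < 4" "i \<noteq> j" "i \<noteq> l" "j \<noteq> l" "f \<noteq> l" "f \<noteq> j" "f \<noteq> i" using quadD[OF q] by auto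
  note ej = etan_props[OF qq(1,2,5)] and el = etan_props[OF qq(1,3,6)]
  have sr: "0 < sin r" using r by (intro sin_gt_zero) auto
  have ny: "norm y = 1" using y by (simp add: face_def)
  have iy: "v i \<bullet> y = cos r" using cos_sph_dist[OF norm_v[OF qq(1)] ny] r by simp
  have yex: "y = co i y *\<^sub>R v i + co j y *\<^sub>R v j + co l y *\<^sub>R v l"
    using expand_quad[OF q, of y] y(1) by (simp add: face_def)
  define d where "d = (1 / sin r) *\<^sub>R (y - cos r *\<^sub>R v i)"
  have yd: "y = cos r *\<^sub>R v i + sin r *\<^sub>R d" using sr unfolding d_def by simp
  have od: "v i \<bullet> d = 0" unfolding d_def using iy norm_v[OF qq(1)] by (simp add: inner_diff unit_inner)
  have "1 = (cos r)\<^sup>2 + (sin r)\<^sup>2 * (norm d)\<^sup>2"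
    using norm_lincomb_squared[of "cos r" "v i" "sin r" d] yd ny norm_v[OF qq(1)] od by simp
  then have "(sin r)\<^sup>2 * (norm d)\<^sup>2 = (sin r)\<^sup>2" using sin_cos_squared_add[of r] by linarith
  then have "(norm d)\<^sup>2 = 1" using sr by simp
  then have nd: "norm d = 1" by (rule norm_eq_1I)
  have "v i \<bullet> y = co i y + co j y * c + co l y * c"
    using arg_cong[OF yex, of "\<lambda>w. v i \<bullet> w"] qq by (simp add: inner_add gram)
  then have "y - cos r *\<^sub>R v i = (co j y * sin side) *\<^sub>R etan i j + (co l y * sin side) *\<^sub>R etan i l"
    using yex iy sin_side unfolding etan_def by (simp add: algebra_simps)
  then have de: "d = (co j y * sin side / sin r) *\<^sub>R etan i j + (co l y * sin side / sin r) *\<^sub>R etan i l"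
    unfolding d_def by (simp add: scaleR_add_right)
  have nonanti: "etan i l \<noteq> - etan i j"
  proof
    assume "etan i l = - etan i j"
    then have "etan i j \<bullet> etan i l = - (etan i j \<bullet> etan i j)" by simp
    also have "\<dots> = - 1" using ej(1) by (simp add: norm_eq_1)
    finally have "c / (1 + c) = - 1" using etan_inner[OF qq(1-3,5-7)] cos_ang by simp
    then show False using c_bounds by (simp add: field_simps)
  qed
  have "sph_dist (etan i j) d + sph_dist d (etan i l) = sph_dist (etan i j) (etan i l)"
    by (rule sph_dist_between[OF ej(1) nd el(1) nonanti de]) (use y sin_side sr in auto)
  also have "\<dots> = ang" unfolding sph_dist_def etan_inner[OF qq(1-3,5-7)] using ang_bounds by (intro arccos_cos) auto
  finally have sum: "sph_dist (etan i j) d + sph_dist d (etan i l) = ang" .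
  have "etan i j \<noteq> d"
  proof
    assume "etan i j = d"
    then have "co l (etan i j) = co l d" by simp
    moreover have "co l (etan i j) = 0" using qq unfolding etan_def by (simp add: co_v)
    moreover have "co l d = co l y / sin r" unfolding d_def using qq by (simp add: co_v)
    ultimately show False using y sr by simp
  qed
  then have "0 < sph_dist (etan i j) d" using sph_dist_eq_0[OF ej(1) nd] sph_dist_bounds[OF ej(1) nd] by linarith
  then show ?thesis using nd od yd sum by blast
qed

text \<open>The two ways around vertex \<open>i\<close> from \<open>y\<close> to \<open>z\<close>
  have total angle 3 \<open>ang\<close> < 2 pi. One of them has angle below pi, and unfolding it by
  \<open>sector_shortcut\<close> beats the path of length 2 r through the vertex.\<close>

lemma vertex_shortcut:
  assumes q: "quad i j f l" and y: "y \<in> face f" "0 < co j y" "0 < co l y" and z: "z \<in> face l" "0 < co j z" "0 < co f z"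
    and r: "sph_dist (v i) y = r" "sph_dist (v i) z = r" "0 < r" "r < pi / 2" "r \<le> side"
  shows "\<exists>L<2*r. 0 \<le> L \<and> joined bdry y z (ennreal L)"
proof -
  have qq: "i < 4" "j < 4" "l < 4" "f < 4" "i \<noteq> j" "i \<noteq> l" "j \<noteq> l" "f \<noteq> l" "f \<noteq> j" "f \<noteq> i" using quadD[OF q] by auto
  have q': "quad i j l f" "quad i l f j" "quad i f l j" using q unfolding quad_def by auto
  note ej = etan_props[OF qq(1,2,5)] and el = etan_props[OF qq(1,3,6)] and ef = etan_props[OF qq(1,4) qq(10)[symmetric]]
  obtain d1 where d1: "norm d1 = 1" "v i \<bullet> d1 = 0" "y = cos r *\<^sub>R v i + sin r *\<^sub>R d1"
     "0 < sph_dist (etan i j) d1" "sph_dist (etan i j) d1 + sph_dist d1 (etan i l) = ang"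
    using vertex_direction[OF q y r(1,3,4)] by blast
  obtain d2 where d2: "norm d2 = 1" "v i \<bullet> d2 = 0" "z = cos r *\<^sub>R v i + sin r *\<^sub>R d2"
     "0 < sph_dist (etan i j) d2" "sph_dist (etan i j) d2 + sph_dist d2 (etan i f) = ang"
    using vertex_direction[OF q'(1) z r(2,3,4)] by blast
  have edge_faces: "edge i j \<subseteq> face f \<inter> face l" "edge i l \<subseteq> face f \<inter> face j" "edge i f \<subseteq> face l \<inter> face j"
    using qq unfolding edge_def face_def by auto
  define P where "P = (\<lambda>j s. cos s *\<^sub>R v i + sin s *\<^sub>R etan i j)"
  have Pe: "P j s \<in> edge i j" "P l s \<in> edge i l" "P f s \<in> edge i f" if "0 < s" "s \<le> r" for s
    using edge_point[OF q, of s] edge_point[OF q'(2), of s] edge_point[OF q'(3), of s] that r(5) unfolding P_def by auto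
  have nn: "norm y = 1" "norm z = 1" using y z by (auto simp: face_def)
  show ?thesis
  proof (cases "sph_dist (etan i j) d1 + sph_dist (etan i j) d2 < pi")
    \<comment> \<open>The way across the common edge \<open>i j\<close> of the two faces; the
      intermediate direction is used twice, with angle 0 between.\<close>
    case True
    obtain s where s: "0 < s" "s \<le> r" "sph_dist y (P j s) + sph_dist (P j s) (P j s) + sph_dist (P j s) z < 2 * r"
      using sector_shortcut[OF norm_v[OF qq(1)] d1(1) ej(1) ej(1) d2(1) d1(2) ej(2) ej(2) d2(2),
          of "sph_dist (etan i j) d1" 0 "sph_dist (etan i j) d2" r]
        ej(1) d1 d2 r True unfolding P_def by (auto simp: cos_sph_dist inner_commute unit_inner)
    have p: "P j s \<in> face f" "P j s \<in> face l" using Pe[OF s(1,2)] edge_faces by auto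
    then have np: "norm (P j s) = 1" by (simp add: face_def)
    show ?thesis using joined_face2[OF qq(4,3) y(1) p z(1)] s(3) np
        sph_dist_bounds[OF nn(1) np] sph_dist_bounds[OF np nn(2)]
      by (intro exI[of _ "sph_dist y (P j s) + sph_dist (P j s) z"]) auto
  next
    \<comment> \<open>The way through the third face \<open>j\<close>, crossing the edges
      \<open>i l\<close> and \<open>i f\<close>.\<close>
    case False
    let ?A = "sph_dist d1 (etan i l)" and ?C = "sph_dist d2 (etan i f)"
    have AC: "0 \<le> ?A" "0 \<le> ?C" using sph_dist_bounds[OF d1(1) el(1)] sph_dist_bounds[OF d2(1) ef(1)] by auto
    have tot: "?A + ang + ?C < pi" using False d1(5) d2(5) ang_bounds by linarith
    have lf: "etan i l \<bullet> etan i f = cos ang" using qq by (intro etan_inner) auto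
    obtain s1 s2 where s: "0 < s1" "s1 \<le> r" "0 < s2" "s2 \<le> r"
      "sph_dist y (P l s1) + sph_dist (P l s1) (P f s2) + sph_dist (P f s2) z < 2 * r"
      using sector_shortcut[OF norm_v[OF qq(1)] d1(1) el(1) ef(1) d2(1) d1(2) el(2) ef(2) d2(2) _ lf _ AC(1) _ AC(2) _ tot r(3,4)]
        ang_bounds AC el(1) ef(1) d1(1,3) d2(1,3) unfolding P_def by (auto simp: cos_sph_dist inner_commute)
    have p: "P l s1 \<in> face f" "P l s1 \<in> face j" "P f s2 \<in> face j" "P f s2 \<in> face l" using Pe s(1-4) edge_faces by auto
    then have np: "norm (P l s1) = 1" "norm (P f s2) = 1" by (simp_all add: face_def)
    show ?thesis using joined_face3[OF qq(4,2,3) y(1) p z(1)] s(5)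
        sph_dist_bounds[OF nn(1) np(1)] sph_dist_bounds[OF np] sph_dist_bounds[OF np(2) nn(2)]
      by (intro exI[of _ "sph_dist y (P l s1) + sph_dist (P l s1) (P f s2) + sph_dist (P f s2) z"]) auto
  qed
qed

end


section \<open>No vertices, equal angles at the edges, disjoint arcs\<close>

context geod begin

lemma cont_on: "continuous_on A g" using cont continuous_on_subset by blast

lemma left_point: "\<exists>s. \<tau> (k - 1) < s \<and> s < \<tau> k \<and> \<tau> k - e / 2 \<le> s"
  using tau_less[of "k - 1" k] e_pos
  by (intro exI[of _ "max (\<tau> k - e / 2) ((\<tau> (k - 1) + \<tau> k) / 2)"]) (auto simp: less_max_iff_disj)

lemma right_point: "\<exists>t. \<tau> k < t \<and> t < \<tau> (k + 1) \<and> t \<le> \<tau> k + e / 2"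
  using tau_less[of k "k + 1"] e_pos
  by (intro exI[of _ "min (\<tau> k + e / 2) ((\<tau> k + \<tau> (k + 1)) / 2)"]) (auto simp: min_less_iff_disj)

lemma x_unit: "norm (x k) = 1" unfolding x_def by (rule unit)

lemma x_nonneg: "i < 4 \<Longrightarrow> 0 \<le> co i (x k)" unfolding x_def by (rule nonneg)

text \<open>Points at equal small distance \<open>r\<close> before and after a vertex would be
  joined through it with length 2 r, against \<open>vertex_shortcut\<close>.\<close>

lemma no_vertex:
  assumes i: "i < 4" shows "x k \<noteq> v i"
proof
  assume xv: "x k = v i"
  define f where "f = phi (k - 1)"
  define l where "l = phi k"
  have "f \<noteq> l" "f < 4" "l < 4" "i \<noteq> f" "i \<noteq> l"
    using phi_neq[of k] phi_less x_zero[of k] xv co_v[OF i i] unfolding f_def l_def by auto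
  then obtain j where q: "quad i j f l"
  proof -
    obtain a b where "quad f l a b" using quad_ex[of f l] \<open>f \<noteq> l\<close> \<open>f < 4\<close> \<open>l < 4\<close> by blast
    then have "quad a b f l" "quad b a f l" unfolding quad_def by auto
    moreover have "i = a \<or> i = b" using quad_cases[OF \<open>quad f l a b\<close> i] \<open>i \<noteq> f\<close> \<open>i \<noteq> l\<close> by auto
    ultimately show ?thesis using that by blast
  qed
  note qq = quadD[OF q]
  obtain s0 where s0: "\<tau> (k - 1) < s0" "s0 < \<tau> k" "\<tau> k - e / 2 \<le> s0" using left_point by blast
  obtain t0 where t0: "\<tau> k < t0" "t0 < \<tau> (k + 1)" "t0 \<le> \<tau> k + e / 2" using right_point by blast
  define \<rho> where "\<rho> = (\<lambda>t. sph_dist (v i) (g t))"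
  have \<rho>0: "\<rho> (\<tau> k) = 0" using xv unfolding \<rho>_def x_def by (simp add: norm_v i)
  have pos: "0 < \<rho> t" if "\<tau> k - 1 < t" "t < \<tau> k + 1" "t \<noteq> \<tau> k" for t
  proof -
    have "g t \<noteq> v i" using g_neq[of t "\<tau> k"] g_neq[of "\<tau> k" t] that xv unfolding x_def by (cases "t < \<tau> k") auto
    then show ?thesis unfolding \<rho>_def
      using sph_dist_eq_0[OF norm_v[OF i] unit, of t] sph_dist_bounds[OF norm_v[OF i] unit, of t] by auto
  qed
  have c\<rho>: "continuous_on A \<rho>" for A
    unfolding \<rho>_def sph_dist_def using abs_inner_unit_le_one[OF norm_v[OF i] unit]
    by (intro continuous_on_arccos continuous_intros cont_on ballI) (auto simp: abs_le_iff minus_le_iff)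
  \<comment> \<open>Small enough to occur as a distance from the vertex on both sides within the
    window, and to place the detour on the edges at the vertex.\<close>
  define r where "r = min (min (\<rho> s0) (\<rho> t0)) (min side (pi / 4))"
  have p0: "0 < \<rho> s0" "0 < \<rho> t0" using s0 t0 e_small by (auto intro!: pos)
  then have r: "0 < r" "r < pi / 2" "r \<le> side" "r \<le> \<rho> s0" "r \<le> \<rho> t0"
    using side_bounds pi_gt_zero unfolding r_def by (auto simp: min_def)
  obtain s where s: "s0 \<le> s" "s \<le> \<tau> k" "\<rho> s = r" using IVT2'[of \<rho> "\<tau> k" r s0] r s0 c\<rho> \<rho>0 by auto
  obtain t where t: "\<tau> k \<le> t" "t \<le> t0" "\<rho> t = r" using IVT'[of \<rho> "\<tau> k" r t0] r t0 c\<rho> \<rho>0 by auto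
  have "s \<noteq> \<tau> k" "t \<noteq> \<tau> k" using s(3) t(3) \<rho>0 r by auto
  then have st: "\<tau> (k - 1) < s" "s < \<tau> (k - 1 + 1)" "\<tau> k < t" "t < \<tau> (k + 1)" "t \<le> s + e" using s t s0 t0 by auto
  have Y: "g s \<in> face f" "0 < co j (g s)" "0 < co l (g s)"
    using in_face[of "k - 1" s] arc_pos[OF st(1,2)] st qq unfolding f_def by auto
  have Z: "g t \<in> face l" "0 < co j (g t)" "0 < co f (g t)"
    using in_face[of k t] arc_pos[OF st(3,4)] st qq unfolding l_def by auto
  obtain L where L: "L < 2 * r" "0 \<le> L" "joined bdry (g s) (g t) (ennreal L)"
    using vertex_shortcut[OF q Y Z s(3)[unfolded \<rho>_def] t(3)[unfolded \<rho>_def] r(1-3)] by blast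
  have "sph_dist (g s) (g (\<tau> k)) + sph_dist (g (\<tau> k)) (g t) \<le> L"
    using st by (intro minimal L) auto
  moreover have "sph_dist (g s) (g (\<tau> k)) = r" "sph_dist (g (\<tau> k)) (g t) = r"
    using s(3) t(3) xv unfolding \<rho>_def x_def by (auto simp: sph_dist_commute)
  ultimately show False using L by simp
qed

lemma quad_phi: "\<exists>i j. quad i j (phi (k - 1)) (phi k)"
proof -
  obtain a b where "quad (phi (k - 1)) (phi k) a b" using quad_ex phi_neq phi_less by blast
  then have "quad a b (phi (k - 1)) (phi k)" unfolding quad_def by auto
  then show ?thesis by blast
qed

text \<open>With a third vanishing coordinate the crossing would be a vertex.\<close>

lemma x_pos:
  assumes "i < 4" "i \<noteq> phi (k - 1)" "i \<noteq> phi k" shows "0 < co i (x k)"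
proof (rule ccontr)
  assume "\<not> 0 < co i (x k)"
  then have i0: "co i (x k) = 0" using x_nonneg[OF assms(1), of k] by simp
  obtain a b where ab: "quad a b (phi (k - 1)) (phi k)" using quad_phi by blast
  have "\<exists>j. quad i j (phi (k - 1)) (phi k)"
  proof -
    have "i = a \<or> i = b" using quad_cases[OF ab assms(1)] assms by auto
    moreover have "quad b a (phi (k - 1)) (phi k)" using ab unfolding quad_def by auto
    ultimately show ?thesis using ab by blast
  qed
  then obtain j where q: "quad i j (phi (k - 1)) (phi k)" by blast
  have xj: "x k = co j (x k) *\<^sub>R v j" using expand_quad[OF q, of "x k"] i0 x_zero[of k] by simp
  then have "norm (x k) = \<bar>co j (x k)\<bar> * norm (v j)" by (metis norm_scaleR)
  then have "co j (x k) = 1" using x_unit x_nonneg[of j k] norm_v[of j] quadD[OF q] by simp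
  then show False using xj no_vertex[of j k] quadD[OF q] by simp
qed

text \<open>An arc with both ends on one edge would lie on that edge, but its interior points are
  not on any edge.\<close>

lemma phi_neq2: "phi (k - 1) \<noteq> phi (k + 1)"
proof
  assume eq: "phi (k - 1) = phi (k + 1)"
  obtain t where t: "\<tau> k < t" "t < \<tau> (k + 1)" using right_point by blast
  obtain a b where "g t = a *\<^sub>R x k + b *\<^sub>R x (k + 1)" using arc_coeffs[OF t] by blast
  then have "co (phi (k - 1)) (g t) = 0" using x_zero(1)[of k] x_zero(2)[of "k + 1"] eq by simp
  moreover have "0 < co (phi (k - 1)) (g t)" using arc_pos[OF t phi_less phi_neq] .
  ultimately show False by simp
qed

text \<open>First variation: sliding the crossing along its edge does not shorten the two legs, so
  the derivative of their total length vanishes. Both tangents are orthogonal to \<open>x k\<close>,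
  which allows the edge direction to be replaced by the edge end \<open>v j\<close>.\<close>

lemma straight:
  assumes q: "quad i j (phi (k - 1)) (phi k)"
  shows "v j \<bullet> (sph_dir (x k) (x (k - 1)) + sph_dir (x k) (x (k + 1))) = 0"
proof -
  define f where "f = phi (k - 1)"
  define l where "l = phi k"
  have q: "quad i j f l" using q by (simp add: f_def l_def)
  note qq = quadD[OF q]
  let ?x = "x k"
  obtain s where s: "\<tau> (k - 1) < s" "s < \<tau> (k - 1 + 1)" "\<tau> k - e / 2 \<le> s" using left_point[of k] by auto
  obtain t where t: "\<tau> k < t" "t < \<tau> (k + 1)" "t \<le> \<tau> k + e / 2" using right_point by blast
  let ?y = "g s" and ?z = "g t"
  obtain a b where ab: "0 < a" "0 < b" "?y = a *\<^sub>R x (k - 1) + b *\<^sub>R x (k - 1 + 1)" using arc_coeffs[OF s(1,2)] by blast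
  obtain a' b' where ab': "0 < a'" "0 < b'" "?z = a' *\<^sub>R x k + b' *\<^sub>R x (k + 1)" using arc_coeffs[OF t(1,2)] by blast
  have dir: "sph_dir ?x ?y = sph_dir ?x (x (k - 1))" "sph_dir ?x ?z = sph_dir ?x (x (k + 1))"
    using sph_dir_between[OF x_unit ab(1), of ?y b k] ab(3) sph_dir_between[OF x_unit ab'(2,3)] by (auto simp: add.commute)
  have xp: "0 < co i ?x" "0 < co j ?x" "co f ?x = 0" "co l ?x = 0"
    using x_pos[of i k] x_pos[of j k] x_zero[of k] qq unfolding f_def l_def by auto
  \<comment> \<open>The direction of the edge at the crossing, towards \<open>v j\<close>.\<close>
  define w where "w = v j - (?x \<bullet> v j) *\<^sub>R ?x"
  have w0: "w \<noteq> 0"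
  proof
    assume "w = 0"
    then have "co i w = 0" "co j w = 0" by auto
    then show False using qq xp unfolding w_def by (auto simp: co_v)
  qed
  define u where "u = sgn w"
  have u: "norm u = 1" using w0 by (simp add: u_def norm_sgn)
  have wu: "w = norm w *\<^sub>R u" using w0 by (simp add: u_def sgn_div_norm)
  have xw: "?x \<bullet> w = 0" unfolding w_def using x_unit by (simp add: inner_diff unit_inner)
  then have xu: "?x \<bullet> u = 0" by (simp add: u_def sgn_div_norm)
  have uz: "co f u = 0" "co l u = 0" unfolding u_def sgn_div_norm w_def using qq xp by (auto simp: co_v)
  define X where "X = (\<lambda>\<epsilon>. cos \<epsilon> *\<^sub>R ?x + sin \<epsilon> *\<^sub>R u)"
  have X1: "norm (X \<epsilon>) = 1" for \<epsilon>
    unfolding X_def by (rule norm_eq_1I) (simp add: norm_lincomb_squared u x_unit xu)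
  have coX: "continuous_on A (\<lambda>\<epsilon>. co n (X \<epsilon>))" for n A
    unfolding X_def co_add co_scale by (intro continuous_intros)
  have "open ({\<epsilon>. 0 < co i (X \<epsilon>)} \<inter> {\<epsilon>. 0 < co j (X \<epsilon>)})"
    by (intro open_Int open_Collect_less coX continuous_intros)
  moreover have "0 \<in> {\<epsilon>. 0 < co i (X \<epsilon>)} \<inter> {\<epsilon>. 0 < co j (X \<epsilon>)}" using xp by (simp add: X_def)
  ultimately obtain d where d: "d > 0" "ball 0 d \<subseteq> {\<epsilon>. 0 < co i (X \<epsilon>)} \<inter> {\<epsilon>. 0 < co j (X \<epsilon>)}"
    unfolding open_contains_ball by blast
  have Xf: "X \<epsilon> \<in> face f" "X \<epsilon> \<in> face l" if "\<bar>\<epsilon>\<bar> < d" for \<epsilon>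
  proof -
    have "\<epsilon> \<in> ball 0 d" using that by (simp add: dist_real_def)
    then have "0 < co i (X \<epsilon>)" "0 < co j (X \<epsilon>)" using d by auto
    moreover have "co f (X \<epsilon>) = 0" "co l (X \<epsilon>) = 0" using uz xp by (auto simp: X_def)
    moreover have "quad i j l f" using q unfolding quad_def by auto
    ultimately show "X \<epsilon> \<in> face f" "X \<epsilon> \<in> face l" using X1 face_iff[OF q] face_iff[of i j l f] by auto
  qed
  define F where "F = (\<lambda>\<epsilon>. arccos (cos \<epsilon> * (?y \<bullet> ?x) + sin \<epsilon> * (?y \<bullet> u)) + arccos (cos \<epsilon> * (?z \<bullet> ?x) + sin \<epsilon> * (?z \<bullet> u)))"
  have Fd: "F \<epsilon> = sph_dist ?y (X \<epsilon>) + sph_dist (X \<epsilon>) ?z" for \<epsilon>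
    unfolding F_def X_def sph_dist_def by (simp add: inner_add inner_commute)
  have "F 0 \<le> F \<epsilon>" if "\<bar>0 - \<epsilon>\<bar> < d" for \<epsilon>
  proof -
    have "sph_dist ?y (g (\<tau> k)) + sph_dist (g (\<tau> k)) ?z \<le> sph_dist ?y (X \<epsilon>) + sph_dist (X \<epsilon>) ?z"
    proof (rule minimal)
      show "joined bdry (g s) (g t) (ennreal (sph_dist ?y (X \<epsilon>) + sph_dist (X \<epsilon>) ?z))"
        using Xf[of \<epsilon>] that qq s t in_face[of "k - 1" s] in_face[of k t]
        by (intro joined_face2[of f l]) (auto simp: f_def l_def)
    qed (use s t sph_dist_bounds[OF unit X1] sph_dist_bounds[OF X1 unit] in auto)
    then show ?thesis unfolding Fd by (simp add: X_def x_def)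
  qed
  \<comment> \<open>Neither leg has length 0 or pi, so \<open>arccos\<close> is differentiable at
    the two values.\<close>
  moreover have lt: "\<bar>w' \<bullet> ?x\<bar> < 1" if w': "w' = ?y \<or> w' = ?z" for w'
  proof -
    obtain r where r: "w' = g r" "r \<noteq> \<tau> k" "\<tau> k - 1 < r" "r < \<tau> k + 1"
    proof (cases "w' = ?y")
      case True then show ?thesis using that[of s] s e_small e_pos by auto
    next
      case False then show ?thesis using that[of t] t w' e_small e_pos by auto
    qed
    then have ne: "w' \<noteq> ?x" "w' \<noteq> - ?x"
      using g_neq[of r "\<tau> k"] g_neq[of "\<tau> k" r] not_antipodal[of r "\<tau> k"] unfolding x_def by (cases "r < \<tau> k"; auto)+
    have n: "norm w' = 1" using r unit by simp
    have "0 < sph_dist w' ?x" "sph_dist w' ?x < pi"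
      using sph_dist_bounds[OF n x_unit[of k]] sph_dist_eq_0[OF n x_unit[of k]] sph_dist_eq_pi[OF n x_unit[of k]] ne
        by (auto simp: minus_equation_iff less_le)
    then have "cos pi < cos (sph_dist w' ?x)" "cos (sph_dist w' ?x) < cos 0"
      using cos_monotone_0_pi[of 0 "sph_dist w' ?x"] cos_monotone_0_pi[of "sph_dist w' ?x" pi] by auto
    then show ?thesis using cos_sph_dist[OF n x_unit] by (simp add: abs_less_iff)
  qed
  have der: "DERIV F 0 :> (?y \<bullet> u) * inverse (- sqrt (1 - (?y \<bullet> ?x)\<^sup>2)) + (?z \<bullet> u) * inverse (- sqrt (1 - (?z \<bullet> ?x)\<^sup>2))"
  proof -
    have D: "DERIV (\<lambda>\<epsilon>. arccos (cos \<epsilon> * A + sin \<epsilon> * B)) 0 :> B * inverse (- sqrt (1 - A\<^sup>2))" if "\<bar>A\<bar> < 1" for A B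
    proof -
      have "DERIV (\<lambda>\<epsilon>. cos \<epsilon> * A + sin \<epsilon> * B) 0 :> B"
        by (rule derivative_eq_intros refl | simp)+
      moreover have "DERIV arccos (cos 0 * A + sin 0 * B) :> inverse (- sqrt (1 - (cos 0 * A + sin 0 * B)\<^sup>2))"
        using that by (intro DERIV_arccos) auto
      ultimately have "DERIV (\<lambda>\<epsilon>. arccos (cos \<epsilon> * A + sin \<epsilon> * B)) 0 :> inverse (- sqrt (1 - (cos 0 * A + sin 0 * B)\<^sup>2)) * B"
        by (rule DERIV_chain2[rotated])
      then show ?thesis by (simp add: mult.commute)
    qed
    show ?thesis unfolding F_def using lt by (intro DERIV_add D) auto
  qed
  ultimately have "(?y \<bullet> u) * inverse (- sqrt (1 - (?y \<bullet> ?x)\<^sup>2)) + (?z \<bullet> u) * inverse (- sqrt (1 - (?z \<bullet> ?x)\<^sup>2)) = 0"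
    using DERIV_local_min[OF der d(1)] by blast
  then have "(?y \<bullet> u) / sqrt (1 - (?x \<bullet> ?y)\<^sup>2) + (?z \<bullet> u) / sqrt (1 - (?x \<bullet> ?z)\<^sup>2) = 0"
    by (simp add: inner_commute divide_inverse)
  then have "u \<bullet> (sph_dir ?x ?y + sph_dir ?x ?z) = 0"
    using inner_sph_dir_perp[OF x_unit unit xu] by (simp add: inner_add)
  moreover have "v j = (?x \<bullet> v j) *\<^sub>R ?x + norm w *\<^sub>R u" using wu by (simp add: w_def)
  moreover have "?x \<bullet> (sph_dir ?x ?y + sph_dir ?x ?z) = 0" using inner_sph_dir_self[OF x_unit] by (simp add: inner_add)
  ultimately have "v j \<bullet> (sph_dir ?x ?y + sph_dir ?x ?z) = 0"
    by (metis add.right_neutral inner_add_left inner_scaleR_left mult_zero_right)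
  then show ?thesis unfolding dir .
qed

lemma tau_shift: "\<tau> (k + n * m) = \<tau> k + of_int n"
proof (induction n rule: int_induct[where k = 0])
  case (step1 i)
  then show ?case using tau_per[of "k + i * m"] by (simp add: algebra_simps)
next
  case (step2 i)
  then show ?case using tau_per[of "k + (i - 1) * m"] by (simp add: algebra_simps)
qed simp

lemma x_inj:
  assumes "x k = x k'" shows "m dvd k - k'"
proof -
  obtain n where "\<tau> k - \<tau> k' = of_int n" using assms g_eq_iff unfolding x_def by (auto elim: Ints_cases)
  then have "\<tau> k = \<tau> (k' + n * m)" by (simp add: tau_shift)
  then have "k = k' + n * m" using strict_mono_eq[OF mono] by blast
  then show ?thesis by simp
qed

text \<open>The curve runs through the whole segment between two crossings: by the intermediate
  value theorem the ratio of two coordinates assumes that of \<open>p\<close>, and the ratio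
  determines the point.\<close>

lemma arc_onto:
  assumes ab: "0 \<le> a" "0 \<le> b" and p: "p = a *\<^sub>R x k + b *\<^sub>R x (k + 1)" "norm p = 1"
  shows "\<exists>t. \<tau> k \<le> t \<and> t \<le> \<tau> (k + 1) \<and> g t = p"
proof -
  define f where "f = phi (k - 1)"
  define j where "j = phi (k + 1)"
  have fj: "f \<noteq> j" "f \<noteq> phi k" "j \<noteq> phi k" "f < 4" "j < 4"
    using phi_neq2[of k] phi_neq[of k] phi_neq[of "k + 1"] phi_less unfolding f_def j_def by auto
  have z: "co f (x k) = 0" "co j (x (k + 1)) = 0" "0 < co j (x k)" "0 < co f (x (k + 1))"
    using x_zero[of k] x_zero[of "k + 1"] x_pos[of j k] x_pos[of f "k + 1"] fj unfolding f_def j_def by auto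
  define \<psi> where "\<psi> = (\<lambda>t. co j (g t) * co f p - co f (g t) * co j p)"
  have pc: "co j p = a * co j (x k)" "co f p = b * co f (x (k + 1))" using z unfolding p(1) by auto
  have cc: "continuous_on A (\<lambda>t. co n (g t))" for n A
    by (rule continuous_on_compose2[OF continuous_co cont_on]) auto
  have c: "continuous_on A \<psi>" for A unfolding \<psi>_def by (intro continuous_intros cc)
  have e: "0 \<le> \<psi> (\<tau> k)" "\<psi> (\<tau> (k + 1)) \<le> 0"
    using z ab pc unfolding \<psi>_def x_def[symmetric] by auto
  obtain t where t: "\<tau> k \<le> t" "t \<le> \<tau> (k + 1)" "\<psi> t = 0"
    using IVT2'[of \<psi> "\<tau> (k + 1)" 0 "\<tau> k"] e c tau_less[of k "k + 1"] by auto
  obtain a' b' where ab': "0 \<le> a'" "0 \<le> b'" "g t = a' *\<^sub>R x k + b' *\<^sub>R x (k + 1)"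
    using arc_between[OF t(1,2)] unfolding between_def by blast
  have gc: "co j (g t) = a' * co j (x k)" "co f (g t) = b' * co f (x (k + 1))" using z unfolding ab'(3) by auto
  have "(a' * b - b' * a) * (co j (x k) * co f (x (k + 1))) = 0"
    using t(3) unfolding \<psi>_def gc pc by (simp add: algebra_simps)
  then have par: "a' * b = b' * a" using z by simp
  have "g t = p"
  proof (cases "a = 0")
    case True
    then have "b \<noteq> 0" using p by auto
    then have "a' = 0" using par True by simp
    then have "b' = 1" "b = 1" using ab' ab True p unit[of t] x_unit[of "k + 1"] by auto
    then show ?thesis using \<open>a' = 0\<close> True ab' p by simp
  next
    case False
    then have b': "b' = a' * b / a" using par by (simp add: field_simps)
    have gp: "g t = (a' / a) *\<^sub>R p" unfolding ab'(3) p(1) b' using False by (simp add: scaleR_add_right)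
    then have "norm (g t) = \<bar>a' / a\<bar> * norm p" by simp
    then have "a' / a = 1" using unit[of t] p(2) ab ab' by simp
    then show ?thesis using gp by simp
  qed
  then show ?thesis using t by blast
qed

text \<open>Simplicity expressed without the curve: a common point of the cones over two arcs,
  interior to the first one, is reached at two times, which must differ by an integer.\<close>

lemma arcs_disjoint:
  assumes ab: "0 < a" "0 < b" and ab': "0 \<le> a'" "0 \<le> b'"
    and eq: "a *\<^sub>R x k + b *\<^sub>R x (k + 1) = a' *\<^sub>R x k' + b' *\<^sub>R x (k' + 1)"
  shows "m dvd k - k'"
proof -
  define p where "p = a *\<^sub>R x k + b *\<^sub>R x (k + 1)"
  define f where "f = phi (k - 1)"
  define j where "j = phi (k + 1)"
  have fj: "f \<noteq> j" "f \<noteq> phi k" "j \<noteq> phi k" "f < 4" "j < 4"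
    using phi_neq2[of k] phi_neq[of k] phi_neq[of "k + 1"] phi_less unfolding f_def j_def by auto
  have z: "co f (x k) = 0" "co j (x (k + 1)) = 0" "0 < co j (x k)" "0 < co f (x (k + 1))"
    using x_zero[of k] x_zero[of "k + 1"] x_pos[of j k] x_pos[of f "k + 1"] fj unfolding f_def j_def by auto
  have cp: "0 < co f p" "0 < co j p" using z ab unfolding p_def by auto
  then have "p \<noteq> 0" by auto
  define N where "N = 1 / norm p"
  have N: "0 < N" using \<open>p \<noteq> 0\<close> by (simp add: N_def)
  have nN: "norm (N *\<^sub>R p) = 1" using \<open>p \<noteq> 0\<close> by (simp add: N_def)
  obtain t where t: "\<tau> k \<le> t" "t \<le> \<tau> (k + 1)" "g t = N *\<^sub>R p"
    using arc_onto[of "N * a" "N * b" "N *\<^sub>R p" k] nN N ab unfolding p_def by (auto simp: scaleR_add_right)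
  obtain t' where t': "\<tau> k' \<le> t'" "t' \<le> \<tau> (k' + 1)" "g t' = N *\<^sub>R p"
    using arc_onto[of "N * a'" "N * b'" "N *\<^sub>R p" k'] nN N ab' eq unfolding p_def by (auto simp: scaleR_add_right)
  have "t \<noteq> \<tau> k" using t(3) z(1) cp N unfolding x_def by auto
  moreover have "t \<noteq> \<tau> (k + 1)" using t(3) z(2) cp N unfolding x_def by auto
  ultimately have tt: "\<tau> k < t" "t < \<tau> (k + 1)" using t by auto
  obtain n where n: "t - t' = of_int n" using g_eq_iff[of t t'] t t' by (auto elim: Ints_cases)
  have "\<tau> (k' + n * m) \<le> t" "t \<le> \<tau> (k' + n * m + 1)"
    using t' n tau_shift[of k' n] tau_shift[of "k' + 1" n] by (auto simp: algebra_simps)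
  then have "\<tau> (k' + n * m) < \<tau> (k + 1)" "\<tau> k < \<tau> (k' + n * m + 1)" using tt by auto
  then have "k' + n * m < k + 1" "k < k' + n * m + 1" using strict_mono_less[OF mono] by auto
  then have "k = k' + n * m" by simp
  then show ?thesis by simp
qed

text \<open>A crossing lies on \<open>edge i j\<close> iff it leads between the faces
  \<open>f\<close> and \<open>l\<close>, and simplicity makes the crossings of one period distinct
  points.\<close>

lemma edge_count:
  assumes q: "quad i j f l"
  shows "card (range g \<inter> edge i j) = card {k \<in> {0..<m}. {phi (k - 1), phi k} = {f, l}}"
proof -
  let ?K = "{k \<in> {0..<m}. {phi (k - 1), phi k} = {f, l}}"
  have iff: "x k \<in> edge i j \<longleftrightarrow> {phi (k - 1), phi k} = {f, l}" for k
  proof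
    assume "x k \<in> edge i j"
    then have "co f (x k) = 0" "co l (x k) = 0" using edge_iff[OF q] by auto
    then have "f \<in> {phi (k - 1), phi k}" "l \<in> {phi (k - 1), phi k}"
      using x_pos[of f k] x_pos[of l k] quadD[OF q] by force+
    then show "{phi (k - 1), phi k} = {f, l}" using quadD(10)[OF q] by auto
  next
    assume "{phi (k - 1), phi k} = {f, l}"
    then have "co f (x k) = 0" "co l (x k) = 0" using x_zero[of k] by (auto simp: doubleton_eq_iff)
    then show "x k \<in> edge i j" using edge_iff[OF q] x_unit x_nonneg quadD[OF q] by auto
  qed
  have "range g \<inter> edge i j = x ` ?K"
  proof (intro equalityI subsetI)
    fix p assume p: "p \<in> range g \<inter> edge i j"
    then obtain t where t: "p = g t" by blast
    then have "crossing g t" using p quadD[OF q] unfolding crossing_def by blast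
    then obtain k where "t = \<tau> k" using tau_range by blast
    moreover have "\<tau> k = \<tau> (k mod m) + of_int (k div m)" using tau_shift[of "k mod m" "k div m"] by (simp add: algebra_simps)
    ultimately have px: "p = x (k mod m)" using t periodic_int[of g "\<tau> (k mod m)" "k div m"] per unfolding x_def by simp
    then have "k mod m \<in> ?K" using p iff m_pos by auto
    then show "p \<in> x ` ?K" using px by blast
  next
    fix p assume "p \<in> x ` ?K" then show "p \<in> range g \<inter> edge i j" using iff by (auto simp: x_def)
  qed
  moreover have "inj_on x ?K"
  proof (rule inj_onI)
    fix k k' assume "k \<in> ?K" "k' \<in> ?K" "x k = x k'"
    then show "k = k'" using x_inj[of k k'] by (auto dest!: zdvd_imp_le[rotated] simp: mod_eq_dvd_iff[symmetric])
  qed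
  ultimately show ?thesis by (simp add: card_image)
qed

end


section \<open>Discrete geodesics: left, right and heights\<close>

text \<open>A Vandermonde product. Its sign is that of the permutation of the four indices and
  serves as orientation.\<close>

definition par :: "nat \<Rightarrow> nat \<Rightarrow> nat \<Rightarrow> nat \<Rightarrow> int" where
  "par a b c d = (int b - int a) * (int c - int a) * (int d - int a) * (int c - int b) * (int d - int b) * (int d - int c)"

lemma par_swap: "par b a c d = - par a b c d" "par a c b d = - par a b c d" "par a b d c = - par a b c d"
  unfolding par_def by algebra+

lemma par_nonzero: "quad a b c d \<Longrightarrow> par a b c d \<noteq> 0"
  using quadD[of a b c d] unfolding par_def by simp

text \<open>What is kept of a simple closed geodesic: crossing points and faces, equal angles,
  disjoint arcs. The sign \<open>ori\<close> decides which side is called left, so later statements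
  can be applied to the side that is convenient.\<close>

locale dgeo = tetra v c for v :: "nat \<Rightarrow> 'a::euclidean_space" and c :: real +
  fixes x :: "int \<Rightarrow> 'a" and phi :: "int \<Rightarrow> nat" and m :: int
  assumes m_pos: "0 < m" and x_per: "x (k + m) = x k" and phi_per: "phi (k + m) = phi k"
    and x_unit: "norm (x k) = 1" and phi_less: "phi k < 4"
    and phi_neq: "phi (k - 1) \<noteq> phi k" and phi_neq2: "phi (k - 1) \<noteq> phi (k + 1)"
    and x_zero: "co (phi (k - 1)) (x k) = 0" "co (phi k) (x k) = 0"
    and x_pos: "i < 4 \<Longrightarrow> i \<noteq> phi (k - 1) \<Longrightarrow> i \<noteq> phi k \<Longrightarrow> 0 < co i (x k)"
    and straight: "quad i j (phi (k - 1)) (phi k) \<Longrightarrow>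
        v j \<bullet> (sph_dir (x k) (x (k - 1)) + sph_dir (x k) (x (k + 1))) = 0"
    and arcs_disjoint: "0 < a \<Longrightarrow> 0 < b \<Longrightarrow> 0 \<le> a' \<Longrightarrow> 0 \<le> b' \<Longrightarrow>
        a *\<^sub>R x k + b *\<^sub>R x (k + 1) = a' *\<^sub>R x k' + b' *\<^sub>R x (k' + 1) \<Longrightarrow> m dvd k - k'"
    and x_inj: "x k = x k' \<Longrightarrow> m dvd k - k'"
  fixes ori :: int
  assumes ori: "ori = 1 \<or> ori = - 1"
begin

text \<open>Forward unit tangents of arc \<open>k\<close>, at its start and (primed) at its
  end.\<close>

definition tng :: "int \<Rightarrow> 'a" where "tng k = sph_dir (x k) (x (k + 1))"
definition tng' :: "int \<Rightarrow> 'a" where "tng' k = - sph_dir (x (k + 1)) (x k)"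
definition sigma :: "int \<Rightarrow> real" where "sigma k = sph_dist (x k) (x (k + 1))"

lemma x_nonneg: "i < 4 \<Longrightarrow> 0 \<le> co i (x k)"
  using x_zero[of k] x_pos[of i k] by (metis less_imp_le order_refl)

lemma x_neq: "x k \<noteq> x (k + 1)"
proof
  assume "x k = x (k + 1)"
  then have "co (phi (k - 1)) (x (k + 1)) = 0" using x_zero(1)[of k] by simp
  then show False using x_pos[of "phi (k - 1)" "k + 1"] phi_neq[of k] phi_neq2[of k] phi_less by simp
qed

lemma sigma_bounds: "0 < sigma k" "sigma k < pi"
proof -
  have "x (k + 1) \<noteq> - x k" by (rule nonneg_not_antipodal) (auto intro: x_nonneg x_unit)
  then show "0 < sigma k" "sigma k < pi" unfolding sigma_def
    using sph_dist_bounds[OF x_unit x_unit, of k "k + 1"] sph_dist_eq_0[OF x_unit x_unit, of k "k + 1"]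
      sph_dist_eq_pi[OF x_unit x_unit, of k "k + 1"] x_neq[of k] by (auto simp: less_le)
qed

lemma sin_sigma: "0 < sin (sigma k)" using sigma_bounds by (rule sin_gt_zero)

lemma x_dir:
  "x (k + 1) = cos (sigma k) *\<^sub>R x k + sin (sigma k) *\<^sub>R tng k"
  "x k = cos (sigma k) *\<^sub>R x (k + 1) - sin (sigma k) *\<^sub>R tng' k"
proof -
  have *: "sin (sph_dist a b) *\<^sub>R sph_dir a b = b - cos (sph_dist a b) *\<^sub>R a"
    if "norm a = 1" "norm b = 1" "0 < sin (sph_dist a b)" for a b :: 'a
  proof -
    have "norm (b - (a \<bullet> b) *\<^sub>R a) = sin (sph_dist a b)"
      using perp_norm[OF that(2,1)] by (simp add: inner_commute sph_dist_commute)
    then show ?thesis using that by (simp add: sph_dir_def sgn_div_norm cos_sph_dist)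
  qed
  show "x (k + 1) = cos (sigma k) *\<^sub>R x k + sin (sigma k) *\<^sub>R tng k"
    using *[OF x_unit x_unit, of k "k + 1"] sin_sigma[of k] unfolding tng_def sigma_def by simp
  show "x k = cos (sigma k) *\<^sub>R x (k + 1) - sin (sigma k) *\<^sub>R tng' k"
    using *[OF x_unit x_unit, of "k + 1" k] sin_sigma[of k] unfolding tng'_def sigma_def
    by (simp add: sph_dist_commute)
qed

lemma x_tng: "x k \<bullet> tng k = 0" "norm (tng k) = 1"
proof -
  show 1: "x k \<bullet> tng k = 0" unfolding tng_def by (rule inner_sph_dir_self[OF x_unit])
  have "(norm (x (k + 1)))\<^sup>2 = (cos (sigma k))\<^sup>2 + (sin (sigma k))\<^sup>2 * (norm (tng k))\<^sup>2"
    using norm_lincomb_squared[of "cos (sigma k)" "x k" "sin (sigma k)" "tng k"] x_dir(1)[of k] 1 x_unit[of k] by simp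
  then have "(sin (sigma k))\<^sup>2 * (norm (tng k))\<^sup>2 = (sin (sigma k))\<^sup>2"
    using x_unit[of "k + 1"] sin_cos_squared_add[of "sigma k"] by (metis add.commute add_right_cancel one_power2)
  then show "norm (tng k) = 1" using sin_sigma[of k] by (intro norm_eq_1I) simp
qed

lemma tng'_eq: "tng' k = cos (sigma k) *\<^sub>R tng k - sin (sigma k) *\<^sub>R x k"
proof -
  have "sin (sigma k) *\<^sub>R tng' k = cos (sigma k) *\<^sub>R x (k + 1) - x k"
    using x_dir(2)[of k] by (simp add: algebra_simps)
  also have "\<dots> = (cos (sigma k) * cos (sigma k) - 1) *\<^sub>R x k + (cos (sigma k) * sin (sigma k)) *\<^sub>R tng k"
    unfolding x_dir(1) by (simp add: algebra_simps)
  also have "cos (sigma k) * cos (sigma k) - 1 = - (sin (sigma k) * sin (sigma k))"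
    using sin_cos_squared_add[of "sigma k"] by (simp add: power2_eq_square)
  finally have "sin (sigma k) *\<^sub>R tng' k = sin (sigma k) *\<^sub>R (cos (sigma k) *\<^sub>R tng k - sin (sigma k) *\<^sub>R x k)"
    by (simp add: algebra_simps)
  then show ?thesis using sin_sigma[of k] by simp
qed

text \<open>The ends of the edge crossed at \<open>x k\<close>, told apart by the orientation of
  (left end, right end, old face, new face).\<close>

definition lft :: "int \<Rightarrow> nat" where
  "lft k = (SOME i. \<exists>j. quad i j (phi (k - 1)) (phi k) \<and> 0 < ori * par i j (phi (k - 1)) (phi k))"
definition rgt :: "int \<Rightarrow> nat" where
  "rgt k = (SOME j. quad (lft k) j (phi (k - 1)) (phi k))"

lemma lr: "quad (lft k) (rgt k) (phi (k - 1)) (phi k)" "0 < ori * par (lft k) (rgt k) (phi (k - 1)) (phi k)"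
proof -
  obtain a b where "quad (phi (k - 1)) (phi k) a b" using quad_ex phi_neq phi_less by blast
  then have q: "quad a b (phi (k - 1)) (phi k)" "quad b a (phi (k - 1)) (phi k)" unfolding quad_def by auto
  have "\<exists>i j. quad i j (phi (k - 1)) (phi k) \<and> 0 < ori * par i j (phi (k - 1)) (phi k)"
  proof (cases "0 < ori * par a b (phi (k - 1)) (phi k)")
    case False
    then have "0 < ori * par b a (phi (k - 1)) (phi k)"
      using par_nonzero[OF q(1)] ori par_swap(1)[of b a "phi (k - 1)" "phi k"] by auto
    then show ?thesis using q by blast
  qed (use q in blast)
  then have "\<exists>j. quad (lft k) j (phi (k - 1)) (phi k) \<and> 0 < ori * par (lft k) j (phi (k - 1)) (phi k)"
    unfolding lft_def by (rule someI_ex)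
  then obtain j where j: "quad (lft k) j (phi (k - 1)) (phi k)" "0 < ori * par (lft k) j (phi (k - 1)) (phi k)" by blast
  then have r: "quad (lft k) (rgt k) (phi (k - 1)) (phi k)" unfolding rgt_def by (metis someI)
  then have "rgt k = j" using quad_cases[OF j(1), of "rgt k"] quadD[OF r] by auto
  then show "quad (lft k) (rgt k) (phi (k - 1)) (phi k)" "0 < ori * par (lft k) (rgt k) (phi (k - 1)) (phi k)" using j by auto
qed

lemma lrI: "quad i j (phi (k - 1)) (phi k) \<Longrightarrow> 0 < ori * par i j (phi (k - 1)) (phi k) \<Longrightarrow> lft k = i \<and> rgt k = j"
proof -
  assume q: "quad i j (phi (k - 1)) (phi k)" "0 < ori * par i j (phi (k - 1)) (phi k)"
  note ql = quadD[OF lr(1)[of k]] and qi = quadD[OF q(1)]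
  have "(lft k = i \<and> rgt k = j) \<or> (lft k = j \<and> rgt k = i)"
    using quad_cases[OF q(1), of "lft k"] quad_cases[OF q(1), of "rgt k"] ql qi by metis
  then show ?thesis
  proof
    assume a: "lft k = j \<and> rgt k = i"
    have "par i j (phi (k - 1)) (phi k) = - par j i (phi (k - 1)) (phi k)" by (rule par_swap(1))
    then show ?thesis using a lr(2)[of k] q(2) by auto
  qed simp
qed

text \<open>The next face lies opposite the right end, so the next edge again contains the left end
  and the strand pivots around it. The other three indices are permuted cyclically, which keeps the
  sign.\<close>

lemma turn_left: "phi (k + 1) = rgt k \<Longrightarrow> lft (k + 1) = lft k \<and> rgt (k + 1) = phi (k - 1)"
proof (rule lrI)
  assume r: "phi (k + 1) = rgt k"
  show "quad (lft k) (phi (k - 1)) (phi (k + 1 - 1)) (phi (k + 1))"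
    using lr(1)[of k] unfolding r quad_def by auto
  have "par (lft k) (phi (k - 1)) (phi k) (rgt k) = par (lft k) (rgt k) (phi (k - 1)) (phi k)"
    using par_swap by (metis minus_minus)
  then show "0 < ori * par (lft k) (phi (k - 1)) (phi (k + 1 - 1)) (phi (k + 1))"
    using lr(2)[of k] unfolding r by simp
qed

lemma turn_right: "phi (k + 1) = lft k \<Longrightarrow> lft (k + 1) = phi (k - 1) \<and> rgt (k + 1) = rgt k"
proof (rule lrI)
  assume r: "phi (k + 1) = lft k"
  show "quad (phi (k - 1)) (rgt k) (phi (k + 1 - 1)) (phi (k + 1))"
    using lr(1)[of k] unfolding r quad_def by auto
  have "par (phi (k - 1)) (rgt k) (phi k) (lft k) = par (lft k) (rgt k) (phi (k - 1)) (phi k)"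
    using par_swap by (metis minus_minus)
  then show "0 < ori * par (phi (k - 1)) (rgt k) (phi (k + 1 - 1)) (phi (k + 1))"
    using lr(2)[of k] unfolding r by simp
qed

lemma turn_cases:
  obtains (left) "phi (k + 1) = rgt k" "lft (k + 1) = lft k" "rgt (k + 1) = phi (k - 1)"
  | (right) "phi (k + 1) = lft k" "lft (k + 1) = phi (k - 1)" "rgt (k + 1) = rgt k"
proof -
  have "phi (k + 1) = rgt k \<or> phi (k + 1) = lft k"
    using quad_cases[OF lr(1)[of k], of "phi (k + 1)"] phi_less phi_neq[of "k + 1"] phi_neq2[of k] by auto
  then show ?thesis using turn_left[of k] turn_right[of k] that by blast
qed

lemma x_edge: "x k = co (lft k) (x k) *\<^sub>R v (lft k) + co (rgt k) (x k) *\<^sub>R v (rgt k)"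
  "0 < co (lft k) (x k)" "0 < co (rgt k) (x k)"
proof -
  note q = lr(1)[of k]
  show "x k = co (lft k) (x k) *\<^sub>R v (lft k) + co (rgt k) (x k) *\<^sub>R v (rgt k)"
    using expand_quad[OF q, of "x k"] x_zero[of k] by simp
  show "0 < co (lft k) (x k)" "0 < co (rgt k) (x k)" using quadD[OF q] by (auto intro: x_pos)
qed

text \<open>After normalization: the unit normal of the great circle of arc \<open>k\<close> within
  the hyperplane of its face, pointing to the side of the left vertex. Inner products with it are
  the heights over the arc.\<close>

definition nrm0 :: "int \<Rightarrow> 'a" where
  "nrm0 k = v (lft k) - (v (lft k) \<bullet> x k) *\<^sub>R x k - (v (lft k) \<bullet> tng k) *\<^sub>R tng k"
definition nrm :: "int \<Rightarrow> 'a" where "nrm k = sgn (nrm0 k)"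

lemma tng_lincomb: "tng k = (1 / sin (sigma k)) *\<^sub>R x (k + 1) - (cos (sigma k) / sin (sigma k)) *\<^sub>R x k"
  using sin_sigma[of k] unfolding x_dir(1) by (simp add: scaleR_add_right)

lemma co_phi:
  "co (phi k) (x k) = 0" "co (phi k) (x (k + 1)) = 0" "co (phi k) (tng k) = 0" "co (phi k) (nrm k) = 0"
proof -
  show *: "co (phi k) (x k) = 0" "co (phi k) (x (k + 1)) = 0" using x_zero(2)[of k] x_zero(1)[of "k + 1"] by auto
  then show t: "co (phi k) (tng k) = 0" unfolding tng_lincomb by simp
  show "co (phi k) (nrm k) = 0" unfolding nrm_def nrm0_def sgn_div_norm
    using * t quadD[OF lr(1)[of k]] by (simp add: co_v)
qed

lemma nrm0_nonzero: "nrm0 k \<noteq> 0"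
proof
  assume z: "nrm0 k = 0"
  define i j f l where "i = lft k" and "j = rgt k" and "f = phi (k - 1)" and "l = phi k"
  have q: "quad i j f l" using lr(1)[of k] by (simp add: i_def j_def f_def l_def)
  note qq = quadD[OF q]
  define a b where "a = v i \<bullet> x k" and "b = v i \<bullet> tng k"
  define A where "A = a - b * (cos (sigma k) / sin (sigma k))"
  define B where "B = b / sin (sigma k)"
  have "v i = a *\<^sub>R x k + b *\<^sub>R tng k" using z unfolding nrm0_def a_def b_def i_def by (simp add: algebra_simps)
  also have "\<dots> = A *\<^sub>R x k + B *\<^sub>R x (k + 1)" unfolding tng_lincomb A_def B_def
    by (simp add: algebra_simps)
  finally have vi: "v i = A *\<^sub>R x k + B *\<^sub>R x (k + 1)" .
  have eqs: "co n (v i) = A * co n (x k) + B * co n (x (k + 1))" for n unfolding vi by simp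
  have kp: "0 < co i (x k)" "0 < co j (x k)" "co f (x k) = 0" using x_edge(2,3)[of k] x_zero(1)[of k] by (auto simp: i_def j_def f_def)
  have f1: "0 < co f (x (k + 1))" using x_pos[of f "k + 1"] phi_neq[of k] phi_neq2[of k] qq unfolding f_def by simp
  have B0: "B = 0" using eqs[of f] kp f1 qq by (simp add: co_v)
  then have "A = 0" using eqs[of j] kp qq by (simp add: co_v)
  then show False using B0 eqs[of i] qq by (simp add: co_v)
qed

lemma nrm_props:
  "norm (nrm k) = 1" "x k \<bullet> nrm k = 0" "tng k \<bullet> nrm k = 0" "x (k + 1) \<bullet> nrm k = 0" "tng' k \<bullet> nrm k = 0"
  "0 < v (lft k) \<bullet> nrm k"
  "v (lft k) = (v (lft k) \<bullet> x k) *\<^sub>R x k + (v (lft k) \<bullet> tng k) *\<^sub>R tng k + (v (lft k) \<bullet> nrm k) *\<^sub>R nrm k"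
proof -
  show n: "norm (nrm k) = 1" unfolding nrm_def using nrm0_nonzero by (simp add: norm_sgn)
  have "x k \<bullet> nrm0 k = 0" "tng k \<bullet> nrm0 k = 0" unfolding nrm0_def
    using x_unit[of k] x_tng[of k] by (simp_all add: inner_diff unit_inner inner_commute)
  then show xn: "x k \<bullet> nrm k = 0" "tng k \<bullet> nrm k = 0" unfolding nrm_def sgn_div_norm by auto
  then show "x (k + 1) \<bullet> nrm k = 0" "tng' k \<bullet> nrm k = 0" unfolding x_dir(1) tng'_eq by (simp_all add: inner_add inner_diff)
  have n0: "nrm0 k = norm (nrm0 k) *\<^sub>R nrm k" unfolding nrm_def sgn_div_norm using nrm0_nonzero by simp
  have vl: "v (lft k) = (v (lft k) \<bullet> x k) *\<^sub>R x k + (v (lft k) \<bullet> tng k) *\<^sub>R tng k + norm (nrm0 k) *\<^sub>R nrm k"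
    using n0 unfolding nrm0_def by (simp add: algebra_simps)
  have "v (lft k) \<bullet> nrm k = norm (nrm0 k)"
    using arg_cong[OF vl, of "\<lambda>w. w \<bullet> nrm k"] xn n by (simp add: inner_add unit_inner)
  then show "0 < v (lft k) \<bullet> nrm k"
    "v (lft k) = (v (lft k) \<bullet> x k) *\<^sub>R x k + (v (lft k) \<bullet> tng k) *\<^sub>R tng k + (v (lft k) \<bullet> nrm k) *\<^sub>R nrm k"
    using vl nrm0_nonzero[of k] by auto
qed

text \<open>A crossing has height 0 and is a positive combination of the two ends of its edge, so
  these have opposite heights. Consecutive edges share an end, which carries the signs over.\<close>

lemma height_signs:
  "0 < v (lft k) \<bullet> nrm k" "v (rgt k) \<bullet> nrm k < 0"
  "0 < v (lft (k + 1)) \<bullet> nrm k" "v (rgt (k + 1)) \<bullet> nrm k < 0"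
proof -
  have flip: "(0 < v (lft j) \<bullet> n \<longrightarrow> v (rgt j) \<bullet> n < 0) \<and> (v (rgt j) \<bullet> n < 0 \<longrightarrow> 0 < v (lft j) \<bullet> n)"
    if "x j \<bullet> n = 0" for j n
  proof -
    have "co (lft j) (x j) * (v (lft j) \<bullet> n) + co (rgt j) (x j) * (v (rgt j) \<bullet> n) = 0"
      using that by (subst (asm) x_edge(1)) (simp add: inner_add)
    then show ?thesis using x_edge(2,3)[of j]
      by (smt (verit) mult_neg_neg mult_pos_neg mult_pos_pos mult_neg_pos mult_nonneg_nonneg mult_nonneg_nonpos)
  qed
  show a: "0 < v (lft k) \<bullet> nrm k" by (rule nrm_props)
  show b: "v (rgt k) \<bullet> nrm k < 0" using flip[OF nrm_props(2)] a by blast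
  have "0 < v (lft (k + 1)) \<bullet> nrm k \<and> v (rgt (k + 1)) \<bullet> nrm k < 0"
    by (cases rule: turn_cases[of k]) (use a b flip[OF nrm_props(4)] in \<open>metis+\<close>)
  then show "0 < v (lft (k + 1)) \<bullet> nrm k" "v (rgt (k + 1)) \<bullet> nrm k < 0" by auto
qed

lemma frame_expand:
  assumes "co (phi k) y = 0"
  shows "y = (y \<bullet> x k) *\<^sub>R x k + (y \<bullet> tng k) *\<^sub>R tng k + (y \<bullet> nrm k) *\<^sub>R nrm k"
proof -
  let ?S = "span {x k, tng k, nrm k}"
  have xs: "x k \<in> ?S" "tng k \<in> ?S" "nrm k \<in> ?S" by (auto intro: span_base)
  then have x1: "x (k + 1) \<in> ?S" unfolding x_dir(1) by (intro span_add span_scale)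
  have l: "v (lft k) \<in> ?S" by (subst nrm_props(7)) (intro span_add span_scale xs)
  have other: "v (rgt j) \<in> ?S" if "v (lft j) \<in> ?S" "x j \<in> ?S" for j
  proof -
    have "v (rgt j) = (1 / co (rgt j) (x j)) *\<^sub>R (x j - co (lft j) (x j) *\<^sub>R v (lft j))"
      using x_edge(3)[of j] arg_cong[OF x_edge(1)[of j], of "\<lambda>w. w - co (lft j) (x j) *\<^sub>R v (lft j)"] by simp
    then show ?thesis using that by (metis span_diff span_scale)
  qed
  have other': "v (lft j) \<in> ?S" if "v (rgt j) \<in> ?S" "x j \<in> ?S" for j
  proof -
    have "v (lft j) = (1 / co (lft j) (x j)) *\<^sub>R (x j - co (rgt j) (x j) *\<^sub>R v (rgt j))"
      using x_edge(2)[of j] arg_cong[OF x_edge(1)[of j], of "\<lambda>w. w - co (rgt j) (x j) *\<^sub>R v (rgt j)"] by simp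
    then show ?thesis using that by (metis span_diff span_scale)
  qed
  have r: "v (rgt k) \<in> ?S" using other[OF l xs(1)] .
  have f: "v (phi (k - 1)) \<in> ?S"
    by (cases rule: turn_cases[of k]) (use other[of "k + 1"] other'[of "k + 1"] l r x1 in \<open>metis+\<close>)
  have "y = co (lft k) y *\<^sub>R v (lft k) + co (rgt k) y *\<^sub>R v (rgt k) + co (phi (k - 1)) y *\<^sub>R v (phi (k - 1))"
    using expand_quad[OF lr(1)[of k], of y] assms by simp
  then have "y \<in> ?S" using l r f by (metis span_add span_scale)
  then obtain a b d where y: "y = a *\<^sub>R x k + b *\<^sub>R tng k + d *\<^sub>R nrm k"
    by (auto simp: span_insert span_singleton algebra_simps)
  have "y \<bullet> x k = a" "y \<bullet> tng k = b" "y \<bullet> nrm k = d"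
    unfolding y using x_unit[of k] x_tng[of k] nrm_props[of k]
    by (simp_all add: inner_add inner_commute unit_inner)
  then show ?thesis using y by simp
qed

end


section \<open>Real algebra of the turn around a vertex\<close>

text \<open>Here \<open>h\<close> is the height of a vertex and \<open>em2\<close>,
  \<open>em\<close>, \<open>e0\<close>, \<open>e1\<close>, \<open>e2\<close> are the heights of its
  successive neighbours in the unfolding around it. The differences y = e - c h satisfy the
  recurrence of a rotation by the face angle, whose cosine is \<open>\<kappa>\<close>. With d = y1 -
  ym, the hypotheses \<open>conv\<close> become (2 \<kappa> + 1) ((\<kappa> - 1) y0 + d / 2) > 0 and
  the same with -d, and 2 \<kappa> + 1 > 0 because the face angle is below 2 pi / 3.\<close>

lemma fan_algebra_1:
  fixes c h \<kappa> :: real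
  assumes c: "- 1 / 3 < c" "c < 1" and k: "\<kappa> = c / (1 + c)"
    and rec: "em + e1 = 2 * \<kappa> * (h + e0)" "e0 + e2 = 2 * \<kappa> * (h + e1)" "em2 + e0 = 2 * \<kappa> * (h + em)"
    and conv: "em2 > e1" "e2 > em"
  shows "\<bar>(e1 - c * h) - (em - c * h)\<bar> < - 2 * (1 - \<kappa>) * (e0 - c * h)" "e0 < c * h"
proof -
  have kb: "- 1 / 2 < \<kappa>" "\<kappa> < 1" using c unfolding k by (auto simp: field_simps)
  have kc: "2 * \<kappa> * (1 + c) = 2 * c" using c unfolding k by simp
  define y0 y1 ym where "y0 = e0 - c * h" and "y1 = e1 - c * h" and "ym = em - c * h"
  have r: "ym + y1 = 2 * \<kappa> * y0"
    using rec(1) arg_cong[OF kc, of "\<lambda>t. t * h"] unfolding y0_def y1_def ym_def by (simp add: algebra_simps)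
  have 1: "e2 = 2 * \<kappa> * y1 - y0 + c * h"
    using rec(2) arg_cong[OF kc, of "\<lambda>t. t * h"] unfolding y0_def y1_def ym_def by (simp add: algebra_simps)
  have 2: "em2 = 2 * \<kappa> * ym - y0 + c * h"
    using rec(3) arg_cong[OF kc, of "\<lambda>t. t * h"] unfolding y0_def y1_def ym_def by (simp add: algebra_simps)
  have 3: "y1 < 2 * \<kappa> * ym - y0" "ym < 2 * \<kappa> * y1 - y0" using conv unfolding 1 2 y1_def ym_def by auto
  define d where "d = y1 - ym"
  have y: "y1 = \<kappa> * y0 + d / 2" "ym = \<kappa> * y0 - d / 2" using r unfolding d_def by (simp_all add: field_simps)
  have "0 < (2 * \<kappa> + 1) * ((\<kappa> - 1) * y0 - d / 2)" "0 < (2 * \<kappa> + 1) * ((\<kappa> - 1) * y0 + d / 2)"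
    using 3 unfolding y by (simp_all add: algebra_simps)
  then have "d / 2 < (\<kappa> - 1) * y0" "- d / 2 < (\<kappa> - 1) * y0" using kb by (simp_all add: zero_less_mult_iff)
  then have *: "\<bar>d\<bar> < - 2 * (1 - \<kappa>) * y0" by (simp add: abs_if algebra_simps)
  then show "\<bar>(e1 - c * h) - (em - c * h)\<bar> < - 2 * (1 - \<kappa>) * (e0 - c * h)"
    unfolding d_def y0_def y1_def ym_def .
  have "0 < (1 - \<kappa>) * (- y0)" using * by linarith
  then have "0 < - y0" by (rule zero_less_mult_pos) (use kb in simp)
  then show "e0 < c * h" by (simp add: y0_def)
qed

text \<open>In the tangent plane at the vertex, Y and E are the components of a neighbour along and
  across the meridian through the vertex. These vectors have squared length 1 - c^2, and consecutive
  ones differ by a rotation by the face angle in the sense fixed by \<open>cross\<close>. The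
  hypothesis \<open>d\<close> says that the middle one is within half the face angle of the downward
  meridian, so the two next to it lie on different sides of the meridian.\<close>

lemma fan_algebra_2:
  fixes c h \<kappa> \<rho> :: real
  assumes c: "- 1 / 3 < c" "c < 1" and k: "\<kappa> = c / (1 + c)" and h: "0 < h" "\<rho>\<^sup>2 + h\<^sup>2 = 1" "0 < \<rho>"
    and in0: "\<rho> * F0 + h * e0 = c" "F0\<^sup>2 + E0\<^sup>2 + e0\<^sup>2 = 1"
    and in1: "\<rho> * F1 + h * e1 = c" "F1\<^sup>2 + E1\<^sup>2 + e1\<^sup>2 = 1" "F0 * F1 + E0 * E1 + e0 * e1 = c"
    and rec: "em + e1 = 2 * \<kappa> * (h + e0)" "Em + E1 = 2 * \<kappa> * E0"
    and d: "\<bar>(e1 - c * h) - (em - c * h)\<bar> < - 2 * (1 - \<kappa>) * (e0 - c * h)"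
    and r: "0 < r" "0 < r1" "h + r * e0 = 0" "h + r1 * e1 = 0"
    and cross: "0 < (\<rho> + r * F0) * (r1 * E1) - (r * E0) * (\<rho> + r1 * F1)"
  shows "0 < E1" "Em < 0"
proof -
  have kb: "- 1 / 2 < \<kappa>" "\<kappa> < 1" using c unfolding k by (auto simp: field_simps)
  have kc: "\<kappa> * (1 + c) = c" using c unfolding k by simp
  have i0: "\<rho> * F0 + h * e0 - c = 0" and i1: "\<rho> * F1 + h * e1 - c = 0" and i01: "F0 * F1 + E0 * E1 + e0 * e1 - c = 0"
    and kc0: "\<kappa> * (1 + c) - c = 0" using in0(1) in1(1,3) kc by auto
  define S where "S = 1 - c\<^sup>2"
  have S: "0 < S" "\<kappa> * S = c - c\<^sup>2"
  proof -
    have "S = (1 - c) * (1 + c)" unfolding S_def by (simp add: power2_eq_square algebra_simps)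
    then show "0 < S" using c by simp
    have "\<kappa> * S = (\<kappa> * (1 + c)) * (1 - c)" unfolding S_def by (simp add: power2_eq_square algebra_simps)
    then show "\<kappa> * S = c - c\<^sup>2" unfolding kc by (simp add: power2_eq_square algebra_simps)
  qed
  define Y0 Y1 Ym where "Y0 = (e0 - c * h) / \<rho>" and "Y1 = (e1 - c * h) / \<rho>" and "Ym = (em - c * h) / \<rho>"
  have ey: "e0 = \<rho> * Y0 + c * h" "e1 = \<rho> * Y1 + c * h" "em = \<rho> * Ym + c * h"
    using h unfolding Y0_def Y1_def Ym_def by auto
  have F: "F0 = c * \<rho> - h * Y0" "F1 = c * \<rho> - h * Y1"
  proof -
    have "\<rho> * F0 = \<rho> * (c * \<rho> - h * Y0)" using i0 h(2) unfolding ey by algebra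
    then show "F0 = c * \<rho> - h * Y0" using h by simp
    have "\<rho> * F1 = \<rho> * (c * \<rho> - h * Y1)" using i1 h(2) unfolding ey by algebra
    then show "F1 = c * \<rho> - h * Y1" using h by simp
  qed
  have n0: "Y0\<^sup>2 + E0\<^sup>2 - S = 0" using in0(2) h(2) unfolding F ey S_def by algebra
  have n1: "Y1\<^sup>2 + E1\<^sup>2 - S = 0" using in1(2) h(2) unfolding F ey S_def by algebra
  have n01: "Y0 * Y1 + E0 * E1 = \<kappa> * S" using i01 h(2) unfolding S(2) F ey by algebra
  define D where "D = 2 * (Y1 - \<kappa> * Y0)"
  define \<delta> where "\<delta> = 2 * (E1 - \<kappa> * E0)"
  have Yrec: "Ym + Y1 = 2 * \<kappa> * Y0"
  proof -
    have "\<rho> * (Ym + Y1) = \<rho> * (2 * \<kappa> * Y0)" using rec(1) kc0 unfolding ey by algebra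
    then show ?thesis using h by simp
  qed
  have dD: "\<bar>D\<bar> < - 2 * (1 - \<kappa>) * Y0"
  proof -
    have "(e1 - c * h) - (em - c * h) = \<rho> * D" using Yrec unfolding ey D_def by (simp add: algebra_simps) algebra
    then have "\<rho> * \<bar>D\<bar> < \<rho> * (- 2 * (1 - \<kappa>) * Y0)" using d h unfolding ey by (simp add: abs_mult algebra_simps)
    then show ?thesis using h by (metis mult_less_cancel_left_pos)
  qed
  have rr: "\<rho> + r * F0 = - (r * Y0) / h" "\<rho> + r1 * F1 = - (r1 * Y1) / h"
  proof -
    have "h * (\<rho> + r * F0) = - (r * Y0)" using r(3) h(2) unfolding F ey by algebra
    then show "\<rho> + r * F0 = - (r * Y0) / h" using h by (simp add: field_simps)
    have "h * (\<rho> + r1 * F1) = - (r1 * Y1)" using r(4) h(2) unfolding F ey by algebra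
    then show "\<rho> + r1 * F1 = - (r1 * Y1) / h" using h by (simp add: field_simps)
  qed
  \<comment> \<open>The cross product of two consecutive neighbours. Dividing it by their squared
    length gives \<open>w\<close>, the sine of the face angle.\<close>
  define L where "L = Y1 * E0 - Y0 * E1"
  have "0 < (r * r1 / h) * L" using cross unfolding rr L_def by (simp add: algebra_simps diff_divide_distrib)
  moreover have "0 < r * r1 / h" using r(1,2) h(1) by simp
  ultimately have L: "0 < L" by (rule zero_less_mult_pos)
  have dS: "\<delta> * S = - 2 * Y0 * L" "D * S = 2 * E0 * L"
    using n0 n01 unfolding \<delta>_def D_def L_def by algebra+
  have LL: "L\<^sup>2 = (1 - \<kappa>\<^sup>2) * S\<^sup>2" using n0 n1 n01 unfolding L_def by algebra
  define w where "w = L / S"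
  have w: "0 < w" "w\<^sup>2 = 1 - \<kappa>\<^sup>2" using L S LL unfolding w_def by (auto simp: power_divide)
  have dw: "\<delta> = - 2 * w * Y0" "D = 2 * w * E0" using dS S unfolding w_def by (simp_all add: field_simps)
  have Y0: "Y0 < 0"
  proof -
    have "0 < (1 - \<kappa>) * (- Y0)" using dD by linarith
    then have "0 < - Y0" by (rule zero_less_mult_pos) (use kb in simp)
    then show ?thesis by simp
  qed
  have e: "w * \<bar>E0\<bar> < (1 - \<kappa>) * (- Y0)" 
  proof -
    have "\<bar>2 * w * E0\<bar> = 2 * (w * \<bar>E0\<bar>)" using w(1) by (simp add: abs_mult)
    then show ?thesis using dD unfolding dw by linarith
  qed
  have "w * (\<bar>\<kappa>\<bar> * \<bar>E0\<bar>) = \<bar>\<kappa>\<bar> * (w * \<bar>E0\<bar>)" by simp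
  also have "\<dots> \<le> (1 + \<kappa>) * (w * \<bar>E0\<bar>)" using kb w(1) by (intro mult_right_mono) auto
  also have "\<dots> < (1 + \<kappa>) * ((1 - \<kappa>) * (- Y0))" using e kb by (intro mult_strict_left_mono) auto
  also have "\<dots> = w * (w * (- Y0))" using w(2) by algebra
  finally have "\<bar>\<kappa> * E0\<bar> < w * (- Y0)" unfolding mult_less_cancel_left_pos[OF w(1)] abs_mult .
  moreover have "E1 = \<kappa> * E0 + w * (- Y0)" using dw(1) unfolding \<delta>_def by simp
  moreover have "Em = \<kappa> * E0 - w * (- Y0)" using rec(2) calculation(2) by (simp add: algebra_simps)
  ultimately show "0 < E1" "Em < 0" by linarith+
qed

text \<open>A forward step of less than pi cannot jump over a half turn on which the cosine is not
  positive, so all points stay in one open half circle.\<close>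

lemma cos_chain:
  fixes y :: "nat \<Rightarrow> real"
  assumes pos: "\<And>i. i \<le> n \<Longrightarrow> 0 < cos (y i - \<theta>)" and step: "\<And>i. i < n \<Longrightarrow> y i \<le> y (Suc i) \<and> y (Suc i) < y i + pi"
  shows "y n - y 0 < pi"
proof -
  have "\<exists>k::int. \<bar>y 0 - \<theta> - 2 * pi * of_int k\<bar> \<le> pi"
  proof (intro exI[of _ "round ((y 0 - \<theta>) / (2 * pi))"])
    define q where "q = (y 0 - \<theta>) / (2 * pi)"
    have yq: "y 0 - \<theta> = 2 * pi * q" unfolding q_def by simp
    have "\<bar>of_int (round q) - q\<bar> \<le> 1 / 2" by (rule of_int_round_abs_le)
    then have "2 * pi * \<bar>q - of_int (round q)\<bar> \<le> 2 * pi * (1 / 2)"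
      by (intro mult_left_mono) (auto simp: abs_minus_commute)
    then have "\<bar>2 * pi * (q - of_int (round q))\<bar> \<le> pi" by (simp add: abs_mult)
    then show "\<bar>y 0 - \<theta> - 2 * pi * of_int (round ((y 0 - \<theta>) / (2 * pi)))\<bar> \<le> pi"
      unfolding q_def[symmetric] yq by (simp add: right_diff_distrib)
  qed
  then obtain k :: int where k: "\<bar>y 0 - \<theta> - 2 * pi * of_int k\<bar> \<le> pi" by blast
  define u where "u = (\<lambda>i. y i - \<theta> - 2 * pi * of_int k)"
  have cu: "0 < cos (u i)" if "i \<le> n" for i
  proof -
    have "cos (u i) = cos (y i - \<theta>)" unfolding u_def
      using cos.plus_of_int[of "y i - \<theta>" "- k"] by (simp add: algebra_simps)
    then show ?thesis using pos[OF that] by simp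
  qed
  have neg: "cos t \<le> 0" if "pi / 2 \<le> t" "t \<le> 3 * pi / 2" for t
  proof -
    have "cos t = - cos (t - pi)" by simp
    moreover have "0 \<le> cos (t - pi)" using that by (intro cos_ge_zero) auto
    ultimately show ?thesis by simp
  qed
  have u0: "\<bar>u 0\<bar> < pi / 2"
    using k cu[of 0] neg[of "\<bar>u 0\<bar>"] unfolding u_def[symmetric] by (cases "\<bar>u 0\<bar> < pi / 2") (auto simp: u_def)
  have "- (pi / 2) < u i \<and> u i < pi / 2" if "i \<le> n" for i
    using that
  proof (induction i)
    case (Suc i)
    then have "- (pi / 2) < u (Suc i)" "u (Suc i) < 3 * pi / 2" using step[of i] unfolding u_def by auto
    then show ?case using cu[OF Suc.prems] neg[of "u (Suc i)"] by (cases "u (Suc i) < pi / 2") auto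
  qed (use u0 in auto)
  from this[of n] u0 have "u n - u 0 < pi" by auto
  then show ?thesis unfolding u_def by simp
qed

section \<open>Development of the geodesic onto the equator\<close>

context dgeo begin

text \<open>Arc length counted from crossing 0, in both directions; \<open>pos m\<close> is the
  length of one period.\<close>

definition pos :: "int \<Rightarrow> real" where
  "pos k = (if 0 \<le> k then \<Sum>j\<in>{0..<k}. sigma j else - (\<Sum>j\<in>{k..<0}. sigma j))"

lemma pos_Suc: "pos (k + 1) = pos k + sigma k"
proof (cases "0 \<le> k")
  case True
  then have "{0..<k + 1} = insert k {0..<k}" by auto
  then show ?thesis using True unfolding pos_def by simp
next
  case False
  then have e: "{k..<0} = insert k {k + 1..<0}" by auto
  then have "(\<Sum>j\<in>{k..<0}. sigma j) = sigma k + (\<Sum>j\<in>{k + 1..<0}. sigma j)" by simp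
  moreover have "pos (k + 1) = - (\<Sum>j\<in>{k + 1..<0}. sigma j)"
    using False unfolding pos_def by (cases "k + 1 = 0") auto
  ultimately show ?thesis using False unfolding pos_def by simp
qed

lemma sigma_per: "sigma (k + m) = sigma k"
proof -
  have "k + m + 1 = (k + 1) + m" by simp
  then show ?thesis unfolding sigma_def by (simp only: x_per)
qed

lemma pos_per: "pos (k + m) = pos k + pos m"
proof (induction k rule: int_induct[where k = 0])
  case base then show ?case by (simp add: pos_def)
next
  case (step1 i)
  then show ?case using pos_Suc[of i] pos_Suc[of "i + m"] sigma_per[of i] by (simp add: algebra_simps)
next
  case (step2 i)
  then show ?case using pos_Suc[of "i - 1"] pos_Suc[of "i - 1 + m"] sigma_per[of "i - 1"] by (simp add: algebra_simps)
qed

text \<open>Arc \<open>k\<close> is laid on the equator of the unit sphere, from longitude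
  \<open>pos k\<close> to \<open>pos (k + 1)\<close>, and the last coordinate is the height over the
  arc. Inner products are preserved when one argument is in the hyperplane of face
  \<open>phi k\<close> (\<open>dev_inner\<close>).\<close>

definition dev :: "int \<Rightarrow> 'a \<Rightarrow> complex \<times> real" where
  "dev k y = (Complex (y \<bullet> x k) (y \<bullet> tng k) * cis (pos k), y \<bullet> nrm k)"

lemma dev_add: "dev k (y + z) = dev k y + dev k z"
  unfolding dev_def by (simp add: inner_add complex_eq_iff algebra_simps)

lemma dev_scale: "dev k (a *\<^sub>R y) = a *\<^sub>R dev k y"
  unfolding dev_def by (simp add: complex_eq_iff algebra_simps)

lemma inner_mult_cis: "(z * cis t) \<bullet> (w * cis t) = z \<bullet> w"
proof -
  have "(sin t)\<^sup>2 = 1 - (cos t)\<^sup>2" by (rule sin_squared_eq)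
  then show ?thesis unfolding inner_complex_def by (simp add: power2_eq_square) algebra
qed

lemma dev_inner: "co (phi k) y = 0 \<Longrightarrow> dev k y \<bullet> dev k z = y \<bullet> z"
proof -
  assume "co (phi k) y = 0"
  then have "y \<bullet> z = ((y \<bullet> x k) *\<^sub>R x k + (y \<bullet> tng k) *\<^sub>R tng k + (y \<bullet> nrm k) *\<^sub>R nrm k) \<bullet> z"
    using frame_expand by metis
  then show ?thesis unfolding dev_def inner_prod_def fst_conv snd_conv inner_mult_cis
    by (simp add: inner_complex_def inner_add inner_commute)
qed

lemma dev_end: "dev k y = (Complex (y \<bullet> x (k + 1)) (y \<bullet> tng' k) * cis (pos (k + 1)), y \<bullet> nrm k)"
proof -
  have "Complex (y \<bullet> x (k + 1)) (y \<bullet> tng' k) = Complex (y \<bullet> x k) (y \<bullet> tng k) * cis (- sigma k)"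
    unfolding x_dir(1) tng'_eq by (simp add: complex_eq_iff inner_add inner_diff algebra_simps)
  moreover have "cis (- sigma k) * cis (pos (k + 1)) = cis (pos k)" unfolding pos_Suc cis_mult by simp
  ultimately show ?thesis unfolding dev_def by (simp add: mult.assoc)
qed

lemma dev_self:
  "dev k y \<bullet> dev k y = (y \<bullet> x k)\<^sup>2 + (y \<bullet> tng k)\<^sup>2 + (y \<bullet> nrm k)\<^sup>2"
  "dev k y \<bullet> dev k y = (y \<bullet> x (k + 1))\<^sup>2 + (y \<bullet> tng' k)\<^sup>2 + (y \<bullet> nrm k)\<^sup>2"
proof -
  show "dev k y \<bullet> dev k y = (y \<bullet> x k)\<^sup>2 + (y \<bullet> tng k)\<^sup>2 + (y \<bullet> nrm k)\<^sup>2"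
    unfolding dev_def inner_prod_def fst_conv snd_conv inner_mult_cis
    by (simp add: inner_complex_def power2_eq_square)
  show "dev k y \<bullet> dev k y = (y \<bullet> x (k + 1))\<^sup>2 + (y \<bullet> tng' k)\<^sup>2 + (y \<bullet> nrm k)\<^sup>2"
    unfolding dev_end inner_prod_def fst_conv snd_conv inner_mult_cis
    by (simp add: inner_complex_def power2_eq_square)
qed

lemma tng_edge: "v (lft (k + 1)) \<bullet> tng (k + 1) = v (lft (k + 1)) \<bullet> tng' k" "v (rgt (k + 1)) \<bullet> tng (k + 1) = v (rgt (k + 1)) \<bullet> tng' k"
proof -
  have q: "quad (lft (k+1)) (rgt (k+1)) (phi (k+1-1)) (phi (k+1))" by (rule lr)
  then have q': "quad (rgt (k+1)) (lft (k+1)) (phi (k+1-1)) (phi (k+1))" unfolding quad_def by auto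
  show "v (lft (k + 1)) \<bullet> tng (k + 1) = v (lft (k + 1)) \<bullet> tng' k" "v (rgt (k + 1)) \<bullet> tng (k + 1) = v (rgt (k + 1)) \<bullet> tng' k"
    using straight[OF q] straight[OF q'] unfolding tng_def tng'_def by (simp_all add: inner_add)
qed

text \<open>For the left end the norm and the two other components agree before and after the
  crossing, hence so do the heights up to sign, and \<open>height_signs\<close> gives the sign. The
  right end follows because the crossing has height 0.\<close>

lemma nrm_edge: "v (lft (k + 1)) \<bullet> nrm (k + 1) = v (lft (k + 1)) \<bullet> nrm k" "v (rgt (k + 1)) \<bullet> nrm (k + 1) = v (rgt (k + 1)) \<bullet> nrm k"
proof -
  let ?u = "v (lft (k + 1))" and ?w = "v (rgt (k + 1))"
  have q: "quad (lft (k+1)) (rgt (k+1)) (phi k) (phi (k+1))" using lr(1)[of "k + 1"] by simp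
  note qq = quadD[OF q]
  have cu: "co (phi k) ?u = 0" "co (phi (k + 1)) ?u = 0" using qq by (simp_all add: co_v)
  have "(?u \<bullet> x (k+1))\<^sup>2 + (?u \<bullet> tng' k)\<^sup>2 + (?u \<bullet> nrm k)\<^sup>2 = ?u \<bullet> ?u"
    using dev_self(2)[of k ?u] dev_inner[OF cu(1), of ?u] by linarith
  moreover have "(?u \<bullet> x (k+1))\<^sup>2 + (?u \<bullet> tng (k + 1))\<^sup>2 + (?u \<bullet> nrm (k + 1))\<^sup>2 = ?u \<bullet> ?u"
    using dev_self(1)[of "k + 1" ?u] dev_inner[OF cu(2), of ?u] by linarith
  ultimately have "(?u \<bullet> nrm (k + 1))\<^sup>2 = (?u \<bullet> nrm k)\<^sup>2" unfolding tng_edge by linarith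
  then show u: "?u \<bullet> nrm (k + 1) = ?u \<bullet> nrm k"
    by (rule power2_eq_imp_eq) (use height_signs(1)[of "k+1"] height_signs(3)[of k] in auto)
  have "co (lft (k+1)) (x (k+1)) * (?u \<bullet> n) + co (rgt (k+1)) (x (k+1)) * (?w \<bullet> n) = 0" if "x (k+1) \<bullet> n = 0" for n
    using that by (subst (asm) x_edge(1)) (simp add: inner_add)
  from this[OF nrm_props(2)[of "k+1"]] this[OF nrm_props(4)[of k]]
  have "co (rgt (k+1)) (x (k+1)) * (?w \<bullet> nrm (k+1)) = co (rgt (k+1)) (x (k+1)) * (?w \<bullet> nrm k)" unfolding u by linarith
  then show "?w \<bullet> nrm (k + 1) = ?w \<bullet> nrm k" using x_edge(3)[of "k+1"] by simp
qed

text \<open>Consecutive developments fit together along the common edge; this is where the equal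
  angle law enters.\<close>

lemma dev_edge: "dev (k + 1) (v (lft (k + 1))) = dev k (v (lft (k + 1)))" "dev (k + 1) (v (rgt (k + 1))) = dev k (v (rgt (k + 1)))"
  unfolding dev_end[of k] unfolding dev_def by (simp_all add: tng_edge nrm_edge)

lemma dev_x: "dev k (x k) = (cis (pos k), 0)" "dev k (x (k + 1)) = (cis (pos (k + 1)), 0)"
proof -
  have "tng' k \<bullet> x (k + 1) = 0"
    unfolding x_dir(1) tng'_eq using x_tng[of k] x_unit[of k] by (simp add: inner_add inner_diff inner_commute unit_inner)
  then have "x (k + 1) \<bullet> tng' k = 0" by (simp add: inner_commute)
  then show "dev k (x (k + 1)) = (cis (pos (k + 1)), 0)" unfolding dev_end
    using x_unit[of "k + 1"] nrm_props(4)[of k] by (simp add: unit_inner complex_eq_iff)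
  show "dev k (x k) = (cis (pos k), 0)" unfolding dev_def
    using x_unit[of k] nrm_props(2)[of k] x_tng[of k] by (simp add: unit_inner complex_eq_iff)
qed

end


context dgeo begin

lemma lft_per: "lft (k + m) = lft k"
proof -
  have "k + m - 1 = (k - 1) + m" by simp
  then show ?thesis unfolding lft_def by (simp only: phi_per)
qed

lemma rgt_per: "rgt (k + m) = rgt k"
proof -
  have "k + m - 1 = (k - 1) + m" by simp
  then show ?thesis unfolding rgt_def lft_per by (simp only: phi_per)
qed

lemma tng_per: "tng (k + m) = tng k"
proof -
  have "k + m + 1 = (k + 1) + m" by simp
  then show ?thesis unfolding tng_def by (simp only: x_per)
qed

lemma nrm_per: "nrm (k + m) = nrm k"
  unfolding nrm_def nrm0_def lft_per tng_per x_per ..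

lemma dev_linear: "dev k (y - z) = dev k y - dev k z"
  using dev_add[of k y "- 1 *\<^sub>R z"] dev_scale[of k "- 1" z] by simp

text \<open>The third vertices of the two faces at an edge unfold to points symmetric about the edge plane.\<close>

lemma unfold:
  "dev (k + 1) (v (phi k)) + dev k (v (phi (k + 1)))
     = (2 * (c / (1 + c))) *\<^sub>R (dev k (v (lft (k + 1))) + dev k (v (rgt (k + 1))))"
proof -
  define i j f l where "i = lft (k + 1)" and "j = rgt (k + 1)" and "f = phi k" and "l = phi (k + 1)"
  have q: "quad i j f l" using lr(1)[of "k + 1"] by (simp add: i_def j_def f_def l_def)
  note qq = quadD[OF q]
  define \<kappa> where "\<kappa> = c / (1 + c)"
  have kc: "\<kappa> * (1 + c) = c" using c_bounds unfolding \<kappa>_def by simp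
  \<comment> \<open>The parts of the two third vertices orthogonal to the edge plane; this
    orthogonality is what determines \<open>\<kappa>\<close>.\<close>
  define p where "p = v f - \<kappa> *\<^sub>R (v i + v j)"
  define p' where "p' = v l - \<kappa> *\<^sub>R (v i + v j)"
  have orth: "p \<bullet> v i = 0" "p \<bullet> v j = 0" "p' \<bullet> v i = 0" "p' \<bullet> v j = 0"
    using qq kc unfolding p_def p'_def by (simp_all add: inner_diff inner_add gram algebra_simps)
  have pf: "p \<bullet> v f = 1 - \<kappa> * (2 * c)" "p' \<bullet> v l = 1 - \<kappa> * (2 * c)"
    using qq unfolding p_def p'_def by (simp_all add: inner_diff inner_add gram)
  have pp: "p \<bullet> p = 1 - \<kappa> * (2 * c)" "p' \<bullet> p' = 1 - \<kappa> * (2 * c)"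
  proof -
    have "p \<bullet> p = p \<bullet> v f - \<kappa> * (p \<bullet> v i + p \<bullet> v j)" by (subst (2) p_def) (simp add: inner_diff_right inner_add_right)
    moreover have "p' \<bullet> p' = p' \<bullet> v l - \<kappa> * (p' \<bullet> v i + p' \<bullet> v j)" by (subst (2) p'_def) (simp add: inner_diff_right inner_add_right)
    ultimately show "p \<bullet> p = 1 - \<kappa> * (2 * c)" "p' \<bullet> p' = 1 - \<kappa> * (2 * c)" using orth pf by simp_all
  qed
  have Qpos: "0 < 1 - \<kappa> * (2 * c)"
  proof -
    have "\<kappa> * (1 + c) - c = 0" using kc by simp
    then have "(1 + c) * (1 - \<kappa> * (2 * c)) = (1 - c) * (1 + 2 * c)" by algebra
    moreover have "0 < (1 - c) * (1 + 2 * c)" using c_bounds by simp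
    ultimately have "0 < (1 + c) * (1 - \<kappa> * (2 * c))" by simp
    then show ?thesis by (rule zero_less_mult_pos) (use c_bounds in simp)
  qed
  have cop: "co l p = 0" "co f p' = 0" using qq unfolding p_def p'_def by (simp_all add: co_v)
  have x1: "x (k + 1) = co i (x (k + 1)) *\<^sub>R v i + co j (x (k + 1)) *\<^sub>R v j"
    unfolding i_def j_def by (rule x_edge(1))
  have px: "p \<bullet> x (k + 1) = 0" "p' \<bullet> x (k + 1) = 0" using orth by (subst x1, simp add: inner_add)+
  \<comment> \<open>Both images lie on the line orthogonal to the image of the edge plane and have
    equal norm, so they agree up to sign. \<open>T\<close> and \<open>T'\<close> have opposite signs
    because the geodesic passes from one face into the other.\<close>
  define T N T' N' where "T = p \<bullet> tng (k + 1)" and "N = p \<bullet> nrm (k + 1)" and "T' = p' \<bullet> tng' k" and "N' = p' \<bullet> nrm k"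
  have Tpos: "0 < T"
  proof -
    have ie: "p \<bullet> (a1 *\<^sub>R v i + a2 *\<^sub>R v j + a3 *\<^sub>R v f) = a3 * (1 - \<kappa> * (2 * c))" for a1 a2 a3
      using orth pf by (simp add: inner_add)
    have "x (k + 1 + 1) = co i (x (k + 1 + 1)) *\<^sub>R v i + co j (x (k + 1 + 1)) *\<^sub>R v j + co f (x (k + 1 + 1)) *\<^sub>R v f"
      using expand_quad[OF q, of "x (k + 1 + 1)"] x_zero(1)[of "k + 1 + 1", unfolded add_diff_cancel_right', folded l_def]
      by (simp only: scale_zero_left add_0_right)
    from arg_cong[OF this, of "\<lambda>w. p \<bullet> w"]
    have "p \<bullet> x (k + 1 + 1) = co f (x (k + 1 + 1)) * (1 - \<kappa> * (2 * c))" unfolding ie .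
    moreover have "0 < co f (x (k + 1 + 1))"
      using x_pos[of f "k + 1 + 1", unfolded add_diff_cancel_right', folded l_def]
        phi_neq2[of "k + 1", unfolded add_diff_cancel_right', folded f_def] qq by blast
    ultimately have "0 < p \<bullet> x (k + 1 + 1)" using Qpos by simp
    also have "p \<bullet> x (k + 1 + 1) = sin (sigma (k + 1)) * T"
      using px unfolding x_dir(1)[of "k + 1"] T_def by (simp add: inner_add)
    finally show ?thesis using sin_sigma[of "k + 1"] by (simp add: zero_less_mult_iff)
  qed
  have T'neg: "T' < 0"
  proof -
    have ie: "p' \<bullet> (a1 *\<^sub>R v i + a2 *\<^sub>R v j + a3 *\<^sub>R v l) = a3 * (1 - \<kappa> * (2 * c))" for a1 a2 a3
      using orth pf by (simp add: inner_add)
    have "x k = co i (x k) *\<^sub>R v i + co j (x k) *\<^sub>R v j + co l (x k) *\<^sub>R v l"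
      using expand_quad[OF q, of "x k"] x_zero(2)[of k] unfolding f_def by simp
    from arg_cong[OF this, of "\<lambda>w. p' \<bullet> w"]
    have "p' \<bullet> x k = co l (x k) * (1 - \<kappa> * (2 * c))" unfolding ie .
    moreover have "0 < co l (x k)"
      using x_pos[of l k, folded f_def] phi_neq2[of k, folded l_def] qq by metis
    ultimately have "0 < p' \<bullet> x k" using Qpos by simp
    also have "p' \<bullet> x k = - (sin (sigma k) * T')"
      using px by (subst x_dir(2)) (simp add: inner_diff T'_def)
    finally show ?thesis using sin_sigma[of k] by (simp add: mult_less_0_iff)
  qed
  have dp: "dev (k + 1) p = (Complex 0 T * cis (pos (k + 1)), N)" "dev k p' = (Complex 0 T' * cis (pos (k + 1)), N')"
    using px unfolding dev_end[of k] unfolding dev_def T_def N_def T'_def N'_def by simp_all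
  define A B H where "A = v i \<bullet> x (k + 1)" and "B = v i \<bullet> tng' k" and "H = v i \<bullet> nrm k"
  have di: "dev k (v i) = (Complex A B * cis (pos (k + 1)), H)" "dev (k + 1) (v i) = dev k (v i)" "dev (k + 1) (v j) = dev k (v j)"
    unfolding A_def B_def H_def i_def j_def using dev_edge[of k] by (simp_all add: dev_end)
  have H: "0 < H" unfolding H_def i_def by (rule height_signs)
  have o1: "T * B + N * H = 0"
    using dev_inner[of "k + 1" p "v i"] cop orth unfolding l_def di(2) unfolding dp di(1) inner_prod_def fst_conv snd_conv inner_mult_cis
    by (simp add: inner_complex_def l_def)
  have o2: "T' * B + N' * H = 0"
    using dev_inner[of k p' "v i"] cop orth unfolding f_def unfolding dp di(1) inner_prod_def fst_conv snd_conv inner_mult_cis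
    by (simp add: inner_complex_def f_def)
  have n1: "T * T + N * N = 1 - \<kappa> * (2 * c)"
    using dev_inner[of "k + 1" p p] cop pp unfolding l_def unfolding dp inner_prod_def fst_conv snd_conv inner_mult_cis
    by (simp add: inner_complex_def)
  have n2: "T' * T' + N' * N' = 1 - \<kappa> * (2 * c)"
    using dev_inner[of k p' p'] cop pp unfolding f_def unfolding dp inner_prod_def fst_conv snd_conv inner_mult_cis
    by (simp add: inner_complex_def)
  have "H * H * (T * T + N * N) = T * T * (H * H + B * B)" "H * H * (T' * T' + N' * N') = T' * T' * (H * H + B * B)"
    using o1 o2 by algebra+
  then have "T * T * (H * H + B * B) = T' * T' * (H * H + B * B)" unfolding n1 n2 by (rule_tac trans[OF sym])
  moreover have "0 < H * H + B * B" using H by (simp add: add_pos_nonneg)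
  ultimately have "T * T = T' * T'" by (metis less_irrefl mult_right_cancel)
  then have "(T - T') * (T + T') = 0" by (simp add: algebra_simps)
  then have TT: "T' = - T" using Tpos T'neg by simp
  have "(N + N') * H = 0" using o1 o2 unfolding TT by (simp add: algebra_simps)
  then have NN: "N' = - N" using H by simp
  have "dev (k + 1) p + dev k p' = 0" unfolding dp TT NN by (simp add: complex_eq_iff zero_prod_def)
  then have "dev (k + 1) (v f) + dev k (v l) = (2 * \<kappa>) *\<^sub>R (dev k (v i) + dev k (v j))"
    unfolding p_def p'_def dev_linear dev_scale dev_add di by (simp add: algebra_simps scaleR_2 flip: scaleR_scaleR)
  then show ?thesis unfolding f_def l_def i_def j_def \<kappa>_def .
qed

lemma dev_surj: "\<exists>w. co (phi k) w = 0 \<and> dev k w = P"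
proof -
  obtain z h where P: "P = (z, h)" by (cases P)
  define u where "u = z * cis (- pos k)"
  define w where "w = Re u *\<^sub>R x k + Im u *\<^sub>R tng k + h *\<^sub>R nrm k"
  have "co (phi k) w = 0" unfolding w_def using co_phi[of k] by simp
  moreover have "w \<bullet> x k = Re u" "w \<bullet> tng k = Im u" "w \<bullet> nrm k = h"
    unfolding w_def using x_unit[of k] x_tng[of k] nrm_props[of k] by (simp_all add: inner_add inner_commute unit_inner)
  moreover have "Complex (Re u) (Im u) * cis (pos k) = z" unfolding complex_surj unfolding u_def by (simp add: mult.assoc cis_mult)
  ultimately show ?thesis unfolding dev_def P by (intro exI[of _ w]) simp
qed

text \<open>Two strands crossing the same edge in opposite directions: developed along the first strand,
  the great circle of the second strand does not change.\<close>

lemma dev_opposite_strand: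
  assumes o: "phi k' = phi (k + 1)" "phi (k' + 1) = phi k"
  shows "dev (k + 1) (nrm k') = dev k (nrm (k' + 1))"
proof -
  define i j f l where "i = lft (k + 1)" and "j = rgt (k + 1)" and "f = phi k" and "l = phi (k + 1)"
  have q: "quad i j f l" using lr(1)[of "k + 1"] by (simp add: i_def j_def f_def l_def)
  note qq = quadD[OF q]
  have q': "quad (lft (k' + 1)) (rgt (k' + 1)) l f" using lr(1)[of "k' + 1"] o by (simp add: f_def l_def)
  have ij: "(lft (k' + 1) = i \<and> rgt (k' + 1) = j) \<or> (lft (k' + 1) = j \<and> rgt (k' + 1) = i)"
    using quad_cases[OF q, of "lft (k' + 1)"] quad_cases[OF q, of "rgt (k' + 1)"] quadD[OF q'] by metis
  have ne: "v i \<bullet> nrm (k' + 1) = v i \<bullet> nrm k'" "v j \<bullet> nrm (k' + 1) = v j \<bullet> nrm k'"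
    using nrm_edge[of k'] ij by auto
  define \<kappa> where "\<kappa> = c / (1 + c)"
  have un: "v l \<bullet> nrm (k' + 1) + v f \<bullet> nrm k' = 2 * \<kappa> * (v i \<bullet> nrm k' + v j \<bullet> nrm k')"
    using arg_cong[OF unfold[of k'], of snd] ij unfolding o f_def[symmetric] l_def[symmetric] \<kappa>_def[symmetric]
    by (auto simp: dev_def add.commute)
  have uk: "dev (k + 1) (v f) = (2 * \<kappa>) *\<^sub>R (dev k (v i) + dev k (v j)) - dev k (v l)"
    using unfold[of k] unfolding f_def l_def i_def j_def \<kappa>_def by (simp add: algebra_simps)
  have de: "dev (k + 1) (v i) = dev k (v i)" "dev (k + 1) (v j) = dev k (v j)"
    unfolding i_def j_def by (rule dev_edge)+
  have cn: "co l (nrm k') = 0" "co f (nrm (k' + 1)) = 0" using co_phi(4)[of k'] co_phi(4)[of "k' + 1"] o by (simp_all add: f_def l_def)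
  \<comment> \<open>The discrepancy of the two sides, pulled back to the hyperplane of face
    \<open>l\<close>; it turns out to be orthogonal to the three vertices spanning that
    hyperplane.\<close>
  obtain w where w: "co l w = 0" "dev (k + 1) w = dev (k + 1) (nrm k') - dev k (nrm (k' + 1))"
    using dev_surj[of "k + 1"] unfolding l_def by blast
  have wz: "w \<bullet> y = nrm k' \<bullet> y - dev k (nrm (k' + 1)) \<bullet> dev (k + 1) y" for y
    using dev_inner[of "k + 1" w y] dev_inner[of "k + 1" "nrm k'" y] w cn unfolding l_def by (simp add: inner_diff)
  have n: "dev k (nrm (k' + 1)) \<bullet> dev k y = nrm (k' + 1) \<bullet> y" for y
    using dev_inner[of k "nrm (k' + 1)" y] cn unfolding f_def by simp
  have "w \<bullet> v i = 0" "w \<bullet> v j = 0" unfolding wz de n using ne by (simp_all add: inner_commute)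
  moreover have "w \<bullet> v f = 0" unfolding wz uk using un ne n[of "v i"] n[of "v j"] n[of "v l"]
    by (simp add: inner_diff_right inner_add_right inner_commute algebra_simps)
  moreover have "w = co i w *\<^sub>R v i + co j w *\<^sub>R v j + co f w *\<^sub>R v f"
    using expand_quad[OF q, of w] w(1) by simp
  ultimately have "w \<bullet> w = 0" by (metis add_0 inner_add_right inner_scaleR_right mult_zero_right)
  then have "w = 0" by simp
  moreover have "dev (k + 1) 0 = 0" using dev_scale[of "k + 1" 0 0] by simp
  ultimately show ?thesis using w(2) by simp
qed

section \<open>Feet of vertices, fans and the lens estimate\<close>

text \<open>The longitude of the foot of the perpendicular from vertex \<open>i\<close> to the great
  circle of arc \<open>k\<close>. The arctangent is the right branch when
  \<open>v i \<bullet> x k\<close> is positive, which is established within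
  \<open>fan\<close>.\<close>

definition foot :: "int \<Rightarrow> nat \<Rightarrow> real" where
  "foot k i = pos k + arctan ((v i \<bullet> tng k) / (v i \<bullet> x k))"

lemma foot_per: "foot (k + m) i = foot k i + pos m"
  unfolding foot_def tng_per x_per pos_per[of k] by simp

lemma dev_lft: "dev (k + 1) (v (lft (k + 1))) = dev k (v (lft (k + 1)))" by (rule dev_edge)

text \<open>Three consecutive crossings of the edges at a vertex lying on the left.\<close>

lemma fan:
  assumes lf: "lft (a + 1) = i" "lft (a + 2) = i" "lft (a + 3) = i"
    and conv: "0 < x (a + 3) \<bullet> nrm a" "0 < x (a + 1) \<bullet> nrm (a + 3)"
  shows "\<exists>\<rho>>0. fst (dev (a + 2) (v i)) = of_real \<rho> * cis (foot (a + 2) i)"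
    "foot (a + 2) i < pos (a + 3)" "pos (a + 3) < foot (a + 2) i + pi"
    "foot (a + 2) i - pi < pos (a + 1)" "pos (a + 1) < foot (a + 2) i"
    "0 < v i \<bullet> nrm a" "v i \<bullet> nrm (a + 1) = v i \<bullet> nrm a" "v i \<bullet> nrm (a + 2) = v i \<bullet> nrm a" "v i \<bullet> nrm (a + 3) = v i \<bullet> nrm a"
    "phi (a + 3) = phi a"
proof -
  have e: "a + 1 + 1 = a + 2" "a + 2 + 1 = a + 3" "a + 2 - 1 = a + 1" "a + 1 - 1 = a" "a + 3 - 1 = a + 2" by auto
  define j where "j = phi a"
  define f where "f = phi (a + 1)"
  define l where "l = phi (a + 2)"
  have t1: "phi (a + 2) = rgt (a + 1)" "rgt (a + 2) = phi a"
  proof -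
    have "lft (a + 2) \<noteq> phi (a + 1 - 1)" using lf quadD[OF lr(1)[of "a + 1"]] by simp
    then show "phi (a + 2) = rgt (a + 1)" "rgt (a + 2) = phi a"
      using turn_cases[of "a + 1"] unfolding e by metis+
  qed
  have t2: "phi (a + 3) = rgt (a + 2)" "rgt (a + 3) = phi (a + 1)"
  proof -
    have "lft (a + 3) \<noteq> phi (a + 2 - 1)" using lf quadD[OF lr(1)[of "a + 2"]] by simp
    then show "phi (a + 3) = rgt (a + 2)" "rgt (a + 3) = phi (a + 1)"
      using turn_cases[of "a + 2"] unfolding e by metis+
  qed
  show "phi (a + 3) = phi a" using t1 t2 by simp
  have q: "quad i j f l" using lr(1)[of "a + 2"] lf t1 unfolding e j_def f_def l_def by simp
  note qq = quadD[OF q]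
  \<comment> \<open>The faces around vertex \<open>i\<close> are unfolded: \<open>Pm2\<close>,
    \<open>Pm\<close>, \<open>P0\<close>, \<open>P1\<close>, \<open>P2\<close> are the images of its
    successive neighbours, where the labels f, l, j repeat after three faces.\<close>
  define V where "V = dev (a + 2) (v i)"
  define P0 where "P0 = dev (a + 2) (v j)"
  define P1 where "P1 = dev (a + 2) (v f)"
  define Pm where "Pm = dev (a + 1) (v l)"
  define P2 where "P2 = dev (a + 3) (v l)"
  define Pm2 where "Pm2 = dev a (v f)"
  have V: "dev (a + 1) (v i) = V" "dev a (v i) = V" "dev (a + 3) (v i) = V"
    using dev_edge(1)[of a] dev_edge(1)[of "a + 1"] dev_edge(1)[of "a + 2"] lf unfolding e V_def by simp_all
  have P: "dev (a + 1) (v j) = P0" "dev (a + 3) (v f) = P1" "dev a (v l) = Pm"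
    using dev_edge(2)[of a] dev_edge(2)[of "a + 1"] dev_edge(2)[of "a + 2"] t1 t2
    unfolding e P0_def P1_def Pm_def j_def f_def l_def by simp_all
  define \<kappa> where "\<kappa> = c / (1 + c)"
  have u0: "P1 + Pm = (2 * \<kappa>) *\<^sub>R (V + P0)"
    using unfold[of "a + 1"] V P lf t1 unfolding e P1_def Pm_def \<kappa>_def j_def f_def l_def by simp
  have u1: "P2 + P0 = (2 * \<kappa>) *\<^sub>R (V + P1)"
    using unfold[of "a + 2"] V P lf t1 t2 unfolding e P0_def P1_def P2_def V_def \<kappa>_def j_def f_def l_def by simp
  have um: "P0 + Pm2 = (2 * \<kappa>) *\<^sub>R (V + Pm)"
    using unfold[of a] V P lf t1 t2 unfolding e Pm_def Pm2_def \<kappa>_def j_def f_def l_def by simp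
  define h where "h = snd V"
  have hh: "v i \<bullet> nrm a = h" "v i \<bullet> nrm (a + 1) = h" "v i \<bullet> nrm (a + 2) = h" "v i \<bullet> nrm (a + 3) = h"
    using V(1,2,3) unfolding V_def h_def dev_def by auto
  then show "v i \<bullet> nrm (a + 1) = v i \<bullet> nrm a" "v i \<bullet> nrm (a + 2) = v i \<bullet> nrm a" "v i \<bullet> nrm (a + 3) = v i \<bullet> nrm a" by auto
  have h: "0 < h" using height_signs(1)[of "a + 1"] lf hh by simp
  then show "0 < v i \<bullet> nrm a" using hh by simp
  define A B where "A = co i (x (a + 2))" and "B = co j (x (a + 2))"
  have X2: "x (a + 2) = A *\<^sub>R v i + B *\<^sub>R v j" "0 < A" "0 < B"
    using x_edge[of "a + 2"] lf t1 unfolding A_def B_def j_def by auto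
  define A1 B1 where "A1 = co i (x (a + 3))" and "B1 = co f (x (a + 3))"
  have X3: "x (a + 3) = A1 *\<^sub>R v i + B1 *\<^sub>R v f" "0 < A1" "0 < B1"
    using x_edge[of "a + 3"] lf t2 unfolding A1_def B1_def f_def by auto
  define A' B' where "A' = co i (x (a + 1))" and "B' = co l (x (a + 1))"
  have X1: "x (a + 1) = A' *\<^sub>R v i + B' *\<^sub>R v l" "0 < A'" "0 < B'"
    using x_edge[of "a + 1"] lf t1 unfolding A'_def B'_def l_def by auto
  have D2: "A *\<^sub>R V + B *\<^sub>R P0 = (cis (pos (a + 2)), 0)"
    using dev_x(1)[of "a + 2"] unfolding X2(1) dev_add dev_scale V_def P0_def .
  have D3: "A1 *\<^sub>R V + B1 *\<^sub>R P1 = (cis (pos (a + 3)), 0)"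
    using dev_x(2)[of "a + 2"] unfolding e X3(1) dev_add dev_scale V_def P1_def .
  have D1: "A' *\<^sub>R V + B' *\<^sub>R Pm = (cis (pos (a + 1)), 0)"
    using dev_x(1)[of "a + 1"] unfolding X1(1) dev_add dev_scale V(1) Pm_def .
  define em em2 e0 e1 e2 where "em = snd Pm" and "em2 = snd Pm2" and "e0 = snd P0" and "e1 = snd P1" and "e2 = snd P2"
  have r: "A * h + B * e0 = 0" "A1 * h + B1 * e1 = 0" "A' * h + B' * em = 0"
    using arg_cong[OF D2, of snd] arg_cong[OF D3, of snd] arg_cong[OF D1, of snd]
    unfolding h_def em_def e0_def e1_def by simp_all
  \<comment> \<open>The first and the fourth arc lie in the same face. The hypotheses
    \<open>conv\<close> compare, for the neighbours \<open>f\<close> and \<open>l\<close>, the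
    heights of their two unfolded copies.\<close>
  have cv: "e1 < em2" "em < e2"
  proof -
    have "v f \<bullet> nrm a = em2" unfolding em2_def Pm2_def dev_def by simp
    then have "0 < A1 * h + B1 * em2" using conv(1) hh unfolding X3(1) by (simp add: inner_add)
    then have "B1 * e1 < B1 * em2" using r(2) by linarith
    then show "e1 < em2" using X3 by simp
    have "v l \<bullet> nrm (a + 3) = e2" unfolding e2_def P2_def dev_def by simp
    then have "0 < A' * h + B' * e2" using conv(2) hh unfolding X1(1) by (simp add: inner_add)
    then have "B' * em < B' * e2" using r(3) by linarith
    then show "em < e2" using X1 by simp
  qed
  have rec: "em + e1 = 2 * \<kappa> * (h + e0)" "e0 + e2 = 2 * \<kappa> * (h + e1)" "em2 + e0 = 2 * \<kappa> * (h + em)"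
    using arg_cong[OF u0, of snd] arg_cong[OF u1, of snd] arg_cong[OF um, of snd]
    unfolding em_def em2_def e0_def e1_def e2_def h_def by (simp_all add: add.commute)
  note fa = fan_algebra_1[OF c_bounds \<kappa>_def rec cv]
  have vx: "0 < v i \<bullet> x (a + 2)"
  proof -
    have "B * e0 < B * (c * h)" using fa(2) X2(3) by simp
    then have "0 < h * (A + B * c)" using r(1) by (simp add: algebra_simps)
    then have "0 < A + B * c" using h by (rule zero_less_mult_pos)
    then show ?thesis unfolding X2(1) using qq by (simp add: inner_add gram mult.commute)
  qed
  define \<beta> where "\<beta> = arctan ((v i \<bullet> tng (a + 2)) / (v i \<bullet> x (a + 2)))"
  have \<beta>: "- (pi / 2) < \<beta>" "\<beta> < pi / 2" unfolding \<beta>_def by (rule arctan_lbound arctan_ubound)+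
  have cb: "0 < cos \<beta>" using \<beta> by (intro cos_gt_zero_pi)
  define \<rho> where "\<rho> = (v i \<bullet> x (a + 2)) / cos \<beta>"
  have \<rho>: "0 < \<rho>" using vx cb by (simp add: \<rho>_def)
  define F where "F = foot (a + 2) i"
  have Fp: "F = pos (a + 2) + \<beta>" unfolding F_def foot_def \<beta>_def ..
  have fV: "fst V = of_real \<rho> * cis F"
  proof -
    have "v i \<bullet> x (a + 2) = \<rho> * cos \<beta>" using cb by (simp add: \<rho>_def)
    moreover have "v i \<bullet> tng (a + 2) = \<rho> * sin \<beta>"
    proof -
      have "(v i \<bullet> tng (a + 2)) / (v i \<bullet> x (a + 2)) = tan \<beta>" unfolding \<beta>_def by (simp add: tan_arctan)
      then show ?thesis using vx cb unfolding \<rho>_def tan_def by (simp add: field_simps)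
    qed
    ultimately have "Complex (v i \<bullet> x (a + 2)) (v i \<bullet> tng (a + 2)) = of_real \<rho> * cis \<beta>" by (simp add: complex_eq_iff)
    then have "fst V = of_real \<rho> * cis \<beta> * cis (pos (a + 2))" unfolding V_def dev_def by simp
    also have "\<dots> = of_real \<rho> * cis F" unfolding Fp by (simp add: cis_mult mult.assoc add.commute)
    finally show ?thesis .
  qed
  then show "\<exists>\<rho>>0. fst (dev (a + 2) (v i)) = of_real \<rho> * cis (foot (a + 2) i)"
    using \<rho> unfolding V_def F_def by blast
  \<comment> \<open>Turns the equator so that the foot has longitude 0; then \<open>Im (R P)\<close>
    tells on which side of the meridian of the vertex a point lies.\<close>
  define R where "R = (\<lambda>P :: complex \<times> real. fst P * cis (- F))"
  have Radd: "R (p + p') = R p + R p'" and Rsc: "R (t *\<^sub>R p) = t *\<^sub>R R p" for p p' t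
    unfolding R_def by (simp_all add: algebra_simps scaleR_conv_of_real)
  have RV: "R V = of_real \<rho>" unfolding R_def fV by (simp add: mult.assoc cis_mult)
  have Rin: "P \<bullet> P' = Re (R P) * Re (R P') + Im (R P) * Im (R P') + snd P * snd P'" for P P'
    using inner_mult_cis[of "fst P" "- F" "fst P'"] unfolding R_def inner_prod_def by (simp add: inner_complex_def)
  have cl: "co (phi (a + 2)) (v i) = 0" "co (phi (a + 2)) (v j) = 0" "co (phi (a + 2)) (v f) = 0"
    using qq unfolding l_def[symmetric] by (simp_all add: co_v)
  have in_: "V \<bullet> V = 1" "V \<bullet> P0 = c" "V \<bullet> P1 = c" "P0 \<bullet> P0 = 1" "P1 \<bullet> P1 = 1" "P0 \<bullet> P1 = c"
    unfolding V_def P0_def P1_def using qq by (simp_all add: dev_inner cl gram)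
  define F0 E0 F1 E1 Em where "F0 = Re (R P0)" and "E0 = Im (R P0)" and "F1 = Re (R P1)" and "E1 = Im (R P1)" and "Em = Im (R Pm)"
  have eqs: "\<rho>\<^sup>2 + h\<^sup>2 = 1" "\<rho> * F0 + h * e0 = c" "F0\<^sup>2 + E0\<^sup>2 + e0\<^sup>2 = 1"
    "\<rho> * F1 + h * e1 = c" "F1\<^sup>2 + E1\<^sup>2 + e1\<^sup>2 = 1" "F0 * F1 + E0 * E1 + e0 * e1 = c"
    using in_ unfolding Rin RV F0_def E0_def F1_def E1_def e0_def e1_def h_def by (simp_all add: power2_eq_square)
  have Erec: "Em + E1 = 2 * \<kappa> * E0"
  proof -
    have "R P1 + R Pm = (2 * \<kappa>) *\<^sub>R (R V + R P0)" using arg_cong[OF u0, of R] unfolding Radd Rsc .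
    from arg_cong[OF this, of Im] show ?thesis unfolding RV Em_def E1_def E0_def by (simp add: add.commute)
  qed
  have R2: "cis (pos (a + 2) - F) = A *\<^sub>R R V + B *\<^sub>R R P0"
    using arg_cong[OF D2, of R] unfolding Radd Rsc by (simp add: R_def cis_mult)
  have R3: "cis (pos (a + 3) - F) = A1 *\<^sub>R R V + B1 *\<^sub>R R P1"
    using arg_cong[OF D3, of R] unfolding Radd Rsc by (simp add: R_def cis_mult)
  have R1: "cis (pos (a + 1) - F) = A' *\<^sub>R R V + B' *\<^sub>R R Pm"
    using arg_cong[OF D1, of R] unfolding Radd Rsc by (simp add: R_def cis_mult)
  have cs2: "cos (pos (a + 2) - F) = A * \<rho> + B * F0" "sin (pos (a + 2) - F) = B * E0"
    using arg_cong[OF R2, of Re] arg_cong[OF R2, of Im] unfolding RV F0_def E0_def by simp_all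
  have cs3: "cos (pos (a + 3) - F) = A1 * \<rho> + B1 * F1" "sin (pos (a + 3) - F) = B1 * E1"
    using arg_cong[OF R3, of Re] arg_cong[OF R3, of Im] unfolding RV F1_def E1_def by simp_all
  have cs1: "sin (pos (a + 1) - F) = B' * Em"
    using arg_cong[OF R1, of Im] unfolding RV Em_def by simp
  \<comment> \<open>The sine of the arc between two consecutive crossings is positive, which fixes
    the sense of rotation around the vertex.\<close>
  have cross: "0 < (\<rho> + B / A * F0) * (B1 / A1 * E1) - (B / A * E0) * (\<rho> + B1 / A1 * F1)"
  proof -
    have "0 < sin (sigma (a + 2))" by (rule sin_sigma)
    also have "sigma (a + 2) = (pos (a + 3) - F) - (pos (a + 2) - F)" using pos_Suc[of "a + 2"] unfolding e by simp
    also have "sin \<dots> = (A * \<rho> + B * F0) * (B1 * E1) - (B * E0) * (A1 * \<rho> + B1 * F1)"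
      by (simp only: sin_diff[of "pos (a + 3) - F" "pos (a + 2) - F"] cs2 cs3) (simp add: mult.commute)
    also have "\<dots> = (A * A1) * ((\<rho> + B / A * F0) * (B1 / A1 * E1) - (B / A * E0) * (\<rho> + B1 / A1 * F1))"
      using X2(2) X3(2) by (simp add: field_simps)
    finally show ?thesis by (rule zero_less_mult_pos) (use X2(2) X3(2) in simp)
  qed
  have rr: "h + B / A * e0 = 0" "h + B1 / A1 * e1 = 0" using r X2(2) X3(2) by (simp_all add: field_simps)
  note fb = fan_algebra_2[OF c_bounds \<kappa>_def h eqs(1) \<rho> eqs(2-6) rec(1) Erec fa(1) _ _ rr cross]
  have E: "0 < E1" "Em < 0" using fb X2 X3 by simp_all
  have s3: "0 < sin (pos (a + 3) - F)" unfolding cs3 using E X3 by simp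
  have s1: "sin (pos (a + 1) - F) < 0" unfolding cs1 using E X1 by (simp add: mult_pos_neg)
  have p3: "pos (a + 3) = pos (a + 2) + sigma (a + 2)" and p1: "pos (a + 2) = pos (a + 1) + sigma (a + 1)"
    using pos_Suc[of "a + 2"] pos_Suc[of "a + 1"] unfolding e by auto
  have sg: "0 < sigma (a + 2)" "sigma (a + 2) < pi" "0 < sigma (a + 1)" "sigma (a + 1) < pi" by (rule sigma_bounds)+
  \<comment> \<open>The sign of the sine locates the crossing modulo 2 pi; the bounds on
    \<open>\<beta>\<close> and on the arc length exclude the other half turns.\<close>
  show "foot (a + 2) i < pos (a + 3)" unfolding F_def[symmetric]
  proof (rule ccontr)
    assume "\<not> F < pos (a + 3)"
    then have "0 \<le> sin (F - pos (a + 3))" using Fp p3 sg \<beta> by (intro sin_ge_zero) auto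
    then show False using s3 sin_minus[of "pos (a + 3) - F"] by simp
  qed
  show "pos (a + 3) < foot (a + 2) i + pi" unfolding F_def[symmetric]
  proof (rule ccontr)
    assume "\<not> pos (a + 3) < F + pi"
    then have "0 \<le> sin (pos (a + 3) - F - pi)" using Fp p3 sg \<beta> by (intro sin_ge_zero) auto
    then show False using s3 by (simp add: sin_diff)
  qed
  show "pos (a + 1) < foot (a + 2) i" unfolding F_def[symmetric]
  proof (rule ccontr)
    assume "\<not> pos (a + 1) < F"
    then have "0 \<le> sin (pos (a + 1) - F)" using Fp p1 sg \<beta> by (intro sin_ge_zero) auto
    then show False using s1 by simp
  qed
  show "foot (a + 2) i - pi < pos (a + 1)" unfolding F_def[symmetric]
  proof (rule ccontr)
    assume "\<not> F - pi < pos (a + 1)"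
    then have "0 \<le> sin (F - pi - pos (a + 1))" using Fp p1 sg \<beta> by (intro sin_ge_zero) auto
    moreover have "sin (F - pi - pos (a + 1)) = sin (pos (a + 1) - F)"
      using sin_minus[of "pos (a + 1) - F"] by (simp add: sin_diff)
    ultimately show False using s1 by simp
  qed
qed

text \<open>The strand from \<open>b\<close> to \<open>b + J + 2\<close> is laid on the equator, and
  the opposite strand develops into one great circle with normal \<open>W\<close>. At the crossings
  from \<open>b + 1\<close> to \<open>b + J + 1\<close> and at the feet of the two end vertices the
  equator lies strictly on the positive side of that circle, so this piece fits into an open half
  circle.\<close>

lemma lens:
  fixes b :: int and J :: nat
  assumes J: "2 \<le> J" and m: "m = 2 * int J + 4"
    and fan1: "lft (b - 1) = i" "lft b = i" "lft (b + 1) = i"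
      "0 < x (b + 1) \<bullet> nrm (b - 2)" "0 < x (b - 1) \<bullet> nrm (b + 1)"
    and fan2: "lft (b + int J + 1) = e" "lft (b + int J + 2) = e" "lft (b + int J + 3) = e"
      "0 < x (b + int J + 3) \<bullet> nrm (b + int J)" "0 < x (b + int J + 1) \<bullet> nrm (b + int J + 3)"
    and band: "\<And>k. 2 \<le> k \<Longrightarrow> k \<le> J \<Longrightarrow> phi (b + int k) = phi (b - int k - 1) \<and> phi (b + int k - 1) = phi (b - int k)
       \<and> 0 < x (b + int k) \<bullet> nrm (b - int k - 1)"
  shows "foot (b + int J + 2) e - foot b i < pi"
proof -
  have n1: "b - 2 + 1 = b - 1" "b - 2 + 2 = b" "b - 2 + 3 = b + 1" by auto
  note F1 = fan[of "b - 2" i, unfolded n1, OF fan1]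
  have n2: "b + int J + 1 + 1 = b + int J + 2" "b + int J + 2 + 1 = b + int J + 3" by auto
  note F2 = fan[of "b + int J" e, OF fan2]
  \<comment> \<open>The developed normal of the arc \<open>b - 2\<close>;
    \<open>dev_opposite_strand\<close> shows by induction that the later opposite arcs have the same
    one.\<close>
  define W where "W = dev (b + 1) (nrm (b - 2))"
  have W: "dev (b + int k) (nrm (b - int k - 1)) = W" if "1 \<le> k" "k \<le> J" for k
    using that
  proof (induction k rule: dec_induct)
    case base then show ?case by (simp add: W_def)
  next
    case (step k)
    have o: "phi (b - int (Suc k) - 1) = phi (b + int k + 1)" "phi (b - int (Suc k) - 1 + 1) = phi (b + int k)"
      using band[of "Suc k"] step by (simp_all add: algebra_simps)
    have "dev (b + int k + 1) (nrm (b - int (Suc k) - 1)) = dev (b + int k) (nrm (b - int (Suc k) - 1 + 1))"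
      by (rule dev_opposite_strand[OF o])
    then show ?case using step by (simp add: algebra_simps)
  qed
  define z where "z = (\<lambda>s. fst W \<bullet> cis s)"
  have nW: "W \<bullet> W = 1"
    unfolding W_def using co_phi(4)[of "b - 2"] F1(10) nrm_props(1)[of "b - 2"] by (simp add: dev_inner unit_inner)
  have zp: "0 < z (pos (b + int k))" if k: "1 \<le> k" "k \<le> J" for k
  proof -
    have pf: "phi (b + int k) = phi (b - int k - 1)" "0 < x (b + int k) \<bullet> nrm (b - int k - 1)"
      using band[of k] F1(10) fan1(4) k by (cases "k = 1"; simp add: algebra_simps)+
    have "x (b + int k) \<bullet> nrm (b - int k - 1) = dev (b + int k) (x (b + int k)) \<bullet> W"
      using dev_inner[of "b + int k" "x (b + int k)" "nrm (b - int k - 1)"] co_phi(1)[of "b + int k"] W[OF k] by simp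
    also have "\<dots> = z (pos (b + int k))" unfolding dev_x(1) z_def by (simp add: inner_prod_def inner_commute)
    finally show ?thesis using pf by simp
  qed
  have WJ: "dev (b + int J) (nrm (b - int J - 1)) = W" using W[of J] J by simp
  have per: "nrm (b + int J + 3) = nrm (b - int J - 1)"
    using nrm_per[of "b - int J - 1"] unfolding m by (simp add: algebra_simps)
  have zJ: "0 < z (pos (b + int J + 1))"
  proof -
    have "dev (b + int J) (x (b + int J + 1)) \<bullet> W = x (b + int J + 1) \<bullet> nrm (b - int J - 1)"
      using dev_inner[of "b + int J" "x (b + int J + 1)" "nrm (b - int J - 1)"] co_phi(2)[of "b + int J"] WJ by simp
    moreover have "dev (b + int J) (x (b + int J + 1)) \<bullet> W = z (pos (b + int J + 1))"
      unfolding dev_x(2) z_def by (simp add: inner_prod_def inner_commute)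
    ultimately show ?thesis using fan2(5) per by simp
  qed
  have k1: "snd W < 1"
  proof (rule ccontr)
    assume "\<not> snd W < 1"
    moreover have "fst W \<bullet> fst W + snd W * snd W = 1" using nW by (simp add: inner_prod_def)
    moreover have "1 * 1 \<le> snd W * snd W" using calculation(1) by (intro mult_mono) auto
    moreover have "0 \<le> fst W \<bullet> fst W" by simp
    ultimately have "fst W \<bullet> fst W = 0" by linarith
    then have "fst W = 0" by simp
    then show False using zJ by (simp add: z_def)
  qed
  \<comment> \<open>A vertex with the same height \<open>h\<close> over both circles: its image is
    (\<open>\<rho>\<close> cis F, h), so \<open>\<rho>\<close> z(F) = h (1 - snd W), which is
    positive because \<open>W\<close> is not the pole.\<close>
  have zf: "0 < z F" if V: "fst V = of_real \<rho> * cis F" "0 < \<rho>" "snd V = h" "0 < h" "V \<bullet> W = h" for V \<rho> F h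
  proof -
    have "h = \<rho> * z F + h * snd W"
      using V(5) unfolding inner_prod_def V(1,3) z_def by (simp add: inner_complex_def algebra_simps)
    then have "\<rho> * z F = h * (1 - snd W)" by (simp add: algebra_simps)
    also have "0 < h * (1 - snd W)" using V(4) k1 by simp
    finally show ?thesis by (rule zero_less_mult_pos) (rule V(2))
  qed
  have z1: "0 < z (foot b i)"
  proof -
    obtain \<rho> where r: "0 < \<rho>" "fst (dev b (v i)) = of_real \<rho> * cis (foot b i)" using F1(1) by blast
    have d: "dev (b + 1) (v i) = dev b (v i)" using dev_lft[of b] fan1 by simp
    have c0: "co (phi (b + 1)) (v i) = 0"
      using quadD[OF lr(1)[of "b + 1"]] fan1 by (simp add: co_v)
    have "dev b (v i) \<bullet> W = v i \<bullet> nrm (b - 2)" using dev_inner[OF c0, of "nrm (b - 2)"] d unfolding W_def by simp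
    then show ?thesis using zf[of "dev b (v i)", OF r(2,1)] F1(6-9) by (simp add: dev_def)
  qed
  have z2: "0 < z (foot (b + int J + 2) e)"
  proof -
    obtain \<rho> where r: "0 < \<rho>" "fst (dev (b + int J + 2) (v e)) = of_real \<rho> * cis (foot (b + int J + 2) e)" using F2(1) by blast
    have d: "dev (b + int J + 2) (v e) = dev (b + int J) (v e)"
      using dev_lft[of "b + int J"] dev_lft[of "b + int J + 1"] fan2 unfolding n2 by simp
    have c0: "co (phi (b + int J)) (v e) = 0"
      using quadD[OF lr(1)[of "b + int J + 1"]] fan2 by (simp add: co_v)
    have "dev (b + int J + 2) (v e) \<bullet> W = v e \<bullet> nrm (b - int J - 1)"
      using dev_inner[OF c0, of "nrm (b - int J - 1)"] d WJ by simp
    then show ?thesis using zf[of "dev (b + int J + 2) (v e)", OF r(2,1)] F2(6-9) per by (simp add: dev_def)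
  qed
  obtain R \<theta> where RT: "fst W = of_real R * cis \<theta>" "0 \<le> R"
    using rcis_cmod_Arg[of "fst W"] unfolding rcis_def by (metis norm_ge_zero)
  have zc: "z s = R * cos (s - \<theta>)" for s
    unfolding z_def RT(1) by (simp add: inner_complex_def cos_diff algebra_simps)
  have Rp: "0 < R" using zJ RT(2) unfolding zc by (cases "R = 0") auto
  \<comment> \<open>The foot of \<open>i\<close>, then the crossings from \<open>b + 1\<close> to
    \<open>b + J + 1\<close>, then the foot of \<open>e\<close>. The first and the last gap are
    below pi by \<open>fan\<close>, the others are arc lengths.\<close>
  define y where "y = (\<lambda>k. if k = 0 then foot b i else if k \<le> J + 1 then pos (b + int k) else foot (b + int J + 2) e)"
  have "y (J + 2) - y 0 < pi"
  proof (rule cos_chain)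
    fix k assume "k \<le> J + 2"
    have "0 < z (y k)"
    proof -
      consider "k = 0" | "1 \<le> k" "k \<le> J" | "k = J + 1" | "k = J + 2" using \<open>k \<le> J + 2\<close> by linarith
      then show ?thesis
      proof cases
        case 3
        have "pos (b + int k) = pos (b + int J + 1)" using 3 by (simp add: algebra_simps)
        then show ?thesis using 3 zJ by (simp add: y_def)
      qed (use z1 z2 zp[of k] in \<open>auto simp: y_def\<close>)
    qed
    then show "0 < cos (y k - \<theta>)" unfolding zc using Rp by (simp add: zero_less_mult_iff)
  next
    fix k assume "k < J + 2"
    then consider "k = 0" | "1 \<le> k" "k \<le> J" | "k = J + 1" by linarith
    then show "y k \<le> y (Suc k) \<and> y (Suc k) < y k + pi"
    proof cases
      case 1
      have "pos (b + int (Suc k)) = pos (b + 1)" using 1 by simp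
      then show ?thesis using 1 F1(2,3) by (simp add: y_def)
    next
      case 2
      have "b + int (Suc k) = b + int k + 1" by simp
      then have "pos (b + int (Suc k)) = pos (b + int k) + sigma (b + int k)" using pos_Suc[of "b + int k"] by (simp only:)
      then show ?thesis using 2 sigma_bounds[of "b + int k"] by (simp add: y_def)
    next
      case 3
      have "pos (b + int k) = pos (b + int J + 1)" using 3 by (simp add: algebra_simps)
      then show ?thesis using 3 F2(4,5) by (simp add: y_def)
    qed
  qed
  then show ?thesis by (simp add: y_def)
qed

end


section \<open>Sides of strands running through the same face\<close>

lemma periodic_sum_shift:
  fixes F :: "int \<Rightarrow> 'b::comm_monoid_add"
  assumes "\<And>k. F (k + m) = F k" "0 < m"
  shows "(\<Sum>k\<in>{0..<m}. F (k + 1)) = (\<Sum>k\<in>{0..<m}. F k)"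
proof -
  have "(\<Sum>k\<in>{0..<m}. F (k + 1)) = (\<Sum>k\<in>{1..<m + 1}. F k)"
    by (rule sum.reindex_bij_witness[of _ "\<lambda>k. k - 1" "\<lambda>k. k + 1"]) auto
  also have "{1..<m + 1} = insert m {1..<m}" using assms(2) by auto
  also have "(\<Sum>k\<in>insert m {1..<m}. F k) = F 0 + (\<Sum>k\<in>{1..<m}. F k)" using assms(1)[of 0] by simp
  also have "\<dots> = (\<Sum>k\<in>insert 0 {1..<m}. F k)" by simp
  also have "insert 0 {1..<m} = {0..<m}" using assms(2) by auto
  finally show ?thesis .
qed

lemma card_filter_sum: "finite A \<Longrightarrow> card {k \<in> A. P k} = (\<Sum>k\<in>A. if P k then 1 else 0)"
  by (simp add: sum.If_cases Int_def)

context dgeo begin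

text \<open>An edge is recorded by the two faces meeting in it rather than by its ends: with value
  {f, l}, crossing \<open>k\<close> lies on the edge joining the other two vertices.\<close>

definition Ec :: "int \<Rightarrow> nat set" where "Ec k = {phi (k - 1), phi k}"

lemma phi_mod: "m dvd k - k' \<Longrightarrow> phi k = phi k'"
proof -
  assume "m dvd k - k'"
  then obtain n where n: "k = k' + n * m" by (metis add.commute diff_add_cancel dvd_def mult.commute)
  have "phi (k' + n * m) = phi k'"
  proof (induction n rule: int_induct[where k = 0])
    case (step1 i) then show ?case using phi_per[of "k' + i * m"] by (simp add: algebra_simps)
  next
    case (step2 i) then show ?case using phi_per[of "k' + (i - 1) * m"] by (simp add: algebra_simps)
  qed simp
  then show ?thesis using n by simp
qed

lemma x_in_Ec:
  assumes q: "quad i j f l" and E: "Ec k = {f, l}"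
  shows "x k = co i (x k) *\<^sub>R v i + co j (x k) *\<^sub>R v j" "0 < co i (x k)" "0 < co j (x k)"
proof -
  have "co f (x k) = 0" "co l (x k) = 0" using E x_zero[of k] unfolding Ec_def by (auto simp: doubleton_eq_iff)
  then show "x k = co i (x k) *\<^sub>R v i + co j (x k) *\<^sub>R v j" using expand_quad[OF q, of "x k"] by simp
  have "i \<notin> Ec k" "j \<notin> Ec k" using quadD[OF q] unfolding E by auto
  then show "0 < co i (x k)" "0 < co j (x k)" using quadD[OF q] unfolding Ec_def by (auto intro: x_pos)
qed

lemma height_pos:
  assumes q: "quad i j f l" and E: "Ec k = {f, l}" and "0 < v i \<bullet> n" "0 < v j \<bullet> n"
  shows "0 < x k \<bullet> n"
  using assms(3,4) x_in_Ec(2,3)[OF q E] by (subst x_in_Ec(1)[OF q E]) (simp add: inner_add add_pos_pos)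

lemma height_neg:
  assumes q: "quad i j f l" and E: "Ec k = {f, l}" and "v i \<bullet> n < 0" "v j \<bullet> n < 0"
  shows "x k \<bullet> n < 0"
  using assms(3,4) x_in_Ec(2,3)[OF q E] by (subst x_in_Ec(1)[OF q E]) (simp add: inner_add add_neg_neg mult_pos_neg)

lemma lr_Ec: "quad (lft k) (rgt k) (phi (k - 1)) (phi k)" by (rule lr)

lemma nrm_edge_pt: "Ec r = Ec (k + 1) \<Longrightarrow> x r \<bullet> nrm (k + 1) = x r \<bullet> nrm k"
proof -
  assume "Ec r = Ec (k + 1)"
  then have E: "Ec r = {phi (k + 1 - 1), phi (k + 1)}" by (simp add: Ec_def)
  note X = x_in_Ec(1)[OF lr(1)[of "k + 1"] E]
  have "x r \<bullet> n = co (lft (k+1)) (x r) * (v (lft (k+1)) \<bullet> n) + co (rgt (k+1)) (x r) * (v (rgt (k+1)) \<bullet> n)" for n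
    using arg_cong[OF X, of "\<lambda>w. w \<bullet> n"] by (simp add: inner_add)
  then show ?thesis by (simp add: nrm_edge)
qed

text \<open>Arcs in the same face do not cross, so each of them lies on one side of the other.\<close>

lemma same_side_aux:
  assumes ph: "phi k = phi k'" and nd: "\<not> m dvd k - k'"
  shows "0 < (x k' \<bullet> nrm k) * (x (k' + 1) \<bullet> nrm k)"
proof (rule ccontr)
  assume neg: "\<not> 0 < (x k' \<bullet> nrm k) * (x (k' + 1) \<bullet> nrm k)"
  define A where "A = x k' \<bullet> nrm k"
  define B where "B = x (k' + 1) \<bullet> nrm k"
  have AB: "A * B \<le> 0" using neg by (simp add: A_def B_def)
  \<comment> \<open>If the ends of arc \<open>k'\<close> were not strictly on one side, some point
    of that arc would lie on the great circle of arc \<open>k\<close>. Nonnegative coordinates then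
    place it on arc \<open>k\<close> itself, against disjointness.\<close>
  obtain a' b' where ab': "0 \<le> a'" "0 \<le> b'" "0 < a' + b'" "a' * A + b' * B = 0"
  proof (cases "A = 0")
    case True then show ?thesis using that[of 1 0] by simp
  next
    case False
    have "\<bar>B\<bar> * A + \<bar>A\<bar> * B = 0" using AB False by (auto simp: mult_le_0_iff abs_if)
    then show ?thesis using that[of "\<bar>B\<bar>" "\<bar>A\<bar>"] False by auto
  qed
  define p where "p = a' *\<^sub>R x k' + b' *\<^sub>R x (k' + 1)"
  have pn: "p \<bullet> nrm k = 0" using ab'(4) unfolding p_def A_def B_def by (simp add: inner_add)
  have pc: "co (phi k) p = 0" unfolding p_def ph using co_phi[of k'] by simp
  have p0: "p \<noteq> 0"
  proof
    assume "p = 0"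
    obtain f where f: "f = phi (k' - 1)" by simp
    have "co f (x k') = 0" "0 < co f (x (k' + 1))"
      using x_zero(1)[of k'] x_pos[of f "k' + 1"] phi_less phi_neq[of k'] phi_neq2[of k'] unfolding f by auto
    moreover have "a' * co f (x k') + b' * co f (x (k' + 1)) = 0" using arg_cong[OF \<open>p = 0\<close>, of "co f"] unfolding p_def by simp
    ultimately have b0: "b' = 0" by simp
    then have "a' *\<^sub>R x k' = 0" using \<open>p = 0\<close> by (simp add: p_def)
    then have "a' = 0" using x_unit[of k'] by auto
    then show False using ab'(3) b0 by simp
  qed
  have cop: "0 \<le> co n p" if "n < 4" for n
    unfolding p_def using ab' x_nonneg[OF that] by simp
  have "p = (p \<bullet> x k) *\<^sub>R x k + (p \<bullet> tng k) *\<^sub>R tng k" using frame_expand[OF pc] pn by simp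
  also have "\<dots> = (p \<bullet> x k - (p \<bullet> tng k) * (cos (sigma k) / sin (sigma k))) *\<^sub>R x k + ((p \<bullet> tng k) / sin (sigma k)) *\<^sub>R x (k + 1)"
    by (subst (2) tng_lincomb) (simp add: algebra_simps)
  finally obtain a b where ab: "p = a *\<^sub>R x k + b *\<^sub>R x (k + 1)" by blast
  define f where "f = phi (k - 1)"
  define j where "j = phi (k + 1)"
  have fj: "f < 4" "j < 4" "f \<noteq> j" "f \<noteq> phi k" "j \<noteq> phi k"
    using phi_less phi_neq[of k] phi_neq[of "k + 1"] phi_neq2[of k] unfolding f_def j_def by auto
  have z: "co f (x k) = 0" "0 < co f (x (k + 1))" "0 < co j (x k)" "co j (x (k + 1)) = 0"
    using x_zero(1)[of k] x_zero(2)[of "k + 1"] x_pos[of f "k + 1"] x_pos[of j k] fj unfolding f_def j_def by auto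
  have "0 \<le> b * co f (x (k + 1))" "0 \<le> a * co j (x k)" using cop[OF fj(1)] cop[OF fj(2)] z unfolding ab by simp_all
  then have nn: "0 \<le> a" "0 \<le> b" using z by (simp_all add: zero_le_mult_iff)
  have eq: "a *\<^sub>R x k + b *\<^sub>R x (k + 1) = a' *\<^sub>R x k' + b' *\<^sub>R x (k' + 1)" using ab unfolding p_def by simp
  have unit_eq: "y = y'" if "s *\<^sub>R y = t *\<^sub>R y'" "0 < s" "0 \<le> t" "norm y = 1" "norm y' = 1" for s t and y y' :: 'a
  proof -
    have "norm (s *\<^sub>R y) = norm (t *\<^sub>R y')" by (simp only: that(1))
    then have "s = t" using that(2-5) unfolding norm_scaleR by simp
    then show ?thesis using that by simp
  qed
  show False
  proof (cases "0 < a \<and> 0 < b")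
    case True
    then show False using arcs_disjoint[of a b a' b' k k'] ab' eq nd by blast
  next
    case F1: False
    show False
    proof (cases "0 < a' \<and> 0 < b'")
      case True
      then have "m dvd k' - k" using arcs_disjoint[of a' b' a b k' k] nn eq by metis
      then show False using nd by (metis dvd_minus_iff minus_diff_eq)
    next
      case False
      have "\<not> (a = 0 \<and> b = 0)" using p0 ab by auto
      then have c1: "(0 < a \<and> b = 0) \<or> (a = 0 \<and> 0 < b)" using F1 nn by linarith
      have c2: "a' = 0 \<or> b' = 0" using False ab' by linarith
      consider "0 < a" "b = 0" "b' = 0" | "0 < a" "b = 0" "a' = 0" | "a = 0" "0 < b" "b' = 0" | "a = 0" "0 < b" "a' = 0"
        using c1 c2 by blast
      then show False
      proof cases
        case 1
        have "a *\<^sub>R x k = a' *\<^sub>R x k'" using eq 1 by simp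
        then have "x k = x k'" by (rule unit_eq[OF _ 1(1) ab'(1) x_unit x_unit])
        then show False using x_inj nd by blast
      next
        case 2
        have "a *\<^sub>R x k = b' *\<^sub>R x (k' + 1)" using eq 2 by simp
        then have "x k = x (k' + 1)" by (rule unit_eq[OF _ 2(1) ab'(2) x_unit x_unit])
        then have "m dvd k - (k' + 1)" using x_inj by blast
        then have "phi (k - 1) = phi k'" by (intro phi_mod) (simp add: algebra_simps)
        then show False using ph phi_neq[of k] by simp
      next
        case 3
        have "b *\<^sub>R x (k + 1) = a' *\<^sub>R x k'" using eq 3 by simp
        then have "x (k + 1) = x k'" by (rule unit_eq[OF _ 3(2) ab'(1) x_unit x_unit])
        then have "m dvd k + 1 - k'" using x_inj by blast
        then have "phi (k + 1) = phi k'" by (intro phi_mod) (simp add: algebra_simps)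
        then show False using ph phi_neq[of "k + 1"] by simp
      next
        case 4
        have "b *\<^sub>R x (k + 1) = b' *\<^sub>R x (k' + 1)" using eq 4 by simp
        then have "x (k + 1) = x (k' + 1)" by (rule unit_eq[OF _ 4(2) ab'(2) x_unit x_unit])
        then have "m dvd k + 1 - (k' + 1)" using x_inj by blast
        then show False using nd by simp
      qed
    qed
  qed
qed

lemma same_side: "phi k' = phi k \<Longrightarrow> 0 < x k' \<bullet> nrm k \<longleftrightarrow> 0 < x (k' + 1) \<bullet> nrm k"
proof (cases "m dvd k - k'")
  case True
  obtain n where n: "k = k' + n * m" using True by (metis add.commute diff_add_cancel dvd_def mult.commute)
  have "x (k' + n * m) = x k' \<and> x (k' + n * m + 1) = x (k' + 1)"
  proof (induction n rule: int_induct[where k = 0])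
    case (step1 i) then show ?case using x_per[of "k' + i * m"] x_per[of "k' + i * m + 1"] by (simp add: algebra_simps)
  next
    case (step2 i) then show ?case using x_per[of "k' + (i - 1) * m"] x_per[of "k' + (i - 1) * m + 1"] by (simp add: algebra_simps)
  qed simp
  then show ?thesis using nrm_props(2,4)[of k] n by simp
next
  case False
  assume "phi k' = phi k"
  then show ?thesis using same_side_aux[of k k'] False by (auto simp: zero_less_mult_iff)
qed

text \<open>The other end of the arc that lies in face \<open>l\<close> and ends at crossing
  \<open>r\<close>.\<close>

definition mate :: "nat \<Rightarrow> int \<Rightarrow> int" where "mate l r = (if phi r = l then r + 1 else r - 1)"

lemma mate_side: "l \<in> Ec r \<Longrightarrow> phi k = l \<Longrightarrow> 0 < x r \<bullet> nrm k \<Longrightarrow> 0 < x (mate l r) \<bullet> nrm k"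
  using same_side[of r k] same_side[of "r - 1" k] unfolding mate_def Ec_def by auto

lemma mate_Ec: "l \<in> Ec r \<Longrightarrow> l \<in> Ec (mate l r)"
  unfolding mate_def Ec_def by auto

text \<open>The crossing is the one next to the left end of its edge.\<close>

definition near :: "int \<Rightarrow> bool" where
  "near k \<longleftrightarrow> (\<forall>r. Ec r = Ec k \<longrightarrow> x r \<bullet> nrm k \<le> 0)"

text \<open>The sign of the height tells which of two points of the edge is closer to the left end.
  So each of the two crossings is at least as close as the other, and unit norm makes them
  equal.\<close>

lemma near_eq:
  assumes "lft k = lft k'" "rgt k = rgt k'" "Ec k = Ec k'" "near k" "near k'"
  shows "x k = x k'"
proof -
  define i j where "i = lft k" and "j = rgt k"
  define A B A' B' where "A = co i (x k)" and "B = co j (x k)" and "A' = co i (x k')" and "B' = co j (x k')"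
  have X: "x k = A *\<^sub>R v i + B *\<^sub>R v j" "0 < A" "0 < B" "x k' = A' *\<^sub>R v i + B' *\<^sub>R v j" "0 < A'" "0 < B'"
    using x_edge[of k] x_edge[of k'] assms unfolding A_def B_def A'_def B'_def i_def j_def by auto
  have le: "A' * B \<le> B' * A" if h: "v i \<bullet> n > 0" "v j \<bullet> n < 0" "A * (v i \<bullet> n) + B * (v j \<bullet> n) = 0" "A' * (v i \<bullet> n) + B' * (v j \<bullet> n) \<le> 0" "0 < A"
    for n A B A' B'
  proof -
    have "A * (A' * (v i \<bullet> n) + B' * (v j \<bullet> n)) \<le> 0" using h(4,5) by (simp add: mult_le_0_iff)
    moreover have "A * (A' * (v i \<bullet> n) + B' * (v j \<bullet> n)) = (B' * A - A' * B) * (v j \<bullet> n)" using h(3) by algebra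
    ultimately show ?thesis using h(2) by (simp add: mult_le_0_iff)
  qed
  have "x k' \<bullet> nrm k \<le> 0" "x k \<bullet> nrm k' \<le> 0" using assms unfolding near_def by auto
  then have "A' * B \<le> B' * A" "A * B' \<le> B * A'"
    using le[of "nrm k" A B A' B'] le[of "nrm k'" A' B' A B] height_signs(1,2)[of k] height_signs(1,2)[of k'] nrm_props(2)[of k] nrm_props(2)[of k'] X assms
    unfolding i_def j_def by (simp_all add: inner_add)
  then have par: "A' * B = B' * A" by (simp add: mult.commute)
  have "x k' = (A' / A) *\<^sub>R x k"
  proof -
    have "B' = A' / A * B" using par X by (simp add: field_simps)
    then show ?thesis using X by (simp add: scaleR_add_right)
  qed
  moreover have "norm (x k') = \<bar>A' / A\<bar> * norm (x k)" using calculation by (simp only: norm_scaleR)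
  then have "A' / A = 1" using x_unit[of k] x_unit[of k'] X(2,5) by simp
  ultimately show ?thesis by simp
qed

lemma lr_swap: "phi (k' - 1) = phi k \<Longrightarrow> phi k' = phi (k - 1) \<Longrightarrow> lft k' = rgt k \<and> rgt k' = lft k"
proof (rule lrI)
  assume a: "phi (k' - 1) = phi k" "phi k' = phi (k - 1)"
  show "quad (rgt k) (lft k) (phi (k' - 1)) (phi k')" using lr(1)[of k] unfolding a quad_def by auto
  have "par (rgt k) (lft k) (phi k) (phi (k - 1)) = par (lft k) (rgt k) (phi (k - 1)) (phi k)"
    by (metis minus_minus par_swap(1,3))
  then show "0 < ori * par (rgt k) (lft k) (phi (k' - 1)) (phi k')" using lr(2)[of k] unfolding a by simp
qed

end

section \<open>Crossing counts and the band of two strands\<close>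

text \<open>\<open>opp l\<close> is the face meeting face \<open>l\<close> in the edge that carries
  as many points as the other two edges of \<open>l\<close> together. Such an edge, in the
  application one with p + q points, is called a C edge below.\<close>

locale comb = dgeo +
  fixes opp :: "nat \<Rightarrow> nat"
  assumes opp: "l < 4 \<Longrightarrow> opp l < 4" "l < 4 \<Longrightarrow> opp l \<noteq> l" "l < 4 \<Longrightarrow> opp (opp l) = l"
    and count_sum: "quad a b (opp l) l \<Longrightarrow>
      card {k \<in> {0..<m}. {phi (k - 1), phi k} = {opp l, l}}
      = card {k \<in> {0..<m}. {phi (k - 1), phi k} = {a, l}} + card {k \<in> {0..<m}. {phi (k - 1), phi k} = {b, l}}"
    and count_pos: "f < 4 \<Longrightarrow> l < 4 \<Longrightarrow> f \<noteq> l \<Longrightarrow> 0 < card {k \<in> {0..<m}. {phi (k - 1), phi k} = {f, l}}"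
begin

text \<open>Each crossing of the edge is an end of exactly one arc in face \<open>l\<close>, and by
  \<open>phi_neq2\<close> no arc has both ends on it. So crossings of the edge are counted by arcs
  of the face.\<close>

lemma count_arcs:
  assumes "f \<noteq> l"
  shows "card {k \<in> {0..<m}. {phi (k - 1), phi k} = {f, l}}
    = (\<Sum>k\<in>{0..<m}. if phi k = l \<and> (phi (k - 1) = f \<or> phi (k + 1) = f) then 1 else 0)"
proof -
  have "card {k \<in> {0..<m}. {phi (k - 1), phi k} = {f, l}} = (\<Sum>k\<in>{0..<m}. if {phi (k - 1), phi k} = {f, l} then 1 else 0)"
    by (rule card_filter_sum) simp
  also have "\<dots> = (\<Sum>k\<in>{0..<m}. (if phi k = l \<and> phi (k - 1) = f then 1 else 0) + (if phi (k - 1) = l \<and> phi k = f then 1 else 0))"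
    using assms by (intro sum.cong) (auto simp: doubleton_eq_iff)
  also have "\<dots> = (\<Sum>k\<in>{0..<m}. (if phi k = l \<and> phi (k - 1) = f then 1 else 0)) + (\<Sum>k\<in>{0..<m}. (if phi (k - 1) = l \<and> phi k = f then 1 else 0))"
    by (rule sum.distrib)
  also have "(\<Sum>k\<in>{0..<m}. (if phi (k - 1) = l \<and> phi k = f then 1 else 0)) = (\<Sum>k\<in>{0..<m}. (if phi (k + 1 - 1) = l \<and> phi (k + 1) = f then 1 else 0 :: nat))"
  proof (rule periodic_sum_shift[symmetric, OF _ m_pos])
    fix k have "k + m - 1 = k - 1 + m" by simp
    then show "(if phi (k + m - 1) = l \<and> phi (k + m) = f then 1 else 0) = (if phi (k - 1) = l \<and> phi k = f then 1 else 0 :: nat)"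
      by (simp only: phi_per)
  qed
  also have "(\<Sum>k\<in>{0..<m}. (if phi k = l \<and> phi (k - 1) = f then 1 else 0)) + (\<Sum>k\<in>{0..<m}. (if phi (k + 1 - 1) = l \<and> phi (k + 1) = f then 1 else 0 :: nat))
     = (\<Sum>k\<in>{0..<m}. if phi k = l \<and> (phi (k - 1) = f \<or> phi (k + 1) = f) then 1 else 0)"
    unfolding sum.distrib[symmetric] by (intro sum.cong) (auto simp: phi_neq2 phi_neq2[symmetric])
  finally show ?thesis .
qed

text \<open>The arcs of face \<open>l\<close> have twice as many ends as there are arcs, and by
  \<open>count_sum\<close> half of these ends lie on the C edge. Since an arc has at most one end
  there, every arc has one.\<close>

lemma arc_opp: "phi (k - 1) = opp (phi k) \<or> phi (k + 1) = opp (phi k)"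
proof -
  define k0 where "k0 = k mod m"
  define l where "l = phi k0"
  have lo: "l < 4" "opp l < 4" "opp l \<noteq> l" unfolding l_def using opp phi_less by auto
  obtain a b where "quad (opp l) l a b" using quad_ex lo by blast
  then have q: "quad a b (opp l) l" unfolding quad_def by auto
  note qq = quadD[OF q]
  have S: "(\<Sum>k\<in>{0..<m}. if phi k = l \<and> (phi (k - 1) = opp l \<or> phi (k + 1) = opp l) then 1 else 0 :: nat)
     + ((\<Sum>k\<in>{0..<m}. if phi k = l \<and> (phi (k - 1) = a \<or> phi (k + 1) = a) then 1 else 0)
     + (\<Sum>k\<in>{0..<m}. if phi k = l \<and> (phi (k - 1) = b \<or> phi (k + 1) = b) then 1 else 0))
     = (\<Sum>k\<in>{0..<m}. if phi k = l then 2 else 0)"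
    unfolding sum.distrib[symmetric]
  proof (rule sum.cong[OF refl])
    fix k
    have n: "phi (k - 1) < 4" "phi (k + 1) < 4" "phi (k - 1) \<noteq> phi (k + 1)" "phi (k - 1) \<noteq> phi k"
      by (rule phi_less phi_neq2 phi_neq)+
    have n': "phi (k + 1) \<noteq> phi k" using phi_neq[of "k + 1"] by simp
    show "(if phi k = l \<and> (phi (k - 1) = opp l \<or> phi (k + 1) = opp l) then 1 else 0 :: nat)
      + ((if phi k = l \<and> (phi (k - 1) = a \<or> phi (k + 1) = a) then 1 else 0)
      + (if phi k = l \<and> (phi (k - 1) = b \<or> phi (k + 1) = b) then 1 else 0)) = (if phi k = l then 2 else 0)"
    proof (cases "phi k = l")
      case True
      define \<alpha> \<beta> where "\<alpha> = phi (k - 1)" and "\<beta> = phi (k + 1)"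
      have "\<alpha> = a \<or> \<alpha> = b \<or> \<alpha> = opp l" "\<beta> = a \<or> \<beta> = b \<or> \<beta> = opp l" "\<alpha> \<noteq> \<beta>"
        using quad_cases[OF q n(1)] quad_cases[OF q n(2)] n(3,4) n' True unfolding \<alpha>_def \<beta>_def by metis+
      then show ?thesis using True qq(5,6,8) unfolding \<alpha>_def[symmetric] \<beta>_def[symmetric]
        by (elim disjE) simp_all
    qed simp
  qed
  then have "2 * (\<Sum>k\<in>{0..<m}. if phi k = l \<and> (phi (k - 1) = opp l \<or> phi (k + 1) = opp l) then 1 else 0 :: nat)
      = 2 * (\<Sum>k\<in>{0..<m}. if phi k = l then 1 else 0)"
  proof -
    have "(\<Sum>k\<in>{0..<m}. if phi k = l then 2 else 0 :: nat) = 2 * (\<Sum>k\<in>{0..<m}. if phi k = l then 1 else 0)"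
      unfolding sum_distrib_left by (intro sum.cong) auto
    then show ?thesis
      using S count_sum[OF q] unfolding count_arcs[OF lo(3)] count_arcs[OF qq(7)] count_arcs[OF qq(9)] by linarith
  qed
  then have "card {k \<in> {0..<m}. phi k = l \<and> (phi (k - 1) = opp l \<or> phi (k + 1) = opp l)} = card {k \<in> {0..<m}. phi k = l}"
    unfolding card_filter_sum[OF finite_atLeastLessThan_int] by linarith
  then have "{k \<in> {0..<m}. phi k = l \<and> (phi (k - 1) = opp l \<or> phi (k + 1) = opp l)} = {k \<in> {0..<m}. phi k = l}"
    by (intro card_subset_eq) (auto intro: finite_subset[of _ "{0..<m}"])
  moreover have "k0 \<in> {k \<in> {0..<m}. phi k = l}" using m_pos by (simp add: k0_def l_def)
  ultimately have "phi (k0 - 1) = opp (phi k0) \<or> phi (k0 + 1) = opp (phi k0)" unfolding l_def by blast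
  moreover have "m dvd (k - 1) - (k0 - 1)" "m dvd k - k0" "m dvd (k + 1) - (k0 + 1)" unfolding k0_def by (simp_all add: minus_mod_eq_mult_div)
  ultimately show ?thesis using phi_mod by metis
qed

lemma opp_sym: "a < 4 \<Longrightarrow> b < 4 \<Longrightarrow> a = opp b \<longleftrightarrow> b = opp a"
  using opp by metis

lemma opp_quad: "quad a b f l \<Longrightarrow> f = opp l \<Longrightarrow> b = opp a"
proof -
  assume q: "quad a b f l" and f: "f = opp l"
  note qq = quadD[OF q]
  have "opp a \<noteq> f" "opp a \<noteq> l" using f opp(3)[OF qq(1)] opp(3)[OF qq(4)] qq by metis+
  then show ?thesis using quad_cases[OF q opp(1)[OF qq(1)]] opp(2)[OF qq(1)] by auto
qed

definition isC :: "int \<Rightarrow> bool" where "isC k \<longleftrightarrow> phi (k - 1) = opp (phi k)"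

lemma isC_alt: "isC (k + 1) \<longleftrightarrow> \<not> isC k"
proof -
  have a: "isC (k + 1) \<longleftrightarrow> phi (k + 1) = opp (phi k)"
    unfolding isC_def using opp_sym[OF phi_less phi_less, of k "k + 1"] by simp
  show ?thesis unfolding a unfolding isC_def using arc_opp[of k] phi_neq2[of k] by metis
qed

lemma isC_mate: "l \<in> Ec r \<Longrightarrow> isC (mate l r) \<longleftrightarrow> \<not> isC r"
  using isC_alt[of r] isC_alt[of "r - 1"] unfolding mate_def by auto

lemma isC_Ec: "l \<in> Ec r \<Longrightarrow> isC r \<longleftrightarrow> Ec r = {opp l, l}"
proof -
  assume "l \<in> Ec r"
  then have "l = phi (r - 1) \<or> l = phi r" unfolding Ec_def by blast
  then show ?thesis
  proof
    assume l: "l = phi (r - 1)"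
    show ?thesis unfolding isC_def Ec_def l opp_sym[OF phi_less phi_less, of "r - 1" r]
      by (metis doubleton_eq_iff)
  next
    assume l: "l = phi r"
    show ?thesis unfolding isC_def Ec_def l by (metis doubleton_eq_iff)
  qed
qed

lemma Ec_other: "l \<in> Ec r \<Longrightarrow> \<exists>f. Ec r = {f, l} \<and> f < 4 \<and> f \<noteq> l"
proof (cases "l = phi r")
  case True
  then show ?thesis using phi_less phi_neq[of r] by (intro exI[of _ "phi (r - 1)"]) (simp add: Ec_def)
next
  case False
  assume "l \<in> Ec r"
  then have "l = phi (r - 1)" using False by (simp add: Ec_def)
  then show ?thesis using phi_less phi_neq[of r] by (intro exI[of _ "phi r"]) (simp add: Ec_def insert_commute)
qed

lemma nonC_Ec:
  assumes "l \<in> Ec r" "\<not> isC r" "quad a b (opp l) l" shows "Ec r = {a, l} \<or> Ec r = {b, l}"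
proof -
  obtain f where f: "Ec r = {f, l}" "f < 4" "f \<noteq> l" using Ec_other[OF assms(1)] by blast
  then show ?thesis using quad_cases[OF assms(3) f(2)] assms(2) isC_Ec[OF assms(1)] by auto
qed

lemma m_even: "even m"
proof -
  have "isC (int n) \<longleftrightarrow> (isC 0 \<longleftrightarrow> even n)" for n
  proof (induction n)
    case (Suc n) then show ?case using isC_alt[of "int n"] by (simp add: add.commute)
  qed simp
  from this[of "nat m"] have "isC m \<longleftrightarrow> (isC 0 \<longleftrightarrow> even m)" using m_pos by (simp add: even_nat_iff)
  moreover have "isC m \<longleftrightarrow> isC 0" using phi_mod[of m 0] phi_mod[of "m - 1" "-1"] unfolding isC_def by simp
  ultimately show ?thesis by blast
qed

end


context comb begin

lemma on_edge: "f < 4 \<Longrightarrow> l < 4 \<Longrightarrow> f \<noteq> l \<Longrightarrow> \<exists>r. Ec r = {f, l}"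
  using count_pos[of f l] unfolding Ec_def by (auto simp: card_gt_0_iff)

lemma mate_to_C: "l \<in> Ec r \<Longrightarrow> \<not> isC r \<Longrightarrow> Ec (mate l r) = {opp l, l}"
  using isC_Ec[OF mate_Ec] isC_mate by blast

lemma nonC_of: "Ec r = {a, l} \<Longrightarrow> a \<noteq> opp l \<Longrightarrow> \<not> isC r"
  using isC_Ec[of l r] by (metis doubleton_eq_iff insertI1 insert_commute)

text \<open>If the strand leaving \<open>b\<close> turned away from the left end, a whole edge of
  the face would lie to its left. That edge carries a crossing, and the arc of the face ending there
  has its other end on the C edge, to the left of \<open>x b\<close>, against \<open>near b\<close>.
  The same argument works backwards, and the turns after that are forced by
  \<open>arc_opp\<close>.\<close>

lemma start:
  assumes C: "isC b" and near: "near b"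
  shows "phi (b + 1) = rgt b" "lft (b + 1) = lft b" "rgt (b + 1) = phi (b - 1)" "near (b + 1)"
    "phi (b - 2) = rgt b" "lft (b - 1) = lft b" "rgt (b - 1) = phi b"
    "\<And>r. Ec r = Ec (b - 1) \<Longrightarrow> x r \<bullet> nrm (b - 2) \<le> 0"
    "phi (b + 2) = lft b" "lft (b + 2) = phi b" "rgt (b + 2) = phi (b - 1)"
    "phi (b - 3) = lft b" "lft (b - 2) = phi (b - 1)" "rgt (b - 2) = phi b"
proof -
  have e: "b - 1 + 1 = b" "b - 1 - 1 = b - 2" "b + 1 - 1 = b" "b + 1 + 1 = b + 2" "b - 2 + 1 = b - 1" "b - 2 - 1 = b - 3" by auto
  define i j f l where "i = lft b" and "j = rgt b" and "f = phi (b - 1)" and "l = phi b"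
  have q: "quad i j f l" using lr(1)[of b] unfolding i_def j_def f_def l_def .
  note qq = quadD[OF q]
  have perm: "quad i f j l" "quad i l j f" "quad i j l f" "quad f l i j" using q unfolding quad_def by auto
  have fo: "f = opp l" "l = opp f" using C opp_sym[OF qq(3,4)] unfolding isC_def f_def l_def by auto
  have ji: "j = opp i" "i = opp j" using opp_quad[OF q fo(1)] opp_sym[OF qq(1,2)] by auto
  have Eb: "Ec b = {f, l}" unfolding Ec_def f_def l_def ..
  have nb: "x r \<bullet> nrm b \<le> 0" if "Ec r = {f, l}" for r using near that Eb unfolding near_def by simp
  have nb': "x r \<bullet> nrm (b - 1) \<le> 0" if "Ec r = {f, l}" for r
    using nb[OF that] nrm_edge_pt[of r "b - 1"] that Eb unfolding e by simp
  have hb: "0 < v i \<bullet> nrm b" "v j \<bullet> nrm b < 0" "0 < v i \<bullet> nrm (b - 1)" "v j \<bullet> nrm (b - 1) < 0"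
    using height_signs[of b] height_signs(3,4)[of "b - 1"] unfolding e i_def j_def by auto
  have mC: "Ec (mate l r) = {f, l}" if "l \<in> Ec r" "\<not> isC r" for r
    using mate_to_C[OF that] unfolding fo(1)[symmetric] .
  have mC': "Ec (mate f r) = {f, l}" if "f \<in> Ec r" "\<not> isC r" for r
    using mate_to_C[OF that] unfolding fo(2)[symmetric] by (metis insert_commute)
  have nC: "\<not> isC r" if "Ec r = {j, l} \<or> Ec r = {i, l}" for r
    using nonC_of[of r j l] nonC_of[of r i l] that qq unfolding fo(1)[symmetric] by blast
  have nC': "\<not> isC r" if "Ec r = {j, f} \<or> Ec r = {i, f}" for r
    using nonC_of[of r j f] nonC_of[of r i f] that qq unfolding fo(2)[symmetric] by blast
  have tf: "phi (b + 1) = j"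
  proof (cases rule: turn_cases[of b])
    case left then show ?thesis by (simp add: j_def)
  next
    case right
    obtain r where r: "Ec r = {j, l}" using on_edge qq by metis
    have "0 < v f \<bullet> nrm b" using height_signs(3)[of b] right by (simp add: f_def)
    then have "0 < x r \<bullet> nrm b" using height_pos[OF perm(1) r] hb by simp
    then have "0 < x (mate l r) \<bullet> nrm b" using r by (intro mate_side) (auto simp: l_def)
    then show ?thesis using nb[OF mC[of r]] r nC[of r] by auto
  qed
  then show 1: "phi (b + 1) = rgt b" "lft (b + 1) = lft b" "rgt (b + 1) = phi (b - 1)"
    using turn_left[of b] by (simp_all add: j_def)
  have E1: "Ec (b + 1) = {j, l}" unfolding Ec_def e using tf by (simp add: l_def insert_commute)
  \<comment> \<open>A closer crossing on this edge would be linked by its arc to a crossing of the C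
    edge closer than \<open>b\<close>.\<close>
  show near1: "near (b + 1)" unfolding near_def
  proof (intro allI impI, rule ccontr)
    fix r assume r: "Ec r = Ec (b + 1)" "\<not> x r \<bullet> nrm (b + 1) \<le> 0"
    then have "0 < x r \<bullet> nrm b" using nrm_edge_pt[OF r(1)] by simp
    then have "0 < x (mate l r) \<bullet> nrm b" using r E1 by (intro mate_side) (auto simp: l_def)
    then show False using nb[OF mC[of r]] r E1 nC[of r] by auto
  qed
  have tb: "phi b = rgt (b - 1) \<and> lft b = lft (b - 1) \<and> rgt b = phi (b - 2)"
  proof (cases rule: turn_cases[of "b - 1"])
    case left then show ?thesis unfolding e by simp
  next
    case right
    obtain r where r: "Ec r = {j, f}" using on_edge qq by metis
    have "v l \<bullet> nrm (b - 1) > 0" using height_signs(1)[of "b - 1"] right unfolding e by (simp add: l_def)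
    then have "0 < x r \<bullet> nrm (b - 1)" using height_pos[OF perm(2) r] hb by simp
    then have "0 < x (mate f r) \<bullet> nrm (b - 1)" using r by (intro mate_side) (auto simp: f_def)
    then show ?thesis using nb'[OF mC'[of r]] r nC'[of r] by auto
  qed
  then show 2: "phi (b - 2) = rgt b" "lft (b - 1) = lft b" "rgt (b - 1) = phi b" by auto
  have Em1: "Ec (b - 1) = {j, f}" unfolding Ec_def e using 2 by (simp add: f_def j_def)
  show near2: "x r \<bullet> nrm (b - 2) \<le> 0" if r: "Ec r = Ec (b - 1)" for r
  proof (rule ccontr)
    assume "\<not> x r \<bullet> nrm (b - 2) \<le> 0"
    then have "0 < x r \<bullet> nrm (b - 1)" using nrm_edge_pt[of r "b - 2"] r unfolding e by simp
    then have "0 < x (mate f r) \<bullet> nrm (b - 1)" using r Em1 by (intro mate_side) (auto simp: f_def)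
    then show False using nb'[OF mC'[of r]] r Em1 nC'[of r] by auto
  qed
  have p2: "phi (b + 2) = i"
    using arc_opp[of "b + 1"] qq unfolding e tf ji(2)[symmetric] l_def[symmetric] by auto
  then show 3: "phi (b + 2) = lft b" "lft (b + 2) = phi b" "rgt (b + 2) = phi (b - 1)"
    using turn_right[of "b + 1"] 1 unfolding e by (simp_all add: i_def)
  have m3: "phi (b - 3) = i"
    using arc_opp[of "b - 2"] qq unfolding e 2(1) f_def[symmetric] j_def[symmetric] ji(2)[symmetric] by auto
  then show "phi (b - 3) = lft b" by (simp add: i_def)
  show "lft (b - 2) = phi (b - 1)" "rgt (b - 2) = phi b"
  proof -
    have "phi (b - 1) = lft (b - 2) \<and> rgt (b - 1) = rgt (b - 2)"
    proof (cases rule: turn_cases[of "b - 2"])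
      case left
      have "rgt (b - 1) = i" using left(3) m3 unfolding e by simp
      then show ?thesis using 2 qq by (simp add: i_def l_def)
    qed (simp add: e)
    then show "lft (b - 2) = phi (b - 1)" "rgt (b - 2) = phi b" using 2 by auto
  qed
qed

text \<open>Crossings \<open>b + k\<close> and \<open>b - k\<close> lie on the same edge and are
  passed in opposite directions. Each strand lies to the left of the other, and the last clause says
  that the gap between them on that edge is empty.\<close>

definition band :: "int \<Rightarrow> int \<Rightarrow> bool" where
  "band b k \<longleftrightarrow> phi (b + k - 1) = phi (b - k) \<and> phi (b + k) = phi (b - k - 1) \<and>
     0 < x (b + k) \<bullet> nrm (b - k) \<and> 0 < x (b - k) \<bullet> nrm (b + k) \<and>
     (\<forall>r. Ec r = Ec (b + k) \<longrightarrow> \<not> (0 < x r \<bullet> nrm (b + k) \<and> 0 < x r \<bullet> nrm (b - k)))"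

text \<open>The arcs \<open>b + 1\<close> and \<open>b - 2\<close> lie in the same face, and the
  heights of the edge ends show that each is to the left of the other. An arc from a crossing in the
  gap would end on the edge of \<open>b - 1\<close> or of \<open>b + 1\<close>, closer to the vertex
  than these crossings, against \<open>start\<close>.\<close>

lemma start_conv:
  assumes C: "isC b" and near: "near b"
  shows "0 < x (b + 1) \<bullet> nrm (b - 2)" "0 < x (b - 1) \<bullet> nrm (b + 1)" "band b 2"
proof -
  note st = start[OF C near]
  have e: "b - 1 + 1 = b" "b - 1 - 1 = b - 2" "b + 1 - 1 = b" "b + 1 + 1 = b + 2" "b - 2 + 1 = b - 1" "b - 2 - 1 = b - 3"
    "b - 3 + 1 = b - 2" "b + 2 - 1 = b + 1" by auto
  define i j f l where "i = lft b" and "j = rgt b" and "f = phi (b - 1)" and "l = phi b"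
  note st' = st[folded i_def j_def f_def l_def]
  have q: "quad i j f l" using lr(1)[of b] unfolding i_def j_def f_def l_def .
  note qq = quadD[OF q]
  have perm: "quad i f j l" "quad i l j f" "quad f l i j" using q unfolding quad_def by auto
  have fo: "f = opp l" using C unfolding isC_def f_def l_def by auto
  have ji: "j = opp i" "i = opp j" using opp_quad[OF q fo(1)] opp_sym[OF qq(1,2)] by auto
  have Ec1: "Ec (b + 1) = {j, l}" "Ec (b - 1) = {j, f}" "Ec (b + 2) = {j, i}" "Ec (b - 2) = {i, j}"
    unfolding Ec_def e using st' by (auto simp: f_def l_def)
  have h1: "0 < v i \<bullet> nrm (b + 1)" "v f \<bullet> nrm (b + 1) < 0" "0 < v l \<bullet> nrm (b + 1)"
    using height_signs[of "b + 1"] st' unfolding e by auto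
  have h2: "0 < v i \<bullet> nrm (b - 2)" "v l \<bullet> nrm (b - 2) < 0" "0 < v f \<bullet> nrm (b - 2)"
    using height_signs[of "b - 2"] st' unfolding e by auto
  show c1: "0 < x (b + 1) \<bullet> nrm (b - 2)"
    using height_pos[of i f l j "b + 1"] perm Ec1 h2 by (auto simp: insert_commute quad_def)
  show c2: "0 < x (b - 1) \<bullet> nrm (b + 1)"
    using height_pos[of i l f j "b - 1"] perm Ec1 h1 by (auto simp: insert_commute quad_def)
  have d: "phi (b + 1) = j" "phi (b - 2) = j" using st' by auto
  have x2: "0 < x (b + 2) \<bullet> nrm (b - 2)" using c1 same_side[of "b + 1" "b - 2"] d unfolding e by simp
  have xm2: "0 < x (b - 2) \<bullet> nrm (b + 1)" using c2 same_side[of "b - 2" "b + 1"] d unfolding e by simp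
  have xm2': "0 < x (b - 2) \<bullet> nrm (b + 2)" using xm2 nrm_edge_pt[of "b - 2" "b + 1"] Ec1 unfolding e by (simp add: insert_commute)
  have gap: "\<not> (0 < x r \<bullet> nrm (b + 2) \<and> 0 < x r \<bullet> nrm (b - 2))" if r: "Ec r = Ec (b + 2)" for r
  proof
    assume a: "0 < x r \<bullet> nrm (b + 2) \<and> 0 < x r \<bullet> nrm (b - 2)"
    have rE: "Ec r = {j, i}" "j \<in> Ec r" using r Ec1 by auto
    have "0 < x r \<bullet> nrm (b + 1)" using a nrm_edge_pt[of r "b + 1"] r unfolding e by simp
    then have m1: "0 < x (mate j r) \<bullet> nrm (b + 1)" using rE d by (intro mate_side) auto
    have m2: "0 < x (mate j r) \<bullet> nrm (b - 2)" using a rE d by (intro mate_side) auto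
    have "isC r" using isC_Ec[OF rE(2)] rE(1) unfolding ji(2)[symmetric] by (simp add: insert_commute)
    then have "\<not> isC (mate j r)" using isC_mate[OF rE(2)] by simp
    then have "Ec (mate j r) = {f, j} \<or> Ec (mate j r) = {l, j}"
      using nonC_Ec[OF mate_Ec[OF rE(2)]] perm(3)[unfolded ji(2)] by metis
    then show False
    proof
      assume "Ec (mate j r) = {f, j}"
      then have "Ec (mate j r) = Ec (b - 1)" using Ec1 by auto
      from st(8)[OF this] m2 show False by simp
    next
      assume "Ec (mate j r) = {l, j}"
      then have "Ec (mate j r) = Ec (b + 1)" using Ec1 by auto
      then have "x (mate j r) \<bullet> nrm (b + 1) \<le> 0" using st(4) unfolding near_def by blast
      then show False using m1 by simp
    qed
  qed
  show "band b 2" unfolding band_def e using st' d x2 xm2' gap by auto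
qed

text \<open>A crossing in the gap on the next edge would start an arc that stays between the
  strands. It cannot end on the previous edge, where the gap is empty, and the third edge of the
  face lies entirely to the right of one of the strands.\<close>

lemma band_step:
  assumes B: "band b k" and same: "phi (b + k + 1) = phi (b - k - 2)"
  shows "band b (k + 1)"
proof -
  have e: "b + (k + 1) = b + k + 1" "b - (k + 1) = b - k - 1" "b - k - 1 + 1 = b - k" "b - k - 1 - 1 = b - k - 2" "b + k + 1 - 1 = b + k" by auto
  define s t where "s = b + k" and "t = b - k"
  have B: "phi (s - 1) = phi t" "phi s = phi (t - 1)" "0 < x s \<bullet> nrm t" "0 < x t \<bullet> nrm s"
    "\<And>r. Ec r = Ec s \<Longrightarrow> \<not> (0 < x r \<bullet> nrm s \<and> 0 < x r \<bullet> nrm t)"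
    using B unfolding band_def s_def t_def by auto
  have same: "phi (s + 1) = phi (t - 2)" using same unfolding s_def t_def .
  have et: "t - 1 + 1 = t" "t - 1 - 1 = t - 2" "s + 1 - 1 = s" by auto
  define d where "d = phi s"
  have Est: "Ec s = Ec t" unfolding Ec_def using B by auto
  have E1: "Ec (s + 1) = Ec (t - 1)" unfolding Ec_def et using B same by auto
  have a1: "0 < x s \<bullet> nrm (t - 1)" using B(3) nrm_edge_pt[of s "t - 1"] Est unfolding et by simp
  have a2: "0 < x (s + 1) \<bullet> nrm (t - 1)" using same_side[of s "t - 1"] B(2) a1 by simp
  have b1: "0 < x (t - 1) \<bullet> nrm s" using same_side[of "t - 1" s] B(2,4) unfolding et by simp
  have b2: "0 < x (t - 1) \<bullet> nrm (s + 1)" using b1 nrm_edge_pt[of "t - 1" s] E1 by simp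
  have gap: "\<not> (0 < x r \<bullet> nrm (s + 1) \<and> 0 < x r \<bullet> nrm (t - 1))" if r: "Ec r = Ec (s + 1)" for r
  proof
    assume a: "0 < x r \<bullet> nrm (s + 1) \<and> 0 < x r \<bullet> nrm (t - 1)"
    have "d \<in> Ec (s + 1)" unfolding Ec_def et d_def by simp
    then have dr: "d \<in> Ec r" using r by simp
    have "0 < x r \<bullet> nrm s" using a nrm_edge_pt[OF r] by simp
    then have m1: "0 < x (mate d r) \<bullet> nrm s" using dr by (intro mate_side) (auto simp: d_def)
    have m2: "0 < x (mate d r) \<bullet> nrm (t - 1)" using a dr B(2) by (intro mate_side) (auto simp: d_def)
    have m2': "Ec (mate d r) = Ec s \<Longrightarrow> 0 < x (mate d r) \<bullet> nrm t"
      using m2 nrm_edge_pt[of "mate d r" "t - 1"] Est unfolding et by simp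
    have nE: "Ec (mate d r) \<noteq> Ec s" using m1 m2' B(5) by blast
    have "Ec (mate d r) \<noteq> Ec (s + 1)"
    proof
      assume "Ec (mate d r) = Ec (s + 1)"
      then have "isC (mate d r) \<longleftrightarrow> isC r" using isC_Ec[OF dr] isC_Ec[OF mate_Ec[OF dr]] r by simp
      then show False using isC_mate[OF dr] by simp
    qed
    define p u z where "p = lft s" and "u = rgt s" and "z = phi (s - 1)"
    have q: "quad p u z d" unfolding p_def u_def z_def d_def by (rule lr)
    note qq = quadD[OF q]
    obtain y where y: "Ec (mate d r) = {y, d}" "y < 4" "y \<noteq> d"
      using Ec_other[OF mate_Ec[OF dr]] by blast
    have Es: "Ec s = {z, d}" "Ec (s + 1) = {d, phi (s + 1)}" unfolding Ec_def et z_def d_def by auto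
    have y2: "y \<noteq> z" "y \<noteq> phi (s + 1)" using nE \<open>Ec (mate d r) \<noteq> Ec (s + 1)\<close> unfolding y(1) Es by auto
    have sw: "lft t = u" "rgt t = p" using lr_swap[of t s] B unfolding u_def p_def by auto
    have sw1: "lft (t - 1) = rgt (s + 1)" "rgt (t - 1) = lft (s + 1)" using lr_swap[of "t - 1" "s + 1"] B same unfolding et by auto
    show False
    proof (cases rule: turn_cases[of s])
      case left
      then have "y = p" using quad_cases[OF q y(2)] y y2 by (auto simp: u_def)
      have "v u \<bullet> nrm s < 0" "v z \<bullet> nrm s < 0" using height_signs(2,4)[of s] left by (auto simp: u_def z_def)
      moreover have "quad u z p d" using q unfolding quad_def by auto
      ultimately show False using height_neg[of u z p d "mate d r" "nrm s"] y(1) \<open>y = p\<close> m1 by simp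
    next
      case right
      then have "y = u" using quad_cases[OF q y(2)] y y2 by (auto simp: p_def)
      have "v p \<bullet> nrm (t - 1) < 0" using height_signs(4)[of "t - 1"] sw unfolding et by simp
      moreover have "v z \<bullet> nrm (t - 1) < 0" using height_signs(2)[of "t - 1"] sw1 right by (simp add: z_def)
      moreover have "quad p z u d" using q unfolding quad_def by auto
      ultimately show False using height_neg[of p z u d "mate d r" "nrm (t - 1)"] y(1) \<open>y = u\<close> m2 by simp
    qed
  qed
  show ?thesis unfolding band_def e using B same a2 b2 gap unfolding s_def t_def by (auto simp: algebra_simps)
qed

text \<open>The strands enter a face through a C edge and leave it through the two other edges, so
  the vertex opposite the entry edge separates them. Because the gap is empty, both strands pass
  closest to this vertex, also on the following edge, which they both cross; by
  \<open>near_eq\<close> they cross it at the same point.\<close>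

lemma band_end:
  assumes B: "band b k" and diff: "phi (b + k + 1) \<noteq> phi (b - k - 2)"
  shows "\<exists>e. lft (b + k + 1) = e \<and> lft (b + k + 2) = e \<and> lft (b - k - 1) = e \<and>
     0 < x (b - k - 1) \<bullet> nrm (b + k) \<and> 0 < x (b + k + 1) \<bullet> nrm (b - k - 1) \<and> x (b + k + 2) = x (b - k - 2)"
proof -
  define s t where "s = b + k" and "t = b - k"
  have B: "phi (s - 1) = phi t" "phi s = phi (t - 1)" "0 < x s \<bullet> nrm t" "0 < x t \<bullet> nrm s"
    "\<And>r. Ec r = Ec s \<Longrightarrow> \<not> (0 < x r \<bullet> nrm s \<and> 0 < x r \<bullet> nrm t)"
    using B unfolding band_def s_def t_def by auto
  have diff: "phi (s + 1) \<noteq> phi (t - 2)" using diff unfolding s_def t_def .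
  have et: "t - 1 + 1 = t" "t - 1 - 1 = t - 2" "s + 1 - 1 = s" "t - 2 + 1 = t - 1" "t - 2 - 1 = t - 3" "s + 1 + 1 = s + 2" "s + 2 - 1 = s + 1" by auto
  define d p u z where "d = phi s" and "p = lft s" and "u = rgt s" and "z = phi (s - 1)"
  have q: "quad p u z d" unfolding p_def u_def z_def d_def by (rule lr)
  note qq = quadD[OF q]
  have Est: "Ec s = Ec t" unfolding Ec_def using B by auto
  have a1: "0 < x s \<bullet> nrm (t - 1)" using B(3) nrm_edge_pt[of s "t - 1"] Est unfolding et by simp
  have a2: "0 < x (s + 1) \<bullet> nrm (t - 1)" using same_side[of s "t - 1"] B(2) a1 by simp
  have b1: "0 < x (t - 1) \<bullet> nrm s" using same_side[of "t - 1" s] B(2,4) unfolding et by simp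
  have sw: "lft t = u" "rgt t = p" using lr_swap[of t s] B unfolding u_def p_def by auto
  \<comment> \<open>Otherwise both strands would have to leave the face through its C edge.\<close>
  have zo: "z = opp d"
  proof (rule ccontr)
    assume "z \<noteq> opp d"
    then have "phi (s + 1) = opp d" using arc_opp[of s] unfolding z_def d_def by auto
    moreover have "phi (t - 2) = opp d"
      using arc_opp[of "t - 1"] \<open>z \<noteq> opp d\<close> B unfolding et z_def d_def by auto
    ultimately show False using diff by simp
  qed
  have uo: "u = opp p" "p = opp u" using opp_quad[OF q zo] opp_sym[OF qq(1,2)] by auto
  have t2: "phi (t - 2) = p \<or> phi (t - 2) = u"
    using quad_cases[OF q, of "phi (t - 2)"] phi_less phi_neq[of "t - 1"] phi_neq2[of "t - 1"] B unfolding et z_def d_def by auto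
  have right: "phi (s + 1) = p" "lft (s + 1) = z" "rgt (s + 1) = u"
  proof -
    have "phi (s + 1) = lft s \<and> lft (s + 1) = phi (s - 1) \<and> rgt (s + 1) = rgt s"
    proof (cases rule: turn_cases[of s])
      case left
      have "Ec (t - 1) = {p, d}" using left t2 diff B unfolding Ec_def et u_def d_def by auto
      moreover have "v u \<bullet> nrm s < 0" "v z \<bullet> nrm s < 0" using height_signs(2,4)[of s] left by (auto simp: u_def z_def)
      moreover have "quad u z p d" using q unfolding quad_def by auto
      ultimately show ?thesis using height_neg[of u z p d "t - 1" "nrm s"] b1 by auto
    qed simp
    then show "phi (s + 1) = p" "lft (s + 1) = z" "rgt (s + 1) = u" by (simp_all add: p_def z_def u_def)
  qed
  have t2u: "phi (t - 2) = u" using t2 right diff by auto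
  have tr: "lft (t - 1) = z" "rgt (t - 1) = p"
  proof -
    have "lft (t - 1) = phi t \<and> rgt (t - 1) = rgt t"
    proof (cases rule: turn_cases[of "t - 1"])
      case left
      have "rgt t = u" using left(3) t2u unfolding et by simp
      then show ?thesis using sw qq by simp
    qed (simp add: et)
    then show "lft (t - 1) = z" "rgt (t - 1) = p" using sw B by (simp_all add: z_def)
  qed
  have hs: "0 < v p \<bullet> nrm s" "v u \<bullet> nrm s < 0" "0 < v z \<bullet> nrm s"
    using height_signs[of s] right by (auto simp: p_def u_def)
  have ht: "0 < v u \<bullet> nrm (t - 1)" "v p \<bullet> nrm (t - 1) < 0" "0 < v z \<bullet> nrm (t - 1)"
    using height_signs[of "t - 1"] tr sw unfolding et by auto
  have Es: "Ec s = {z, d}" "Ec (s + 1) = {p, d}" "Ec (t - 1) = {u, d}"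
    unfolding Ec_def et z_def d_def using right t2u B by (auto simp: d_def)
  have near1: "x r \<bullet> nrm s \<le> 0" if r: "Ec r = {p, d}" for r
  proof (rule ccontr)
    assume "\<not> x r \<bullet> nrm s \<le> 0"
    then have a: "0 < x r \<bullet> nrm s" by simp
    have "quad u z p d" using q unfolding quad_def by auto
    then have c: "0 < x r \<bullet> nrm (t - 1)" using height_pos[of u z p d r "nrm (t - 1)"] r ht by simp
    have dr: "d \<in> Ec r" using r by simp
    have "\<not> isC r" using nonC_of[OF r] qq unfolding zo[symmetric] by blast
    then have E: "Ec (mate d r) = Ec s" using mate_to_C[OF dr] unfolding Es zo by simp
    have "0 < x (mate d r) \<bullet> nrm s" using a dr by (intro mate_side) (auto simp: d_def)
    moreover have "0 < x (mate d r) \<bullet> nrm (t - 1)" using c dr B by (intro mate_side) (auto simp: d_def)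
    then have "0 < x (mate d r) \<bullet> nrm t" using nrm_edge_pt[of "mate d r" "t - 1"] E Est unfolding et by simp
    ultimately show False using B(5)[OF E] by blast
  qed
  have near2: "x r \<bullet> nrm (t - 1) \<le> 0" if r: "Ec r = {u, d}" for r
  proof (rule ccontr)
    assume "\<not> x r \<bullet> nrm (t - 1) \<le> 0"
    then have a: "0 < x r \<bullet> nrm (t - 1)" by simp
    have "quad p z u d" using q unfolding quad_def by auto
    then have c: "0 < x r \<bullet> nrm s" using height_pos[of p z u d r "nrm s"] r hs by simp
    have dr: "d \<in> Ec r" using r by simp
    have "\<not> isC r" using nonC_of[OF r] qq unfolding zo[symmetric] by blast
    then have E: "Ec (mate d r) = Ec s" using mate_to_C[OF dr] unfolding Es zo by simp
    have "0 < x (mate d r) \<bullet> nrm s" using c dr by (intro mate_side) (auto simp: d_def)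
    moreover have "0 < x (mate d r) \<bullet> nrm (t - 1)" using a dr B by (intro mate_side) (auto simp: d_def)
    then have "0 < x (mate d r) \<bullet> nrm t" using nrm_edge_pt[of "mate d r" "t - 1"] E Est unfolding et by simp
    ultimately show False using B(5)[OF E] by blast
  qed
  have s2: "phi (s + 2) = u" "lft (s + 2) = z" "rgt (s + 2) = d"
  proof -
    have "phi (s + 2) = u" using arc_opp[of "s + 1"] qq unfolding et right(1) uo(1)[symmetric] d_def[symmetric] by auto
    then show "phi (s + 2) = u" "lft (s + 2) = z" "rgt (s + 2) = d"
      using turn_left[of "s + 1"] right unfolding et by (simp_all add: d_def)
  qed
  have t3: "phi (t - 3) = p" "lft (t - 2) = z" "rgt (t - 2) = d"
  proof -
    show p3: "phi (t - 3) = p" using arc_opp[of "t - 2"] qq unfolding et t2u uo(2)[symmetric] B(2)[symmetric] d_def[symmetric] by auto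
    have "phi (t - 1) = rgt (t - 2) \<and> lft (t - 1) = lft (t - 2)"
    proof (cases rule: turn_cases[of "t - 2"])
      case right
      have "lft (t - 1) = p" using right(2) p3 unfolding et by simp
      then show ?thesis using tr qq by simp
    qed (simp add: et)
    then show "lft (t - 2) = z" "rgt (t - 2) = d" using tr B by (simp_all add: d_def)
  qed
  have E2: "Ec (s + 2) = {p, u}" "Ec (t - 2) = {p, u}" unfolding Ec_def et using right s2 t2u t3 by auto
  \<comment> \<open>A closer crossing would be linked by its arc either to the edge just crossed,
    where nothing is closer, or to an edge lying entirely to the right.\<close>
  have n1: "near (s + 2)" unfolding near_def
  proof (intro allI impI, rule ccontr)
    fix r assume r: "Ec r = Ec (s + 2)" "\<not> x r \<bullet> nrm (s + 2) \<le> 0"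
    have a: "0 < x r \<bullet> nrm (s + 1)" using r nrm_edge_pt[of r "s + 1"] unfolding et by simp
    have pr: "p \<in> Ec r" using r E2 by simp
    have a': "0 < x (mate p r) \<bullet> nrm (s + 1)" using a pr right by (intro mate_side) auto
    have "isC r" using isC_Ec[OF pr] r(1) unfolding E2 uo(1)[symmetric] by (simp add: insert_commute)
    then have "\<not> isC (mate p r)" using isC_mate[OF pr] by simp
    moreover have "quad d z (opp p) p" using q unfolding uo(1)[symmetric] quad_def by auto
    ultimately have "Ec (mate p r) = {d, p} \<or> Ec (mate p r) = {z, p}" using nonC_Ec[OF mate_Ec[OF pr]] by blast
    then show False
    proof
      assume "Ec (mate p r) = {d, p}"
      then have E: "Ec (mate p r) = {p, d}" by auto
      then show False using near1[OF E] a' nrm_edge_pt[of "mate p r" s] Es by simp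
    next
      assume E: "Ec (mate p r) = {z, p}"
      have "v u \<bullet> nrm (s + 1) < 0" "v d \<bullet> nrm (s + 1) < 0"
        using height_signs(2,4)[of "s + 1"] right s2 unfolding et by auto
      moreover have "quad u d z p" using q unfolding quad_def by auto
      ultimately show False using height_neg[of u d z p "mate p r"] E a' by fastforce
    qed
  qed
  have n2: "near (t - 2)" unfolding near_def
  proof (intro allI impI, rule ccontr)
    fix r assume r: "Ec r = Ec (t - 2)" "\<not> x r \<bullet> nrm (t - 2) \<le> 0"
    have ur: "u \<in> Ec r" using r E2 by simp
    have a': "0 < x (mate u r) \<bullet> nrm (t - 2)" using r ur t2u by (intro mate_side) auto
    have "isC r" using isC_Ec[OF ur] r(1) unfolding E2 uo(2)[symmetric] by simp
    then have "\<not> isC (mate u r)" using isC_mate[OF ur] by simp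
    moreover have "quad d z (opp u) u" using q unfolding uo(2)[symmetric] quad_def by auto
    ultimately have "Ec (mate u r) = {d, u} \<or> Ec (mate u r) = {z, u}" using nonC_Ec[OF mate_Ec[OF ur]] by blast
    then show False
    proof
      assume "Ec (mate u r) = {d, u}"
      then have E: "Ec (mate u r) = {u, d}" by auto
      then show False using near2[OF E] a' nrm_edge_pt[of "mate u r" "t - 2"] Es unfolding et by simp
    next
      assume E: "Ec (mate u r) = {z, u}"
      have "v p \<bullet> nrm (t - 2) < 0" "v d \<bullet> nrm (t - 2) < 0"
        using height_signs(2,4)[of "t - 2"] tr t3 unfolding et by auto
      moreover have "quad p d z u" using q unfolding quad_def by auto
      ultimately show False using height_neg[of p d z u "mate u r"] E a' by fastforce
    qed
  qed
  have "x (s + 2) = x (t - 2)" using near_eq[OF _ _ _ n1 n2] s2 t3 E2 by simp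
  then show ?thesis using right s2 tr a2 b1 unfolding s_def t_def by blast
qed

end


section \<open>The geodesic is shorter than a great circle\<close>

context comb begin

lemma band_upto:
  assumes "band b 2" and "\<And>k. 2 \<le> k \<Longrightarrow> k < J \<Longrightarrow> phi (b + int k + 1) = phi (b - int k - 2)"
  shows "2 \<le> k \<Longrightarrow> k \<le> J \<Longrightarrow> band b (int k)"
proof (induction k rule: dec_induct)
  case base then show ?case using assms(1) by simp
next
  case (step k)
  then have "band b (int k + 1)" using assms(2)[of k] by (intro band_step) auto
  then show ?case by (simp add: add.commute)
qed

text \<open>After two full periods both strands of the band would be back at \<open>x b\<close>,
  which has height 0 over its own arc instead of a positive height.\<close>

lemma band_terminates:
  assumes B: "band b 2"
  obtains J where "2 \<le> J" "\<And>k. 2 \<le> k \<Longrightarrow> k \<le> J \<Longrightarrow> band b (int k)" "phi (b + int J + 1) \<noteq> phi (b - int J - 2)"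
proof -
  let ?P = "\<lambda>k. 2 \<le> k \<and> phi (b + int k + 1) \<noteq> phi (b - int k - 2)"
  have "\<exists>k. ?P k"
  proof (rule ccontr)
    assume a: "\<not> (\<exists>k. ?P k)"
    define M where "M = nat (2 * m)"
    have M: "int M = 2 * m" "2 \<le> M" using m_pos by (auto simp: M_def)
    have "band b (int M)" using a M by (intro band_upto[OF B, of M]) auto
    then have "0 < x (b + 2 * m) \<bullet> nrm (b - 2 * m)" unfolding band_def M by blast
    moreover have "x (b + 2 * m) = x b" using x_per[of b] x_per[of "b + m"] by (simp add: algebra_simps)
    moreover have "nrm (b - 2 * m) = nrm b" using nrm_per[of "b - m"] nrm_per[of "b - 2 * m"] by (simp add: algebra_simps)
    ultimately show False using nrm_props(2)[of b] by simp
  qed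
  then obtain k0 where "?P k0" by blast
  define J where "J = (LEAST k. ?P k)"
  have J: "?P J" unfolding J_def by (rule LeastI[of ?P k0]) fact
  have "phi (b + int k + 1) = phi (b - int k - 2)" if "2 \<le> k" "k < J" for k
    using not_less_Least[of k ?P] that unfolding J_def by blast
  then have "band b (int k)" if "2 \<le> k" "k \<le> J" for k
    using that by (intro band_upto[OF B, of J]) auto
  then show ?thesis using that J by blast
qed

text \<open>The strands join behind the second vertex, so \<open>m\<close> divides 2 J + 4, and
  equality is shown. The geodesic is then cut at the feet of \<open>i\<close> and \<open>e\<close>
  into two strands, each of which is shorter than pi by \<open>lens\<close>.\<close>

theorem total_length:
  assumes C: "isC b" and near: "near b"
  shows "pos m < 2 * pi"
proof -
  note st = start[OF C near] and sc = start_conv[OF C near]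
  obtain J where J: "2 \<le> J" "\<And>k. 2 \<le> k \<Longrightarrow> k \<le> J \<Longrightarrow> band b (int k)" "phi (b + int J + 1) \<noteq> phi (b - int J - 2)"
    using band_terminates[OF sc(3)] by blast
  obtain e where e: "lft (b + int J + 1) = e" "lft (b + int J + 2) = e" "lft (b - int J - 1) = e"
     "0 < x (b - int J - 1) \<bullet> nrm (b + int J)" "0 < x (b + int J + 1) \<bullet> nrm (b - int J - 1)" "x (b + int J + 2) = x (b - int J - 2)"
    using band_end[OF J(2)[of J] J(3)] J(1) by auto
  have "m dvd 2 * int J + 4" using x_inj[OF e(6)] by (simp add: algebra_simps)
  then obtain n where n: "2 * int J + 4 = m * n" by blast
  have npos: "0 < n" using n m_pos by (smt (verit) mult_nonneg_nonpos of_nat_0_le_iff)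
  have bandf: "phi (b + int k - 1) = phi (b - int k)" "phi (b + int k) = phi (b - int k - 1)"
     "0 < x (b + int k) \<bullet> nrm (b - int k - 1)" "0 < x (b - int k) \<bullet> nrm (b + int k - 1)"
    if k: "2 \<le> k" "k \<le> J" for k
  proof -
    have B: "band b (int k)" using J(2) k by blast
    then show 1: "phi (b + int k - 1) = phi (b - int k)" "phi (b + int k) = phi (b - int k - 1)"
      unfolding band_def by auto
    have E: "Ec (b + int k) = Ec (b - int k)" unfolding Ec_def using 1 by auto
    show "0 < x (b + int k) \<bullet> nrm (b - int k - 1)"
      using nrm_edge_pt[of "b + int k" "b - int k - 1"] E B unfolding band_def by simp
    show "0 < x (b - int k) \<bullet> nrm (b + int k - 1)"
      using nrm_edge_pt[of "b - int k" "b + int k - 1"] E B unfolding band_def by simp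
  qed
  have m2: "m \<noteq> 2"
  proof
    assume "m = 2"
    then have "phi (b + 2) = phi b" "phi (b + 1) = phi (b - 1)" using phi_per[of b] phi_per[of "b - 1"]
      by (simp_all add: algebra_simps)
    then show False using st(1,9) quadD[OF lr(1)[of b]] by simp
  qed
  obtain h where h: "m = 2 * h" using m_even by blast
  have h2: "2 \<le> h" using h m2 m_pos by auto
  \<comment> \<open>For a larger multiple, with m = 2 h, the crossings \<open>b + h\<close> and
    \<open>b - h\<close> would coincide inside the band, and a point of an arc would have positive
    height over that arc.\<close>
  have n1: "n = 1"
  proof (rule ccontr)
    assume "n \<noteq> 1"
    then have "2 \<le> n" using npos by simp
    then have "h * 2 \<le> h * n" using h2 by simp
    also have "h * n = int J + 2" using n h by simp
    finally have hJ: "h \<le> int J" using J(1) by linarith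
    define k where "k = nat h"
    have k: "int k = h" "2 \<le> k" "k \<le> J" using h2 hJ by (auto simp: k_def)
    have "0 < x (b + h) \<bullet> nrm (b - h)" using J(2)[OF k(2,3)] unfolding band_def k(1) by blast
    moreover have "x (b + h) = x (b - h)" using x_per[of "b - h"] h by (simp add: algebra_simps)
    ultimately show False using nrm_props(2)[of "b - h"] by simp
  qed
  have m: "m = 2 * int J + 4" using n n1 by simp
  have conv: "b + int J + 3 = b - int J - 1 + m" "b + int J + 2 = b - int J - 2 + m" using m by auto
  have lf3: "lft (b + int J + 3) = e" unfolding conv(1) lft_per by (rule e)
  have x3: "x (b + int J + 3) = x (b - int J - 1)" and n3: "nrm (b + int J + 3) = nrm (b - int J - 1)"
    unfolding conv(1) x_per nrm_per by auto
  define i where "i = lft b"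
  have first: "foot (b + int J + 2) e - foot b i < pi"
  proof (rule lens[OF J(1) m])
    show "lft (b - 1) = i" "lft b = i" "lft (b + 1) = i" using st by (auto simp: i_def)
    show "0 < x (b + 1) \<bullet> nrm (b - 2)" "0 < x (b - 1) \<bullet> nrm (b + 1)" by (rule sc)+
    show "lft (b + int J + 1) = e" "lft (b + int J + 2) = e" "lft (b + int J + 3) = e" by (rule e lf3)+
    show "0 < x (b + int J + 3) \<bullet> nrm (b + int J)" unfolding x3 by (rule e)
    show "0 < x (b + int J + 1) \<bullet> nrm (b + int J + 3)" unfolding n3 by (rule e)
  qed (use bandf in auto)
  \<comment> \<open>The remaining strand, starting at the turn around \<open>e\<close>. It runs
    through the same band in the other order: its step \<open>k\<close> is step
    \<open>J + 2 - k\<close> of the first strand.\<close>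
  define b' where "b' = b + int J + 2"
  have b'a: "b' - 1 = b + int J + 1" "b' + 1 = b + int J + 3" "b' - 2 = b + int J" by (auto simp: b'_def)
  have b'b: "b' + int J + 1 = b - 1 + m" "b' + int J + 2 = b + m" "b' + int J + 3 = b + 1 + m" "b' + int J = b - 2 + m"
    using m by (auto simp: b'_def)
  have second: "foot (b' + int J + 2) i - foot b' e < pi"
  proof (rule lens[OF J(1) m])
    show "lft (b' - 1) = e" "lft (b' + 1) = e" unfolding b'a by (rule e lf3)+
    show "lft b' = e" unfolding b'_def by (rule e)
    show "0 < x (b' + 1) \<bullet> nrm (b' - 2)" unfolding b'a x3 by (rule e)
    show "0 < x (b' - 1) \<bullet> nrm (b' + 1)" unfolding b'a n3 by (rule e)
    show "lft (b' + int J + 1) = i" "lft (b' + int J + 2) = i" "lft (b' + int J + 3) = i"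
      unfolding b'b(1-3) lft_per using st by (auto simp: i_def)
    have "x (b' + int J + 3) = x (b + 1)" "x (b' + int J + 1) = x (b - 1)" "nrm (b' + int J + 3) = nrm (b + 1)"
      unfolding b'b(1-3) x_per nrm_per by (rule refl)+
    moreover have "nrm (b' + int J) = nrm (b - 2)" unfolding b'b(4) nrm_per ..
    ultimately show "0 < x (b' + int J + 3) \<bullet> nrm (b' + int J)" "0 < x (b' + int J + 1) \<bullet> nrm (b' + int J + 3)"
      using sc by simp_all
    fix k assume k: "2 \<le> k" "k \<le> J"
    define j where "j = J + 2 - k"
    have j: "2 \<le> j" "j \<le> J" "int j = int J + 2 - int k" using k by (auto simp: j_def)
    have idx: "b' + int k = b - int j + m" "b' - int k - 1 = b + int j - 1" "b' + int k - 1 = b - int j - 1 + m" "b' - int k = b + int j"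
      using j m by (auto simp: b'_def)
    show "phi (b' + int k) = phi (b' - int k - 1) \<and> phi (b' + int k - 1) = phi (b' - int k) \<and> 0 < x (b' + int k) \<bullet> nrm (b' - int k - 1)"
    proof (intro conjI)
      show "phi (b' + int k) = phi (b' - int k - 1)" unfolding idx(1,2) phi_per by (rule bandf(1)[OF j(1,2), symmetric])
      show "phi (b' + int k - 1) = phi (b' - int k)" unfolding idx(3,4) phi_per by (rule bandf(2)[OF j(1,2), symmetric])
      show "0 < x (b' + int k) \<bullet> nrm (b' - int k - 1)" unfolding idx(1,2) x_per by (rule bandf(4)[OF j(1,2)])
    qed
  qed
  have "foot (b' + int J + 2) i = foot b i + pos m" unfolding b'b(2) foot_per ..
  then show ?thesis using first second unfolding b'_def by linarith
qed

end


section \<open>Comparison with the inscribed Euclidean tetrahedron\<close>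

text \<open>Concavity of the sine on [0, pi], together with its value 0 at 0.\<close>

lemma sin_star:
  fixes x y :: real assumes "0 \<le> x" "x \<le> y" "y \<le> pi" "0 < y"
  shows "x / y * sin y \<le> sin x"
proof -
  have "convex_on {0..pi} (\<lambda>x. - sin x)"
  proof (rule f''_ge0_imp_convex)
    show "convex {0..pi}" by simp
    fix x :: real assume x: "x \<in> {0..pi}"
    show "((\<lambda>x. - sin x) has_real_derivative - cos x) (at x)" by (auto intro!: derivative_eq_intros)
    show "((\<lambda>x. - cos x) has_real_derivative sin x) (at x)" by (auto intro!: derivative_eq_intros)
    show "0 \<le> sin x" using x by (auto intro: sin_ge_zero)
  qed
  then have "- sin ((1 - x / y) *\<^sub>R 0 + (x / y) *\<^sub>R y) \<le> (1 - x / y) * (- sin 0) + (x / y) * (- sin y)"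
    using assms by (intro convex_onD) (auto simp: divide_le_eq)
  then show ?thesis using assms by simp
qed

context tetra begin

lemma sin_sum_square: "1 + c = 2 * (cos (side / 2))\<^sup>2" "1 - c = 2 * (sin (side / 2))\<^sup>2"
  using cos_double_cos[of "side / 2"] cos_double_sin[of "side / 2"] cos_side by auto

lemma edge_polar:
  assumes q: "quad i j f l" and x: "norm x = 1" "x = co i x *\<^sub>R v i + co j x *\<^sub>R v j" "0 \<le> co i x" "0 \<le> co j x"
  defines "s \<equiv> sph_dist (v i) x"
  shows "x = cos s *\<^sub>R v i + sin s *\<^sub>R etan i j" "0 \<le> s" "s \<le> side" "s + sph_dist (v j) x = side"
proof -
  note qq = quadD[OF q]
  have nn: "norm (v i) = 1" "norm (v j) = 1" using norm_v qq by auto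
  have ne: "v j \<noteq> - v i"
  proof
    assume "v j = - v i"
    then have "co j (v j) = co j (- v i)" by simp
    then show False using qq by (simp add: co_v)
  qed
  have sd: "sph_dist (v i) (v j) = side" unfolding sph_dist_def side_def using qq by (simp add: gram)
  have "sph_dist (v i) x + sph_dist x (v j) = side"
    using sph_dist_between[OF nn(1) x(1) nn(2) ne x(2-4)] sd by simp
  then show sum: "s + sph_dist (v j) x = side" by (simp add: s_def sph_dist_commute)
  show s0: "0 \<le> s" using sph_dist_bounds[OF nn(1) x(1)] by (simp add: s_def)
  show "s \<le> side" using sum sph_dist_bounds[OF nn(2) x(1)] by linarith
  have cs: "v i \<bullet> x = cos s" using cos_sph_dist[OF nn(1) x(1)] by (simp add: s_def)
  have vx: "v i \<bullet> x = co i x + co j x * c"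
    using arg_cong[OF x(2), of "\<lambda>w. v i \<bullet> w"] qq by (simp add: inner_add gram)
  have d: "x - (v i \<bullet> x) *\<^sub>R v i = (co j x * sin side) *\<^sub>R etan i j"
    using x(2) vx sin_side unfolding etan_def by (simp add: algebra_simps)
  have "norm (x - (v i \<bullet> x) *\<^sub>R v i) = sin s" using perp_norm[OF x(1) nn(1)] by (simp add: s_def inner_commute sph_dist_commute)
  then have "co j x * sin side = sin s"
    unfolding d using etan_props(1)[OF qq(1,2,5)] x(4) sin_side by simp
  then show "x = cos s *\<^sub>R v i + sin s *\<^sub>R etan i j" using d cs by (simp add: algebra_simps)
qed

text \<open>Ratio of the Euclidean edge 2 sin (side / 2) to the spherical edge
  \<open>side\<close>.\<close>

definition stretch :: real where "stretch = sin (side / 2) / (side / 2)"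

lemma stretch_pos: "0 < stretch"
proof -
  have h: "0 < side / 2" "side / 2 < pi" using side_bounds by linarith+
  then have "0 < sin (side / 2)" by (rule sin_gt_zero)
  then show ?thesis unfolding stretch_def using h(1) by (rule divide_pos_pos)
qed

text \<open>Moving from the spherical face to the Euclidean triangle with the same vertices,
  linearly on each edge, does not increase the length of a chord.\<close>

lemma corner_chord:
  assumes n: "norm y = 1" "norm z = 1" and y: "y = cos s *\<^sub>R v i + sin s *\<^sub>R etan i j" and z: "z = cos t *\<^sub>R v i + sin t *\<^sub>R etan i f"
    and q: "quad i j f l" and st: "0 \<le> s" "s \<le> side" "0 \<le> t" "t \<le> side"
  shows "stretch\<^sup>2 * (s\<^sup>2 + t\<^sup>2 - s * t) \<le> (sph_dist y z)\<^sup>2"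
proof -
  note qq = quadD[OF q]
  have yz: "y \<bullet> z = cos s * cos t + sin s * sin t * cos ang"
    unfolding y z using etan_props(2)[OF qq(1,2,5)] etan_props(2)[OF qq(1,3,6)] etan_inner[of i j f] norm_v[OF qq(1)] qq
    by (simp add: inner_add inner_commute[of "etan i j" "v i"] inner_commute[of "etan i f" "v i"] unit_inner)
  have "(dist y z)\<^sup>2 = 2 - 2 * (y \<bullet> z)"
    using n by (simp add: dist_norm power2_norm_eq_inner inner_diff inner_commute[of z y] unit_inner)
  \<comment> \<open>This splitting corresponds to s^2 + t^2 - s t = (s - t)^2 + s t; the summands
    are compared one by one, each time by concavity of the sine.\<close>
  also have "\<dots> = 2 * (1 - cos (s - t)) + 2 * (sin s * sin t) * (1 - cos ang)"
    unfolding yz cos_diff by (simp add: algebra_simps)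
  also have "1 - cos (s - t) = 2 * (sin ((s - t) / 2))\<^sup>2" 
  proof -
    have "2 * ((s - t) / 2) = s - t" by simp
    then have "cos (s - t) = 1 - 2 * (sin ((s - t) / 2))\<^sup>2" using cos_double_sin[of "(s - t) / 2"] by (simp only:)
    then show ?thesis by simp
  qed
  also have "1 - cos ang = 1 / (1 + c)" unfolding cos_ang using c_bounds by (simp add: field_simps)
  finally have d: "(dist y z)\<^sup>2 = 4 * (sin ((s - t) / 2))\<^sup>2 + sin s * sin t * (2 / (1 + c))" by simp
  have half: "0 < side / 2" "side / 2 \<le> pi" using side_bounds by auto
  have 1: "stretch\<^sup>2 * (s - t)\<^sup>2 \<le> 4 * (sin ((s - t) / 2))\<^sup>2"
  proof -
    define u where "u = \<bar>s - t\<bar> / 2"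
    have u: "0 \<le> u" "u \<le> side / 2" using st by (auto simp: u_def)
    have "u / (side / 2) * sin (side / 2) \<le> sin u" using u half by (intro sin_star) auto
    then have "(stretch * u)\<^sup>2 \<le> (sin u)\<^sup>2" 
      using mult_nonneg_nonneg[OF less_imp_le[OF stretch_pos] u(1)] by (intro power_mono) (simp_all add: stretch_def mult.commute)
    moreover have "(sin u)\<^sup>2 = (sin ((s - t) / 2))\<^sup>2"
    proof (cases "s \<le> t")
      case True
      then have "\<bar>s - t\<bar> = - (s - t)" by simp
      then have "u = - ((s - t) / 2)" unfolding u_def by (simp only: minus_divide_left)
      then show ?thesis by (simp only: sin_minus power2_minus)
    qed (simp add: u_def)
    moreover have "4 * u\<^sup>2 = (s - t)\<^sup>2" by (simp add: u_def power_divide)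
    ultimately have "stretch\<^sup>2 * u\<^sup>2 \<le> (sin ((s - t) / 2))\<^sup>2" by (simp only: power_mult_distrib)
    then have "stretch\<^sup>2 * u\<^sup>2 * 4 \<le> (sin ((s - t) / 2))\<^sup>2 * 4" by (rule mult_right_mono) simp
    moreover have "stretch\<^sup>2 * (s - t)\<^sup>2 = stretch\<^sup>2 * u\<^sup>2 * 4" unfolding \<open>4 * u\<^sup>2 = (s - t)\<^sup>2\<close>[symmetric] by simp
    ultimately show ?thesis by linarith
  qed
  have sn: "stretch * cos (side / 2) * r \<le> sin r" if r: "0 \<le> r" "r \<le> side" for r
  proof -
    have "r / side * sin side \<le> sin r" using r side_bounds by (intro sin_star) auto
    moreover have "sin side = 2 * sin (side / 2) * cos (side / 2)" using sin_double[of "side / 2"] by simp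
    moreover have "stretch * cos (side / 2) * r = r / side * (2 * sin (side / 2) * cos (side / 2))"
      unfolding stretch_def by simp
    ultimately show ?thesis by simp
  qed
  have cp: "0 < cos (side / 2)" using side_bounds by (intro cos_gt_zero) auto
  have "(stretch * cos (side / 2) * s) * (stretch * cos (side / 2) * t) \<le> sin s * sin t"
    using sn[of s] sn[of t] st stretch_pos cp side_bounds by (intro mult_mono) (auto intro!: sin_ge_zero)
  then have le: "(stretch * cos (side / 2) * s) * (stretch * cos (side / 2) * t) * (2 / (1 + c)) \<le> sin s * sin t * (2 / (1 + c))"
    using c_bounds by (intro mult_right_mono) auto
  have cc: "(cos (side / 2))\<^sup>2 * (2 / (1 + c)) = 1" unfolding sin_sum_square(1) using cp by simp
  have "(stretch * cos (side / 2) * s) * (stretch * cos (side / 2) * t) * (2 / (1 + c))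
      = stretch\<^sup>2 * (s * t) * ((cos (side / 2))\<^sup>2 * (2 / (1 + c)))"
    by (simp only: power2_eq_square mult_ac)
  then have 2: "stretch\<^sup>2 * (s * t) \<le> sin s * sin t * (2 / (1 + c))" using le unfolding cc by simp
  have "stretch\<^sup>2 * (s\<^sup>2 + t\<^sup>2 - s * t) = stretch\<^sup>2 * (s - t)\<^sup>2 + stretch\<^sup>2 * (s * t)"
    by (simp add: power2_eq_square algebra_simps)
  then have "stretch\<^sup>2 * (s\<^sup>2 + t\<^sup>2 - s * t) \<le> (dist y z)\<^sup>2" using 1 2 d by linarith
  also have "dist y z \<le> sph_dist y z"
    using chord_eq_2_sin[OF n] sph_dist_bounds[OF n] sin_x_le_x[of "sph_dist y z / 2"] by simp
  then have "(dist y z)\<^sup>2 \<le> (sph_dist y z)\<^sup>2" by (intro power_mono) auto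
  finally show ?thesis .
qed

text \<open>In a Euclidean corner of angle pi / 3, s^2 + t^2 - s t is the squared length of the
  segment cutting off legs \<open>s\<close> and \<open>t\<close>. The bracket on the left is its
  inner product with a vector of length sqrt N in the direction of the Euclidean geodesic. So this
  is Cauchy-Schwarz, with defect 3 (s p - t (p + q))^2.\<close>

lemma corner_bound:
  fixes p q :: real
  assumes "stretch\<^sup>2 * (s\<^sup>2 + t\<^sup>2 - s * t) \<le> d\<^sup>2" "0 \<le> d" "0 < p" "0 < q"
  shows "stretch * (s * (p / 2 + q) + t * ((p - q) / 2)) \<le> d * sqrt (p\<^sup>2 + p * q + q\<^sup>2)"
proof -
  define N where "N = p\<^sup>2 + p * q + q\<^sup>2"
  have N: "0 < N" using assms unfolding N_def by (simp add: add_pos_pos)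
  define W where "W = s * (p + 2 * q) + t * (p - q)"
  have W: "s * (p / 2 + q) + t * ((p - q) / 2) = W / 2"
    unfolding W_def by (simp add: add_divide_distrib distrib_left)
  have "4 * ((s\<^sup>2 + t\<^sup>2 - s * t) * N) = W\<^sup>2 + 3 * (s * p - t * (p + q))\<^sup>2"
    unfolding N_def W_def by algebra
  then have "W\<^sup>2 / 4 \<le> (s\<^sup>2 + t\<^sup>2 - s * t) * N"
    using zero_le_power2[of "s * p - t * (p + q)"] by linarith
  then have "stretch\<^sup>2 * (W\<^sup>2 / 4) \<le> stretch\<^sup>2 * ((s\<^sup>2 + t\<^sup>2 - s * t) * N)" by (rule mult_left_mono) simp
  also have "\<dots> \<le> d\<^sup>2 * N" using mult_right_mono[OF assms(1) less_imp_le[OF N]] by (simp only: mult.assoc)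
  also have "\<dots> = (d * sqrt N)\<^sup>2" using N by (simp add: power_mult_distrib)
  also have "stretch\<^sup>2 * (W\<^sup>2 / 4) = (stretch * (W / 2))\<^sup>2" by (simp add: power_mult_distrib power_divide)
  finally have "stretch * (W / 2) \<le> d * sqrt N"
    by (rule power2_le_imp_le) (use assms(2) N in simp)
  then show ?thesis unfolding W N_def .
qed

end

text \<open>\<open>opA l\<close> is the face meeting face \<open>l\<close> in an edge with p points;
  the remaining edge of each face has q points. Crossings of these two kinds of edges are called A
  and B crossings.\<close>

locale comb_pq = comb +
  fixes opA :: "nat \<Rightarrow> nat" and p q :: nat
  assumes opA: "l < 4 \<Longrightarrow> opA l < 4" "l < 4 \<Longrightarrow> opA l \<noteq> l" "l < 4 \<Longrightarrow> opA (opA l) = l" "l < 4 \<Longrightarrow> opA l \<noteq> opp l"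
    and pq: "0 < p" "0 < q"
    and cntA: "l < 4 \<Longrightarrow> card {k \<in> {0..<m}. {phi (k - 1), phi k} = {opA l, l}} = p"
    and cntC: "l < 4 \<Longrightarrow> card {k \<in> {0..<m}. {phi (k - 1), phi k} = {opp l, l}} = p + q"
    and cntB: "f < 4 \<Longrightarrow> l < 4 \<Longrightarrow> f \<noteq> l \<Longrightarrow> f \<noteq> opA l \<Longrightarrow> f \<noteq> opp l \<Longrightarrow> card {k \<in> {0..<m}. {phi (k - 1), phi k} = {f, l}} = q"
begin

lemma opp_opA_quad:
  assumes "l < 4" shows "quad l (opp l) (opA l) (opp (opA l))"
proof (rule quadI)
  show "l < 4" "opp l < 4" "opA l < 4" "opp (opA l) < 4" using assms opp opA by auto
  have "opA l \<noteq> opp l" "opp (opA l) \<noteq> opA l" "opp l \<noteq> l" "opA l \<noteq> l" using assms opp opA by auto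
  moreover have "opp (opA l) \<noteq> l" using opp(3)[OF opA(1)[OF assms]] \<open>opA l \<noteq> opp l\<close> by metis
  moreover have "opp (opA l) \<noteq> opp l" using opp(3)[OF opA(1)[OF assms]] opp(3)[OF assms] \<open>opA l \<noteq> l\<close> by metis
  ultimately show "distinct [l, opp l, opA l, opp (opA l)]" by auto
qed

definition isA :: "int \<Rightarrow> bool" where "isA k \<longleftrightarrow> phi (k - 1) = opA (phi k)"
definition isB :: "int \<Rightarrow> bool" where "isB k \<longleftrightarrow> \<not> isA k \<and> \<not> isC k"

lemma isA_nC: "isA k \<Longrightarrow> \<not> isC k"
  using opA(4)[OF phi_less[of k]] unfolding isA_def isC_def by auto

text \<open>The vertex cut off by arc \<open>k\<close>: the common end of the two edges that the arc
  joins.\<close>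

definition cor :: "int \<Rightarrow> nat" where
  "cor k = (SOME w. quad w (phi (k - 1)) (phi k) (phi (k + 1)))"

lemma cor_quad: "quad (cor k) (phi (k - 1)) (phi k) (phi (k + 1))"
proof -
  obtain a b where "quad (phi (k - 1)) (phi k) a b" using quad_ex phi_neq phi_less by blast
  moreover have "phi (k + 1) = a \<or> phi (k + 1) = b"
    using quad_cases[OF calculation, of "phi (k + 1)"] phi_less phi_neq[of "k + 1"] phi_neq2[of k] by auto
  ultimately have "\<exists>w. quad w (phi (k - 1)) (phi k) (phi (k + 1))" unfolding quad_def by blast
  then show ?thesis unfolding cor_def by (rule someI_ex)
qed

definition dst :: "int \<Rightarrow> nat \<Rightarrow> real" where "dst k i = sph_dist (v i) (x k)"

lemma dst_sum: "quad i j f l \<Longrightarrow> Ec k = {f, l} \<Longrightarrow> dst k i + dst k j = side"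
  using edge_polar(4)[of i j f l "x k"] x_in_Ec[of i j f l k] x_unit unfolding dst_def by auto

lemma arc_bound: "stretch\<^sup>2 * ((dst k (cor k))\<^sup>2 + (dst (k + 1) (cor k))\<^sup>2 - dst k (cor k) * dst (k + 1) (cor k)) \<le> (sigma k)\<^sup>2"
proof -
  have q: "quad (cor k) (phi (k - 1)) (phi k) (phi (k + 1))" by (rule cor_quad)
  then have q1: "quad (cor k) (phi (k + 1)) (phi (k - 1)) (phi k)" and q2: "quad (cor k) (phi (k - 1)) (phi k) (phi (k + 1))" unfolding quad_def by auto
  have E: "Ec k = {phi (k - 1), phi k}" "Ec (k + 1) = {phi k, phi (k + 1)}" unfolding Ec_def by auto
  note X1 = x_in_Ec[OF q1 E(1)] and X2 = x_in_Ec[OF q2 E(2)]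
  note P1 = edge_polar[OF q1 x_unit X1(1) less_imp_le[OF X1(2)] less_imp_le[OF X1(3)]]
  note P2 = edge_polar[OF q2 x_unit X2(1) less_imp_le[OF X2(2)] less_imp_le[OF X2(3)]]
  show ?thesis unfolding dst_def sigma_def
    by (rule corner_chord[OF x_unit x_unit P1(1) P2(1) q1 P1(2,3) P2(2,3)])
qed

end


context comb_pq begin

text \<open>With \<open>ct\<close>, the two coefficients of \<open>corner_bound\<close>, p and q
  being exchanged for B. Each arc joins a C crossing to an A or B crossing; \<open>wt\<close> is the
  coefficient of the latter, and its \<open>ct\<close> is the coefficient passed on to the C
  end.\<close>

definition wt :: "int \<Rightarrow> real" where
  "wt k = (if isA k then p / 2 + q else if isB k then q / 2 + p else 0)"

definition ct :: "int \<Rightarrow> real" where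
  "ct k = (if isA k then (p - real q) / 2 else if isB k then (q - real p) / 2 else 0)"

lemma isC_next: "isC (k + 1) \<longleftrightarrow> \<not> isC k" "isC (k - 1) \<longleftrightarrow> \<not> isC k"
  using isC_alt[of k] isC_alt[of "k - 1"] by auto

lemma wt_C: "isC k \<Longrightarrow> wt k = 0" "isC k \<Longrightarrow> ct k = 0"
  using isA_nC[of k] by (auto simp: wt_def ct_def isB_def)

lemma sigma_bound:
  "stretch * (dst k (cor k) * (wt k + ct (k + 1)) + dst (k + 1) (cor k) * (wt (k + 1) + ct k))
    \<le> sigma k * sqrt (real (p\<^sup>2 + p * q + q\<^sup>2))"
proof -
  have s0: "0 \<le> sigma k" unfolding sigma_def using sph_dist_bounds[OF x_unit x_unit] by blast
  have pq': "0 < real p" "0 < real q" using pq by auto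
  have N: "real (p\<^sup>2 + p * q + q\<^sup>2) = (real p)\<^sup>2 + real p * real q + (real q)\<^sup>2"
    "real (p\<^sup>2 + p * q + q\<^sup>2) = (real q)\<^sup>2 + real q * real p + (real p)\<^sup>2" by simp_all
  note ab = arc_bound[of k]
  have ab': "stretch\<^sup>2 * ((dst (k + 1) (cor k))\<^sup>2 + (dst k (cor k))\<^sup>2 - dst (k + 1) (cor k) * dst k (cor k)) \<le> (sigma k)\<^sup>2"
    using ab by (simp add: mult.commute add.commute)
  show ?thesis
  proof (cases "isC k")
    case True
    then have n: "\<not> isC (k + 1)" using isC_next by simp
    show ?thesis
    proof (cases "isA (k + 1)")
      case A: True
      have "wt (k + 1) = real p / 2 + q" "ct (k + 1) = (real p - q) / 2" using A by (auto simp: wt_def ct_def)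
      then show ?thesis using corner_bound[OF ab' s0 pq'] unfolding N(1) wt_C[OF True]
        by (simp only: add.commute add_0_left add_0_right)
    next
      case B: False
      have "wt (k + 1) = real q / 2 + p" "ct (k + 1) = (real q - p) / 2" using B n by (auto simp: wt_def ct_def isB_def)
      then show ?thesis using corner_bound[OF ab' s0 pq'(2,1)] unfolding N(2) wt_C[OF True]
        by (simp only: add.commute add_0_left add_0_right)
    qed
  next
    case False
    then have n: "isC (k + 1)" using isC_next by simp
    show ?thesis
    proof (cases "isA k")
      case A: True
      have "wt k = real p / 2 + q" "ct k = (real p - q) / 2" using A by (auto simp: wt_def ct_def)
      then show ?thesis using corner_bound[OF ab s0 pq'] unfolding N(1) wt_C[OF n]
        by (simp only: add_0_left add_0_right)
    next
      case B: False
      have "wt k = real q / 2 + p" "ct k = (real q - p) / 2" using B False by (auto simp: wt_def ct_def isB_def)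
      then show ?thesis using corner_bound[OF ab s0 pq'(2,1)] unfolding N(2) wt_C[OF n]
        by (simp only: add_0_left add_0_right)
    qed
  qed
qed

lemma cor_quad_minus: "quad (cor (k - 1)) (phi (k - 2)) (phi (k - 1)) (phi k)"
  using cor_quad[of "k - 1"] by simp

lemma opA_opp:
  assumes f: "f < 4"
  shows "opA (opp f) = opp (opA f)"
proof -
  define l where "l = opp f"
  have l: "l < 4" using opp(1)[OF f] by (simp add: l_def)
  have "opA l \<noteq> f"
  proof
    assume "opA l = f"
    then have "opA f = opp f" using opA(3)[OF l] unfolding l_def by (simp only:)
    then show False using opA(4)[OF f] by simp
  qed
  moreover have "opA l \<noteq> opA f"
  proof
    assume "opA l = opA f"
    then have "opA (opA l) = opA (opA f)" by (rule arg_cong)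
    then have "l = f" unfolding opA(3)[OF l] opA(3)[OF f] .
    then show False using opp(2)[OF f] unfolding l_def by blast
  qed
  moreover have "opA l \<noteq> opp f" using opA(2)[OF l] unfolding l_def .
  ultimately show ?thesis
    using quad_cases[OF opp_opA_quad[OF f] opA(1)[OF l]] unfolding l_def by blast
qed

text \<open>At an A or B crossing the two arcs cut off different ends of the edge, whose distances
  add up to \<open>side\<close>. At a C crossing they do so exactly when both neighbouring crossings
  are of the same kind; otherwise they cut off the same end and the two coefficients cancel. In
  either case the position of the crossing drops out.\<close>

lemma crossing_sum:
  "dst k (cor k) * (wt k + ct (k + 1)) + dst k (cor (k - 1)) * (wt k + ct (k - 1))
   = side * (wt k + (ct (k + 1) + ct (k - 1)) / 2)"
proof (cases "isC k")
  case False
  have C: "isC (k + 1)" "isC (k - 1)" using False isC_next by auto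
  have e: "phi k = opp (phi (k + 1))" "phi (k - 2) = opp (phi (k - 1))" using C unfolding isC_def by simp_all
  have e1: "phi (k + 1) = opp (phi k)" using opp(3)[OF phi_less[of "k + 1"]] e(1) by metis
  have ne: "phi (k + 1) \<noteq> phi (k - 2)"
  proof
    assume "phi (k + 1) = phi (k - 2)"
    then have "opp (phi k) = opp (phi (k - 1))" using e1 e(2) by simp
    then have "phi k = phi (k - 1)" using opp(3)[OF phi_less] by metis
    then show False using phi_neq[of k] by simp
  qed
  note q1 = cor_quad[of k] and q2 = cor_quad_minus[of k]
  have "phi (k - 2) = cor k" using quad_cases[OF q1, of "phi (k - 2)"] phi_less ne quadD[OF q2] by auto
  then have "quad (cor k) (cor (k - 1)) (phi (k - 1)) (phi k)"
    using q2 unfolding quad_def by auto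
  then have "dst k (cor k) + dst k (cor (k - 1)) = side" by (rule dst_sum) (simp add: Ec_def)
  moreover have "ct (k + 1) = 0" "ct (k - 1) = 0" using C wt_C by auto
  ultimately show ?thesis by (simp add: distrib_right[symmetric])
next
  case True
  have nC: "\<not> isC (k + 1)" "\<not> isC (k - 1)" using True isC_next by auto
  define f where "f = phi k"
  define l where "l = phi (k - 1)"
  have fl: "l = opp f" "f < 4" "l < 4" using True phi_less opp(1) unfolding isC_def f_def l_def by auto
  have ol: "opA l = opp (opA f)" unfolding fl(1) by (rule opA_opp[OF fl(2)])
  have q: "quad (opA f) (opA l) f l" using opp_opA_quad[OF fl(2)] ol fl(1) unfolding quad_def by auto
  note q1 = cor_quad[of k, folded f_def l_def] and q2 = cor_quad_minus[of k, folded f_def l_def]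
  have sum: "dst k (opA f) + dst k (opA l) = side" by (rule dst_sum[OF q]) (auto simp: Ec_def f_def l_def)
  have A1: "isA (k + 1) \<longleftrightarrow> phi (k + 1) = opA f" unfolding isA_def
    using opA(3)[OF phi_less[of "k + 1"]] opA(3)[OF fl(2)] by (auto simp: f_def)
  have A2: "isA (k - 1) \<longleftrightarrow> phi (k - 2) = opA l" unfolding isA_def by (simp add: l_def)
  have c1: "cor k = (if isA (k + 1) then opA l else opA f)"
    using quad_cases[OF q, of "cor k"] quad_cases[OF q, of "phi (k + 1)"] quadD[OF q1] quadD[OF q] A1 by auto
  have c2: "cor (k - 1) = (if isA (k - 1) then opA f else opA l)"
    using quad_cases[OF q, of "cor (k - 1)"] quad_cases[OF q, of "phi (k - 2)"] quadD[OF q2] quadD[OF q] A2 by auto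
  define h where "h = (real p - q) / 2"
  have ct1: "ct (k + 1) = (if isA (k + 1) then h else - h)" and ct2: "ct (k - 1) = (if isA (k - 1) then h else - h)"
    using nC by (auto simp: ct_def isB_def h_def field_simps)
  have "dst k (cor k) * ct (k + 1) + dst k (cor (k - 1)) * ct (k - 1)
    = (dst k (opA f) + dst k (opA l)) * ((ct (k + 1) + ct (k - 1)) / 2)"
    unfolding c1 c2 ct1 ct2 by (simp add: algebra_simps)
  then show ?thesis unfolding sum using wt_C(1)[OF True] by simp
qed

lemma isA_iff: "isA k \<longleftrightarrow> Ec k = {opA 0, 0} \<or> Ec k = {opA (opp 0), opp 0}"
  and isB_iff: "isB k \<longleftrightarrow> Ec k = {opA (opp 0), 0} \<or> Ec k = {opA 0, opp 0}"
  and opA_opp_quad: "quad 0 (opp 0) (opA 0) (opA (opp 0))"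
proof -
  have z: "0 < (4::nat)" by simp
  note q0 = opp_opA_quad[OF z]
  note o = opp(1)[OF z] opp(2)[OF z] opp(3)[OF z] opA(1)[OF z] opA(2)[OF z] opA(3)[OF z] opA(4)[OF z]
  note o' = opA(1)[OF o(1)] opA(2)[OF o(1)] opA(3)[OF o(1)] opA(4)[OF o(1)]
  have d: "opA (opp 0) = opp (opA 0)" by (rule opA_opp[OF z])
  show q: "quad 0 (opp 0) (opA 0) (opA (opp 0))" using q0 unfolding d .
  define b where "b = opp 0"
  define u where "u = opA 0"
  define w where "w = opA (opp 0)"
  have A: "opA 0 = u" "opA b = w" "opA u = 0" "opA w = b"
    using o(6) o'(3) by (auto simp: b_def u_def w_def)
  have P: "opp 0 = b" "opp b = 0" "opp u = w" "opp w = u"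
    using o(3) opp(3)[OF o(4)] d by (auto simp: b_def u_def w_def)
  have Q: "quad 0 b u w" using q by (simp add: b_def u_def w_def)
  note D = quadD(5-10)[OF Q]
  have c1: "phi k = 0 \<or> phi k = b \<or> phi k = u \<or> phi k = w" and c2: "phi (k - 1) = 0 \<or> phi (k - 1) = b \<or> phi (k - 1) = u \<or> phi (k - 1) = w"
    using quad_cases[OF Q] phi_less by auto
  have ne: "phi (k - 1) \<noteq> phi k" using phi_neq[of k] by simp
  show "isA k \<longleftrightarrow> Ec k = {opA 0, 0} \<or> Ec k = {opA (opp 0), opp 0}"
    unfolding isA_def Ec_def P(1) A doubleton_eq_iff using c1 c2 ne D
    by (elim disjE) (simp_all only: A, auto)
  show "isB k \<longleftrightarrow> Ec k = {opA (opp 0), 0} \<or> Ec k = {opA 0, opp 0}"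
    unfolding isB_def isA_def isC_def Ec_def P(1) A doubleton_eq_iff using c1 c2 ne D
    by (elim disjE) (simp_all only: A P, auto)
qed

lemma isABC_per: "isA (k + m) = isA k" "isB (k + m) = isB k"
proof -
  have "phi (k + m - 1) = phi (k - 1)" using phi_per[of "k - 1"] by (simp add: algebra_simps)
  then show "isA (k + m) = isA k" "isB (k + m) = isB k"
    unfolding isB_def isA_def isC_def phi_per by simp_all
qed

lemma wt_per: "wt (k + m) = wt k" "ct (k + m) = ct k"
  unfolding wt_def ct_def isABC_per by (rule refl)+

text \<open>Per period there are 2 p crossings of weight p + q / 2 and 2 q crossings of weight q + p
  / 2.\<close>

lemma sum_wt_ct: "(\<Sum>k\<in>{0..<m}. wt k + ct k) = 2 * real (p\<^sup>2 + p * q + q\<^sup>2)"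
proof -
  let ?n = "\<lambda>f l. card {k \<in> {0..<m}. Ec k = {f, l}}"
  let ?i = "\<lambda>f l k. if Ec k = {f, l} then 1 else 0 :: real"
  note Q = quadD[OF opA_opp_quad]
  have cnt: "(\<Sum>k\<in>{0..<m}. ?i f l k) = real (?n f l)" for f l
    by (simp add: sum.If_cases Int_def)
  have n: "?n (opA 0) 0 = p" "?n (opA (opp 0)) (opp 0) = p"
    using cntA[OF Q(1)] cntA[OF Q(2)] unfolding Ec_def by auto
  have opp_opp: "opp (opp 0) = 0" using opp(3)[OF Q(1)] .
  have n1: "?n (opA (opp 0)) 0 = q"
    unfolding Ec_def by (rule cntB[OF Q(4) Q(1)]) (use Q(5-10) in simp_all)
  have n2: "?n (opA 0) (opp 0) = q"
    unfolding Ec_def by (rule cntB[OF Q(3) Q(2)]) (use Q(5-10) opp_opp in simp_all)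
  have "(\<Sum>k\<in>{0..<m}. wt k + ct k)
    = (\<Sum>k\<in>{0..<m}. (p + real q / 2) * (?i (opA 0) 0 k + ?i (opA (opp 0)) (opp 0) k)
        + (q + real p / 2) * (?i (opA (opp 0)) 0 k + ?i (opA 0) (opp 0) k))"
  proof (rule sum.cong[OF refl])
    fix k
    have d: "\<not> (Ec k = {opA 0, 0} \<and> Ec k = {opA (opp 0), opp 0})" "\<not> (Ec k = {opA (opp 0), 0} \<and> Ec k = {opA 0, opp 0})"
      "\<not> (isA k \<and> isB k)"
      using Q by (auto simp: doubleton_eq_iff isB_def)
    have "wt k + ct k = (if isA k then p + real q / 2 else 0) + (if isB k then q + real p / 2 else 0)"
      using d(3) by (auto simp: wt_def ct_def field_simps)
    moreover have "(if isA k then p + real q / 2 else 0) = (p + real q / 2) * (?i (opA 0) 0 k + ?i (opA (opp 0)) (opp 0) k)"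
      using d(1) unfolding isA_iff by auto
    moreover have "(if isB k then q + real p / 2 else 0) = (q + real p / 2) * (?i (opA (opp 0)) 0 k + ?i (opA 0) (opp 0) k)"
      using d(2) unfolding isB_iff by auto
    ultimately show "wt k + ct k = (p + real q / 2) * (?i (opA 0) 0 k + ?i (opA (opp 0)) (opp 0) k)
        + (q + real p / 2) * (?i (opA (opp 0)) 0 k + ?i (opA 0) (opp 0) k)" by simp
  qed
  also have "\<dots> = (p + real q / 2) * (real p + real p) + (q + real p / 2) * (real q + real q)"
    unfolding sum.distrib sum_distrib_left[symmetric] cnt n n1 n2 ..
  also have "\<dots> = 2 * real (p\<^sup>2 + p * q + q\<^sup>2)" by (simp add: power2_eq_square algebra_simps)
  finally show ?thesis .
qed

text \<open>Summing \<open>sigma_bound\<close> over a period and regrouping its left side by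
  crossings bounds the product of \<open>stretch\<close>, \<open>side\<close> and 2 N by L sqrt N,
  and \<open>stretch\<close> times \<open>side\<close> is 2 sin (side / 2).\<close>

lemma length_lower: "4 * sin (side / 2) * sqrt (real (p\<^sup>2 + p * q + q\<^sup>2)) \<le> pos m"
proof -
  define N where "N = real (p\<^sup>2 + p * q + q\<^sup>2)"
  have N: "0 < N" using pq unfolding N_def by (simp add: add_pos_pos)
  define L where "L k = dst k (cor k) * (wt k + ct (k + 1))" for k
  define R where "R k = dst k (cor (k - 1)) * (wt k + ct (k - 1))" for k
  have ct_per: "ct (k + m - 1) = ct (k - 1)" for k using wt_per(2)[of "k - 1"] by (simp add: algebra_simps)
  have cor_per: "cor (k + m - 1) = cor (k - 1)" for k
  proof -
    have "phi (k + m - 2) = phi (k - 2)" "phi (k + m - 1) = phi (k - 1)"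
      using phi_per[of "k - 1"] phi_per[of "k - 2"] by (simp_all add: algebra_simps)
    then show ?thesis unfolding cor_def by (simp add: phi_per)
  qed
  have R_per: "R (k + m) = R k" for k unfolding R_def dst_def wt_per ct_per cor_per x_per ..
  have Rs: "R (k + 1) = dst (k + 1) (cor k) * (wt (k + 1) + ct k)" for k unfolding R_def by simp
  have "(\<Sum>k\<in>{0..<m}. L k + R (k + 1)) = (\<Sum>k\<in>{0..<m}. L k) + (\<Sum>k\<in>{0..<m}. R k)"
    unfolding sum.distrib periodic_sum_shift[of R, OF R_per m_pos] ..
  also have "\<dots> = (\<Sum>k\<in>{0..<m}. side * (wt k + (ct (k + 1) + ct (k - 1)) / 2))"
    unfolding sum.distrib[symmetric] L_def R_def crossing_sum ..
  also have "\<dots> = side * ((\<Sum>k\<in>{0..<m}. wt k) + ((\<Sum>k\<in>{0..<m}. ct (k + 1)) + (\<Sum>k\<in>{0..<m}. ct (k - 1))) / 2)"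
    by (simp only: sum_distrib_left[symmetric] sum.distrib sum_divide_distrib[symmetric])
  also have "(\<Sum>k\<in>{0..<m}. ct (k + 1)) = (\<Sum>k\<in>{0..<m}. ct k)" by (rule periodic_sum_shift[of ct, OF wt_per(2) m_pos])
  also have "(\<Sum>k\<in>{0..<m}. ct (k - 1)) = (\<Sum>k\<in>{0..<m}. ct k)"
    using periodic_sum_shift[of "\<lambda>k. ct (k - 1)", OF ct_per m_pos] by simp
  also have "(\<Sum>k\<in>{0..<m}. wt k) + ((\<Sum>k\<in>{0..<m}. ct k) + (\<Sum>k\<in>{0..<m}. ct k)) / 2 = 2 * N"
    using sum_wt_ct unfolding sum.distrib N_def by simp
  finally have LR: "(\<Sum>k\<in>{0..<m}. L k + R (k + 1)) = side * (2 * N)" .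
  have "stretch * (\<Sum>k\<in>{0..<m}. L k + R (k + 1)) \<le> (\<Sum>k\<in>{0..<m}. sigma k * sqrt N)"
    unfolding sum_distrib_left using sigma_bound unfolding Rs L_def N_def by (intro sum_mono) simp
  also have "\<dots> = pos m * sqrt N" unfolding pos_def using m_pos by (simp add: sum_distrib_right)
  finally have "stretch * (side * (2 * N)) \<le> pos m * sqrt N" unfolding LR .
  moreover have "stretch * (side * (2 * N)) = 4 * sin (side / 2) * sqrt N * sqrt N"
    unfolding stretch_def using side_bounds N by simp
  ultimately have "4 * sin (side / 2) * sqrt N * sqrt N \<le> pos m * sqrt N" by simp
  then show ?thesis using N unfolding N_def[symmetric] by (simp only: mult_le_cancel_right real_sqrt_gt_0_iff)
qed

theorem type_bound:
  assumes "isC b" "near b"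
  shows "2 * (1 - c) * real (p\<^sup>2 + p * q + q\<^sup>2) < pi\<^sup>2"
proof -
  define N where "N = real (p\<^sup>2 + p * q + q\<^sup>2)"
  have N: "0 \<le> N" unfolding N_def by simp
  have "0 < side / 2" "side / 2 < pi" using side_bounds by linarith+
  then have s: "0 < sin (side / 2)" by (rule sin_gt_zero)
  have "4 * sin (side / 2) * sqrt N < 2 * pi" using length_lower total_length[OF assms] unfolding N_def by linarith
  then have "(4 * sin (side / 2) * sqrt N)\<^sup>2 < (2 * pi)\<^sup>2" using s N by (intro power_strict_mono) auto
  moreover have "(4 * sin (side / 2) * sqrt N)\<^sup>2 = 4 * (2 * (1 - c) * N)"
    unfolding sin_sum_square(2) power_mult_distrib using N by simp
  moreover have "(2 * pi)\<^sup>2 = 4 * pi\<^sup>2" by (simp add: power_mult_distrib)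
  ultimately have "4 * (2 * (1 - c) * N) < 4 * pi\<^sup>2" by (simp only:)
  then have "2 * (1 - c) * N < pi\<^sup>2" by linarith
  then show ?thesis unfolding N_def .
qed

end


section \<open>From the polyhedral definition to four vertices\<close>

lemma convex_cone_hull_3:
  "convex_cone hull {a, b, c :: 'a::real_vector} = {r *\<^sub>R a + s *\<^sub>R b + t *\<^sub>R c | r s t. 0 \<le> r \<and> 0 \<le> s \<and> 0 \<le> t}" (is "_ = ?S")
proof
  show "convex_cone hull {a, b, c} \<subseteq> ?S"
  proof (rule hull_minimal)
    have mem: "r *\<^sub>R a + s *\<^sub>R b + t *\<^sub>R c \<in> ?S" if "0 \<le> r" "0 \<le> s" "0 \<le> t" for r s t using that by blast
    show "{a, b, c} \<subseteq> ?S" using mem[of 1 0 0] mem[of 0 1 0] mem[of 0 0 1] by simp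
    show "convex_cone ?S" unfolding convex_cone_iff
    proof (intro conjI ballI impI allI)
      show "0 \<in> ?S" using mem[of 0 0 0] by simp
    next
      fix x y assume "x \<in> ?S" "y \<in> ?S"
      then obtain r s t r' s' t' where "0 \<le> r" "0 \<le> s" "0 \<le> t" "0 \<le> r'" "0 \<le> s'" "0 \<le> t'"
        "x = r *\<^sub>R a + s *\<^sub>R b + t *\<^sub>R c" "y = r' *\<^sub>R a + s' *\<^sub>R b + t' *\<^sub>R c" by blast
      then show "x + y \<in> ?S" using mem[of "r + r'" "s + s'" "t + t'"] by (simp add: algebra_simps)
    next
      fix x k assume "x \<in> ?S" "0 \<le> (k::real)"
      then obtain r s t where "0 \<le> r" "0 \<le> s" "0 \<le> t" "x = r *\<^sub>R a + s *\<^sub>R b + t *\<^sub>R c" by blast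
      then show "k *\<^sub>R x \<in> ?S" using mem[of "k * r" "k * s" "k * t"] \<open>0 \<le> k\<close> by (simp add: algebra_simps)
    qed
  qed
  show "?S \<subseteq> convex_cone hull {a, b, c}"
  proof
    fix x assume "x \<in> ?S"
    then obtain r s t where "0 \<le> r" "0 \<le> s" "0 \<le> t" "x = r *\<^sub>R a + s *\<^sub>R b + t *\<^sub>R c" by blast
    moreover have "a \<in> convex_cone hull {a, b, c}" "b \<in> convex_cone hull {a, b, c}" "c \<in> convex_cone hull {a, b, c}"
      by (simp_all add: hull_inc)
    ultimately show "x \<in> convex_cone hull {a, b, c}"
      by (simp only:) (intro convex_cone_hull_add convex_cone_hull_mul)
  qed
qed

text \<open>If \<open>y\<close> is on the facet, the cone also contains 0 and 2 y; the supporting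
  inequality at these two points forces its constant to be 0.\<close>

lemma conic_facet_normal:
  fixes K :: "'a::euclidean_space set"
  assumes "polyhedron K" "conic K" "C facet_of K"
  shows "\<exists>n. n \<noteq> 0 \<and> K \<subseteq> {x. n \<bullet> x \<le> 0} \<and> C = K \<inter> {x. n \<bullet> x = 0}"
proof -
  obtain n b where n: "n \<noteq> 0" "K \<subseteq> {x. n \<bullet> x \<le> b}" "C = K \<inter> {x. n \<bullet> x = b}"
    using facet_of_polyhedron[OF assms(1,3)] by blast
  obtain y where y: "y \<in> C" using assms(3) unfolding facet_of_def by blast
  then have yK: "y \<in> K" using n(3) by blast
  have "2 *\<^sub>R y \<in> K" "0 *\<^sub>R y \<in> K" using assms(2) yK unfolding conic_def by (metis zero_le_numeral, metis order_refl)
  then have "n \<bullet> (2 *\<^sub>R y) \<le> b" "n \<bullet> (0 *\<^sub>R y) \<le> b" using n(2) by blast+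
  moreover have "n \<bullet> y = b" using n(3) y by blast
  ultimately have "b = 0" by simp
  then show ?thesis using n by blast
qed

lemma normal_interior: "n \<noteq> 0 \<Longrightarrow> K \<subseteq> {x. n \<bullet> x \<le> 0} \<Longrightarrow> z \<in> interior K \<Longrightarrow> n \<bullet> z < 0"
  using interior_mono[of K "{x. n \<bullet> x \<le> 0}"] interior_halfspace_le[of n 0] by auto

text \<open>The segment from an interior point to a point outside meets the boundary in some facet.
  The facet inequality is strict at the interior point and an equality where the segment meets it,
  so it can hold at the far end only if that end is the boundary point itself.\<close>

lemma polyhedron_eq_facet_halfspaces:
  fixes K :: "'a::euclidean_space set"
  assumes K: "polyhedron K" "interior K \<noteq> {}"
    and n: "\<And>C. C facet_of K \<Longrightarrow> n C \<noteq> 0 \<and> K \<subseteq> {x. n C \<bullet> x \<le> 0} \<and> C = K \<inter> {x. n C \<bullet> x = 0}"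
  shows "K = {x. \<forall>C. C facet_of K \<longrightarrow> n C \<bullet> x \<le> 0}"
proof
  show "K \<subseteq> {x. \<forall>C. C facet_of K \<longrightarrow> n C \<bullet> x \<le> 0}" using n by blast
  show "{x. \<forall>C. C facet_of K \<longrightarrow> n C \<bullet> x \<le> 0} \<subseteq> K"
  proof (rule subsetI, rule ccontr)
    fix y assume y: "y \<in> {x. \<forall>C. C facet_of K \<longrightarrow> n C \<bullet> x \<le> 0}" "y \<notin> K"
    obtain z where z: "z \<in> interior K" using K by blast
    then have "z \<in> K" using interior_subset by blast
    then have "closed_segment z y \<inter> frontier K \<noteq> {}"
      using y by (intro connected_Int_frontier) auto
    then obtain w where w: "w \<in> closed_segment z y" "w \<in> frontier K" by blast
    have "frontier K = K - rel_interior K"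
      using polyhedron_imp_closed[OF K(1)] rel_interior_nonempty_interior[OF K(2)] by (simp add: frontier_def)
    then obtain C where C: "C facet_of K" "w \<in> C" using w(2) rel_boundary_of_polyhedron[OF K(1)] by blast
    obtain u where u: "0 \<le> u" "u \<le> 1" "w = (1 - u) *\<^sub>R z + u *\<^sub>R y" using w(1) by (auto simp: in_segment)
    have "n C \<bullet> z < 0" using normal_interior z n[OF C(1)] by blast
    moreover have "n C \<bullet> y \<le> 0" using y C by blast
    moreover have "(1 - u) * (n C \<bullet> z) + u * (n C \<bullet> y) = 0"
    proof -
      have "n C \<bullet> w = 0" using n[OF C(1)] C(2) by blast
      then show ?thesis unfolding u(3) by (simp add: inner_add)
    qed
    ultimately have "u = 1" using u by (smt (verit) mult_nonneg_nonpos mult_pos_neg)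
    then have "w = y" using u by simp
    then show False using C n[OF C(1)] y by blast
  qed
qed

text \<open>The common kernel of the four facet normals is contained in every facet together with
  its negatives, hence trivial, so the normals form a basis of the four-dimensional space. Up to
  scaling, \<open>f\<close> consists of the negative normals and \<open>v\<close> is the dual basis
  of unit vectors.\<close>

lemma simplicial_cone:
  fixes K :: "'a::euclidean_space set"
  assumes K: "polyhedron K" "interior K \<noteq> {}" "conic K" and dim: "DIM('a) = 4"
    and card: "card {C. C facet_of K} = 4"
    and no_line: "\<And>C u. C facet_of K \<Longrightarrow> u \<in> C \<Longrightarrow> - u \<in> C \<Longrightarrow> u = 0"
  obtains v f :: "nat \<Rightarrow> 'a" where "\<And>i. i < 4 \<Longrightarrow> norm (v i) = 1"
    "\<And>i j. i < 4 \<Longrightarrow> j < 4 \<Longrightarrow> f i \<bullet> v j = (if i = j then 1 else 0)"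
    "\<And>x. x = (\<Sum>i<4. (f i \<bullet> x) *\<^sub>R v i)"
    "K = {x. \<forall>i<4. 0 \<le> f i \<bullet> x}" "{C. C facet_of K} = (\<lambda>i. {x \<in> K. f i \<bullet> x = 0}) ` {..<4}"
proof -
  have "\<forall>C. \<exists>n. C facet_of K \<longrightarrow> n \<noteq> 0 \<and> K \<subseteq> {x. n \<bullet> x \<le> 0} \<and> C = K \<inter> {x. n \<bullet> x = 0}"
    using conic_facet_normal[OF K(1,3)] by blast
  then obtain N where "\<forall>C. C facet_of K \<longrightarrow> N C \<noteq> 0 \<and> K \<subseteq> {x. N C \<bullet> x \<le> 0} \<and> C = K \<inter> {x. N C \<bullet> x = 0}"
    by (rule choice[THEN exE])
  then have N: "\<And>C. C facet_of K \<Longrightarrow> N C \<noteq> 0 \<and> K \<subseteq> {x. N C \<bullet> x \<le> 0} \<and> C = K \<inter> {x. N C \<bullet> x = 0}" by blast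
  have Keq: "K = {x. \<forall>C. C facet_of K \<longrightarrow> N C \<bullet> x \<le> 0}"
    by (rule polyhedron_eq_facet_halfspaces[OF K(1,2)]) (rule N)
  have fin: "finite {C. C facet_of K}" using card by (intro card_ge_0_finite) simp
  obtain h where h: "bij_betw h {0..<4::nat} {C. C facet_of K}" using ex_bij_betw_nat_finite[OF fin] card by auto
  have him: "{C. C facet_of K} = h ` {..<4}" using h by (auto simp: bij_betw_def lessThan_atLeast0)
  have hf: "h i facet_of K" if "i < 4" for i using him that by blast
  define n where "n i = N (h i)" for i
  have Kn: "K = {x. \<forall>i<4. n i \<bullet> x \<le> 0}"
  proof -
    have "(\<forall>C. C facet_of K \<longrightarrow> N C \<bullet> x \<le> 0) \<longleftrightarrow> (\<forall>i<4. n i \<bullet> x \<le> 0)" for x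
    proof -
      have "C facet_of K \<longleftrightarrow> (\<exists>i<4. C = h i)" for C using him by blast
      then show ?thesis unfolding n_def by metis
    qed
    then show ?thesis by (subst Keq) (rule Collect_cong)
  qed
  have hn: "h i = {x \<in> K. n i \<bullet> x = 0}" if "i < 4" for i 
  proof -
    have "h i = K \<inter> {x. N (h i) \<bullet> x = 0}" using N[OF hf[OF that]] by blast
    also have "\<dots> = {x \<in> K. n i \<bullet> x = 0}" unfolding n_def by blast
    finally show ?thesis .
  qed
  have ker: "u = 0" if "\<And>i. i < 4 \<Longrightarrow> n i \<bullet> u = 0" for u
  proof -
    have "u \<in> {x. \<forall>i<4. n i \<bullet> x \<le> 0}" "- u \<in> {x. \<forall>i<4. n i \<bullet> x \<le> 0}" using that by simp_all
    then have "u \<in> K" "- u \<in> K" unfolding Kn[symmetric] by blast+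
    then have "u \<in> h 0" "- u \<in> h 0" using that[of 0] by (simp_all add: hn)
    then show "u = 0" using no_line[OF hf[of 0]] by simp
  qed
  obtain e :: "nat \<Rightarrow> 'a" where e: "bij_betw e {0..<4} Basis" using ex_bij_betw_nat_finite[of "Basis :: 'a set"] dim by auto
  have eB: "e i \<in> Basis" if "i < 4" for i using e that by (auto simp: bij_betw_def)
  have ee: "e i \<bullet> e j = (if i = j then 1 else 0)" if "i < 4" "j < 4" for i j
    using e that eB by (auto simp: bij_betw_def inner_Basis inj_on_def)
  define L where "L x = (\<Sum>i<4. (n i \<bullet> x) *\<^sub>R e i)" for x
  have Le: "L x \<bullet> e j = n j \<bullet> x" if "j < 4" for x j
  proof -
    have "L x \<bullet> e j = (\<Sum>i<4. if i = j then n j \<bullet> x else 0)"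
      unfolding L_def inner_sum_left using that by (intro sum.cong) (auto simp: ee)
    then show ?thesis using that by simp
  qed
  have lin: "linear L" unfolding L_def by (intro linearI) (simp_all add: inner_add scaleR_add_left sum.distrib scaleR_sum_right)
  have "inj L"
  proof (subst linear_injective_0[OF lin], intro allI impI)
    fix x assume "L x = 0"
    then show "x = 0" using Le[of _ x] by (intro ker) simp
  qed
  then have "surj L" using linear_injective_imp_surjective[OF lin] by blast
  then have "\<forall>j. \<exists>w. L w = - e j" by (metis surjD)
  then obtain w where w: "\<forall>j. L (w j) = - e j" by (rule choice[THEN exE])
  have nw: "n i \<bullet> w j = (if i = j then - 1 else 0)" if "i < 4" "j < 4" for i j
    using Le[OF that(1), of "w j"] w ee[OF that(2,1)] by auto
  have w0: "0 < norm (w i)" if "i < 4" for i using nw[OF that that] by auto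
  define v where "v i = (1 / norm (w i)) *\<^sub>R w i" for i
  define f where "f i = - norm (w i) *\<^sub>R n i" for i
  have 1: "norm (v i) = 1" if "i < 4" for i using w0[OF that] by (simp add: v_def)
  have 2: "f i \<bullet> v j = (if i = j then 1 else 0)" if "i < 4" "j < 4" for i j
    using nw[OF that] w0[OF that(1)] by (cases "i = j") (simp_all add: v_def f_def)
  have fn: "n i \<bullet> x = - (f i \<bullet> x) / norm (w i)" if "i < 4" for i x using w0[OF that] by (simp add: f_def)
  have 3: "x = (\<Sum>i<4. (f i \<bullet> x) *\<^sub>R v i)" for x
  proof -
    have "n i \<bullet> (x - (\<Sum>i<4. (f i \<bullet> x) *\<^sub>R v i)) = 0" if i: "i < 4" for i
    proof -
      have "f i \<bullet> (\<Sum>j<4. (f j \<bullet> x) *\<^sub>R v j) = (\<Sum>j<4. if j = i then f i \<bullet> x else 0)"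
        unfolding inner_sum_right using i by (intro sum.cong) (auto simp: 2)
      then show ?thesis using i unfolding fn[OF i] by (simp add: inner_diff)
    qed
    from ker[OF this] show ?thesis by simp
  qed
  have 4: "K = {x. \<forall>i<4. 0 \<le> f i \<bullet> x}"
  proof -
    have "n i \<bullet> x \<le> 0 \<longleftrightarrow> 0 \<le> f i \<bullet> x" if "i < 4" for i x
      unfolding fn[OF that] using w0[OF that] by (simp add: zero_le_divide_iff)
    then show ?thesis using Kn by auto
  qed
  have 5: "{C. C facet_of K} = (\<lambda>i. {x \<in> K. f i \<bullet> x = 0}) ` {..<4}"
  proof -
    have "h i = {x \<in> K. f i \<bullet> x = 0}" if "i < 4" for i
      unfolding hn[OF that] fn[OF that] using w0[OF that] by simp
    then show ?thesis unfolding him by (intro image_cong) auto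
  qed
  show ?thesis by (rule that[of v f]) (rule 1 2 3 4 5; assumption)+
qed

text \<open>The ray of \<open>v j\<close> is extreme: when \<open>v j\<close> is written as a
  nonnegative combination of points of the facet, every point with positive coefficient is a
  multiple of it. So each of the three rays is one of the vertices of the triangle.\<close>

lemma simplicial_facet_rays:
  fixes v f :: "nat \<Rightarrow> 'a::euclidean_space"
  assumes v: "\<And>i. i < 4 \<Longrightarrow> norm (v i) = 1"
    and fv: "\<And>i j. i < 4 \<Longrightarrow> j < 4 \<Longrightarrow> f i \<bullet> v j = (if i = j then 1 else 0)"
    and ex: "\<And>x. x = (\<Sum>i<4. (f i \<bullet> x) *\<^sub>R v i)"
    and l: "l < 4" and hull: "sphere 0 1 \<inter> {x. (\<forall>i<4. 0 \<le> f i \<bullet> x) \<and> f l \<bullet> x = 0} = sph_hull {a, b, d}"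
    and abd: "{a, b, d} \<subseteq> sphere 0 1"
  shows "v ` ({..<4} - {l}) = {a, b, d}"
proof -
  have sub: "v ` ({..<4} - {l}) \<subseteq> {a, b, d}"
  proof
    fix y assume "y \<in> v ` ({..<4} - {l})"
    then obtain j where j: "j < 4" "j \<noteq> l" "y = v j" by auto
    have "v j \<in> sphere 0 1 \<inter> {x. (\<forall>i<4. 0 \<le> f i \<bullet> x) \<and> f l \<bullet> x = 0}" using j v fv l by auto
    then have "v j \<in> convex_cone hull {a, b, d}" unfolding hull sph_hull_def by simp
    then obtain r s t where rst: "0 \<le> r" "0 \<le> s" "0 \<le> t" "v j = r *\<^sub>R a + s *\<^sub>R b + t *\<^sub>R d"
      unfolding convex_cone_hull_3 by blast
    have inh: "z \<in> sph_hull {a, b, d}" if "z \<in> {a, b, d}" for z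
      using that abd unfolding sph_hull_def by (auto intro: hull_inc)
    have nn: "0 \<le> f i \<bullet> z" if "z \<in> {a, b, d}" "i < 4" for z i using inh[OF that(1)] that(2) unfolding hull[symmetric] by auto
    have main: "z = v j" if z: "z \<in> {a, b, d}" and rr: "0 < r'" and le: "\<And>i. i < 4 \<Longrightarrow> r' * (f i \<bullet> z) \<le> f i \<bullet> v j" for z r'
    proof -
      have "f i \<bullet> z = 0" if "i < 4" "i \<noteq> j" for i
        using le[OF that(1)] fv[OF that(1) j(1)] that nn[OF z that(1)] rr by (simp add: mult_le_0_iff)
      then have "z = (\<Sum>i<4. if i = j then (f j \<bullet> z) *\<^sub>R v j else 0)"
        by (subst ex[of z]) (intro sum.cong, auto)
      then have zz: "z = (f j \<bullet> z) *\<^sub>R v j" using j by simp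
      have "norm z = 1" using z abd by auto
      then have "\<bar>f j \<bullet> z\<bar> = 1" using arg_cong[OF zz, of norm] v[OF j(1)] by simp
      then have "f j \<bullet> z = 1" using nn[OF z j(1)] by simp
      then show ?thesis using zz by simp
    qed
    have dist: "f i \<bullet> v j = r * (f i \<bullet> a) + s * (f i \<bullet> b) + t * (f i \<bullet> d)" for i
      unfolding rst(4) by (simp add: inner_add)
    have "v j \<noteq> 0" using v[OF j(1)] by auto
    then have "0 < r \<or> 0 < s \<or> 0 < t" using rst by force
    moreover have "r * (f i \<bullet> a) \<le> f i \<bullet> v j" "s * (f i \<bullet> b) \<le> f i \<bullet> v j" "t * (f i \<bullet> d) \<le> f i \<bullet> v j" if "i < 4" for i
      unfolding dist using nn[OF _ that] rst(1-3) by simp_all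
    ultimately show "y \<in> {a, b, d}" using main[of a r] main[of b s] main[of d t] j(3) by blast
  qed
  have inj: "inj_on v {..<4}"
  proof (rule inj_onI)
    fix i j assume "i \<in> {..<4::nat}" "j \<in> {..<4}" "v i = v j"
    then show "i = j" using fv[of i i] fv[of i j] by (auto split: if_splits)
  qed
  have "card (v ` ({..<4} - {l})) = 3" using l by (subst card_image) (auto intro: inj_on_subset[OF inj] simp: card_Diff_subset)
  moreover have "card {a, b, d} \<le> 3" by (simp add: card_insert_if)
  ultimately show ?thesis using card_seteq[OF _ sub] by simp
qed


text \<open>With r the common inner product, the angle at \<open>a\<close> has cosine (r - r^2) / (1
  - r^2) = r / (1 + r), and this is solved for r.\<close>

lemma regular_triangle_gram:
  fixes a b d :: "'a::euclidean_space"
  assumes dist: "distinct [a, b, d]" and unit: "{a, b, d} \<subseteq> sphere 0 1"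
    and eq: "equilateral a b d" "equiangular \<alpha> a b d"
    and xy: "x \<in> {a, b, d}" "y \<in> {a, b, d}" "x \<noteq> y"
  shows "x \<bullet> y = cos \<alpha> / (1 - cos \<alpha>)"
proof -
  have n: "norm a = 1" "norm b = 1" "norm d = 1" using unit by auto
  have abs: "\<bar>z \<bullet> w\<bar> \<le> 1" if "norm z = 1" "norm w = 1" for z w :: 'a
    using Cauchy_Schwarz_ineq2[of z w] that by simp
  define r where "r = a \<bullet> b"
  have e: "b \<bullet> d = r" "d \<bullet> a = r"
    using eq(1) abs n unfolding equilateral_def sph_dist_def r_def by (simp_all add: arccos_eq_iff)
  have "(norm (a - b))\<^sup>2 = 2 - 2 * r" "(norm (d + b))\<^sup>2 = 2 + 2 * r" "(norm (a + b))\<^sup>2 = 2 + 2 * r"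
    using n e unfolding r_def power2_norm_eq_inner
    by (simp_all add: inner_diff inner_add inner_commute norm_eq_1)
  moreover have "a - b \<noteq> 0" using dist by simp
  moreover have "d + b \<noteq> 0 \<or> a + b \<noteq> 0"
  proof (rule ccontr)
    assume "\<not> ?thesis"
    then have "d = - b" "a = - b" by (simp_all add: eq_neg_iff_add_eq_0)
    then show False using dist by simp
  qed
  ultimately have r: "r < 1" "- 1 < r"
    by (smt (verit, best) zero_less_norm_iff zero_less_power)+
  have dir: "sph_dir a z = (1 / sqrt (1 - r\<^sup>2)) *\<^sub>R (z - r *\<^sub>R a)" if z: "norm z = 1" "a \<bullet> z = r" for z
  proof -
    have "(norm (z - r *\<^sub>R a))\<^sup>2 = 1 - r\<^sup>2"
      unfolding power2_norm_eq_inner using z n by (simp add: inner_diff inner_commute[of z a] unit_inner power2_eq_square)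
    then have "norm (z - r *\<^sub>R a) = sqrt (1 - r\<^sup>2)" by (metis norm_ge_zero real_sqrt_unique)
    then show ?thesis unfolding sph_dir_def z(2) sgn_div_norm by (simp add: divide_inverse)
  qed
  have r2: "0 < 1 - r\<^sup>2" using r by (simp add: abs_square_less_1)
  have ab: "a \<bullet> b = r" "a \<bullet> d = r" using e by (simp_all add: r_def inner_commute)
  have "sph_dir a b \<bullet> sph_dir a d = (1 / sqrt (1 - r\<^sup>2)) * (1 / sqrt (1 - r\<^sup>2)) * ((b - r *\<^sub>R a) \<bullet> (d - r *\<^sub>R a))"
    unfolding dir[OF n(2) ab(1)] dir[OF n(3) ab(2)] by simp
  also have "(b - r *\<^sub>R a) \<bullet> (d - r *\<^sub>R a) = r - r\<^sup>2"
    using e ab n by (simp add: inner_diff inner_commute[of b a] unit_inner power2_eq_square algebra_simps)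
  also have "(1 / sqrt (1 - r\<^sup>2)) * (1 / sqrt (1 - r\<^sup>2)) = 1 / (1 - r\<^sup>2)" using r2 by (simp add: real_sqrt_mult_self)
  also have "1 / (1 - r\<^sup>2) * (r - r\<^sup>2) = r / (1 + r)"
  proof -
    have "1 - r\<^sup>2 = (1 - r) * (1 + r)" "r - r\<^sup>2 = (1 - r) * r" by (simp_all add: power2_eq_square algebra_simps)
    then show ?thesis using r by simp
  qed
  finally have in_: "sph_dir a b \<bullet> sph_dir a d = r / (1 + r)" .
  have "norm (sgn w) \<le> 1" for w :: 'a by (simp add: norm_sgn)
  then have "norm (sph_dir a b) \<le> 1" "norm (sph_dir a d) \<le> 1" unfolding sph_dir_def by auto
  then have "\<bar>sph_dir a b \<bullet> sph_dir a d\<bar> \<le> 1"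
    by (meson Cauchy_Schwarz_ineq2 mult_le_one norm_ge_zero order_trans)
  then have "cos \<alpha> = r / (1 + r)"
    using eq(2) unfolding equiangular_def sph_angle_def sph_dist_def in_ by (metis cos_arccos_abs)
  moreover from this have "1 - cos \<alpha> = 1 / (1 + r)" using r by (simp add: field_simps)
  ultimately have "cos \<alpha> / (1 - cos \<alpha>) = r" using r by simp
  moreover have "x \<bullet> y = r" using xy e ab by (auto simp: inner_commute)
  ultimately show ?thesis by simp
qed

lemma sph_faces_2_eq:
  fixes T :: "'a::euclidean_space set"
  assumes "DIM('a) = 4" "interior (conic hull T) \<noteq> {}"
  shows "sph_faces 2 T = (\<lambda>F. sphere 0 1 \<inter> F) ` {F. F facet_of conic hull T}"
proof -
  have "aff_dim (conic hull T) = 4" using aff_dim_nonempty_interior[OF assms(2)] assms(1) by simp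
  then have "F facet_of conic hull T \<longleftrightarrow> F face_of conic hull T \<and> aff_dim F = int 2 + 1" for F
    unfolding facet_of_def by auto
  then show ?thesis unfolding sph_faces_def by auto
qed

lemma inj_on_sphere_Int:
  assumes "\<And>F. F \<in> M \<Longrightarrow> conic F \<and> F \<noteq> {}"
  shows "inj_on (\<lambda>F. sphere 0 1 \<inter> F) (M :: 'a::euclidean_space set set)"
proof (rule inj_onI)
  have *: "F \<subseteq> G" if F: "F \<in> M" and G: "G \<in> M" and eq: "sphere 0 1 \<inter> F = sphere 0 1 \<inter> G" for F G
  proof
    fix x assume x: "x \<in> F"
    show "x \<in> G"
    proof (cases "x = 0")
      case True
      then show ?thesis using assms[OF G] conic_contains_0 by blast
    next
      case False
      then have "(1 / norm x) *\<^sub>R x \<in> sphere 0 1 \<inter> F" using assms[OF F] x unfolding conic_def by simp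
      then have "(1 / norm x) *\<^sub>R x \<in> G" using eq by blast
      then have "norm x *\<^sub>R ((1 / norm x) *\<^sub>R x) \<in> G" using assms[OF G] unfolding conic_def by (meson norm_ge_zero)
      then show ?thesis using False by simp
    qed
  qed
  fix F G assume "F \<in> M" "G \<in> M" "sphere 0 1 \<inter> F = sphere 0 1 \<inter> G"
  then show "F = G" using *[of F G] *[of G F] by (metis subset_antisym)
qed

lemma sph_hull_no_line:
  assumes ind: "independent {a, b, d :: 'a::euclidean_space}" "distinct [a, b, d]"
    and u: "u \<in> sph_hull {a, b, d}" "- u \<in> sph_hull {a, b, d}"
  shows False
proof -
  obtain r s t where 1: "0 \<le> r" "0 \<le> s" "0 \<le> t" "u = r *\<^sub>R a + s *\<^sub>R b + t *\<^sub>R d"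
    using u(1) unfolding sph_hull_def convex_cone_hull_3 by blast
  obtain r' s' t' where 2: "0 \<le> r'" "0 \<le> s'" "0 \<le> t'" "- u = r' *\<^sub>R a + s' *\<^sub>R b + t' *\<^sub>R d"
    using u(2) unfolding sph_hull_def convex_cone_hull_3 by blast
  have "(r + r') *\<^sub>R a + (s + s') *\<^sub>R b + (t + t') *\<^sub>R d = 0"
  proof -
    have "(r + r') *\<^sub>R a + (s + s') *\<^sub>R b + (t + t') *\<^sub>R d = u + - u" unfolding 1(4) 2(4)[unfolded 1(4)] by (simp add: algebra_simps)
    then show ?thesis by simp
  qed
  moreover define q where "q x = (if x = a then r + r' else if x = b then s + s' else t + t')" for x
  ultimately have "(\<Sum>x\<in>{a, b, d}. q x *\<^sub>R x) = 0" using ind(2) by (auto simp: add.assoc)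
  then have "q x = 0" if "x \<in> {a, b, d}" for x
    using independentD[OF ind(1), of "{a, b, d}" q x] that by simp
  from this[of a] this[of b] this[of d] have "r + r' = 0" "s + s' = 0" "t + t' = 0" using ind(2) by (auto simp: q_def)
  then have "r = 0" "s = 0" "t = 0" using 1(1-3) 2(1-3) by linarith+
  then have "u = 0" using 1(4) by simp
  then show False using u(1) by (simp add: sph_hull_def)
qed

text \<open>The cone over \<open>T\<close> is simplicial, and any two of its four rays lie on a
  common facet, where \<open>regular_triangle_gram\<close> gives their inner product. An edge comes
  from a two-dimensional face of the cone, which is an intersection of facets.\<close>

theorem regular_tetrahedron_vertices:
  fixes T :: "'a::euclidean_space set"
  assumes dim: "DIM('a) = 4" and T: "regular_tetrahedron \<alpha> T" and al: "pi / 3 < \<alpha>" "\<alpha> < 2 * pi / 3"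
  defines "c \<equiv> cos \<alpha> / (1 - cos \<alpha>)"
  obtains v where "tetra v c" "surface T = tetra.bdry v c"
    "sph_faces 1 T \<subseteq> {tetra.edge v c i j | i j. i < 4 \<and> j < 4 \<and> i \<noteq> j}"
proof -
  define K where "K = conic hull T"
  have K: "polyhedron K" "interior K \<noteq> {}" "conic K"
    using T conic_conic_hull unfolding regular_tetrahedron_def sph_polyhedron_def K_def by auto
  have faces: "sph_faces 2 T = (\<lambda>F. sphere 0 1 \<inter> F) ` {F. F facet_of K}"
    using sph_faces_2_eq[OF dim] K(2) unfolding K_def by blast
  have conicF: "conic C" if C: "C facet_of K" for C
  proof -
    obtain n where "C = K \<inter> {x. n \<bullet> x = 0}" using conic_facet_normal[OF K(1,3) C] by blast
    then show ?thesis using K(3) unfolding conic_def by simp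
  qed
  have tri: "\<exists>a b d. distinct [a, b, d] \<and> {a, b, d} \<subseteq> sphere 0 1 \<and> independent {a, b, d} \<and>
        sphere 0 1 \<inter> C = sph_hull {a, b, d} \<and> equilateral a b d \<and> equiangular \<alpha> a b d" if C: "C facet_of K" for C
    using T C faces unfolding regular_tetrahedron_def regular_triangle_def by auto
  have "card ((\<lambda>F. sphere 0 1 \<inter> F) ` {F. F facet_of K}) = 4"
    using T faces unfolding regular_tetrahedron_def by simp
  moreover have "inj_on (\<lambda>F. sphere 0 1 \<inter> F) {F. F facet_of K}"
    using conicF unfolding facet_of_def by (intro inj_on_sphere_Int) auto
  ultimately have card: "card {F. F facet_of K} = 4" by (simp add: card_image)
  have no_line: "u = 0" if C: "C facet_of K" and u: "u \<in> C" "- u \<in> C" for C u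
  proof (rule ccontr)
    assume "u \<noteq> 0"
    define w where "w = (1 / norm u) *\<^sub>R u"
    have "(1 / norm u) *\<^sub>R u \<in> C" "(1 / norm u) *\<^sub>R (- u) \<in> C"
      using conicF[OF C] u unfolding conic_def by (meson divide_nonneg_nonneg norm_ge_zero zero_le_one)+
    then have "w \<in> sphere 0 1 \<inter> C" "- w \<in> sphere 0 1 \<inter> C" using \<open>u \<noteq> 0\<close> by (simp_all add: w_def)
    then show False using tri[OF C] sph_hull_no_line by metis
  qed
  obtain v f :: "nat \<Rightarrow> 'a" where v: "\<And>i. i < 4 \<Longrightarrow> norm (v i) = 1"
    and fv: "\<And>i j. i < 4 \<Longrightarrow> j < 4 \<Longrightarrow> f i \<bullet> v j = (if i = j then 1 else 0)"
    and ex: "\<And>x. x = (\<Sum>i<4. (f i \<bullet> x) *\<^sub>R v i)"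
    and Kf: "K = {x. \<forall>i<4. 0 \<le> f i \<bullet> x}" and fac: "{C. C facet_of K} = (\<lambda>i. {x \<in> K. f i \<bullet> x = 0}) ` {..<4}"
    by (rule simplicial_cone[OF K dim card]) (rule no_line, assumption+, blast)
  have gr: "v i \<bullet> v j = c" if ij: "i < 4" "j < 4" "i \<noteq> j" for i j
  proof -
    obtain k l where q: "quad i j k l" using quad_ex[OF ij] by blast
    note qq = quadD[OF q]
    have "{x \<in> K. f l \<bullet> x = 0} facet_of K" using fac qq by blast
    then obtain a b d where abd: "distinct [a, b, d]" "{a, b, d} \<subseteq> sphere 0 1"
        "sphere 0 1 \<inter> {x \<in> K. f l \<bullet> x = 0} = sph_hull {a, b, d}" "equilateral a b d" "equiangular \<alpha> a b d"
      using tri by blast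
    have "sphere 0 1 \<inter> {x. (\<forall>i<4. 0 \<le> f i \<bullet> x) \<and> f l \<bullet> x = 0} = sph_hull {a, b, d}"
      using abd(3) unfolding Kf by simp
    then have im: "v ` ({..<4} - {l}) = {a, b, d}"
      using simplicial_facet_rays[OF v fv ex qq(4) _ abd(2)] by blast
    have "v i \<in> {a, b, d}" "v j \<in> {a, b, d}" unfolding im[symmetric] using qq by auto
    moreover have "v i \<noteq> v j" using fv[OF ij(1,1)] fv[OF ij(1,2)] ij(3) by auto
    ultimately show ?thesis unfolding c_def by (rule regular_triangle_gram[OF abd(1,2,4,5)])
  qed
  \<comment> \<open>The range of \<alpha> corresponds to -1/3 < c < 1.\<close>
  have "cos \<alpha> < cos (pi / 3)" "cos (2 * pi / 3) < cos \<alpha>"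
    using al by (intro cos_monotone_0_pi; simp)+
  then have ca: "cos \<alpha> < 1 / 2" "- 1 / 2 < cos \<alpha>" by (simp_all add: cos_60 cos_120)
  interpret tetra v c
  proof
    show "v i \<bullet> v j = (if i = j then 1 else c)" if "i < 4" "j < 4" for i j
      using gr[OF that] v[OF that(1)] by (auto simp: norm_eq_1)
    show "- 1 / 3 < c" "c < 1" unfolding c_def using ca by (simp_all add: field_simps)
    show "DIM('a) = 4" by (rule dim)
  qed
  have co: "co i x = f i \<bullet> x" if "i < 4" for i x
  proof -
    have "co i x = (\<Sum>j<4. (f j \<bullet> x) * co i (v j))"
      by (subst ex[of x]) (simp add: linear_sum[OF linear_co])
    also have "\<dots> = (\<Sum>j<4. if j = i then f i \<bullet> x else 0)" using that by (intro sum.cong) (auto simp: co_v)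
    finally show ?thesis using that by simp
  qed
  have K_co: "K = {x. \<forall>i<4. 0 \<le> co i x}" unfolding Kf using co by auto
  have fac_co: "{C. C facet_of K} = (\<lambda>i. {x \<in> K. co i x = 0}) ` {..<4}"
    unfolding fac using co by (intro image_cong) auto
  have surf: "surface T = bdry"
  proof -
    have "surface T = (\<Union>l<4. sphere 0 1 \<inter> {x \<in> K. co l x = 0})"
      unfolding surface_def faces fac_co by simp
    also have "\<dots> = bdry" unfolding bdry_def face_def K_co by auto
    finally show ?thesis .
  qed
  have indep: "independent (v ` {..<4})"
  proof (rule card_le_dim_spanning[of _ UNIV])
    have "card (v ` {..<4}) \<le> 4" using card_image_le[of "{..<4::nat}" v] by simp
    then show "card (v ` {..<4}) \<le> dim (UNIV :: 'a set)" using dim by simp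
  qed (use span_v in auto)
  have injv: "inj_on v {..<4}"
  proof (rule inj_onI)
    fix i j assume "i \<in> {..<4::nat}" "j \<in> {..<4}" "v i = v j"
    then show "i = j" using co_v[of i i] co_v[of i j] by (auto split: if_splits)
  qed
  have edges: "\<exists>i j. S = edge i j \<and> i < 4 \<and> j < 4 \<and> i \<noteq> j" if S: "S \<in> sph_faces 1 T" for S
  proof -
    obtain F where F: "S = sphere 0 1 \<inter> F" "F face_of K" "aff_dim F = 2"
      using S unfolding sph_faces_def K_def by auto
    have "F \<noteq> {}" using F(3) by auto
    moreover have "F \<noteq> K" using F(3) aff_dim_nonempty_interior[OF K(2)] dim by auto
    ultimately have Feq: "F = \<Inter>{C. C facet_of K \<and> F \<subseteq> C}" by (rule face_of_polyhedron[OF K(1) F(2)])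
    have FK: "F \<subseteq> K" using F(2) by (rule face_of_imp_subset)
    define I where "I = {i. i < 4 \<and> F \<subseteq> {x \<in> K. co i x = 0}}"
    have Fco: "F = {x \<in> K. \<forall>i\<in>I. co i x = 0}"
    proof
      show "F \<subseteq> {x \<in> K. \<forall>i\<in>I. co i x = 0}" using FK unfolding I_def by blast
      show "{x \<in> K. \<forall>i\<in>I. co i x = 0} \<subseteq> F"
      proof
        fix x assume x: "x \<in> {x \<in> K. \<forall>i\<in>I. co i x = 0}"
        have "x \<in> C" if C: "C facet_of K" "F \<subseteq> C" for C
        proof -
          obtain i where "i < 4" "C = {x \<in> K. co i x = 0}" using C(1) fac_co by blast
          then show ?thesis using x C(2) unfolding I_def by blast
        qed
        then show "x \<in> F" by (subst Feq) blast
      qed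
    qed
    define J where "J = {..<4} - I"
    have J: "J \<subseteq> {..<4}" "finite J" by (auto simp: J_def)
    \<comment> \<open>The face is spanned by the rays on it, so its dimension counts them; dimension
      2 leaves the two ends of an edge.\<close>
    have "dim F = card J"
    proof (rule dim_unique[of "v ` J"])
      show "v ` J \<subseteq> F"
      proof
        fix y assume "y \<in> v ` J"
        then obtain j where j: "j < 4" "j \<notin> I" "y = v j" by (auto simp: J_def)
        have "co i y = 0" if "i \<in> I" for i
        proof -
          have "i < 4" "i \<noteq> j" using that j(2) by (auto simp: I_def)
          then show ?thesis using j by (simp add: co_v)
        qed
        moreover have "0 \<le> co i y" if "i < 4" for i using that j by (simp add: co_v)
        ultimately show "y \<in> F" unfolding Fco K_co by blast
      qed
      show "F \<subseteq> span (v ` J)"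
      proof
        fix x assume "x \<in> F"
        then have "co i x = 0" if "i \<in> {..<4} - J" for i using that unfolding Fco J_def by auto
        then have "(\<Sum>i<4. co i x *\<^sub>R v i) = (\<Sum>i\<in>J. co i x *\<^sub>R v i)"
          using J by (intro sum.mono_neutral_right) auto
        then have "x = (\<Sum>i\<in>J. co i x *\<^sub>R v i)" using expand[of x] by simp
        also have "\<dots> \<in> span (v ` J)" by (intro span_sum span_scale span_base) auto
        finally show "x \<in> span (v ` J)" .
      qed
      show "independent (v ` J)" by (rule independent_mono[OF indep]) (use J in auto)
      show "card (v ` J) = card J" by (rule card_image) (rule inj_on_subset[OF injv J(1)])
    qed
    moreover have "0 \<in> F" unfolding Fco K_co by simp
    ultimately have "card J = 2" using F(3) aff_dim_zero[of F] by (simp add: hull_inc)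
    then obtain i j where ij: "J = {i, j}" "i \<noteq> j" by (auto simp: card_2_iff)
    have lt: "i < 4" "j < 4" using ij J(1) by auto
    have I: "I = {k. k < 4 \<and> k \<noteq> i \<and> k \<noteq> j}" using ij J_def unfolding I_def by blast
    have "S = edge i j" unfolding F(1) Fco K_co edge_def I by auto
    then show ?thesis using lt ij(2) by blast
  qed
  show ?thesis
    by (rule that[OF tetra_axioms surf]) (use edges in blast)
qed


section \<open>The crossing nearest to a vertex and the inequality for the type\<close>

context dgeo begin

lemma x_mod: "x (k mod m) = x k"
proof -
  have "x (k + n * m) = x k" for n
  proof (induction n rule: int_induct[where k = 0])
    case (step1 i) then show ?case using x_per[of "k + i * m"] by (simp add: algebra_simps)
  next
    case (step2 i) then show ?case using x_per[of "k + (i - 1) * m"] by (simp add: algebra_simps)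
  qed simp
  from this[of "- (k div m)"] show ?thesis by (simp add: minus_div_mult_eq_mod)
qed

lemma Ec_mod: "Ec (k mod m) = Ec k"
proof -
  have "m dvd k mod m - k" by (simp add: mod_eq_dvd_iff[symmetric])
  moreover from this have "m dvd (k mod m - 1) - (k - 1)" by simp
  ultimately show ?thesis unfolding Ec_def using phi_mod by metis
qed

text \<open>The ratio of the two coordinates measures how far a point of the edge is from vertex
  \<open>i\<close>, and one period contains finitely many crossings.\<close>

lemma nearest_exists:
  assumes q: "quad i j f l" and ne: "0 < card {k \<in> {0..<m}. {phi (k - 1), phi k} = {f, l}}"
  shows "\<exists>b. Ec b = {f, l} \<and> (\<forall>r. Ec r = {f, l} \<longrightarrow> co j (x b) / co i (x b) \<le> co j (x r) / co i (x r))"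
proof -
  define M where "M = {k \<in> {0..<m}. Ec k = {f, l}}"
  have "finite M" "M \<noteq> {}" using ne card_gt_0_iff[of M] unfolding M_def Ec_def by auto
  then obtain b where b: "b \<in> M" "\<forall>r\<in>M. co j (x b) / co i (x b) \<le> co j (x r) / co i (x r)"
    using ex_min_if_finite[of "(\<lambda>r. co j (x r) / co i (x r)) ` M"] by (auto simp: not_less)
  have "co j (x b) / co i (x b) \<le> co j (x r) / co i (x r)" if "Ec r = {f, l}" for r
  proof -
    have "r mod m \<in> M" using that Ec_mod[of r] m_pos unfolding M_def by simp
    then show ?thesis using b(2) unfolding x_mod[of r, symmetric] by blast
  qed
  then show ?thesis using b(1) unfolding M_def by blast
qed

text \<open>On the edge, the height is a positive multiple of an expression that decreases in the
  coordinate ratio and vanishes at \<open>x b\<close>.\<close>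

lemma nearI:
  assumes q: "quad i j f l" and E: "Ec b = {f, l}" and lft: "lft b = i"
    and min: "\<And>r. Ec r = {f, l} \<Longrightarrow> co j (x b) / co i (x b) \<le> co j (x r) / co i (x r)"
  shows "near b"
  unfolding near_def
proof (intro allI impI)
  fix r assume "Ec r = Ec b"
  then have Er: "Ec r = {f, l}" using E by simp
  note X = x_in_Ec[OF q E] and R = x_in_Ec[OF q Er]
  have "quad (lft b) (rgt b) (phi (b - 1)) (phi b)" by (rule lr)
  then have rgt: "rgt b = j"
    using quad_cases[OF q, of "rgt b"] quadD[of "lft b" "rgt b" "phi (b - 1)" "phi b"] lft E unfolding Ec_def by auto
  have h: "0 < v i \<bullet> nrm b" "v j \<bullet> nrm b < 0" using height_signs(1,2)[of b] lft rgt by auto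
  have ht: "w \<bullet> nrm b = co i w * (v i \<bullet> nrm b + (co j w / co i w) * (v j \<bullet> nrm b))"
    if "w = co i w *\<^sub>R v i + co j w *\<^sub>R v j" "0 < co i w" for w
    using arg_cong[OF that(1), of "\<lambda>z. z \<bullet> nrm b"] that(2) by (simp add: inner_add field_simps)
  have "0 = v i \<bullet> nrm b + (co j (x b) / co i (x b)) * (v j \<bullet> nrm b)"
    using ht[OF X(1,2)] nrm_props(2)[of b] X(2) by simp
  also have "\<dots> \<ge> v i \<bullet> nrm b + (co j (x r) / co i (x r)) * (v j \<bullet> nrm b)"
    using mult_right_mono_neg[OF min[OF Er], of "v j \<bullet> nrm b"] h(2) by simp
  finally show "x r \<bullet> nrm b \<le> 0" unfolding ht[OF R(1,2)] using R(2) by (simp add: mult_nonneg_nonpos)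
qed

end

context geod begin

lemma dgeo_geod:
  assumes "ori = 1 \<or> ori = - 1" shows "dgeo v c x phi m ori"
  by unfold_locales (fact m_pos x_per phi_per x_unit phi_less phi_neq phi_neq2 x_zero x_pos straight arcs_disjoint x_inj assms)+

theorem geodesic_type_bound:
  assumes opp: "\<And>l. l < 4 \<Longrightarrow> opp l < 4" "\<And>l. l < 4 \<Longrightarrow> opp l \<noteq> l" "\<And>l. l < 4 \<Longrightarrow> opp (opp l) = l"
    and opA: "\<And>l. l < 4 \<Longrightarrow> opA l < 4" "\<And>l. l < 4 \<Longrightarrow> opA l \<noteq> l" "\<And>l. l < 4 \<Longrightarrow> opA (opA l) = l"
      "\<And>l. l < 4 \<Longrightarrow> opA l \<noteq> opp l"
    and pq: "0 < p" "0 < q"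
    and A: "\<And>i j l. quad i j (opA l) l \<Longrightarrow> card (range g \<inter> edge i j) = p"
    and C: "\<And>i j l. quad i j (opp l) l \<Longrightarrow> card (range g \<inter> edge i j) = p + q"
    and B: "\<And>i j f l. quad i j f l \<Longrightarrow> f \<noteq> opA l \<Longrightarrow> f \<noteq> opp l \<Longrightarrow> card (range g \<inter> edge i j) = q"
  shows "2 * (1 - c) * real (p\<^sup>2 + p * q + q\<^sup>2) < pi\<^sup>2"
proof -
  let ?n = "\<lambda>f l. card {k \<in> {0..<m}. {phi (k - 1), phi k} = {f, l}}"
  have cq: "\<exists>i j. quad i j f l" if fl: "f < 4" "l < 4" "f \<noteq> l" for f l
  proof -
    obtain i j where "quad f l i j" using quad_ex[OF fl] by blast
    then show ?thesis unfolding quad_def by (metis insert_commute)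
  qed
  have cA: "?n (opA l) l = p" if l: "l < 4" for l
  proof -
    obtain i j where q: "quad i j (opA l) l" using cq[OF opA(1)[OF l] l opA(2)[OF l]] by blast
    show ?thesis unfolding edge_count[OF q, symmetric] by (rule A[OF q])
  qed
  have cC: "?n (opp l) l = p + q" if l: "l < 4" for l
  proof -
    obtain i j where q: "quad i j (opp l) l" using cq[OF opp(1)[OF l] l opp(2)[OF l]] by blast
    show ?thesis unfolding edge_count[OF q, symmetric] by (rule C[OF q])
  qed
  have cB: "?n f l = q" if fl: "f < 4" "l < 4" "f \<noteq> l" "f \<noteq> opA l" "f \<noteq> opp l" for f l
  proof -
    obtain i j where q: "quad i j f l" using cq[OF fl(1-3)] by blast
    show ?thesis unfolding edge_count[OF q, symmetric] by (rule B[OF q fl(4,5)])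
  qed
  have sum: "?n (opp l) l = ?n a l + ?n b l" if q: "quad a b (opp l) l" for a b l
  proof -
    note qq = quadD[OF q]
    have "opA l = a \<or> opA l = b"
      using quad_cases[OF q opA(1)[OF qq(4)]] opA(2)[OF qq(4)] opA(4)[OF qq(4)] by blast
    then show ?thesis
    proof
      assume e: "opA l = a"
      have "?n a l = p" using cA[OF qq(4)] e by simp
      moreover have "?n b l = q" using qq e by (intro cB) auto
      ultimately show ?thesis using cC[OF qq(4)] by simp
    next
      assume e: "opA l = b"
      have "?n b l = p" using cA[OF qq(4)] e by simp
      moreover have "?n a l = q" using qq e by (intro cB) auto
      ultimately show ?thesis using cC[OF qq(4)] by simp
    qed
  qed
  have pos: "0 < ?n f l" if "f < 4" "l < 4" "f \<noteq> l" for f l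
    using cA[OF that(2)] cC[OF that(2)] cB[OF that] pq by (cases "f = opA l"; cases "f = opp l") auto
  have comb: "comb_pq v c x phi m ori opp opA p q" if "ori = 1 \<or> ori = - 1" for ori
  proof -
    interpret d: dgeo v c x phi m ori by (rule dgeo_geod[OF that])
    show ?thesis
      by unfold_locales (fact opp opA pq sum pos cA cC cB)+
  qed
  have z: "0 < (4::nat)" by simp
  obtain i j where q: "quad i j (opp 0) 0" using cq[OF opp(1)[OF z] z opp(2)[OF z]] by blast
  \<comment> \<open>Finding the nearest crossing precedes the choice of orientation, so it is done
    with the value 1.\<close>
  interpret one: dgeo v c x phi m 1 by (rule dgeo_geod) simp
  obtain b where b: "{phi (b - 1), phi b} = {opp 0, 0}"
      "\<And>r. {phi (r - 1), phi r} = {opp 0, 0} \<Longrightarrow> co j (x b) / co i (x b) \<le> co j (x r) / co i (x r)"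
    using one.nearest_exists[OF q pos[OF opp(1)[OF z] z opp(2)[OF z]]] unfolding one.Ec_def by blast
  have qb: "quad i j (phi (b - 1)) (phi b)" using q b(1) unfolding quad_def by auto
  \<comment> \<open>Makes vertex \<open>i\<close>, to which crossing \<open>b\<close> is nearest,
    the left end at \<open>b\<close>.\<close>
  define ori where "ori = sgn (par i j (phi (b - 1)) (phi b))"
  have o: "ori = 1 \<or> ori = - 1" "0 < ori * par i j (phi (b - 1)) (phi b)"
    using par_nonzero[OF qb] unfolding ori_def by (auto simp: sgn_if)
  interpret comb_pq v c x phi m ori opp opA p q by (rule comb[OF o(1)])
  have "near b"
    by (rule nearI[OF q]) (use b lrI[OF qb o(2)] in \<open>simp_all add: Ec_def\<close>)
  moreover have "isC b"
    using b(1) opp(3)[OF z] unfolding isC_def by (auto simp: doubleton_eq_iff)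
  ultimately show ?thesis by (intro type_bound)
qed

end


section \<open>Opposite edges, and the passage from curves to chains of arcs\<close>

context tetra begin

lemma v_edge_iff: "i < 4 \<Longrightarrow> j < 4 \<Longrightarrow> n < 4 \<Longrightarrow> v n \<in> edge i j \<longleftrightarrow> n = i \<or> n = j"
  unfolding edge_def using norm_v by (auto simp: co_v)

lemma edge_eq_iff:
  assumes "i < 4" "j < 4" "k < 4" "l < 4"
  shows "edge i j = edge k l \<longleftrightarrow> {i, j} = {k, l}"
proof
  assume e: "edge i j = edge k l"
  have "n \<in> {i, j} \<longleftrightarrow> n \<in> {k, l}" for n
  proof (cases "n < 4")
    case True
    then show ?thesis using v_edge_iff[OF assms(1,2) True] v_edge_iff[OF assms(3,4) True] e by simp
  qed (use assms in auto)
  then show "{i, j} = {k, l}" by blast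
next
  assume "{i, j} = {k, l}"
  then show "edge i j = edge k l" using edge_commute[of i j] by (auto simp: doubleton_eq_iff)
qed

text \<open>Disjoint edges have no common end, so the two edges split the four vertices into pairs,
  and \<open>op\<close> exchanges the members of each pair. As faces are numbered by vertices,
  \<open>op\<close> pairs the faces as well.\<close>

lemma opposite_matching:
  assumes E: "E = edge i j" "i < 4" "j < 4" "i \<noteq> j" and E': "E' = edge i' j'" "i' < 4" "j' < 4" "i' \<noteq> j'"
    and disj: "E \<inter> E' = {}"
  shows "\<exists>op. (\<forall>l<4. op l < 4 \<and> op l \<noteq> l \<and> op (op l) = l) \<and>
    (\<forall>l<4. \<forall>f<4. f \<noteq> l \<longrightarrow> (edge l f \<in> {E, E'} \<longleftrightarrow> f = op l))"
proof -
  have "v n \<notin> edge i j \<inter> edge i' j'" for n using disj E(1) E'(1) by blast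
  then have "i \<noteq> i'" "i \<noteq> j'" "j \<noteq> i'" "j \<noteq> j'"
    using v_edge_iff[OF E(2,3)] v_edge_iff[OF E'(2,3)] E(2,3) by blast+
  then have q: "quad i j i' j'" using E E' by (intro quadI) auto
  note qq = quadD[OF q]
  define op where "op n = (if n = i then j else if n = j then i else if n = i' then j' else i')" for n
  have "\<forall>l<4. op l < 4 \<and> op l \<noteq> l \<and> op (op l) = l"
    unfolding quad_all[OF q] op_def by (simp only: qq qq(5-10)[symmetric] simp_thms if_True if_False)
  moreover have "edge l f \<in> {E, E'} \<longleftrightarrow> f = op l" if "l < 4" "f < 4" "f \<noteq> l" for l f
  proof -
    have ops: "op i = j" "op j = i" "op i' = j'" "op j' = i'"
      unfolding op_def by (simp_all only: qq(5-10) qq(5-10)[symmetric] simp_thms if_True if_False)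
    have h: "\<forall>l<4. \<forall>f<4. f \<noteq> l \<longrightarrow> ({l, f} = {i, j} \<or> {l, f} = {i', j'} \<longleftrightarrow> f = op l)"
      unfolding quad_all[OF q] ops doubleton_eq_iff by (simp only: qq(5-10) qq(5-10)[symmetric] simp_thms)
    have 1: "edge l f \<in> {E, E'} \<longleftrightarrow> {l, f} = {i, j} \<or> {l, f} = {i', j'}"
      unfolding E(1) E'(1) using edge_eq_iff[OF that(1,2) E(2,3)] edge_eq_iff[OF that(1,2) E'(2,3)] by simp
    show ?thesis unfolding 1 by (rule h[rule_format, OF that])
  qed
  ultimately show ?thesis by (intro exI[of _ op] conjI allI impI) blast+
qed

text \<open>The three pairs of opposite edges yield the involutions \<open>a\<close>,
  \<open>b\<close>, \<open>o'\<close>. Finiteness of the point sets on the edges yields the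
  enumeration \<open>\<tau>\<close> of the crossing times, after which the results for
  \<open>geod\<close> apply.\<close>

lemma no_geodesic_of_type:
  assumes faces: "sph_faces 1 T \<subseteq> {edge i j | i j. i < 4 \<and> j < 4 \<and> i \<noteq> j}"
    and g: "simple_closed_geodesic bdry g" and type: "geodesic_type T p q g" and pq: "0 < p" "0 < q"
  shows "2 * (1 - c) * real (p\<^sup>2 + p * q + q\<^sup>2) < pi\<^sup>2"
proof -
  obtain A A' B B' C C' where d: "distinct [A, A', B, B', C, C']" and sf: "sph_faces 1 T = {A, A', B, B', C, C'}"
    and disj: "A \<inter> A' = {}" "B \<inter> B' = {}" "C \<inter> C' = {}"
    and vA: "has_vertices_on g p A" "has_vertices_on g p A'"
    and vB: "has_vertices_on g q B" "has_vertices_on g q B'"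
    and vC: "has_vertices_on g (p + q) C" "has_vertices_on g (p + q) C'"
    using type unfolding geodesic_type_def by (elim exE conjE) (rule that)
  have matching: "\<exists>op. (\<forall>l<4. op l < 4 \<and> op l \<noteq> l \<and> op (op l) = l) \<and>
    (\<forall>l<4. \<forall>f<4. f \<noteq> l \<longrightarrow> (edge l f \<in> {E, E'} \<longleftrightarrow> f = op l))"
    if E: "E \<in> sph_faces 1 T" "E' \<in> sph_faces 1 T" "E \<inter> E' = {}" for E E'
  proof -
    obtain i j where ij: "E = edge i j" "i < 4" "j < 4" "i \<noteq> j" using E(1) faces by blast
    obtain i' j' where ij': "E' = edge i' j'" "i' < 4" "j' < 4" "i' \<noteq> j'" using E(2) faces by blast
    show ?thesis by (rule opposite_matching[OF ij ij' E(3)])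
  qed
  have mA: "A \<in> sph_faces 1 T" "A' \<in> sph_faces 1 T" "A \<inter> A' = {}"
    and mB: "B \<in> sph_faces 1 T" "B' \<in> sph_faces 1 T" "B \<inter> B' = {}"
    and mC: "C \<in> sph_faces 1 T" "C' \<in> sph_faces 1 T" "C \<inter> C' = {}"
    using disj unfolding sf by simp_all
  obtain a where a: "\<forall>l<4. a l < 4 \<and> a l \<noteq> l \<and> a (a l) = l" "\<forall>l<4. \<forall>f<4. f \<noteq> l \<longrightarrow> (edge l f \<in> {A, A'} \<longleftrightarrow> f = a l)"
    using matching[OF mA] by blast
  obtain b where b: "\<forall>l<4. b l < 4 \<and> b l \<noteq> l \<and> b (b l) = l" "\<forall>l<4. \<forall>f<4. f \<noteq> l \<longrightarrow> (edge l f \<in> {B, B'} \<longleftrightarrow> f = b l)"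
    using matching[OF mB] by blast
  obtain o' where o': "\<forall>l<4. o' l < 4 \<and> o' l \<noteq> l \<and> o' (o' l) = l" "\<forall>l<4. \<forall>f<4. f \<noteq> l \<longrightarrow> (edge l f \<in> {C, C'} \<longleftrightarrow> f = o' l)"
    using matching[OF mC] by blast
  have dj: "{A, A'} \<inter> {B, B'} = {}" "{A, A'} \<inter> {C, C'} = {}" "{B, B'} \<inter> {C, C'} = {}"
    using d by auto
  have ne: "a l \<noteq> o' l" "a l \<noteq> b l" "b l \<noteq> o' l" if l: "l < 4" for l
  proof -
    have "edge l (a l) \<in> {A, A'}" using a(1)[rule_format, OF l] a(2)[rule_format, OF l, of "a l"] by blast
    moreover have "edge l (b l) \<in> {B, B'}" using b(1)[rule_format, OF l] b(2)[rule_format, OF l, of "b l"] by blast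
    moreover have "edge l (o' l) \<in> {C, C'}" using o'(1)[rule_format, OF l] o'(2)[rule_format, OF l, of "o' l"] by blast
    ultimately show "a l \<noteq> o' l" "a l \<noteq> b l" "b l \<noteq> o' l" using dj by (metis disjoint_iff)+
  qed
  have other: "f = a l \<or> f = b l \<or> f = o' l" if l: "l < 4" and f: "f < 4" "f \<noteq> l" for f l
  proof -
    have "distinct [l, a l, b l, o' l]"
      using a(1)[rule_format, OF l] b(1)[rule_format, OF l] o'(1)[rule_format, OF l] ne[OF l]
      unfolding distinct.simps by (simp only: list.set insert_iff empty_iff) metis
    then have "quad l (a l) (b l) (o' l)"
      using a(1)[rule_format, OF l] b(1)[rule_format, OF l] o'(1)[rule_format, OF l] l by (intro quadI) blast+
    then show ?thesis using quad_cases[OF _ f(1)] f(2) by blast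
  qed
  \<comment> \<open>The complement of a matched pair is again a matched pair. So an involution read
    off from edge ends also tells which faces meet in these edges.\<close>
  have compl: "j = op i" if q: "quad i j (op l) l" and op: "\<forall>l<4. op l < 4 \<and> op l \<noteq> l \<and> op (op l) = l" for op :: "nat \<Rightarrow> nat" and i j l
  proof -
    note qq = quadD[OF q]
    have i: "op i < 4" "op i \<noteq> i" "op (op i) = i" and l: "op (op l) = l" using op qq by auto
    have "op i \<noteq> op l" using i(3) l qq by metis
    moreover have "op i \<noteq> l" using i(3) qq by metis
    ultimately show ?thesis using quad_cases[OF q i(1)] i(2) by blast
  qed
  have cA: "card (range g \<inter> edge i j) = p" if q: "quad i j (a l) l" for i j l
  proof -
    have "edge i j \<in> {A, A'}" 
      using compl[OF q a(1)] a(2)[rule_format, OF quadD(1,2)[OF q] quadD(5)[OF q, symmetric]] by blast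
    then show ?thesis using vA unfolding has_vertices_on_def by blast
  qed
  have cB: "card (range g \<inter> edge i j) = q" if q: "quad i j (b l) l" for i j l
  proof -
    have "edge i j \<in> {B, B'}" 
      using compl[OF q b(1)] b(2)[rule_format, OF quadD(1,2)[OF q] quadD(5)[OF q, symmetric]] by blast
    then show ?thesis using vB unfolding has_vertices_on_def by blast
  qed
  have cC: "card (range g \<inter> edge i j) = p + q" if q: "quad i j (o' l) l" for i j l
  proof -
    have "edge i j \<in> {C, C'}" 
      using compl[OF q o'(1)] o'(2)[rule_format, OF quadD(1,2)[OF q] quadD(5)[OF q, symmetric]] by blast
    then show ?thesis using vC unfolding has_vertices_on_def by blast
  qed
  have fin: "finite (range g \<inter> edge i j)" if "i < 4" "j < 4" "i \<noteq> j" for i j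
  proof -
    have "j = a i \<or> j = b i \<or> j = o' i" using other that by metis
    then have "edge i j \<in> {A, A', B, B', C, C'}"
      using a(2)[rule_format, OF that(1,2) that(3)[symmetric]] b(2)[rule_format, OF that(1,2) that(3)[symmetric]]
        o'(2)[rule_format, OF that(1,2) that(3)[symmetric]] by blast
    then show ?thesis using vA vB vC unfolding has_vertices_on_def by blast
  qed
  have cg: "closed_geodesic bdry g" and inj: "inj_on g {0..<1}" using g unfolding simple_closed_geodesic_def by auto
  have cont: "continuous_on UNIV g" and rng: "\<And>t. g t \<in> bdry" and per: "\<And>t. g (t + 1) = g t"
    using cg unfolding closed_geodesic_def by auto
  have "bdry \<subseteq> sphere 0 1" using unit_bdry by auto
  then obtain e where e: "locally_minimal bdry g e" using closed_geodesic_locally_minimal[OF cg] by blast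
  have e0: "0 < e" using e unfolding locally_minimal_def by blast
  \<comment> \<open>The window is shrunk below half a period, as \<open>geod\<close>
    demands.\<close>
  have lmin: "locally_minimal bdry g (min e (1 / 4))"
    by (rule locally_minimal_mono[OF e]) (use e0 in simp_all)
  let ?Z = "{t. crossing g t}"
  have "\<exists>(\<tau> :: int \<Rightarrow> real) m. 0 < m \<and> strict_mono \<tau> \<and> range \<tau> = ?Z \<and> (\<forall>k. \<tau> (k + m) = \<tau> k + 1) \<and>
     \<tau> ` {0..<m} = ?Z \<inter> {0..<1}"
  proof (rule periodic_enumeration)
    show "t + 1 \<in> ?Z \<longleftrightarrow> t \<in> ?Z" for t by (simp add: crossing_def per)
    have "g ` (?Z \<inter> {0..<1}) \<subseteq> (\<Union>i<4. \<Union>j\<in>{..<4} - {i}. range g \<inter> edge i j)"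
      unfolding crossing_def by auto
    moreover have "finite (\<Union>i<4. \<Union>j\<in>{..<4} - {i}. range g \<inter> edge i j)"
      by (intro finite_UN_I finite_lessThan finite_Diff fin) auto
    ultimately have "finite (g ` (?Z \<inter> {0..<1}))" by (rule finite_subset)
    then show "finite (?Z \<inter> {0..<1})"
      by (rule finite_imageD) (rule inj_on_subset[OF inj], blast)
    have "range g \<inter> C \<noteq> {}" using vC(1) pq unfolding has_vertices_on_def by auto
    then obtain t where t: "g t \<in> C" by auto
    obtain i j where ij: "C = edge i j" "i < 4" "j < 4" "i \<noteq> j" using faces mC(1) by blast
    have "g (t + of_int (- \<lfloor>t\<rfloor>)) = g t" by (rule periodic_int) (rule per)
    then have "t + of_int (- \<lfloor>t\<rfloor>) \<in> ?Z" using t ij unfolding crossing_def by (simp only: mem_Collect_eq) blast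
    moreover have "t + of_int (- \<lfloor>t\<rfloor>) \<in> {0..<1}" by (simp; linarith)
    ultimately show "?Z \<inter> {0..<1} \<noteq> {}" by blast
  qed
  then obtain \<tau> :: "int \<Rightarrow> real" and m where \<tau>: "0 < m" "strict_mono \<tau>" "range \<tau> = ?Z" "\<And>k. \<tau> (k + m) = \<tau> k + 1" by blast
  interpret geod v c g "min e (1 / 4)" \<tau> m
    by unfold_locales (fact cont rng per inj lmin fin \<tau> | simp)+
  show ?thesis
  proof (rule geodesic_type_bound[of o' a])
    show "card (range g \<inter> edge i j) = q" if "quad i j f l" "f \<noteq> a l" "f \<noteq> o' l" for i j f l
    proof -
      have "f = b l" using other[of l f] that quadD[OF that(1)] by blast
      then show ?thesis using cB that(1) by blast
    qed
  qed (use a(1) o'(1) ne pq cA cC in blast)+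
qed

end

section \<open>The angle threshold as an inequality for the edge\<close>

theorem theorem1:
  fixes p q :: nat and \<alpha> :: real and T :: "(real ^ 4) set"
  assumes "coprime p q"
    and "(p, q) \<notin> {(0, 1), (1, 0), (1, 1)}"
    and "pi / 3 < \<alpha>" and "\<alpha> < 2 * pi / 3"
    and "\<alpha> > 2 * arcsin (sqrt
           (real (p^2 + p * q + q^2) / (4 * real (p^2 + p * q + q^2) - pi^2)))"
    and "regular_tetrahedron \<alpha> T"
  shows "\<not> (\<exists>g. simple_closed_geodesic (surface T) g \<and> geodesic_type T p q g)"
proof
  assume "\<exists>g. simple_closed_geodesic (surface T) g \<and> geodesic_type T p q g"
  then obtain g where g: "simple_closed_geodesic (surface T) g" "geodesic_type T p q g" by blast
  define N where "N = real (p^2 + p * q + q^2)"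
  define c where "c = cos \<alpha> / (1 - cos \<alpha>)"
  \<comment> \<open>With one number 0, coprimality forces the other to be 1, and these pairs are
    excluded.\<close>
  have pq: "0 < p" "0 < q"
    using assms(1,2) by (cases "p = 0"; cases "q = 0"; auto)+
  have "\<not> (p = 1 \<and> q = 1)" using assms(2) by auto
  then have "2 \<le> p \<or> 2 \<le> q" using pq by linarith
  then have "4 \<le> p\<^sup>2 + q\<^sup>2"
    using power_mono[of 2 p 2] power_mono[of 2 q 2] by auto
  moreover have "2 \<le> p * q"
    using \<open>2 \<le> p \<or> 2 \<le> q\<close> pq mult_le_mono[of 2 p 1 q] mult_le_mono[of 1 p 2 q] by auto
  ultimately have "6 \<le> p^2 + p * q + q^2" by linarith
  \<comment> \<open>Together with pi^2 < 16 this makes 4 N - pi^2 positive and the argument of the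
    arcsine at most 1.\<close>
  then have N: "6 \<le> N" unfolding N_def by (metis of_nat_le_iff of_nat_numeral)
  have pi2: "pi\<^sup>2 < 16" using power_strict_mono[OF pi_less_4, of 2] pi_gt_zero by simp
  define s where "s = sqrt (N / (4 * N - pi\<^sup>2))"
  have D: "0 < 4 * N - pi\<^sup>2" "N \<le> 4 * N - pi\<^sup>2" using N pi2 by linarith+
  have s: "0 \<le> s" "s \<le> 1" "s\<^sup>2 = N / (4 * N - pi\<^sup>2)"
    using D N by (simp_all add: s_def)
  have al: "arcsin s < \<alpha> / 2" using assms(5) unfolding N_def[symmetric] s_def by simp
  have "sin (arcsin s) < sin (\<alpha> / 2)"
    using al arcsin_bounded[of s] s assms(3,4) pi_gt_zero by (intro sin_monotone_2pi) auto
  then have "s < sin (\<alpha> / 2)" using s by simp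
  then have "s\<^sup>2 < (sin (\<alpha> / 2))\<^sup>2" using s(1) by (intro power_strict_mono) auto
  define u where "u = (sin (\<alpha> / 2))\<^sup>2"
  have u: "N / (4 * N - pi\<^sup>2) < u" using \<open>s\<^sup>2 < (sin (\<alpha> / 2))\<^sup>2\<close> s(3) by (simp add: u_def)
  have u0: "0 < u" using u D N by (smt (verit) divide_pos_pos)
  have "cos \<alpha> = 1 - 2 * u" using cos_double_sin[of "\<alpha> / 2"] by (simp add: u_def)
  \<comment> \<open>In terms of u = sin (\<alpha> / 2)^2 the threshold N / (4 N - pi^2) < u reads
    pi^2 < 4 N - N / u, and the right side is 2 (1 - c) N.\<close>
  then have c: "1 - c = 2 - 1 / (2 * u)" unfolding c_def using u0 by (simp add: field_simps)
  have "N < u * (4 * N - pi\<^sup>2)" using u D(1) by (simp add: divide_less_eq)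
  then have "N / u < 4 * N - pi\<^sup>2" using u0 by (simp add: divide_less_eq mult.commute)
  moreover have "2 * (1 - c) * N = 4 * N - N / u" unfolding c using u0 by (simp add: field_simps)
  ultimately have big: "pi\<^sup>2 < 2 * (1 - c) * N" by linarith
  have dim: "DIM(real ^ 4) = 4" by simp
  obtain v where v: "tetra v c" "surface T = tetra.bdry v c"
    "sph_faces 1 T \<subseteq> {tetra.edge v c i j | i j. i < 4 \<and> j < 4 \<and> i \<noteq> j}"
    using regular_tetrahedron_vertices[OF dim assms(6,3,4)] unfolding c_def by blast
  interpret tetra v c by (rule v)
  have "2 * (1 - c) * N < pi\<^sup>2"
    unfolding N_def using no_geodesic_of_type[OF v(3) g(1)[unfolded v(2)] g(2) pq] .
  then show False using big by simp
qed

end
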